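(* Let $(\Sigma,\sigma)$ be a topologically mixing countable Markov shift and let the potential $\mathcal{F}=\{f_n\}_{n=1}^{\infty}$ on $\Sigma$ be almost-additive and summable with bounded variation. Then, for any $t>1$, there is a unique equilibrium state $\mu_{t\mathcal{F}}\in\mathcal{M}$ associated to $t\mathcal{F}=\{tf_n\}_{n=1}^{\infty}$. Also, there exists an accumulation point $\mu_\infty\in\mathcal{M}$ for the family $(\mu_{t\mathcal{F}})_{t>1}$ as $t\to\infty$.
   Context: Countable Markov shift: the alphabet is $\mathcal{A}=\mathbb{N}=\{1,2,\dots\}$, $\mathbf{M}=(M_{ij})_{\mathcal{A}\times\mathcal{A}}$ is a matrix of zeros and ones with no zero row and no zero column, $\Sigma=\{x=x_1x_2\cdots\in\mathcal{A}^{\mathbb{N}}: M_{x_ix_{i+1}}=1\ \forall i\in\mathbb{N}\}$, and $\sigma:\Sigma\to\Sigma$ is the shift $(\sigma(x))_i=x_{i+1}$. $\Sigma$ has the topology generated by the cylinders $[w]=\{x\in\Sigma: x_1\cdots x_n=w\}$, $w$ an admissible word of length $n$ (i.e. $M_{w_iw_{i+1}}=1$ for $1\le i<n$). $(\Sigma,\sigma)$ is topologically mixing if for all $a,b\in\mathcal{A}$ there is $N_{ab}\in\mathbb{N}$ such that for every $n\ge N_{ab}$ there is an admissible word $w_1\cdots w_n$ with $w_1=a$, $w_n=b$. Potentials: $\mathcal{F}=\{f_n\}_{n=1}^\infty$ is a sequence of continuous functions $f_n:\Sigma\to\mathbb{R}$. It is almost-additive if there is $C\ge 0$ with $f_n(x)+f_m(\sigma^n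 x)-C\le f_{n+m}(x)\le f_n(x)+f_m(\sigma^n x)+C$ for all $n,m\in\mathbb{N}$, $x\in\Sigma$. It has bounded variation if there is $C\ge0$ with $\sup_n\sup\{|f_n(x)-f_n(y)|: x,y\in\Sigma,\ x_i=y_i,\ 1\le i\le n\}\le C$. It is summable if $\sum_{i\in\mathbb{N}}\exp(\sup (f_1|_{[i]}))<\infty$. $\mathcal{M}$ is the set of $\sigma$-invariant Borel probability measures on $\Sigma$, with the weak (weak-star) topology, i.e. convergence against bounded continuous functions. $h(\mu)$ is the Kolmogorov–Sinai entropy of $\mu\in\mathcal{M}$, and $\mathcal{F}_*(\mu)=\lim_{n\to\infty}\frac1n\int f_n\,d\mu\in[-\infty,\infty)$. Gurevich pressure: $P_G(\mathcal{F})=\lim_{n\to\infty}\frac1n\log\big(\sum_{\sigma^nx=x}\exp(f_n(x))\chi_{[a]}(x)\big)$, which is independent of $a\in\mathcal{A}$. An equilibrium state for $t\mathcal{F}$ is a measure $\mu\in\mathcal{M}$ with $P_G(t\mathcal{F})=h(\mu)+t\mathcal{F}_*(\mu)$ (in particular $\mathcal{F}_*(\mu)>-\infty$). An accumulation point of $(\mu_{t\mathcal{F}})_{t>1}$ as $t\to\infty$ is a measure $\mu_\infty\in\mathcal{M}$ such that $\mu_{t_k\mathcal{F}}\to\mu_\infty$ weakly for some sequence $t_k\to\infty$. *)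

theory Defs
  imports "HOL-Probability.Probability"
begin

text \<open>
  The alphabet \<open>{1, 2, \<dots>}\<close> is represented by the type \<^typ>\<open>nat\<close> (relabelled from \<open>0\<close>), and a
  sequence \<open>x\<^sub>1 x\<^sub>2 \<dots>\<close> by a function whose value at \<open>i\<close> is \<open>x\<^sub>i\<^sub>+\<^sub>1\<close>.
\<close>

definition transition_matrix :: "(nat \<Rightarrow> nat \<Rightarrow> nat) \<Rightarrow> bool" where
  "transition_matrix M \<longleftrightarrow>
     (\<forall>i j. M i j \<in> {0, 1}) \<and> (\<forall>i. \<exists>j. M i j \<noteq> 0) \<and> (\<forall>j. \<exists>i. M i j \<noteq> 0)"

definition shift_space :: "(nat \<Rightarrow> nat \<Rightarrow> nat) \<Rightarrow> (nat \<Rightarrow> nat) set" where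
  "shift_space M = {x. \<forall>i. M (x i) (x (Suc i)) = 1}"

definition shift :: "(nat \<Rightarrow> nat) \<Rightarrow> (nat \<Rightarrow> nat)" where
  "shift x = (\<lambda>i. x (Suc i))"

definition admissible :: "(nat \<Rightarrow> nat \<Rightarrow> nat) \<Rightarrow> nat list \<Rightarrow> bool" where
  "admissible M w \<longleftrightarrow> w \<noteq> [] \<and> (\<forall>i. Suc i < length w \<longrightarrow> M (w ! i) (w ! Suc i) = 1)"

definition cylinder :: "(nat \<Rightarrow> nat \<Rightarrow> nat) \<Rightarrow> nat list \<Rightarrow> (nat \<Rightarrow> nat) set" where
  "cylinder M w = {x \<in> shift_space M. \<forall>i<length w. x i = w ! i}"

definition shift_topology :: "(nat \<Rightarrow> nat \<Rightarrow> nat) \<Rightarrow> (nat \<Rightarrow> nat) topology" where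
  "shift_topology M = topology_generated_by {cylinder M w | w. admissible M w}"

definition topologically_mixing :: "(nat \<Rightarrow> nat \<Rightarrow> nat) \<Rightarrow> bool" where
  "topologically_mixing M \<longleftrightarrow>
     (\<forall>a b. \<exists>N\<ge>1. \<forall>n\<ge>N. \<exists>w. length w = n \<and> admissible M w \<and> hd w = a \<and> last w = b)"

text \<open>
  A potential is a family \<open>f n\<close> of functions of which only the members with \<open>n \<ge> 1\<close> and only the
  values on the shift space matter.
\<close>

definition continuous_potential ::
    "(nat \<Rightarrow> nat \<Rightarrow> nat) \<Rightarrow> (nat \<Rightarrow> (nat \<Rightarrow> nat) \<Rightarrow> real) \<Rightarrow> bool" where
  "continuous_potential M f \<longleftrightarrow> (\<forall>n\<ge>1. continuous_map (shift_topology M) euclideanreal (f n))"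

definition almost_additive ::
    "(nat \<Rightarrow> nat \<Rightarrow> nat) \<Rightarrow> (nat \<Rightarrow> (nat \<Rightarrow> nat) \<Rightarrow> real) \<Rightarrow> bool" where
  "almost_additive M f \<longleftrightarrow>
     (\<exists>C\<ge>0. \<forall>n\<ge>1. \<forall>m\<ge>1. \<forall>x\<in>shift_space M.
        f n x + f m ((shift ^^ n) x) - C \<le> f (n + m) x \<and>
        f (n + m) x \<le> f n x + f m ((shift ^^ n) x) + C)"

definition bounded_variation ::
    "(nat \<Rightarrow> nat \<Rightarrow> nat) \<Rightarrow> (nat \<Rightarrow> (nat \<Rightarrow> nat) \<Rightarrow> real) \<Rightarrow> bool" where
  "bounded_variation M f \<longleftrightarrow>
     (\<exists>C\<ge>0. \<forall>n\<ge>1. \<forall>x\<in>shift_space M. \<forall>y\<in>shift_space M.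
        (\<forall>i<n. x i = y i) \<longrightarrow> \<bar>f n x - f n y\<bar> \<le> C)"

text \<open>
  Convergence of the series includes finiteness of each supremum; the real-valued \<^const>\<open>Sup\<close> needs
  this to be required separately.
\<close>

definition summable_potential ::
    "(nat \<Rightarrow> nat \<Rightarrow> nat) \<Rightarrow> (nat \<Rightarrow> (nat \<Rightarrow> nat) \<Rightarrow> real) \<Rightarrow> bool" where
  "summable_potential M f \<longleftrightarrow>
     (\<forall>i. bdd_above (f 1 ` cylinder M [i])) \<and>
     summable (\<lambda>i. exp (SUP x\<in>cylinder M [i]. f 1 x))"

definition scaled_potential ::
    "real \<Rightarrow> (nat \<Rightarrow> (nat \<Rightarrow> nat) \<Rightarrow> real) \<Rightarrow> nat \<Rightarrow> (nat \<Rightarrow> nat) \<Rightarrow> real" where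
  "scaled_potential t f = (\<lambda>n x. t * f n x)"

definition invariant_measures :: "(nat \<Rightarrow> nat \<Rightarrow> nat) \<Rightarrow> (nat \<Rightarrow> nat) measure set" where
  "invariant_measures M =
     {\<mu>. prob_space \<mu> \<and> space \<mu> = shift_space M \<and>
         sets \<mu> = sigma_sets (shift_space M) {U. openin (shift_topology M) U} \<and>
         (\<forall>A\<in>sets \<mu>. emeasure \<mu> (shift -` A \<inter> space \<mu>) = emeasure \<mu> A)}"

definition weakly_converges ::
    "(nat \<Rightarrow> nat \<Rightarrow> nat) \<Rightarrow> (nat \<Rightarrow> (nat \<Rightarrow> nat) measure) \<Rightarrow> (nat \<Rightarrow> nat) measure \<Rightarrow> bool" where
  "weakly_converges M \<mu>s \<mu> \<longleftrightarrow>
     (\<forall>g. continuous_map (shift_topology M) euclideanreal g \<and> bounded (g ` shift_space M) \<longrightarrow>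
        (\<lambda>k. integral\<^sup>L (\<mu>s k) g) \<longlonglongrightarrow> integral\<^sup>L \<mu> g)"

text \<open>
  Kolmogorov--Sinai entropy, with natural logarithms, as the supremum over finite measurable
  partitions. Since \<open>ln 0 = 0\<close>, null sets (in particular empty cells of a join) contribute nothing.
\<close>

definition partition_entropy :: "'a measure \<Rightarrow> 'a set set \<Rightarrow> real" where
  "partition_entropy \<mu> \<xi> = - (\<Sum>A\<in>\<xi>. measure \<mu> A * ln (measure \<mu> A))"

definition iterated_join :: "'a measure \<Rightarrow> ('a \<Rightarrow> 'a) \<Rightarrow> 'a set set \<Rightarrow> nat \<Rightarrow> 'a set set" where
  "iterated_join \<mu> T \<xi> n =
     {space \<mu> \<inter> (\<Inter>i<n. (T ^^ i) -` B i) | B. \<forall>i<n. B i \<in> \<xi>}"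

definition entropy_wrt_partition :: "'a measure \<Rightarrow> ('a \<Rightarrow> 'a) \<Rightarrow> 'a set set \<Rightarrow> real" where
  "entropy_wrt_partition \<mu> T \<xi> = lim (\<lambda>n. partition_entropy \<mu> (iterated_join \<mu> T \<xi> n) / real n)"

definition ks_entropy :: "'a measure \<Rightarrow> ('a \<Rightarrow> 'a) \<Rightarrow> ereal" where
  "ks_entropy \<mu> T =
     (SUP \<xi>\<in>{\<xi>. finite \<xi> \<and> \<xi> \<subseteq> sets \<mu> \<and> partition_on (space \<mu>) \<xi>}.
        ereal (entropy_wrt_partition \<mu> T \<xi>))"

text \<open>
  The functions \<open>f n\<close> are bounded above under the summability assumption but need not be integrable,
  so the integral has to be allowed to take the value \<open>-\<infinity>\<close>, which the Bochner integral does not. Note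
  that \<^const>\<open>ennreal\<close> maps negative reals to \<open>0\<close>.
\<close>

definition extended_integral :: "'a measure \<Rightarrow> ('a \<Rightarrow> real) \<Rightarrow> ereal" where
  "extended_integral \<mu> g =
     enn2ereal (\<integral>\<^sup>+x. ennreal (g x) \<partial>\<mu>) - enn2ereal (\<integral>\<^sup>+x. ennreal (- g x) \<partial>\<mu>)"

definition potential_mean ::
    "(nat \<Rightarrow> (nat \<Rightarrow> nat) \<Rightarrow> real) \<Rightarrow> (nat \<Rightarrow> nat) measure \<Rightarrow> ereal" where
  "potential_mean f \<mu> = lim (\<lambda>n. extended_integral \<mu> (f n) / ereal (real n))"

definition extended_ln :: "ennreal \<Rightarrow> ereal" where
  "extended_ln z = (if z = 0 then -\<infinity> else if z = \<infinity> then \<infinity> else ereal (ln (enn2real z)))"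

definition periodic_sum ::
    "(nat \<Rightarrow> nat \<Rightarrow> nat) \<Rightarrow> (nat \<Rightarrow> (nat \<Rightarrow> nat) \<Rightarrow> real) \<Rightarrow> nat \<Rightarrow> nat \<Rightarrow> ennreal" where
  "periodic_sum M f a n =
     (\<Sum>\<^sub>\<infinity>x\<in>{x \<in> shift_space M. (shift ^^ n) x = x}.
        ennreal (exp (f n x) * indicator (cylinder M [a]) x))"

text \<open>
  The common value, over all letters \<open>a\<close>, of the limit defining the pressure. For a mixing shift and
  an almost-additive potential of bounded variation the limit exists and does not depend on \<open>a\<close>.
\<close>

definition gurevich_pressure ::
    "(nat \<Rightarrow> nat \<Rightarrow> nat) \<Rightarrow> (nat \<Rightarrow> (nat \<Rightarrow> nat) \<Rightarrow> real) \<Rightarrow> ereal" where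
  "gurevich_pressure M f =
     (THE P. \<forall>a. (\<lambda>n. extended_ln (periodic_sum M f a n) / ereal (real n)) \<longlonglongrightarrow> P)"

text \<open>
  Equilibrium state for \<open>t f\<close>. The condition \<open>f\<^sub>*(\<mu>) > -\<infinity>\<close> keeps the right-hand side from being the
  indeterminate \<open>\<infinity> - \<infinity>\<close>.
\<close>

definition equilibrium_state ::
    "(nat \<Rightarrow> nat \<Rightarrow> nat) \<Rightarrow> (nat \<Rightarrow> (nat \<Rightarrow> nat) \<Rightarrow> real) \<Rightarrow> real \<Rightarrow> (nat \<Rightarrow> nat) measure \<Rightarrow> bool" where
  "equilibrium_state M f t \<mu> \<longleftrightarrow>
     \<mu> \<in> invariant_measures M \<and> potential_mean f \<mu> > -\<infinity> \<and>
     gurevich_pressure M (scaled_potential t f) = ks_entropy \<mu> shift + ereal t * potential_mean f \<mu>"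

definition accumulation_point_at_top ::
    "(nat \<Rightarrow> nat \<Rightarrow> nat) \<Rightarrow> (real \<Rightarrow> (nat \<Rightarrow> nat) measure) \<Rightarrow> (nat \<Rightarrow> nat) measure \<Rightarrow> bool" where
  "accumulation_point_at_top M \<mu> \<mu>_inf \<longleftrightarrow>
     \<mu>_inf \<in> invariant_measures M \<and>
     (\<exists>t :: nat \<Rightarrow> real. (\<forall>k. t k > 1) \<and> filterlim t at_top sequentially \<and>
        weakly_converges M (\<lambda>k. \<mu> (t k)) \<mu>_inf)"

end

theory Submission imports Defs begin

text \<open>
  Replace \<open>f n\<close> by a function \<open>phi\<close> of words, which is additive up to a constant, and call
  \<open>exp (phi w)\<close> the weight of \<open>w\<close>. By summability and mixing, the total weight of the words of length
  \<open>n\<close> with prescribed end letters is \<open>exp (n * P)\<close> up to a constant factor, where \<open>P\<close> is the Gurevich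
  pressure, and the total weight of all words of length \<open>n\<close> is at most of this order. Limits of
  averaged normalised weights give an invariant measure with \<open>\<mu> [w] \<le> K * exp (phi w - n * P)\<close> for
  every word \<open>w\<close> of length \<open>n\<close>, and with a matching lower bound whose constant depends on the first and
  last letters only. The upper bound makes its entropy plus energy at least \<open>P\<close>, and Jensen's inequality
  shows that no measure of finite energy exceeds \<open>P\<close>. The lower bound and mixing make it ergodic, and
  every measure that attains \<open>P\<close> is absolutely continuous with respect to it, hence equal to it.

  For \<open>f\<close> itself this measure may have energy \<open>-\<infinity>\<close> and then is no equilibrium state; for \<open>t > 1\<close>
  the series of \<open>exp (t * phi [i]) * phi [i]\<close> converges, which makes the energy for \<open>t f\<close> finite. As
  \<open>t \<rightarrow> \<infinity>\<close> the energies of the equilibrium states stay bounded from below, and since \<open>phi [i] \<rightarrow> -\<infinity>\<close>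
  these measures are tight.
\<close>

text \<open>No finite set of letters is assumed to connect all pairs of letters, so a lower Gibbs
  bound uniform over all words cannot be expected. Every use of the lower bound therefore first
  discards the words that begin or end outside a finite set of letters, which costs little measure
  by invariance. An almost-additive sequence need not consist of the Birkhoff sums of one function,
  so there is no transfer operator to supply an eigenmeasure; finite words are counted instead, with
  one factor \<open>exp D\<close> for each junction. Entropy is defined by finite partitions, while
  the natural generating partition, by the first letter, is infinite. It is replaced by truncations
  that lump all letters from \<open>N\<close> on. Their cells contain cylinders, which is the right
  direction for upper bounds on the entropy. The opposite direction costs a tail of the entropy
  series of the first letter, and this series is controlled by the same summability that makes the
  energy finite.\<close>

section \<open>Subadditive sequences\<close>

text \<open>The linear lower bound makes the infimum a real number. That the limit is the infimum
  later gives an inequality for the pressure at every single \<open>n\<close>, not only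
  asymptotically.\<close>

lemma fekete:
  fixes a :: "nat \<Rightarrow> real"
  assumes sub: "\<And>m n. m \<ge> 1 \<Longrightarrow> n \<ge> 1 \<Longrightarrow> a (m + n) \<le> a m + a n"
    and low: "\<And>n. n \<ge> 1 \<Longrightarrow> c * real n \<le> a n"
  shows "(\<lambda>n. a n / real n) \<longlonglongrightarrow> (INF n\<in>{1..}. a n / real n)"
proof -
  define l where "l = (INF n\<in>{1..}. a n / real n)"
  have bdd: "bdd_below ((\<lambda>n. a n / real n) ` {1..})"
  proof (rule bdd_belowI2)
    fix n :: nat assume "n \<in> {1..}"
    then show "c \<le> a n / real n" using low[of n] by (simp add: field_simps)
  qed
  have l_le: "l \<le> a n / real n" if "n \<ge> 1" for n
    unfolding l_def using that by (intro cINF_lower bdd) auto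
  show ?thesis unfolding l_def[symmetric]
  proof (rule LIMSEQ_I)
    fix e :: real assume e: "e > 0"
    have "\<exists>x\<in>(\<lambda>n. a n / real n) ` {1..}. x < l + e / 2"
      unfolding l_def using e l_def by (intro cInf_lessD) auto
    then obtain k where k: "k \<ge> 1" "a k / real k < l + e / 2" by auto
    \<comment> \<open>Bounds the error of replacing \<open>a n\<close> by
      \<open>n * (a k / k)\<close>: at most \<open>k\<close> multiples of the slope are missing, and
      the remainder index lies in \<open>{1..k}\<close>.\<close>
    define B where "B = real k * \<bar>a k / real k\<bar> + (\<Sum>r\<in>{1..k}. \<bar>a r\<bar>)"
    have mult: "a (q * k + r) \<le> real q * a k + a r" if "r \<ge> 1" for q r
    proof (induction q)
      case (Suc q)
      have "a (Suc q * k + r) = a (k + (q * k + r))" by (simp add: algebra_simps)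
      also have "\<dots> \<le> a k + a (q * k + r)" using k that by (intro sub) auto
      finally show ?case using Suc by (simp add: algebra_simps)
    qed simp
    have bound: "a n \<le> real n * (a k / real k) + B" if "n \<ge> 1" for n
    proof -
      \<comment> \<open>The remainder runs through \<open>{1..k}\<close> instead of
        \<open>{0..<k}\<close>, since subadditivity is assumed for positive indices and says nothing
        about \<open>a 0\<close>.\<close>
      define q where "q = (n - 1) div k"
      define r where "r = (n - 1) mod k + 1"
      have n: "n = q * k + r" and r: "r \<ge> 1" "r \<le> k"
        using that k unfolding q_def r_def by (auto simp: Suc_leI)
      have "a n \<le> real q * a k + a r" unfolding n by (rule mult[OF r(1)])
      also have "real q * a k = (real n - real r) * (a k / real k)"
        using k by (simp add: n)
      also have "\<dots> \<le> real n * (a k / real k) + real k * \<bar>a k / real k\<bar>"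
      proof -
        have "- (real r * (a k / real k)) \<le> real r * \<bar>a k / real k\<bar>"
          by (metis abs_ge_minus_self abs_mult abs_of_nat)
        also have "\<dots> \<le> real k * \<bar>a k / real k\<bar>" using r by (intro mult_right_mono) auto
        finally show ?thesis by (simp only: left_diff_distrib)
      qed
      also have "a r \<le> (\<Sum>r\<in>{1..k}. \<bar>a r\<bar>)"
        using member_le_sum[of r "{1..k}" "\<lambda>r. \<bar>a r\<bar>"] r by auto
      finally show ?thesis by (simp add: B_def)
    qed
    have "B \<ge> 0" unfolding B_def by (intro add_nonneg_nonneg sum_nonneg) auto
    obtain n0 :: nat where n0: "real n0 > 2 * B / e" using reals_Archimedean2 by blast
    show "\<exists>n0. \<forall>n\<ge>n0. norm (a n / real n - l) < e"
    proof (intro exI allI impI)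
      fix n assume n: "n \<ge> n0 + 1"
      have "real n > 2 * B / e" using n n0 by auto
      then have "B / real n < e / 2"
        using e n by (simp add: field_simps)
      moreover have "a n / real n \<le> a k / real k + B / real n"
        using bound[of n] n by (simp add: field_simps)
      ultimately have "a n / real n < l + e" using k(2) by linarith
      moreover have "l \<le> a n / real n" using l_le n by auto
      ultimately show "norm (a n / real n - l) < e" by auto
    qed
  qed
qed

section \<open>Weights of words\<close>

lemma admissible_append:
  assumes "u \<noteq> []" "v \<noteq> []"
  shows "admissible M (u @ v) \<longleftrightarrow> admissible M u \<and> admissible M v \<and> M (last u) (hd v) = 1"
proof -
  have eq: "admissible M w \<longleftrightarrow> w \<noteq> [] \<and> successively (\<lambda>a b. M a b = 1) w" for w
    unfolding admissible_def successively_conv_nth by auto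
  show ?thesis using assms by (auto simp: eq successively_append_iff)
qed

lemma admissible_Cons:
  "v \<noteq> [] \<Longrightarrow> admissible M (a # v) \<longleftrightarrow> admissible M v \<and> M a (hd v) = 1"
  using admissible_append[of "[a]" v M] by (auto simp: admissible_def)

lemma admissible_single [simp]: "admissible M [a]"
  by (simp add: admissible_def)

lemma not_admissible_Nil [simp]: "\<not> admissible M []"
  by (simp add: admissible_def)

locale mixing_shift =
  fixes M :: "nat \<Rightarrow> nat \<Rightarrow> nat"
  assumes trans: "transition_matrix M" and mix: "topologically_mixing M"
begin

lemma ex_succ: "\<exists>b. M a b = 1"
proof -
  obtain b where "M a b \<noteq> 0" using trans unfolding transition_matrix_def by blast
  moreover have "M a b \<in> {0, 1}" using trans unfolding transition_matrix_def by blast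
  ultimately show ?thesis by auto
qed

lemma ex_pred: "\<exists>b. M b a = 1"
proof -
  obtain b where "M b a \<noteq> 0" using trans unfolding transition_matrix_def by blast
  moreover have "M b a \<in> {0, 1}" using trans unfolding transition_matrix_def by blast
  ultimately show ?thesis by auto
qed

text \<open>Mixing gives a threshold for each pair of letters; the sum of the thresholds serves
  finitely many pairs at once. With \<open>R \<ge> 2\<close> an end letter can be stripped from a
  connecting word and something remains.\<close>

lemma connecting_words:
  assumes "finite F"
  obtains R where "R \<ge> 2"
    "\<And>a b n. a \<in> F \<Longrightarrow> b \<in> F \<Longrightarrow> n \<ge> R \<Longrightarrow> \<exists>w. length w = n \<and> admissible M w \<and> hd w = a \<and> last w = b"
proof -
  have "\<forall>p. \<exists>N. \<forall>n\<ge>N. \<exists>w. length w = n \<and> admissible M w \<and> hd w = fst p \<and> last w = snd p"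
    using mix unfolding topologically_mixing_def by blast
  then obtain N where N: "\<And>p n. n \<ge> N p \<Longrightarrow>
      \<exists>w. length w = n \<and> admissible M w \<and> hd w = fst p \<and> last w = snd p"
    by metis
  define R where "R = 2 + (\<Sum>p\<in>F \<times> F. N p)"
  have "N (a, b) \<le> R" if "a \<in> F" "b \<in> F" for a b
    using member_le_sum[of "(a, b)" "F \<times> F" N] that assms by (auto simp: R_def)
  then have "\<exists>w. length w = n \<and> admissible M w \<and> hd w = a \<and> last w = b"
    if "a \<in> F" "b \<in> F" "n \<ge> R" for a b n
    using N[of "(a, b)" n] that by (metis fst_conv snd_conv order_trans)
  then show thesis by (intro that[of R]) (auto simp: R_def)
qed

end

locale weighted_words = mixing_shift M for M +
  fixes \<phi> :: "nat list \<Rightarrow> real" and D :: real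
  assumes D_nonneg: "0 \<le> D"
    and phi_append: "\<And>u v. admissible M (u @ v) \<Longrightarrow> u \<noteq> [] \<Longrightarrow> v \<noteq> [] \<Longrightarrow> \<bar>\<phi> (u @ v) - \<phi> u - \<phi> v\<bar> \<le> D"
    and summable_letters: "summable (\<lambda>i. exp (\<phi> [i]))"
begin

text \<open>The value 0 for inadmissible words lets sums run over all lists. Together with the value
  1 for the empty word it makes the upper bound for concatenations free of side conditions.\<close>

definition weight :: "nat list \<Rightarrow> real" where
  "weight w = (if w = [] then 1 else if admissible M w then exp (\<phi> w) else 0)"

lemma weight_Nil [simp]: "weight [] = 1" by (simp add: weight_def)

lemma weight_single [simp]: "weight [i] = exp (\<phi> [i])" by (simp add: weight_def)

lemma weight_nonneg [simp]: "0 \<le> weight w" by (simp add: weight_def)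

lemma weight_pos: "admissible M w \<Longrightarrow> 0 < weight w" by (auto simp add: weight_def)

lemma weight_append_le: "weight (u @ v) \<le> exp D * (weight u * weight v)"
proof (cases "u = [] \<or> v = []")
  case True
  then show ?thesis using D_nonneg mult_right_mono[of 1 "exp D" "weight (u @ v)"] by auto
next
  case False
  show ?thesis
  proof (cases "admissible M (u @ v)")
    case True
    then have "admissible M u" "admissible M v" using False admissible_append by blast+
    moreover have "\<phi> (u @ v) \<le> D + (\<phi> u + \<phi> v)" using phi_append[OF True] False by auto
    then have "exp (\<phi> (u @ v)) \<le> exp D * (exp (\<phi> u) * exp (\<phi> v))"
      by (simp flip: exp_add)
    ultimately show ?thesis using True False by (simp add: weight_def)
  qed (use False in \<open>simp add: weight_def\<close>)
qed

text \<open>The junction has to be allowed: otherwise the left side may be positive while the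
  concatenation has weight 0.\<close>

lemma weight_append_ge:
  assumes "u = [] \<or> v = [] \<or> M (last u) (hd v) = 1"
  shows "weight u * weight v \<le> exp D * weight (u @ v)"
proof (cases "u = [] \<or> v = []")
  case True
  then show ?thesis using D_nonneg mult_right_mono[of 1 "exp D" "weight (u @ v)"] by auto
next
  case False
  show ?thesis
  proof (cases "admissible M u \<and> admissible M v")
    case True
    then have adm: "admissible M (u @ v)" using assms False admissible_append by blast
    then have "\<phi> u + \<phi> v \<le> D + \<phi> (u @ v)" using phi_append[OF adm] False by auto
    then have "exp (\<phi> u) * exp (\<phi> v) \<le> exp D * exp (\<phi> (u @ v))"
      by (simp flip: exp_add)
    then show ?thesis using True False adm by (simp add: weight_def)
  qed (use False in \<open>auto simp add: weight_def\<close>)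
qed

end

section \<open>Words of fixed length and contracting recursions\<close>

definition words :: "nat set \<Rightarrow> nat \<Rightarrow> nat list set" where
  "words A n = {w. set w \<subseteq> A \<and> length w = n}"

lemma finite_words [simp]: "finite A \<Longrightarrow> finite (words A n)"
  unfolding words_def by (rule finite_lists_length_eq)

lemma words_0 [simp]: "words A 0 = {[]}" by (auto simp: words_def)

lemma words_1: "words A (Suc 0) = (\<lambda>i. [i]) ` A"
  by (auto simp: words_def length_Suc_conv)

lemma words_add: "words A (n + m) = (\<lambda>(u, v). u @ v) ` (words A n \<times> words A m)"
proof (intro equalityI subsetI)
  fix w assume w: "w \<in> words A (n + m)"
  have "take n w \<in> words A n" "drop n w \<in> words A m"
    using w set_take_subset[of n w] set_drop_subset[of n w] by (auto simp: words_def)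
  then show "w \<in> (\<lambda>(u, v). u @ v) ` (words A n \<times> words A m)"
    by (intro image_eqI[of _ _ "(take n w, drop n w)"]) auto
qed (auto simp: words_def)

lemma inj_on_append_words: "inj_on (\<lambda>(u, v). u @ v) (words A n \<times> words A m)"
  by (auto simp: inj_on_def words_def)

lemma sum_words_add: "(\<Sum>w\<in>words A (n + m). g w) = (\<Sum>u\<in>words A n. \<Sum>v\<in>words A m. g (u @ v))"
  unfolding words_add sum.reindex[OF inj_on_append_words]
  by (simp add: sum.cartesian_product case_prod_unfold)

lemma sum_words_1: "(\<Sum>w\<in>words A (Suc 0). g w) = (\<Sum>i\<in>A. g [i])"
  unfolding words_1 by (subst sum.reindex) (auto simp: inj_on_def)

text \<open>Iteration produces a geometric series of ratio at most 1/2, which at most doubles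
  \<open>K\<close>; the term with \<open>x 1\<close> covers the start.\<close>

lemma contraction_bounded:
  fixes x y :: "nat \<Rightarrow> real"
  assumes rec: "\<And>n. n \<ge> 1 \<Longrightarrow> x (Suc n) \<le> y (Suc n) + q * x n"
    and q: "0 \<le> q" "q \<le> 1/2" and y: "\<And>n. n \<ge> 1 \<Longrightarrow> y n \<le> K" and K: "0 \<le> K" and n: "n \<ge> 1"
  shows "x n \<le> 2 * K + \<bar>x 1\<bar>"
  using n
proof (induction n rule: nat_induct_at_least)
  case base
  then show ?case using K by auto
next
  case (Suc n)
  have "x (Suc n) \<le> K + q * x n" using rec[of n] y[of "Suc n"] Suc by auto
  moreover have "q * x n \<le> q * (2 * K + \<bar>x 1\<bar>)" using Suc q by (intro mult_left_mono) auto
  moreover have "q * (2 * K + \<bar>x 1\<bar>) \<le> 1/2 * (2 * K + \<bar>x 1\<bar>)"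
    using q K by (intro mult_right_mono) auto
  ultimately show ?case using K abs_ge_zero[of "x 1"] by argo
qed

text \<open>Unrolling the recursion \<open>J\<close> times leaves only a small multiple of the
  bounded sequence \<open>x\<close>. If \<open>x n\<close> is still at least \<open>c\<close>, the
  forcing terms must be responsible, so one of the last \<open>J\<close> of them is not
  small.\<close>

lemma contraction_lower:
  fixes x y :: "nat \<Rightarrow> real"
  assumes rec: "\<And>n. n \<ge> 1 \<Longrightarrow> x (Suc n) \<le> y (Suc n) + q * x n"
    and q: "0 \<le> q" "q \<le> 1/2" and K: "\<And>n. n \<ge> 1 \<Longrightarrow> x n \<le> K" and c: "0 < c"
    and x0: "\<And>n. n \<ge> 1 \<Longrightarrow> 0 \<le> x n"
  shows "\<exists>J. \<forall>n>J. c \<le> x n \<longrightarrow> (\<exists>s<J. c / 4 \<le> y (n - s))"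
proof -
  \<comment> \<open>This makes the unrolled remainder smaller than \<open>c / 2\<close>; forcing
    terms that were all below \<open>c / 4\<close> would add up to at most another
    \<open>c / 2\<close>.\<close>
  obtain J where J: "(1/2) ^ J < c / (2 * (\<bar>K\<bar> + 1))"
    using real_arch_pow_inv[of "c / (2 * (\<bar>K\<bar> + 1))" "1/2"] c by auto
  show ?thesis
  proof (rule exI[of _ J], intro allI impI, rule ccontr)
    fix n assume n: "n > J" "c \<le> x n" and neg: "\<not> (\<exists>s<J. c / 4 \<le> y (n - s))"
    have step: "x n \<le> c / 2 * (1 - (1/2) ^ j) + (1/2) ^ j * x (n - j)" if "j \<le> J" for j
      using that
    proof (induction j)
      case (Suc j)
      have "x (n - j) = x (Suc (n - Suc j))" using Suc n by (simp add: Suc_diff_Suc)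
      also have "\<dots> \<le> y (Suc (n - Suc j)) + q * x (n - Suc j)" using Suc n by (intro rec) auto
      also have "Suc (n - Suc j) = n - j" using Suc n by (simp add: Suc_diff_Suc)
      also have "y (n - j) \<le> c / 4" using neg Suc by (auto simp: not_le intro: less_imp_le)
      also have "q * x (n - Suc j) \<le> 1/2 * x (n - Suc j)"
        using q x0[of "n - Suc j"] Suc n by (intro mult_right_mono) auto
      finally have "(1/2) ^ j * x (n - j) \<le> (1/2) ^ j * (c / 4 + 1/2 * x (n - Suc j))"
        by (intro mult_left_mono) auto
      then show ?case using Suc by (simp add: algebra_simps)
    qed simp
    have "(1/2) ^ J * x (n - J) \<le> (1/2) ^ J * (\<bar>K\<bar> + 1)"
      using K[of "n - J"] n by (intro mult_left_mono; (linarith | simp))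
    also have "\<dots> < c / (2 * (\<bar>K\<bar> + 1)) * (\<bar>K\<bar> + 1)"
      using J by (intro mult_strict_right_mono) auto
    also have "\<dots> = c / 2" by (simp add: field_simps)
    finally have "x n < c / 2 * (1 - (1/2) ^ J) + c / 2" using step[of J] by auto
    also have "\<dots> \<le> c" using c by (simp add: algebra_simps)
    finally show False using n by auto
  qed
qed

context weighted_words
begin

text \<open>A finite alphabet \<open>A\<close> keeps the sums finite; \<open>ssum\<close> passes to
  the full alphabet by a supremum.\<close>

definition wsum :: "nat set \<Rightarrow> nat \<Rightarrow> (nat list \<Rightarrow> bool) \<Rightarrow> real" where
  "wsum A n Q = (\<Sum>w\<in>words A n. weight w * of_bool (Q w))"

lemma wsum_nonneg [simp]: "0 \<le> wsum A n Q"
  unfolding wsum_def by (intro sum_nonneg) auto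

lemma wsum_mono_set: "finite B \<Longrightarrow> A \<subseteq> B \<Longrightarrow> wsum A n Q \<le> wsum B n Q"
  unfolding wsum_def by (intro sum_mono2 finite_words) (auto simp: words_def)

lemma wsum_mono:
  "(\<And>w. length w = n \<Longrightarrow> set w \<subseteq> A \<Longrightarrow> Q w \<Longrightarrow> Q' w) \<Longrightarrow> wsum A n Q \<le> wsum A n Q'"
  unfolding wsum_def by (intro sum_mono mult_left_mono) (auto simp: words_def)

lemma wsum_split: "wsum A n Q = wsum A n (\<lambda>w. Q w \<and> Q' w) + wsum A n (\<lambda>w. Q w \<and> \<not> Q' w)"
  unfolding wsum_def by (auto simp flip: sum.distrib intro!: sum.cong)

lemma wsum_append_le:
  assumes "\<And>u v. length u = n \<Longrightarrow> length v = m \<Longrightarrow> R (u @ v) \<Longrightarrow> Q u \<and> Q' v"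
  shows "wsum A (n + m) R \<le> exp D * (wsum A n Q * wsum A m Q')"
proof -
  have "wsum A (n + m) R = (\<Sum>u\<in>words A n. \<Sum>v\<in>words A m. weight (u @ v) * of_bool (R (u @ v)))"
    unfolding wsum_def by (rule sum_words_add)
  also have "\<dots> \<le> (\<Sum>u\<in>words A n. \<Sum>v\<in>words A m.
      exp D * (weight u * of_bool (Q u) * (weight v * of_bool (Q' v))))"
  proof (intro sum_mono)
    fix u v assume "u \<in> words A n" "v \<in> words A m"
    then have "R (u @ v) \<Longrightarrow> Q u \<and> Q' v" using assms by (auto simp: words_def)
    then show "weight (u @ v) * of_bool (R (u @ v))
        \<le> exp D * (weight u * of_bool (Q u) * (weight v * of_bool (Q' v)))"
      using weight_append_le[of u v] by auto
  qed
  also have "\<dots> = exp D * (wsum A n Q * wsum A m Q')"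
    unfolding wsum_def sum_product by (simp add: sum_distrib_left)
  finally show ?thesis .
qed

lemma wsum_prod_le:
  assumes "\<And>u v. length u = n \<Longrightarrow> length v = m \<Longrightarrow> Q u \<Longrightarrow> Q' v \<Longrightarrow>
    (u = [] \<or> v = [] \<or> M (last u) (hd v) = 1) \<and> R (u @ v)"
  shows "wsum A n Q * wsum A m Q' \<le> exp D * wsum A (n + m) R"
proof -
  have "wsum A n Q * wsum A m Q' = (\<Sum>u\<in>words A n. \<Sum>v\<in>words A m.
      (weight u * of_bool (Q u) * (weight v * of_bool (Q' v))))"
    by (simp add: wsum_def sum_product)
  also have "\<dots> \<le> (\<Sum>u\<in>words A n. \<Sum>v\<in>words A m. exp D * (weight (u @ v) * of_bool (R (u @ v))))"
  proof (intro sum_mono)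
    fix u v assume "u \<in> words A n" "v \<in> words A m"
    then have "Q u \<Longrightarrow> Q' v \<Longrightarrow> (u = [] \<or> v = [] \<or> M (last u) (hd v) = 1) \<and> R (u @ v)"
      using assms by (auto simp: words_def)
    then show "weight u * of_bool (Q u) * (weight v * of_bool (Q' v))
        \<le> exp D * (weight (u @ v) * of_bool (R (u @ v)))"
      using weight_append_ge[of u v] by (cases "Q u \<and> Q' v") auto
  qed
  also have "\<dots> = exp D * wsum A (n + m) R"
    unfolding wsum_def sum_words_add by (simp add: sum_distrib_left)
  finally show ?thesis .
qed

lemma wsum_singleton: "set u \<subseteq> A \<Longrightarrow> finite A \<Longrightarrow> wsum A (length u) (\<lambda>w. w = u) = weight u"
proof -
  assume u: "set u \<subseteq> A" "finite A"
  have "wsum A (length u) (\<lambda>w. w = u) = (\<Sum>w\<in>words A (length u). if w = u then weight w else 0)"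
    unfolding wsum_def by (intro sum.cong) auto
  also have "\<dots> = weight u" using u by (subst sum.delta) (auto simp: words_def[of A "length u"] intro: finite_lists_length_eq)
  finally show ?thesis .
qed

lemma wsum_letters: "finite A \<Longrightarrow> wsum A (Suc 0) Q \<le> (\<Sum>i. exp (\<phi> [i]))"
proof -
  assume "finite A"
  have "wsum A (Suc 0) Q \<le> (\<Sum>i\<in>A. exp (\<phi> [i]))"
    unfolding wsum_def sum_words_1 by (intro sum_mono) auto
  also have "\<dots> \<le> (\<Sum>i. exp (\<phi> [i]))"
    using \<open>finite A\<close> by (intro sum_le_suminf summable_letters) auto
  finally show ?thesis .
qed

text \<open>Crude exponential growth, which makes the suprema in \<open>ssum\<close> finite.\<close>

lemma wsum_le_power: "finite A \<Longrightarrow> wsum A n Q \<le> (exp D * (\<Sum>i. exp (\<phi> [i]))) ^ n"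
proof -
  assume A: "finite A"
  have "wsum A n (\<lambda>_. True) \<le> (exp D * (\<Sum>i. exp (\<phi> [i]))) ^ n"
  proof (induction n)
    case 0
    then show ?case by (simp add: wsum_def)
  next
    case (Suc n)
    have "wsum A (Suc n) (\<lambda>_. True) \<le> exp D * (wsum A n (\<lambda>_. True) * wsum A (Suc 0) (\<lambda>_. True))"
      using wsum_append_le[of n "Suc 0" "\<lambda>_. True" "\<lambda>_. True" "\<lambda>_. True" A] by simp
    also have "\<dots> \<le> exp D * ((exp D * (\<Sum>i. exp (\<phi> [i]))) ^ n * (\<Sum>i. exp (\<phi> [i])))"
      using Suc A by (intro mult_left_mono mult_mono wsum_letters zero_le_power mult_nonneg_nonneg
          suminf_nonneg summable_letters) auto
    finally show ?case by (simp add: algebra_simps)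
  qed
  moreover have "wsum A n Q \<le> wsum A n (\<lambda>_. True)" by (rule wsum_mono) auto
  ultimately show ?thesis by auto
qed

definition ssum :: "nat \<Rightarrow> (nat list \<Rightarrow> bool) \<Rightarrow> real" where
  "ssum n Q = (SUP N. wsum {..<N} n Q)"

lemma bdd_above_wsum: "bdd_above (range (\<lambda>N. wsum {..<N} n Q))"
  by (rule bdd_aboveI2[where M = "(exp D * (\<Sum>i. exp (\<phi> [i]))) ^ n"], rule wsum_le_power) simp

lemma wsum_le_ssum:
  assumes "finite A" shows "wsum A n Q \<le> ssum n Q"
proof -
  obtain N where "A \<subseteq> {..<N}" using assms finite_nat_iff_bounded by auto
  then have "wsum A n Q \<le> wsum {..<N} n Q" by (intro wsum_mono_set) auto
  also have "\<dots> \<le> ssum n Q" unfolding ssum_def by (intro cSUP_upper bdd_above_wsum) auto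
  finally show ?thesis .
qed

lemma ssum_least: "(\<And>N. wsum {..<N} n Q \<le> b) \<Longrightarrow> ssum n Q \<le> b"
  unfolding ssum_def by (intro cSUP_least) auto

lemma ssum_nonneg [simp]: "0 \<le> ssum n Q"
  by (rule order_trans[OF wsum_nonneg wsum_le_ssum[of "{}"]]) simp

lemma less_ssumD: "b < ssum n Q \<Longrightarrow> \<exists>N. b < wsum {..<N} n Q"
  unfolding ssum_def using less_cSUP_iff[OF UNIV_not_empty bdd_above_wsum] by simp

lemma ssum_append_le:
  assumes "\<And>u v. length u = n \<Longrightarrow> length v = m \<Longrightarrow> R (u @ v) \<Longrightarrow> Q u \<and> Q' v"
  shows "ssum (n + m) R \<le> exp D * (ssum n Q * ssum m Q')"
proof (rule ssum_least)
  fix N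
  have "wsum {..<N} (n + m) R \<le> exp D * (wsum {..<N} n Q * wsum {..<N} m Q')"
    using assms by (rule wsum_append_le)
  also have "\<dots> \<le> exp D * (ssum n Q * ssum m Q')"
    by (intro mult_left_mono mult_mono wsum_le_ssum) auto
  finally show "wsum {..<N} (n + m) R \<le> exp D * (ssum n Q * ssum m Q')" .
qed

section \<open>The growth rate of the total weight\<close>

definition total :: "nat \<Rightarrow> real" where
  "total n = ssum n (\<lambda>_. True)"

lemma total_add: "total (n + m) \<le> exp D * (total n * total m)"
  unfolding total_def by (rule ssum_append_le) auto

text \<open>Words that may be followed by themselves, that is, the orbits of period \<open>n\<close>
  through the letter \<open>a\<close>. They can be concatenated freely, hence bound the growth from
  below.\<close>

definition loops :: "nat set \<Rightarrow> nat \<Rightarrow> nat \<Rightarrow> real" where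
  "loops A a n = wsum A n (\<lambda>w. hd w = a \<and> M (last w) a = 1)"

lemma loops_add:
  assumes "n \<ge> 1" "m \<ge> 1"
  shows "loops A a n * loops A a m \<le> exp D * loops A a (n + m)"
  unfolding loops_def
proof (rule wsum_prod_le)
  fix u v :: "nat list"
  assume "length u = n" "length v = m"
  then have "u \<noteq> []" "v \<noteq> []" using assms by auto
  moreover assume "hd u = a \<and> M (last u) a = 1" "hd v = a \<and> M (last v) a = 1"
  ultimately show "(u = [] \<or> v = [] \<or> M (last u) (hd v) = 1)
    \<and> hd (u @ v) = a \<and> M (last (u @ v)) a = 1" by auto
qed

lemma loops_power:
  assumes "n \<ge> 1" "k \<ge> 1" "finite A"
  shows "loops A a n ^ k \<le> exp D ^ k * total (n * k)"
proof -
  have "loops A a n ^ k \<le> exp D ^ k * loops A a (n * k)"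
    using assms(2)
  proof (induction k rule: nat_induct_at_least)
    case base
    have "1 * loops A a n \<le> exp D * loops A a n"
      using D_nonneg by (intro mult_right_mono) (auto simp: loops_def)
    then show ?case by simp
  next
    case (Suc k)
    have "loops A a n ^ Suc k \<le> loops A a n * (exp D ^ k * loops A a (n * k))"
      using Suc by (simp add: mult_left_mono loops_def)
    also have "\<dots> = exp D ^ k * (loops A a n * loops A a (n * k))" by simp
    also have "\<dots> \<le> exp D ^ k * (exp D * loops A a (n + n * k))"
      using assms Suc by (intro mult_left_mono loops_add) auto
    finally show ?case by (simp add: mult_ac)
  qed
  also have "loops A a (n * k) \<le> total (n * k)"
    unfolding loops_def total_def
    by (intro order_trans[OF wsum_mono wsum_le_ssum]) (use assms in auto)
  finally show ?thesis by simp
qed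

lemma total_pos: "0 < total n"
proof -
  have "\<exists>w. length w = n \<and> 0 < weight w"
  proof (cases "n = 0")
    case False
    obtain R where "R \<ge> 2" and R: "\<And>a b n. a \<in> {0} \<Longrightarrow> b \<in> {0} \<Longrightarrow> n \<ge> R \<Longrightarrow>
        \<exists>w. length w = n \<and> admissible M w \<and> hd w = a \<and> last w = b"
      by (rule connecting_words[of "{0}"]) auto
    obtain w where w: "length w = n + R" "admissible M w" using R[of 0 0 "n + R"] by auto
    have "admissible M (take n w)"
    proof (cases "drop n w = []")
      case False
      then have "admissible M (take n w @ drop n w)" using w by simp
      then show ?thesis using False \<open>n \<noteq> 0\<close> w by (subst (asm) admissible_append) auto
    qed (use w in auto)
    then show ?thesis using w by (intro exI[of _ "take n w"]) (auto intro: weight_pos)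
  qed (auto intro: exI[of _ "[]"])
  then obtain w where w: "length w = n" "0 < weight w" by auto
  have "weight w = wsum (set w) n (\<lambda>u. u = w)" using wsum_singleton[of w "set w"] w by simp
  also have "\<dots> \<le> wsum (set w) n (\<lambda>_. True)" by (rule wsum_mono) auto
  also have "\<dots> \<le> total n" unfolding total_def by (intro wsum_le_ssum) auto
  finally show ?thesis using w by simp
qed

text \<open>A connecting word from \<open>a\<close> to \<open>a\<close> without its last letter can
  be followed by itself.\<close>

lemma ex_loop: "\<exists>n\<ge>1. \<exists>A. finite A \<and> 0 < loops A a n"
proof -
  obtain R where R: "R \<ge> 2" "\<And>x y n. x \<in> {a} \<Longrightarrow> y \<in> {a} \<Longrightarrow> n \<ge> R \<Longrightarrow>
      \<exists>w. length w = n \<and> admissible M w \<and> hd w = x \<and> last w = y"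
    using connecting_words[of "{a}"] by auto
  then obtain w where w: "length w = R" "admissible M w" "hd w = a" "last w = a" by blast
  define u where "u = butlast w"
  have eq: "w = u @ [a]" and ne: "u \<noteq> []" using w R unfolding u_def
    by (metis append_butlast_last_id list.size(3) not_numeral_le_zero, cases w, auto)
  have u: "admissible M u" "M (last u) a = 1" "hd u = a"
    using w(2,3) ne unfolding eq by (auto simp: admissible_append)
  have "0 < weight u" using u by (intro weight_pos)
  also have "\<dots> = wsum (set u) (length u) (\<lambda>w. w = u)" by (simp add: wsum_singleton)
  also have "\<dots> \<le> loops (set u) a (length u)" unfolding loops_def
    using u by (intro wsum_mono) auto
  finally show ?thesis using ne by (intro exI[of _ "length u"] conjI exI[of _ "set u"]) (auto simp: Suc_leI)
qed

text \<open>Adding \<open>D\<close> makes \<open>ln (total n)\<close> subadditive, so this infimum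
  is also the exponential growth rate. It is identified with the Gurevich pressure later.\<close>

definition pressure :: real where
  "pressure = (INF n\<in>{1..}. (ln (total n) + D) / real n)"

lemma pressure_tendsto_aux: "(\<lambda>n. (ln (total n) + D) / real n) \<longlonglongrightarrow> pressure"
  and pressure_le: "n \<ge> 1 \<Longrightarrow> real n * pressure \<le> ln (total n) + D"
proof -
  obtain k A where k: "k \<ge> 1" "finite A" and pos: "0 < loops A 0 k" using ex_loop[of 0] by blast
  have sub: "ln (total (m + n)) + D \<le> ln (total m) + D + (ln (total n) + D)" for m n
  proof -
    have "ln (total (m + n)) \<le> ln (exp D * (total m * total n))"
      using total_pos total_add by (intro ln_mono) auto
    also have "\<dots> = D + (ln (total m) + ln (total n))"
      using total_pos by (simp add: ln_mult_pos)
    finally show ?thesis by simp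
  qed
  have mul: "ln (total (n * j)) + D \<le> real j * (ln (total n) + D)" if "j \<ge> 1" for n j
    using that
  proof (induction j rule: nat_induct_at_least)
    case (Suc j)
    then show ?case using sub[of n "n * j"] by (simp add: algebra_simps)
  qed simp
  \<comment> \<open>Repeating a fixed loop at the letter 0 gives the linear lower bound that
    Fekete's lemma asks for.\<close>
  define c where "c = (ln (loops A 0 k) - D) / real k"
  have low: "c * real n \<le> ln (total n) + D" if "n \<ge> 1" for n
  proof -
    have "real n * ln (loops A 0 k) = ln (loops A 0 k ^ n)" using pos by (simp add: ln_realpow)
    also have "\<dots> \<le> ln (exp D ^ n * total (k * n))"
      using pos that k by (intro ln_mono loops_power) (auto simp: total_pos)
    also have "\<dots> = real n * D + ln (total (n * k))"
      using total_pos by (simp add: ln_mult_pos ln_realpow mult.commute)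
    also have "\<dots> \<le> real n * D + real k * (ln (total n) + D)"
      using mul[OF k(1), of n] D_nonneg by simp
    finally have "real n * (ln (loops A 0 k) - D) \<le> real k * (ln (total n) + D)"
      by (simp add: algebra_simps)
    then show ?thesis using k by (simp add: c_def field_simps)
  qed
  show lim: "(\<lambda>n. (ln (total n) + D) / real n) \<longlonglongrightarrow> pressure"
    unfolding pressure_def using sub low by (intro fekete[of "\<lambda>n. ln (total n) + D" c]) auto
  show "real n * pressure \<le> ln (total n) + D" if "n \<ge> 1"
  proof -
    have "bdd_below ((\<lambda>n. (ln (total n) + D) / real n) ` {1..})"
      using low by (intro bdd_belowI2[of _ c]) (auto simp: field_simps)
    then have "pressure \<le> (ln (total n) + D) / real n"
      unfolding pressure_def using that by (intro cINF_lower) auto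
    then show ?thesis using that by (simp add: field_simps)
  qed
qed

lemma exp_pressure_le_total: "n \<ge> 1 \<Longrightarrow> exp (- D) * exp (real n * pressure) \<le> total n"
proof -
  assume n: "n \<ge> 1"
  have "exp (real n * pressure) \<le> exp (ln (total n) + D)" using pressure_le[OF n] by simp
  also have "\<dots> = exp D * total n" using total_pos by (simp add: exp_add)
  finally show ?thesis by (simp add: exp_minus field_simps)
qed

text \<open>The power trick: the \<open>k\<close>-th power of the left side is at most
  \<open>exp D ^ k * total (n * k)\<close>. Taking \<open>k\<close>-th roots and letting
  \<open>k\<close> tend to infinity leaves a bound at the fixed length \<open>n\<close> with an
  explicit constant.\<close>

lemma loops_le:
  assumes "n \<ge> 1" "finite A"
  shows "loops A a n \<le> exp D * exp (real n * pressure)"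
proof (cases "loops A a n > 0")
  case True
  have "(\<lambda>k. (ln (total (n * k)) + D) / real (n * k)) \<longlonglongrightarrow> pressure"
    using assms by (intro filterlim_compose[OF pressure_tendsto_aux])
      (auto intro!: filterlim_subseq simp: strict_mono_def)
  then have "(\<lambda>k. D + real n * ((ln (total (n * k)) + D) / real (n * k))) \<longlonglongrightarrow> D + real n * pressure"
    by (intro tendsto_intros)
  moreover have "\<forall>\<^sub>F k in sequentially. ln (loops A a n) \<le> D + real n * ((ln (total (n * k)) + D) / real (n * k))"
    using eventually_ge_at_top[of 1]
  proof eventually_elim
    case (elim k)
    have "real k * ln (loops A a n) = ln (loops A a n ^ k)" using True by (simp add: ln_realpow)
    also have "\<dots> \<le> ln (exp D ^ k * total (n * k))"
      using True elim assms by (intro ln_mono loops_power) (auto simp: total_pos)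
    also have "\<dots> = real k * D + ln (total (n * k))"
      using total_pos by (simp add: ln_mult_pos ln_realpow)
    also have "\<dots> \<le> real k * D + ln (total (n * k)) + D" using D_nonneg by simp
    finally have "ln (loops A a n) \<le> D + (ln (total (n * k)) + D) / real k"
      using elim by (simp add: field_simps)
    also have "(ln (total (n * k)) + D) / real k = real n * ((ln (total (n * k)) + D) / real (n * k))"
      using assms by simp
    finally show ?case .
  qed
  ultimately have "ln (loops A a n) \<le> D + real n * pressure" by (intro tendsto_lowerbound) auto
  then have "exp (ln (loops A a n)) \<le> exp (D + real n * pressure)" by simp
  then show ?thesis using True by (simp add: exp_add)
next
  case False
  then have "loops A a n \<le> 0" by simp
  also have "0 \<le> exp D * exp (real n * pressure)" by simp
  finally show ?thesis .
qed

definition between :: "nat set \<Rightarrow> nat \<Rightarrow> nat \<Rightarrow> nat \<Rightarrow> real" where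
  "between A b c n = wsum A n (\<lambda>w. hd w = b \<and> last w = c)"

text \<open>A fixed word \<open>v\<close> leading from \<open>c\<close> back to \<open>b\<close>
  closes every word from \<open>b\<close> to \<open>c\<close> to a loop at \<open>b\<close>, and
  loops are already bounded. The weight of \<open>v\<close> enters the constant.\<close>

lemma between_le:
  "\<exists>K>0. \<forall>A n. finite A \<longrightarrow> n \<ge> 1 \<longrightarrow> between A b c n \<le> K * exp (real n * pressure)"
proof -
  obtain R where R: "R \<ge> 2" "\<And>x y n. x \<in> {b,c} \<Longrightarrow> y \<in> {b,c} \<Longrightarrow> n \<ge> R \<Longrightarrow>
      \<exists>w. length w = n \<and> admissible M w \<and> hd w = x \<and> last w = y"
    using connecting_words[of "{b,c}"] by auto
  then obtain w where w: "length w = Suc R" "admissible M w" "hd w = c" "last w = b"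
    by (metis insertCI le_SucI order_refl)
  \<comment> \<open>Both end letters of the connecting word are removed, since they already occur as
    the ends of the word that \<open>v\<close> closes.\<close>
  define v where "v = butlast (tl w)"
  obtain w' where w': "w = c # w'" "length w' = R" using w by (cases w) auto
  then have "w' \<noteq> []" using R by auto
  then have eq: "w = [c] @ v @ [b]"
    using w(4) append_butlast_last_id[of w'] by (simp add: v_def w'(1))
  have ne: "v \<noteq> []" using w(1) R by (auto simp: eq)
  have v: "admissible M v" "M c (hd v) = 1" "M (last v) b = 1"
    using w(2) ne unfolding eq by (auto simp: admissible_append admissible_Cons)
  define K where "K = exp D * exp D * exp (real (length v) * pressure) / weight v"
  show ?thesis
  proof (intro exI[of _ K] conjI allI impI)
    show "K > 0" using weight_pos[OF v(1)] by (simp add: K_def)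
    fix A :: "nat set" and n :: nat assume A: "finite A" and n: "n \<ge> 1"
    define B where "B = A \<union> set v"
    have B: "finite B" "A \<subseteq> B" "set v \<subseteq> B" using A by (auto simp: B_def)
    have "between A b c n * weight v \<le> between B b c n * wsum B (length v) (\<lambda>w. w = v)"
      unfolding between_def using B
      by (subst wsum_singleton) (auto intro!: mult_right_mono wsum_mono_set)
    also have "\<dots> \<le> exp D * loops B b (n + length v)"
      unfolding between_def loops_def
    proof (rule wsum_prod_le)
      fix u v' :: "nat list" assume *: "length u = n" "hd u = b \<and> last u = c" "v' = v"
      then have "u \<noteq> []" using n by auto
      with * show "(u = [] \<or> v' = [] \<or> M (last u) (hd v') = 1) \<and> hd (u @ v') = b \<and> M (last (u @ v')) b = 1"
        using v ne n by auto
    qed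
    also have "\<dots> \<le> exp D * (exp D * exp (real (n + length v) * pressure))"
      using B n by (intro mult_left_mono loops_le) auto
    finally show "between A b c n \<le> K * exp (real n * pressure)"
      using weight_pos[OF v(1)] by (simp add: K_def field_simps exp_add)
  qed
qed

lemma extend_between:
  assumes "m \<ge> 1" "u \<noteq> []" "v \<noteq> []" "M (last u) b = 1" "M c (hd v) = 1"
    and B: "finite B" "A \<subseteq> B" "set u \<subseteq> B" "set v \<subseteq> B"
  shows "weight u * weight v * between A b c m
    \<le> exp (2 * D) * between B (hd u) (last v) (length u + m + length v)"
proof -
  have "weight u * weight v * between A b c m \<le> weight u * weight v * between B b c m"
    unfolding between_def using B by (intro mult_left_mono wsum_mono_set) auto
  also have "\<dots> = (wsum B (length u) (\<lambda>w. w = u) * wsum B m (\<lambda>w. hd w = b \<and> last w = c))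
      * wsum B (length v) (\<lambda>w. w = v)"
    using B by (simp add: wsum_singleton between_def)
  also have "\<dots> \<le> (exp D * wsum B (length u + m) (\<lambda>w. w \<noteq> [] \<and> hd w = hd u \<and> last w = c))
      * wsum B (length v) (\<lambda>w. w = v)"
  proof (intro mult_right_mono wsum_prod_le)
    fix u' v' :: "nat list" assume *: "u' = u" "length v' = m" "hd v' = b \<and> last v' = c"
    then have "v' \<noteq> []" using assms by auto
    with * show "(u' = [] \<or> v' = [] \<or> M (last u') (hd v') = 1) \<and>
        (u' @ v' \<noteq> [] \<and> hd (u' @ v') = hd u \<and> last (u' @ v') = c)"
      using assms by auto
  qed auto
  also have "\<dots> = exp D * (wsum B (length u + m) (\<lambda>w. w \<noteq> [] \<and> hd w = hd u \<and> last w = c)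
      * wsum B (length v) (\<lambda>w. w = v))" by simp
  also have "\<dots> \<le> exp D * (exp D * between B (hd u) (last v) (length u + m + length v))"
    unfolding between_def
  proof (intro mult_left_mono wsum_prod_le)
    fix u' v' :: "nat list" assume "u' \<noteq> [] \<and> hd u' = hd u \<and> last u' = c" "v' = v"
    then show "(u' = [] \<or> v' = [] \<or> M (last u') (hd v') = 1) \<and>
        (hd (u' @ v') = hd u \<and> last (u' @ v') = last v)"
      using assms by auto
  qed auto
  finally show ?thesis by (simp add: mult_exp_exp flip: mult.assoc)
qed

end

section \<open>Exponential growth of the weight sums\<close>

context weighted_words
begin

lemma ssum_tail_letters:
  assumes "\<And>i. Q [i] \<Longrightarrow> i \<ge> N"
  shows "ssum (Suc 0) Q \<le> (\<Sum>i. exp (\<phi> [i + N]))"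
proof (rule ssum_least)
  fix K
  have "wsum {..<K} (Suc 0) Q = (\<Sum>i<K. exp (\<phi> [i]) * of_bool (Q [i]))"
    unfolding wsum_def sum_words_1 by simp
  also have "\<dots> \<le> (\<Sum>i<K + N. exp (\<phi> [i]) * of_bool (N \<le> i))"
    by (rule order_trans[OF sum_mono sum_mono2]) (use assms in auto)
  also have "\<dots> = (\<Sum>i\<in>{N..<K + N}. exp (\<phi> [i]))"
    by (rule sum.mono_neutral_cong_right) auto
  also have "\<dots> = (\<Sum>i<K. exp (\<phi> [i + N]))"
    using sum.shift_bounds_nat_ivl[of "\<lambda>i. exp (\<phi> [i])" 0 N K]
    by (simp add: lessThan_atLeast0)
  also have "\<dots> \<le> (\<Sum>i. exp (\<phi> [i + N]))"
    using summable_letters by (intro sum_le_suminf) (auto simp: summable_iff_shift[of "\<lambda>i. exp (\<phi> [i])"])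
  finally show "wsum {..<K} (Suc 0) Q \<le> (\<Sum>i. exp (\<phi> [i + N]))" .
qed

definition from_to :: "nat set \<Rightarrow> nat \<Rightarrow> real" where
  "from_to F n = ssum n (\<lambda>w. hd w \<in> F \<and> last w \<in> F)"

definition ending_in :: "nat set \<Rightarrow> nat \<Rightarrow> real" where
  "ending_in F n = ssum n (\<lambda>w. last w \<in> F)"

lemma wsum_from_to:
  assumes "finite F" "finite A" "n \<ge> 1"
  shows "wsum A n (\<lambda>w. hd w \<in> F \<and> last w \<in> F) = (\<Sum>p\<in>F\<times>F. between A (fst p) (snd p) n)"
proof -
  have *: "of_bool (hd w \<in> F \<and> last w \<in> F) = (\<Sum>p\<in>F\<times>F. of_bool (hd w = fst p \<and> last w = snd p) :: real)" for w
  proof -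
    have "(\<Sum>p\<in>F\<times>F. of_bool (hd w = fst p \<and> last w = snd p) :: real)
        = (\<Sum>p\<in>F\<times>F. if p = (hd w, last w) then 1 else 0)"
      by (intro sum.cong) auto
    then show ?thesis using assms by (auto simp: sum.delta)
  qed
  show ?thesis unfolding wsum_def between_def * sum_distrib_left by (rule sum.swap)
qed

text \<open>
  Summability makes the letters outside a large finite set \<open>F\<close> so light that stripping one of them
  from the end (or the start) of a word contracts the normalised sums; this forces the words with
  both ends in \<open>F\<close> to carry a definite part of the total weight.
\<close>

lemma total_rec:
  "total (Suc n) \<le> ending_in {..<N} (Suc n) + exp D * (\<Sum>i. exp (\<phi> [i + N])) * total n"
  unfolding total_def ending_in_def
proof (rule ssum_least)
  fix K
  let ?A = "{..<K} :: nat set" and ?F = "{..<N} :: nat set"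
  have "wsum ?A (Suc n) (\<lambda>_. True)
      = wsum ?A (Suc n) (\<lambda>w. last w \<in> ?F) + wsum ?A (Suc n) (\<lambda>w. last w \<notin> ?F)"
    using wsum_split[of ?A "Suc n" "\<lambda>_. True" "\<lambda>w. last w \<in> ?F"] by simp
  also have "wsum ?A (Suc n) (\<lambda>w. last w \<in> ?F) \<le> ssum (Suc n) (\<lambda>w. last w \<in> ?F)"
    by (rule wsum_le_ssum) simp
  also have "wsum ?A (Suc n) (\<lambda>w. last w \<notin> ?F) \<le> ssum (n + Suc 0) (\<lambda>w. last w \<notin> ?F)"
    using wsum_le_ssum[of ?A] by simp
  also have "\<dots> \<le> exp D * (ssum n (\<lambda>_. True) * ssum (Suc 0) (\<lambda>w. last w \<notin> ?F))"
    by (rule ssum_append_le) (auto simp: length_Suc_conv)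
  also have "\<dots> \<le> exp D * (ssum n (\<lambda>_. True) * (\<Sum>i. exp (\<phi> [i + N])))"
    by (intro mult_left_mono ssum_tail_letters) auto
  finally show "wsum ?A (Suc n) (\<lambda>_. True) \<le> ssum (Suc n) (\<lambda>w. last w \<in> ?F)
      + exp D * (\<Sum>i. exp (\<phi> [i + N])) * ssum n (\<lambda>_. True)" by (simp add: mult_ac)
qed

lemma ending_in_rec:
  assumes "n \<ge> 1"
  shows "ending_in {..<N} (Suc n) \<le> from_to {..<N} (Suc n)
    + exp D * (\<Sum>i. exp (\<phi> [i + N])) * ending_in {..<N} n"
  unfolding ending_in_def from_to_def
proof (rule ssum_least)
  fix K
  let ?A = "{..<K} :: nat set" and ?F = "{..<N} :: nat set"
  have "wsum ?A (Suc n) (\<lambda>w. last w \<in> ?F) = wsum ?A (Suc n) (\<lambda>w. last w \<in> ?F \<and> hd w \<in> ?F)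
      + wsum ?A (Suc n) (\<lambda>w. last w \<in> ?F \<and> hd w \<notin> ?F)"
    using wsum_split[of ?A "Suc n" "\<lambda>w. last w \<in> ?F" "\<lambda>w. hd w \<in> ?F"] by simp
  also have "wsum ?A (Suc n) (\<lambda>w. last w \<in> ?F \<and> hd w \<in> ?F)
      \<le> ssum (Suc n) (\<lambda>w. hd w \<in> ?F \<and> last w \<in> ?F)"
    by (rule order_trans[OF wsum_mono wsum_le_ssum]) auto
  also have "wsum ?A (Suc n) (\<lambda>w. last w \<in> ?F \<and> hd w \<notin> ?F)
      \<le> ssum (Suc 0 + n) (\<lambda>w. last w \<in> ?F \<and> hd w \<notin> ?F)"
    using wsum_le_ssum[of ?A] by simp
  also have "\<dots> \<le> exp D * (ssum (Suc 0) (\<lambda>w. hd w \<notin> ?F) * ssum n (\<lambda>w. last w \<in> ?F))"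
  proof (rule ssum_append_le)
    fix u v :: "nat list" assume *: "length u = Suc 0" "length v = n" "last (u @ v) \<in> ?F \<and> hd (u @ v) \<notin> ?F"
    then have "u \<noteq> []" "v \<noteq> []" using assms by auto
    then show "hd u \<notin> ?F \<and> last v \<in> ?F" using * by auto
  qed
  also have "\<dots> \<le> exp D * ((\<Sum>i. exp (\<phi> [i + N])) * ssum n (\<lambda>w. last w \<in> ?F))"
    by (intro mult_left_mono mult_right_mono ssum_tail_letters) auto
  finally show "wsum ?A (Suc n) (\<lambda>w. last w \<in> ?F) \<le> ssum (Suc n) (\<lambda>w. hd w \<in> ?F \<and> last w \<in> ?F)
      + exp D * (\<Sum>i. exp (\<phi> [i + N])) * ssum n (\<lambda>w. last w \<in> ?F)" by (simp add: mult_ac)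
qed

lemma from_to_le:
  assumes "finite F"
  shows "\<exists>K>0. \<forall>n\<ge>1. from_to F n \<le> K * exp (real n * pressure)"
proof -
  have "\<forall>p. \<exists>K>0. \<forall>A n. finite A \<longrightarrow> n \<ge> 1 \<longrightarrow> between A (fst p) (snd p) n \<le> K * exp (real n * pressure)"
    using between_le by blast
  then obtain K where K: "\<And>p. K p > 0"
    "\<And>p A n. finite A \<Longrightarrow> n \<ge> 1 \<Longrightarrow> between A (fst p) (snd p) n \<le> K p * exp (real n * pressure)"
    by metis
  have "from_to F n \<le> (1 + (\<Sum>p\<in>F\<times>F. K p)) * exp (real n * pressure)" if "n \<ge> 1" for n
    unfolding from_to_def
  proof (rule ssum_least)
    fix N
    have "wsum {..<N} n (\<lambda>w. hd w \<in> F \<and> last w \<in> F) = (\<Sum>p\<in>F\<times>F. between {..<N} (fst p) (snd p) n)"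
      using assms that by (intro wsum_from_to) auto
    also have "\<dots> \<le> (\<Sum>p\<in>F\<times>F. K p * exp (real n * pressure))"
      using that by (intro sum_mono K) auto
    also have "\<dots> = (\<Sum>p\<in>F\<times>F. K p) * exp (real n * pressure)" by (simp add: sum_distrib_right)
    also have "\<dots> \<le> (1 + (\<Sum>p\<in>F\<times>F. K p)) * exp (real n * pressure)" by (intro mult_right_mono) auto
    finally show "wsum {..<N} n (\<lambda>w. hd w \<in> F \<and> last w \<in> F) \<le> (1 + (\<Sum>p\<in>F\<times>F. K p)) * exp (real n * pressure)" .
  qed
  moreover have "0 < 1 + (\<Sum>p\<in>F\<times>F. K p)"
    using K(1) by (intro add_pos_nonneg sum_nonneg) (auto intro: less_imp_le)
  ultimately show ?thesis by blast
qed

definition normal :: "(nat \<Rightarrow> real) \<Rightarrow> nat \<Rightarrow> real" where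
  "normal x n = x n * exp (- real n * pressure)"

lemma normal_rec:
  assumes "x (Suc n) \<le> y (Suc n) + r * x n"
  shows "normal x (Suc n) \<le> normal y (Suc n) + r * exp (- pressure) * normal x n"
proof -
  have "normal x (Suc n) \<le> (y (Suc n) + r * x n) * exp (- real (Suc n) * pressure)"
    unfolding normal_def using assms by (intro mult_right_mono) auto
  also have "\<dots> = normal y (Suc n) + r * exp (- pressure) * normal x n"
    by (simp add: normal_def algebra_simps flip: exp_add)
  finally show ?thesis .
qed

lemma normal_le_iff: "normal x n \<le> K \<longleftrightarrow> x n \<le> K * exp (real n * pressure)"
  by (simp add: normal_def exp_minus field_simps)

lemma le_normal_iff: "K \<le> normal x n \<longleftrightarrow> K * exp (real n * pressure) \<le> x n"
  by (simp add: normal_def exp_minus field_simps)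

lemma ex_light_tail: "\<exists>N. exp D * (\<Sum>i. exp (\<phi> [i + N])) * exp (- pressure) \<le> 1/2"
proof -
  have "(\<lambda>N. (\<Sum>i. exp (\<phi> [i + N]))) \<longlonglongrightarrow> 0"
    using suminf_exist_split2[OF summable_letters] .
  then have "(\<lambda>N. exp D * (\<Sum>i. exp (\<phi> [i + N])) * exp (- pressure)) \<longlonglongrightarrow> exp D * 0 * exp (- pressure)"
    by (intro tendsto_intros)
  then have "\<forall>\<^sub>F N in sequentially. exp D * (\<Sum>i. exp (\<phi> [i + N])) * exp (- pressure) < 1/2"
    by (rule order_tendstoD(2)) auto
  then show ?thesis by (metis (lifting) eventually_sequentially order_refl less_imp_le)
qed

text \<open>For large \<open>N\<close> both stripping recursions have ratio at most 1/2. They carry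
  the upper bound for \<open>from_to\<close> to \<open>ending_in\<close> and on to
  \<open>total\<close>. In the other direction they carry the lower bound \<open>exp (- D)\<close>
  for the normalised total to the words with both ends below \<open>N\<close>, though only at one of
  the last \<open>J\<close> lengths.\<close>

lemma total_le: "\<exists>K>0. \<forall>n. total n \<le> K * exp (real n * pressure)"
  and from_to_ge: "\<exists>N J c. c > 0 \<and> (\<forall>n>J. \<exists>s<J. c * exp (real (n - s) * pressure) \<le> from_to {..<N} (n - s))"
proof -
  obtain N where N: "exp D * (\<Sum>i. exp (\<phi> [i + N])) * exp (- pressure) \<le> 1/2" using ex_light_tail by blast
  let ?F = "{..<N}" and ?q = "exp D * (\<Sum>i. exp (\<phi> [i + N])) * exp (- pressure)"
  have q: "0 \<le> ?q"
    using summable_letters by (intro mult_nonneg_nonneg suminf_nonneg)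
      (auto simp: summable_iff_shift[of "\<lambda>i. exp (\<phi> [i])"])
  have rec1: "normal (ending_in ?F) (Suc n) \<le> normal (from_to ?F) (Suc n) + ?q * normal (ending_in ?F) n"
    if "n \<ge> 1" for n
    by (rule normal_rec[of "ending_in ?F" n "from_to ?F"], rule ending_in_rec[OF that])
  have rec2: "normal total (Suc n) \<le> normal (ending_in ?F) (Suc n) + ?q * normal total n" for n
    by (rule normal_rec[of total n "ending_in ?F"], rule total_rec)
  obtain K0 where K0: "K0 > 0" "\<And>n. n \<ge> 1 \<Longrightarrow> from_to ?F n \<le> K0 * exp (real n * pressure)"
    using from_to_le[of ?F] by auto
  define K1 where "K1 = 2 * K0 + \<bar>normal (ending_in ?F) 1\<bar>"
  have K1: "normal (ending_in ?F) n \<le> K1" if "n \<ge> 1" for n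
    unfolding K1_def using rec1 q N
  proof (rule contraction_bounded)
    show "normal (from_to ?F) n \<le> K0" if "n \<ge> 1" for n using K0 that by (simp add: normal_le_iff)
  qed (use K0 that in auto)
  define K2 where "K2 = 2 * K1 + \<bar>normal total 1\<bar>"
  have "0 \<le> K1" using K0 by (simp add: K1_def)
  have K2: "normal total n \<le> K2" if "n \<ge> 1" for n
    unfolding K2_def using rec2 q N K1 \<open>0 \<le> K1\<close> that by (rule contraction_bounded)
  show "\<exists>K>0. \<forall>n. total n \<le> K * exp (real n * pressure)"
  proof (intro exI[of _ "max (K2 + 1) (total 0)"] conjI allI)
    show "0 < max (K2 + 1) (total 0)" using total_pos[of 0] by auto
    fix n show "total n \<le> max (K2 + 1) (total 0) * exp (real n * pressure)"
    proof (cases "n = 0")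
      case False
      then have "normal total n \<le> max (K2 + 1) (total 0)" using K2[of n] by auto
      then show ?thesis by (simp add: normal_le_iff)
    qed simp
  qed
  have nonneg: "0 \<le> normal total n" "0 \<le> normal (ending_in ?F) n" for n
    by (auto simp: normal_def total_def ending_in_def)
  have "\<exists>J. \<forall>n>J. exp (- D) \<le> normal total n \<longrightarrow> (\<exists>s<J. exp (- D) / 4 \<le> normal (ending_in ?F) (n - s))"
    using rec2 q N K2 by (rule contraction_lower) (simp_all add: nonneg)
  then obtain J1 where J1: "\<And>n. n > J1 \<Longrightarrow> exp (- D) \<le> normal total n \<Longrightarrow>
      \<exists>s<J1. exp (- D) / 4 \<le> normal (ending_in ?F) (n - s)" by blast
  have "\<exists>J. \<forall>n>J. exp (- D) / 4 \<le> normal (ending_in ?F) n \<longrightarrow>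
      (\<exists>s<J. exp (- D) / 4 / 4 \<le> normal (from_to ?F) (n - s))"
    using rec1 q N K1 by (rule contraction_lower) (simp_all add: nonneg)
  then obtain J2 where J2: "\<And>n. n > J2 \<Longrightarrow> exp (- D) / 4 \<le> normal (ending_in ?F) n \<Longrightarrow>
      \<exists>s<J2. exp (- D) / 4 / 4 \<le> normal (from_to ?F) (n - s)" by blast
  \<comment> \<open>Each of the two stages loses a factor 4 and moves back by fewer than
    \<open>J1\<close> or \<open>J2\<close> lengths.\<close>
  show "\<exists>N J c. c > 0 \<and> (\<forall>n>J. \<exists>s<J. c * exp (real (n - s) * pressure) \<le> from_to {..<N} (n - s))"
  proof (rule exI[of _ N], rule exI[of _ "J1 + J2"], rule exI[of _ "exp (- D) / 4 / 4"], intro conjI allI impI)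
    fix n assume n: "n > J1 + J2"
    have "exp (- D) \<le> normal total n" using exp_pressure_le_total[of n] n by (simp add: le_normal_iff)
    then obtain s where s: "s < J1" "exp (- D) / 4 \<le> normal (ending_in ?F) (n - s)" using J1[of n] n by auto
    then have s1: "n - s > J2" using n by arith
    obtain s' where s': "s' < J2" "exp (- D) / 4 / 4 \<le> normal (from_to ?F) (n - s - s')"
      using J2[of "n - s"] s s1 by blast
    then show "\<exists>s<J1 + J2. exp (- D) / 4 / 4 * exp (real (n - s) * pressure) \<le> from_to {..<N} (n - s)"
      using s by (intro exI[of _ "s + s'"]) (auto simp: le_normal_iff)
  qed simp
qed

text \<open>Some pair of letters from a finite set carries a fixed part of the weight at some length
  close to \<open>n\<close>. Connecting words of adjusted lengths join it to \<open>b\<close> and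
  \<open>c\<close> so that the total length is exactly \<open>n\<close>.\<close>

lemma between_ge:
  "\<exists>c0>0. \<exists>n0. \<forall>n\<ge>n0. \<exists>N0. \<forall>N\<ge>N0. c0 * exp (real n * pressure) \<le> between {..<N} b c n"
proof -
  obtain N J c1 where c1: "c1 > 0"
    and ft: "\<And>n. n > J \<Longrightarrow> \<exists>s<J. c1 * exp (real (n - s) * pressure) \<le> from_to {..<N} (n - s)"
    using from_to_ge by blast
  let ?F = "{..<N}"
  obtain R where R: "R \<ge> 2" "\<And>x y n. x \<in> insert b (insert c ?F) \<Longrightarrow> y \<in> insert b (insert c ?F) \<Longrightarrow> n \<ge> R \<Longrightarrow>
      \<exists>w. length w = n \<and> admissible M w \<and> hd w = x \<and> last w = y"
    by (rule connecting_words[of "insert b (insert c ?F)"]) auto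
  have "\<exists>u. length u = R - 1 \<and> admissible M u \<and> hd u = b \<and> M (last u) x = 1" if x: "x \<in> ?F" for x
  proof -
    obtain w where w: "length w = R" "admissible M w" "hd w = b" "last w = x"
      using R(2)[of b x R] x by auto
    then obtain u where eq: "w = u @ [x]" using R(1)
      by (metis append_butlast_last_id list.size(3) not_numeral_le_zero)
    have ne: "u \<noteq> []" using w(1) R by (auto simp: eq)
    then show ?thesis
      using w(1-3) unfolding eq by (intro exI[of _ u]) (auto simp: admissible_append)
  qed
  then obtain pre where pre: "\<And>x. x \<in> ?F \<Longrightarrow> length (pre x) = R - 1"
    "\<And>x. x \<in> ?F \<Longrightarrow> admissible M (pre x)" "\<And>x. x \<in> ?F \<Longrightarrow> hd (pre x) = b"
    "\<And>x. x \<in> ?F \<Longrightarrow> M (last (pre x)) x = 1"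
    by metis
  \<comment> \<open>The good length may fall short of the target by some \<open>s < J\<close>. The
    connecting word at the right end absorbs this: it depends on the pair of end letter and
    \<open>s\<close>, and is \<open>s\<close> letters longer.\<close>
  have "\<exists>u. length u = R + snd p - 1 \<and> admissible M u \<and> last u = c \<and> M (fst p) (hd u) = 1"
    if x: "fst p \<in> ?F" for p
  proof -
    obtain w where w: "length w = R + snd p" "admissible M w" "hd w = fst p" "last w = c"
      using R(2)[of "fst p" c "R + snd p"] x by auto
    then obtain u where eq: "w = fst p # u" using R(1) by (cases w) auto
    have ne: "u \<noteq> []" using w(1) R by (auto simp: eq)
    then show ?thesis
      using w(1,2,4) unfolding eq by (intro exI[of _ u]) (auto simp: admissible_Cons)
  qed
  then obtain post where post: "\<And>p. fst p \<in> ?F \<Longrightarrow> length (post p) = R + snd p - 1"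
    "\<And>p. fst p \<in> ?F \<Longrightarrow> admissible M (post p)" "\<And>p. fst p \<in> ?F \<Longrightarrow> last (post p) = c"
    "\<And>p. fst p \<in> ?F \<Longrightarrow> M (fst p) (hd (post p)) = 1"
    by metis
  define k1 where "k1 = Min (insert 1 ((\<lambda>x. weight (pre x)) ` ?F))"
  define k2 where "k2 = Min (insert 1 ((\<lambda>p. weight (post p)) ` (?F \<times> {..<J})))"
  have k1: "k1 > 0" "\<And>x. x \<in> ?F \<Longrightarrow> k1 \<le> weight (pre x)"
    unfolding k1_def using pre by (auto intro!: weight_pos)
  have k2: "k2 > 0" "\<And>p. p \<in> ?F \<times> {..<J} \<Longrightarrow> k2 \<le> weight (post p)"
    unfolding k2_def using post by (auto intro!: weight_pos)
  \<comment> \<open>Pigeonhole over the \<open>N * N\<close> pairs of end letters; the factor 2 pays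
    for replacing the supremum by one finite alphabet, and 1 is added in case \<open>N\<close> is
    0.\<close>
  define c2 where "c2 = c1 / (2 * (real N * real N + 1))"
  have c2: "c2 > 0" using c1 by (simp add: c2_def add_nonneg_pos)
  \<comment> \<open>Compares \<open>exp (m * pressure)\<close> with
    \<open>exp (n * pressure)\<close> for lengths that differ by at most \<open>J + 2 * R\<close>;
    the absolute value is there because the sign of the pressure is unknown.\<close>
  define E where "E = exp (- (real (J + 2 * R) * \<bar>pressure\<bar>))"
  define c0 where "c0 = exp (- 2 * D) * k1 * k2 * c2 * E"
  have E: "E > 0" by (simp add: E_def)
  have c0: "c0 > 0" using k1 k2 c2 E by (simp add: c0_def)
  show ?thesis
  proof (rule exI[of _ c0], rule conjI[OF c0], rule exI[of _ "J + 2 * R"], intro allI impI)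
    fix n assume n: "n \<ge> J + 2 * R"
    define n' where "n' = n - (2 * R - 2)"
    have n': "n' > J" using n R by (auto simp: n'_def)
    obtain s where s: "s < J" "c1 * exp (real (n' - s) * pressure) \<le> from_to ?F (n' - s)"
      using ft[OF n'] by blast
    define m where "m = n' - s"
    have m: "m \<ge> 1" "m + s + 2 * R = n + 2" using n' s n R by (auto simp: m_def n'_def)
    have "c1 / 2 * exp (real m * pressure) < from_to ?F m"
      by (rule less_le_trans[of _ "c1 * exp (real m * pressure)"]) (use s c1 in \<open>auto simp: m_def\<close>)
    then obtain K where K: "c1 / 2 * exp (real m * pressure) < wsum {..<K} m (\<lambda>w. hd w \<in> ?F \<and> last w \<in> ?F)"
      unfolding from_to_def using less_ssumD by blast
    have "\<exists>p\<in>?F\<times>?F. c2 * exp (real m * pressure) \<le> between {..<K} (fst p) (snd p) m"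
    proof (rule ccontr)
      assume "\<not> ?thesis"
      then have "(\<Sum>p\<in>?F\<times>?F. between {..<K} (fst p) (snd p) m) \<le> of_nat (card (?F \<times> ?F)) * (c2 * exp (real m * pressure))"
        by (intro sum_bounded_above) (auto simp: not_le intro: less_imp_le)
      also have "\<dots> = (real N * real N * c2) * exp (real m * pressure)" by simp
      also have "\<dots> \<le> c1 / 2 * exp (real m * pressure)"
        using c1 by (intro mult_right_mono) (auto simp: c2_def field_simps add_pos_nonneg)
      finally show False using K m wsum_from_to[of ?F "{..<K}" m] by simp
    qed
    then obtain x y where xy: "x \<in> ?F" "y \<in> ?F" "c2 * exp (real m * pressure) \<le> between {..<K} x y m"
      by auto
    let ?u = "pre x" and ?v = "post (y, s)"
    obtain N1 where N1: "set ?u \<union> set ?v \<subseteq> {..<N1}" using finite_nat_iff_bounded[of "set ?u \<union> set ?v"] by auto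
    show "\<exists>N0. \<forall>N\<ge>N0. c0 * exp (real n * pressure) \<le> between {..<N} b c n"
    proof (intro exI[of _ "max K N1"] allI impI)
      fix N' assume N': "N' \<ge> max K N1"
      have uv: "?u \<noteq> []" "?v \<noteq> []" using pre(1)[of x] post(1)[of "(y,s)"] xy R by auto
      have len: "length ?u + m + length ?v = n" using pre(1)[of x] post(1)[of "(y,s)"] xy R m by auto
      have "k1 * k2 * (c2 * exp (real m * pressure)) \<le> weight ?u * weight ?v * between {..<K} x y m"
        using k1 k2 xy s c2 by (intro mult_mono) (auto simp: between_def less_imp_le)
      also have "\<dots> \<le> exp (2 * D) * between {..<N'} (hd ?u) (last ?v) (length ?u + m + length ?v)"
        using m uv pre(4)[of x] post(4)[of "(y, s)"] xy N' N1 by (intro extend_between) auto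
      also have "\<dots> = exp (2 * D) * between {..<N'} b c n"
        using pre(3)[of x] post(3)[of "(y, s)"] xy len by simp
      finally have *: "exp (- 2 * D) * k1 * k2 * c2 * exp (real m * pressure) \<le> between {..<N'} b c n"
        by (simp add: exp_minus field_simps)
      have "real n * pressure \<le> real m * pressure + real (J + 2 * R) * \<bar>pressure\<bar>"
      proof -
        have "(real n - real m) * pressure \<le> (real n - real m) * \<bar>pressure\<bar>"
          using m R by (intro mult_left_mono) auto
        also have "\<dots> \<le> real (J + 2 * R) * \<bar>pressure\<bar>"
          using m s by (intro mult_right_mono) auto
        finally show ?thesis by (simp add: algebra_simps)
      qed
      then have "E * exp (real n * pressure) \<le> exp (real m * pressure)"
        unfolding E_def mult_exp_exp exp_le_cancel_iff by linarith
      then have "exp (- 2 * D) * k1 * k2 * c2 * (E * exp (real n * pressure)) \<le> exp (- 2 * D) * k1 * k2 * c2 * exp (real m * pressure)"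
        using k1 k2 c2 by (intro mult_left_mono) auto
      with * show "c0 * exp (real n * pressure) \<le> between {..<N'} b c n" by (simp add: c0_def mult_ac)
    qed
  qed
qed

end

section \<open>The Gurevich pressure\<close>

definition initial :: "nat \<Rightarrow> (nat \<Rightarrow> nat) \<Rightarrow> nat list" where
  "initial n x = map x [0..<n]"

lemma length_initial [simp]: "length (initial n x) = n" by (simp add: initial_def)

lemma initial_nth [simp]: "i < n \<Longrightarrow> initial n x ! i = x i" by (simp add: initial_def)

lemma initial_0 [simp]: "initial 0 x = []" by (simp add: initial_def)

lemma initial_Suc: "initial (Suc n) x = initial n x @ [x n]" by (simp add: initial_def)

lemma funpow_shift: "(shift ^^ n) x i = x (i + n)"
  by (induction n arbitrary: i) (auto simp: shift_def)

lemma initial_add: "initial (n + m) x = initial n x @ initial m ((shift ^^ n) x)"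
  by (rule nth_equalityI) (auto simp: nth_append funpow_shift)

lemma initial_Suc_Cons: "initial (Suc n) x = x 0 # initial n (shift x)"
  using initial_add[of 1 n x] by (simp add: initial_def)

lemma hd_initial: "n > 0 \<Longrightarrow> hd (initial n x) = x 0"
  by (cases n) (auto simp: initial_Suc_Cons)

lemma last_initial: "n > 0 \<Longrightarrow> last (initial n x) = x (n - 1)"
  by (cases n) (auto simp: initial_Suc)

lemma cylinder_iff: "x \<in> cylinder M w \<longleftrightarrow> x \<in> shift_space M \<and> initial (length w) x = w"
  by (auto simp: cylinder_def list_eq_iff_nth_eq)

lemma cylinder_Nil [simp]: "cylinder M [] = shift_space M" by (simp add: cylinder_def)

lemma cylinder_subset: "cylinder M w \<subseteq> shift_space M" by (auto simp: cylinder_def)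

lemma funpow_shift_in: "x \<in> shift_space M \<Longrightarrow> (shift ^^ n) x \<in> shift_space M"
  by (auto simp: shift_space_def funpow_shift)

lemma shift_in: "x \<in> shift_space M \<Longrightarrow> shift x \<in> shift_space M"
  by (auto simp: shift_space_def shift_def)

lemma admissible_initial: "x \<in> shift_space M \<Longrightarrow> n > 0 \<Longrightarrow> admissible M (initial n x)"
  by (auto simp: admissible_def shift_space_def simp flip: length_greater_0_conv)

lemma cylinder_append:
  "cylinder M (u @ v) = cylinder M u \<inter> (shift ^^ length u) -` cylinder M v"
  by (auto simp: cylinder_iff initial_add funpow_shift_in)

lemma cylinder_disjoint:
  "length u = length v \<Longrightarrow> u \<noteq> v \<Longrightarrow> cylinder M u \<inter> cylinder M v = {}"
  by (auto simp: cylinder_iff)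

lemma cylinder_eq_empty: "w \<noteq> [] \<Longrightarrow> \<not> admissible M w \<Longrightarrow> cylinder M w = {}"
  using admissible_initial by (force simp: cylinder_iff)

lemma shift_fixed_mod:
  assumes "(shift ^^ n) x = x"
  shows "x i = x (i mod n)"
proof -
  have "x (i + n * k) = x i" for i k
  proof (induction k)
    case (Suc k)
    have "x (i + n * Suc k) = (shift ^^ n) x (i + n * k)" by (simp add: funpow_shift algebra_simps)
    then show ?case using Suc assms by simp
  qed simp
  from this[of "i mod n" "i div n"] show ?thesis by simp
qed

context mixing_shift
begin

text \<open>Every letter has a successor, so an admissible word can be continued forever by a fixed
  choice of successors.\<close>

lemma cylinder_nonempty: "admissible M w \<Longrightarrow> \<exists>x. x \<in> cylinder M w"
proof -
  assume w: "admissible M w"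
  obtain s where s: "\<And>a. M a (s a) = 1" using ex_succ by metis
  define x where "x i = (if i < length w then w ! i else (s ^^ (Suc i - length w)) (last w))" for i
  have "M (x i) (x (Suc i)) = 1" for i
  proof -
    consider "Suc i < length w" | "Suc i = length w" | "length w \<le> i" by linarith
    then show ?thesis
    proof cases
      case 1
      then show ?thesis using w by (simp add: x_def admissible_def)
    next
      case 2
      then have "last w = w ! i" by (metis diff_Suc_1 last_conv_nth length_0_conv nat.distinct(1))
      then show ?thesis using 2 s by (simp add: x_def)
    next
      case 3
      then show ?thesis using s by (simp add: x_def Suc_diff_le)
    qed
  qed
  then have "x \<in> cylinder M w" by (auto simp: cylinder_def shift_space_def) (simp add: x_def)
  then show ?thesis by blast
qed

definition pick :: "nat list \<Rightarrow> nat \<Rightarrow> nat" where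
  "pick w = (SOME x. x \<in> cylinder M w)"

lemma pick_in: "admissible M w \<Longrightarrow> pick w \<in> cylinder M w"
  unfolding pick_def using cylinder_nonempty by (rule someI_ex)

lemma shift_space_nonempty: "shift_space M \<noteq> {}"
  using pick_in[of "[0]"] cylinder_subset by auto

definition periodic_point :: "nat list \<Rightarrow> nat \<Rightarrow> nat" where
  "periodic_point w i = w ! (i mod length w)"

lemma periodic_point:
  assumes "admissible M w" "M (last w) (hd w) = 1"
  shows "periodic_point w \<in> cylinder M w" "(shift ^^ length w) (periodic_point w) = periodic_point w"
proof -
  have w: "w \<noteq> []" using assms by auto
  have "M (periodic_point w i) (periodic_point w (Suc i)) = 1" for i
  proof (cases "Suc (i mod length w) < length w")
    case True
    then have "Suc i mod length w = Suc (i mod length w)" by (simp add: mod_Suc)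
    then show ?thesis using assms True by (simp add: periodic_point_def admissible_def)
  next
    case False
    then have eq: "Suc (i mod length w) = length w"
      using w by (metis length_greater_0_conv mod_less_divisor not_less_eq Suc_lessI)
    then have "i mod length w = length w - 1" "Suc i mod length w = 0" by (auto simp: mod_Suc)
    then show ?thesis using assms w by (simp add: periodic_point_def last_conv_nth hd_conv_nth)
  qed
  then show "periodic_point w \<in> cylinder M w"
    by (auto simp: cylinder_def shift_space_def) (simp add: periodic_point_def)
  show "(shift ^^ length w) (periodic_point w) = periodic_point w"
    by (auto simp: fun_eq_iff funpow_shift periodic_point_def)
qed

end

section \<open>From the potential to weights of words\<close>

locale potential = mixing_shift M for M +
  fixes f :: "nat \<Rightarrow> (nat \<Rightarrow> nat) \<Rightarrow> real" and C :: real
  assumes C_nonneg: "0 \<le> C"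
    and continuous: "continuous_potential M f"
    and upper_add: "\<And>n m x. n \<ge> 1 \<Longrightarrow> m \<ge> 1 \<Longrightarrow> x \<in> shift_space M \<Longrightarrow> f (n + m) x \<le> f n x + f m ((shift ^^ n) x) + C"
    and lower_add: "\<And>n m x. n \<ge> 1 \<Longrightarrow> m \<ge> 1 \<Longrightarrow> x \<in> shift_space M \<Longrightarrow> f n x + f m ((shift ^^ n) x) - C \<le> f (n + m) x"
    and variation: "\<And>n x y. n \<ge> 1 \<Longrightarrow> x \<in> shift_space M \<Longrightarrow> y \<in> shift_space M \<Longrightarrow> (\<forall>i<n. x i = y i) \<Longrightarrow> \<bar>f n x - f n y\<bar> \<le> C"
    and summable: "summable_potential M f"
begin

text \<open>Bounded variation makes the choice of the point irrelevant up to \<open>C\<close>. On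
  nonempty inadmissible words the value is arbitrary, but their weight is 0.\<close>

definition phi :: "nat list \<Rightarrow> real" where
  "phi w = f (length w) (pick w)"

lemma f_phi: "x \<in> cylinder M w \<Longrightarrow> w \<noteq> [] \<Longrightarrow> \<bar>f (length w) x - phi w\<bar> \<le> C"
proof -
  assume x: "x \<in> cylinder M w" and w: "w \<noteq> []"
  then have "admissible M w" using cylinder_eq_empty by blast
  then have p: "pick w \<in> cylinder M w" by (rule pick_in)
  show ?thesis unfolding phi_def
    by (rule variation) (use x p w in \<open>auto simp: cylinder_def Suc_le_eq\<close>)
qed

lemma f_phi_initial: "x \<in> shift_space M \<Longrightarrow> n \<ge> 1 \<Longrightarrow> \<bar>f n x - phi (initial n x)\<bar> \<le> C"
  using f_phi[of x "initial n x"] by (auto simp: cylinder_iff simp flip: length_greater_0_conv)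

lemma f1_le_SUP:
  "x \<in> cylinder M [i] \<Longrightarrow> f 1 x \<le> (SUP x\<in>cylinder M [i]. f 1 x)"
  using summable unfolding summable_potential_def by (intro cSUP_upper) auto

text \<open>One \<open>C\<close> for almost additivity and two for bounded variation.\<close>

definition slack :: real where
  "slack = 3 * C"

sublocale weighted_words M phi slack
proof
  show "0 \<le> slack" using C_nonneg by (simp add: slack_def)
  fix u v assume uv: "admissible M (u @ v)" "u \<noteq> []" "v \<noteq> []"
  have x: "pick (u @ v) \<in> cylinder M (u @ v)" using uv by (intro pick_in)
  then have xu: "pick (u @ v) \<in> cylinder M u" "(shift ^^ length u) (pick (u @ v)) \<in> cylinder M v"
    by (auto simp: cylinder_append)
  have "1 \<le> length u" "1 \<le> length v" using uv by (auto simp: Suc_le_eq)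
  then show "\<bar>phi (u @ v) - phi u - phi v\<bar> \<le> slack"
    using f_phi[OF xu(1)] f_phi[OF xu(2)] uv x cylinder_subset[of M "u @ v"]
      upper_add[of "length u" "length v" "pick (u @ v)"] lower_add[of "length u" "length v" "pick (u @ v)"]
    by (auto simp: phi_def[of "u @ v"] slack_def)
next
  have le: "exp (phi [i]) \<le> exp (SUP x\<in>cylinder M [i]. f 1 x)" for i
    using f1_le_SUP[OF pick_in[of "[i]"]] by (simp add: phi_def)
  have "summable (\<lambda>i. exp (SUP x\<in>cylinder M [i]. f 1 x))"
    using summable unfolding summable_potential_def by blast
  then show "summable (\<lambda>i. exp (phi [i]))"
    by (rule summable_comparison_test'[where N = 0]) (use le in simp)
qed

lemma exp_f_le_weight: "x \<in> shift_space M \<Longrightarrow> n \<ge> 1 \<Longrightarrow> exp (f n x) \<le> exp C * weight (initial n x)"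
  and weight_le_exp_f: "x \<in> shift_space M \<Longrightarrow> n \<ge> 1 \<Longrightarrow> weight (initial n x) \<le> exp C * exp (f n x)"
proof -
  assume x: "x \<in> shift_space M" and n: "n \<ge> 1"
  have "f n x \<le> C + phi (initial n x)" "phi (initial n x) \<le> C + f n x" using f_phi_initial[OF x n] by auto
  then have "exp (f n x) \<le> exp (C + phi (initial n x))" "exp (phi (initial n x)) \<le> exp (C + f n x)" by simp_all
  moreover have "weight (initial n x) = exp (phi (initial n x))"
    using x n admissible_initial[OF x, of n] by (auto simp: weight_def)
  ultimately show "exp (f n x) \<le> exp C * weight (initial n x)" "weight (initial n x) \<le> exp C * exp (f n x)"
    by (simp_all add: exp_add)
qed

text \<open>A point of period \<open>n\<close> is determined by its first \<open>n\<close> letters,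
  and these form a loop. Only finitely many letters occur in a finite partial sum, so the bound for
  finite alphabets applies.\<close>

lemma periodic_sum_le:
  assumes "n \<ge> 1"
  shows "periodic_sum M f a n \<le> ennreal (exp C * (exp slack * exp (real n * pressure)))"
proof -
  let ?g = "\<lambda>x. exp (f n x) * indicator (cylinder M [a]) x :: real"
  have *: "sum (\<lambda>x. ennreal (?g x)) F \<le> ennreal (exp C * (exp slack * exp (real n * pressure)))"
    if F: "finite F" "F \<subseteq> {x \<in> shift_space M. (shift ^^ n) x = x}" for F
  proof -
    define A where "A = (\<Union>x\<in>F. set (initial n x))"
    have A: "finite A" using F by (auto simp: A_def)
    have inj: "inj_on (initial n) F"
    proof (rule inj_onI, rule ext)
      fix x y i assume xy: "x \<in> F" "y \<in> F" "initial n x = initial n y"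
      have "i mod n < n" using assms by auto
      then have "x (i mod n) = y (i mod n)" using xy(3) by (metis initial_nth)
      moreover have "(shift ^^ n) x = x" "(shift ^^ n) y = y" using xy F by auto
      ultimately show "x i = y i" by (metis shift_fixed_mod)
    qed
    have "sum ?g F \<le> (\<Sum>x\<in>F. exp C * (weight (initial n x) * of_bool (hd (initial n x) = a \<and> M (last (initial n x)) a = 1)))"
    proof (intro sum_mono)
      fix x assume x: "x \<in> F"
      then have xs: "x \<in> shift_space M" "(shift ^^ n) x = x" using F by auto
      have "x n = x 0" using fun_cong[OF xs(2), of 0] by (simp add: funpow_shift)
      moreover obtain k where k: "n = Suc k" using assms by (cases n) auto
      moreover have "M (x k) (x (Suc k)) = 1" using xs(1) by (simp add: shift_space_def)
      ultimately have "M (last (initial n x)) (x 0) = 1" by (simp add: last_initial)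
      then show "?g x \<le> exp C * (weight (initial n x) * of_bool (hd (initial n x) = a \<and> M (last (initial n x)) a = 1))"
        using exp_f_le_weight[OF xs(1) assms] assms by (auto simp: indicator_def cylinder_def hd_initial)
    qed
    also have "\<dots> = exp C * (\<Sum>w\<in>initial n ` F. weight w * of_bool (hd w = a \<and> M (last w) a = 1))"
      by (simp add: sum.reindex[OF inj] sum_distrib_left)
    also have "\<dots> \<le> exp C * loops A a n"
    proof -
      have "initial n ` F \<subseteq> words A n" by (auto simp: words_def A_def)
      then show ?thesis
        unfolding loops_def wsum_def using A by (intro mult_left_mono sum_mono2) auto
    qed
    also have "\<dots> \<le> exp C * (exp slack * exp (real n * pressure))"
      using assms A by (intro mult_left_mono loops_le) auto
    finally show ?thesis by (subst sum_ennreal) (auto intro: ennreal_leI)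
  qed
  show ?thesis unfolding periodic_sum_def
    by (subst nonneg_infsum_complete, simp, rule SUP_least, rule *) auto
qed

text \<open>Conversely, repeating a loop gives a periodic point in its cylinder, and different loops
  of the same length give different points.\<close>

lemma periodic_sum_ge:
  assumes "n \<ge> 1"
  shows "ennreal (exp (- C) * loops {..<N} a n) \<le> periodic_sum M f a n"
proof -
  let ?g = "\<lambda>x. exp (f n x) * indicator (cylinder M [a]) x :: real"
  define W where "W = {w \<in> words {..<N} n. admissible M w \<and> hd w = a \<and> M (last w) a = 1}"
  have W: "finite W" by (simp add: W_def)
  have per: "periodic_point w \<in> cylinder M w" "(shift ^^ n) (periodic_point w) = periodic_point w" "length w = n"
    if "w \<in> W" for w
    using periodic_point[of w] that by (auto simp: W_def words_def)
  have inj: "inj_on periodic_point W"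
    by (rule inj_on_inverseI[of _ "initial n"]) (use per in \<open>auto simp: cylinder_iff\<close>)
  have "loops {..<N} a n = (\<Sum>w\<in>W. weight w)"
    unfolding loops_def wsum_def
    by (rule sum.mono_neutral_cong_right) (use assms in \<open>auto simp: W_def weight_def words_def[of _ n] intro: finite_lists_length_eq\<close>)
  also have "\<dots> \<le> (\<Sum>w\<in>W. exp C * ?g (periodic_point w))"
  proof (intro sum_mono)
    fix w assume w: "w \<in> W"
    have x: "periodic_point w \<in> shift_space M" "initial n (periodic_point w) = w"
      using per[OF w] by (auto simp: cylinder_iff)
    have "periodic_point w 0 = a" using hd_initial[of n "periodic_point w"] x w assms by (auto simp: W_def)
    then have "periodic_point w \<in> cylinder M [a]" using x by (auto simp: cylinder_def)
    then show "weight w \<le> exp C * ?g (periodic_point w)"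
      using weight_le_exp_f[OF x(1) assms] x by simp
  qed
  finally have "exp (- C) * loops {..<N} a n \<le> (\<Sum>w\<in>W. ?g (periodic_point w))"
    by (simp add: exp_minus field_simps flip: sum_distrib_left)
  also have "\<dots> = sum ?g (periodic_point ` W)" by (simp add: sum.reindex[OF inj])
  finally have "ennreal (exp (- C) * loops {..<N} a n) \<le> (\<Sum>x\<in>periodic_point ` W. ennreal (?g x))"
    by (subst sum_ennreal) (auto intro: ennreal_leI)
  also have "\<dots> \<le> periodic_sum M f a n"
    unfolding periodic_sum_def
    by (subst nonneg_infsum_complete, simp, rule SUP_upper)
      (use per W in \<open>auto simp: cylinder_iff\<close>)
  finally show ?thesis .
qed

text \<open>Upper and lower bounds are constants times \<open>exp (n * pressure)\<close>, and
  constants disappear after taking logarithms and dividing by \<open>n\<close>. For the lower bound,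
  a word from \<open>a\<close> to a predecessor \<open>b\<close> of \<open>a\<close> is a loop at
  \<open>a\<close>.\<close>

lemma gurevich_pressure_tendsto:
  "(\<lambda>n. extended_ln (periodic_sum M f a n) / ereal (real n)) \<longlonglongrightarrow> ereal pressure"
proof -
  obtain b where b: "M b a = 1" using ex_pred by blast
  obtain c0 n0 where c0: "c0 > 0" "\<And>n. n \<ge> n0 \<Longrightarrow> \<exists>N0. \<forall>N\<ge>N0. c0 * exp (real n * pressure) \<le> between {..<N} a b n"
    using between_ge[of a b] by blast
  define S where "S n = enn2real (periodic_sum M f a n)" for n
  define K where "K = exp C * exp slack"
  define c where "c = exp (- C) * c0"
  have K: "K > 0" "c > 0" using c0 by (auto simp: K_def c_def)
  have up: "periodic_sum M f a n \<le> ennreal (K * exp (real n * pressure))" if "n \<ge> 1" for n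
    using periodic_sum_le[OF that] by (simp add: K_def mult_ac)
  have lo: "ennreal (c * exp (real n * pressure)) \<le> periodic_sum M f a n" if n: "n \<ge> max 1 n0" for n
  proof -
    obtain N where "c0 * exp (real n * pressure) \<le> between {..<N} a b n" using c0(2)[of n] n by auto
    also have "\<dots> \<le> loops {..<N} a n"
      unfolding between_def loops_def by (rule wsum_mono) (use b in auto)
    finally have "c * exp (real n * pressure) \<le> exp (- C) * loops {..<N} a n"
      unfolding c_def by (simp add: mult.assoc)
    then show ?thesis using periodic_sum_ge[of n N a] n by (auto intro: order_trans ennreal_leI)
  qed
  have fin: "periodic_sum M f a n = ennreal (S n)" if "n \<ge> 1" for n
  proof -
    have "periodic_sum M f a n < \<infinity>" using le_less_trans[OF up[OF that] ennreal_less_top] by simp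
    then show ?thesis by (simp add: S_def)
  qed
  have SK: "S n \<le> K * exp (real n * pressure)" if "n \<ge> 1" for n
    using up[OF that] K unfolding fin[OF that] by (subst (asm) ennreal_le_iff) auto
  have Sc: "c * exp (real n * pressure) \<le> S n" if n: "n \<ge> max 1 n0" for n
  proof -
    have "1 \<le> n" using n by simp
    from lo[OF n] show ?thesis unfolding fin[OF \<open>1 \<le> n\<close>]
      by (subst (asm) ennreal_le_iff) (auto simp: S_def)
  qed
  have lim: "(\<lambda>n. ln (S n) / real n) \<longlonglongrightarrow> pressure"
  proof (rule tendsto_sandwich)
    have "(\<lambda>n. pressure + ln c / real n) \<longlonglongrightarrow> pressure + 0" "(\<lambda>n. pressure + ln K / real n) \<longlonglongrightarrow> pressure + 0"
      by (intro tendsto_intros lim_const_over_n)+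
    then show "(\<lambda>n. pressure + ln c / real n) \<longlonglongrightarrow> pressure" "(\<lambda>n. pressure + ln K / real n) \<longlonglongrightarrow> pressure"
      by simp_all
    show "\<forall>\<^sub>F n in sequentially. pressure + ln c / real n \<le> ln (S n) / real n"
      using eventually_ge_at_top[of "max 1 n0"]
    proof eventually_elim
      case (elim n)
      have "ln (c * exp (real n * pressure)) \<le> ln (S n)" using Sc[OF elim] K by (intro ln_mono) auto
      then have "ln c + real n * pressure \<le> ln (S n)" using K by (simp add: ln_mult_pos)
      then have "(ln c + real n * pressure) / real n \<le> ln (S n) / real n" by (rule divide_right_mono) simp
      moreover have "n \<noteq> 0" using elim by auto
      ultimately show ?case by (simp add: add_divide_distrib)
    qed
    show "\<forall>\<^sub>F n in sequentially. ln (S n) / real n \<le> pressure + ln K / real n"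
      using eventually_ge_at_top[of "max 1 n0"]
    proof eventually_elim
      case (elim n)
      have "0 < c * exp (real n * pressure)" using K by simp
      then have "0 < S n" using Sc[OF elim] by linarith
      then have "ln (S n) \<le> ln (K * exp (real n * pressure))" using SK[of n] elim by (intro ln_mono) auto
      then have "ln (S n) \<le> ln K + real n * pressure" using K by (simp add: ln_mult_pos)
      then have "ln (S n) / real n \<le> (ln K + real n * pressure) / real n" by (rule divide_right_mono) simp
      moreover have "n \<noteq> 0" using elim by auto
      ultimately show ?case by (simp add: add_divide_distrib)
    qed
  qed
  have "\<forall>\<^sub>F n in sequentially. ereal (ln (S n) / real n) = extended_ln (periodic_sum M f a n) / ereal (real n)"
    using eventually_ge_at_top[of "max 1 n0"]
  proof eventually_elim
    case (elim n)
    have "0 < c * exp (real n * pressure)" using K by simp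
    then have "0 < S n" using Sc[OF elim] by linarith
    then show ?case using elim fin[of n] by (simp add: extended_ln_def)
  qed
  moreover have "(\<lambda>n. ereal (ln (S n) / real n)) \<longlonglongrightarrow> ereal pressure" using lim by simp
  ultimately show ?thesis by (rule Lim_transform_eventually[rotated])
qed

lemma gurevich_pressure: "gurevich_pressure M f = ereal pressure"
  unfolding gurevich_pressure_def
proof (rule the_equality)
  show "\<forall>a. (\<lambda>n. extended_ln (periodic_sum M f a n) / ereal (real n)) \<longlonglongrightarrow> ereal pressure"
    by (intro allI gurevich_pressure_tendsto)
  fix P assume "\<forall>a. (\<lambda>n. extended_ln (periodic_sum M f a n) / ereal (real n)) \<longlonglongrightarrow> P"
  then have "(\<lambda>n. extended_ln (periodic_sum M f 0 n) / ereal (real n)) \<longlonglongrightarrow> P" by (rule spec)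
  then show "P = ereal pressure" by (rule LIMSEQ_unique) (rule gurevich_pressure_tendsto)
qed

end

section \<open>Borel measures on the shift space\<close>

text \<open>Generated by the cylinders instead of the open sets. As there are countably many words,
  every open set is a countable union of cylinders, so both families generate the same
  sigma-algebra.\<close>

definition shift_borel :: "(nat \<Rightarrow> nat \<Rightarrow> nat) \<Rightarrow> (nat \<Rightarrow> nat) measure" where
  "shift_borel M = sigma (shift_space M) (range (cylinder M))"

lemma space_shift_borel [simp]: "space (shift_borel M) = shift_space M"
  unfolding shift_borel_def by (rule space_measure_of) (auto simp: cylinder_def)

lemma sets_shift_borel: "sets (shift_borel M) = sigma_sets (shift_space M) (range (cylinder M))"
  unfolding shift_borel_def by (rule sets_measure_of) (auto simp: cylinder_def)

lemma cylinder_sets [measurable]: "cylinder M w \<in> sets (shift_borel M)"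
  unfolding sets_shift_borel by (intro sigma_sets.Basic) auto

lemma topspace_shift [simp]: "topspace (shift_topology M) = shift_space M"
proof -
  have "shift_space M \<subseteq> \<Union> {cylinder M w |w. admissible M w}"
  proof
    fix x assume "x \<in> shift_space M"
    then have "x \<in> cylinder M [x 0]" by (simp add: cylinder_def)
    then show "x \<in> \<Union> {cylinder M w |w. admissible M w}" by (auto intro!: exI[of _ "cylinder M [x 0]"])
  qed
  then show ?thesis unfolding shift_topology_def by (auto simp: cylinder_def)
qed

lemma openin_cylinder: "openin (shift_topology M) (cylinder M w)"
proof (cases "w = []")
  case True
  then show ?thesis using openin_topspace[of "shift_topology M"] by simp
next
  case False
  show ?thesis
  proof (cases "admissible M w")
    case True
    then show ?thesis unfolding shift_topology_def by (intro topology_generated_by_Basis) auto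
  qed (use False cylinder_eq_empty in auto)
qed

lemma cylinder_initial_mono: "n \<le> m \<Longrightarrow> cylinder M (initial m x) \<subseteq> cylinder M (initial n x)"
  by (auto simp: cylinder_def)

lemma openin_shift_nhd:
  assumes "openin (shift_topology M) U" "x \<in> U"
  shows "\<exists>n. cylinder M (initial n x) \<subseteq> U"
proof -
  have "generate_topology_on {cylinder M w |w. admissible M w} U"
    using assms(1) unfolding shift_topology_def by (rule openin_topology_generated_by)
  then show ?thesis using assms(2)
  proof (induction rule: generate_topology_on.induct)
    case (Int a b)
    then obtain n m where "cylinder M (initial n x) \<subseteq> a" "cylinder M (initial m x) \<subseteq> b" by auto
    then have "cylinder M (initial (max n m) x) \<subseteq> a \<inter> b"
      using cylinder_initial_mono[of n "max n m" M x] cylinder_initial_mono[of m "max n m" M x] by auto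
    then show ?case by blast
  next
    case (UN K)
    then show ?case by (meson UnionE Union_upper order_trans)
  next
    case (Basis s)
    then obtain w where "s = cylinder M w" by auto
    with Basis have "initial (length w) x = w" by (simp add: cylinder_iff)
    then show ?case using \<open>s = cylinder M w\<close> by (intro exI[of _ "length w"]) simp
  qed simp
qed

lemma sets_shift_borel_eq_open:
  "sigma_sets (shift_space M) {U. openin (shift_topology M) U} = sets (shift_borel M)"
proof
  show "sets (shift_borel M) \<subseteq> sigma_sets (shift_space M) {U. openin (shift_topology M) U}"
    unfolding sets_shift_borel
    by (intro sigma_sets_subseteq) (auto intro: openin_cylinder)
  have "U \<in> sets (shift_borel M)" if U: "openin (shift_topology M) U" for U
  proof -
    have "U = (\<Union>w\<in>{w. cylinder M w \<subseteq> U}. cylinder M w)"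
    proof
      show "U \<subseteq> (\<Union>w\<in>{w. cylinder M w \<subseteq> U}. cylinder M w)"
      proof
        fix x assume x: "x \<in> U"
        then obtain n where n: "cylinder M (initial n x) \<subseteq> U" using openin_shift_nhd[OF U] by blast
        have "x \<in> shift_space M" using openin_subset[OF U] x by auto
        then have "x \<in> cylinder M (initial n x)" by (simp add: cylinder_def)
        then show "x \<in> (\<Union>w\<in>{w. cylinder M w \<subseteq> U}. cylinder M w)" using n by auto
      qed
    qed auto
    also have "\<dots> \<in> sets (shift_borel M)"
      by (intro sets.countable_UN'' cylinder_sets) auto
    finally show ?thesis .
  qed
  then show "sigma_sets (shift_space M) {U. openin (shift_topology M) U} \<subseteq> sets (shift_borel M)"
    using sets.sigma_sets_subset[of "{U. openin (shift_topology M) U}" "shift_borel M"] by auto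
qed

lemma measurable_continuous_map:
  assumes "continuous_map (shift_topology M) euclideanreal g"
  shows "g \<in> borel_measurable (shift_borel M)"
proof (rule borel_measurableI)
  fix S :: "real set" assume "open S"
  then have "openin (shift_topology M) {x \<in> shift_space M. g x \<in> S}"
    using openin_continuous_map_preimage[OF assms, of S] by simp
  then have "{x \<in> shift_space M. g x \<in> S} \<in> sets (shift_borel M)"
    unfolding sets_shift_borel_eq_open[symmetric] by (intro sigma_sets.Basic) auto
  also have "{x \<in> shift_space M. g x \<in> S} = g -` S \<inter> space (shift_borel M)" by auto
  finally show "g -` S \<inter> space (shift_borel M) \<in> sets (shift_borel M)" .
qed

lemma shift_vimage_cylinder: "shift -` cylinder M u \<inter> shift_space M = (\<Union>i. cylinder M (i # u))"
proof (intro equalityI subsetI)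
  fix x assume "x \<in> shift -` cylinder M u \<inter> shift_space M"
  then have "x \<in> cylinder M (x 0 # u)"
    by (auto simp: cylinder_iff initial_Suc_Cons)
  then show "x \<in> (\<Union>i. cylinder M (i # u))" by blast
next
  fix x assume "x \<in> (\<Union>i. cylinder M (i # u))"
  then obtain i where "x \<in> cylinder M (i # u)" by blast
  then show "x \<in> shift -` cylinder M u \<inter> shift_space M"
    by (auto simp: cylinder_iff initial_Suc_Cons intro: shift_in)
qed

lemma measurable_shift [measurable]: "shift \<in> measurable (shift_borel M) (shift_borel M)"
proof (rule measurable_sigma_sets[OF sets_shift_borel])
  show "range (cylinder M) \<subseteq> Pow (shift_space M)" by (auto simp: cylinder_def)
  fix A assume "A \<in> range (cylinder M)"
  then obtain u where u: "A = cylinder M u" by auto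
  show "shift -` A \<inter> space (shift_borel M) \<in> sets (shift_borel M)"
    unfolding u space_shift_borel shift_vimage_cylinder by (intro sets.countable_UN'' cylinder_sets) auto
qed (auto intro: shift_in)

lemma measurable_funpow_shift [measurable]: "shift ^^ n \<in> measurable (shift_borel M) (shift_borel M)"
proof (induction n)
  case (Suc n)
  then show ?case unfolding funpow.simps(2) by (rule measurable_comp[OF _ measurable_shift])
qed (auto simp: id_def)

lemma measurable_initial [measurable]: "initial n \<in> measurable (shift_borel M) (count_space UNIV)"
proof -
  have "initial n -` {w} \<inter> space (shift_borel M) = (if length w = n then cylinder M w else {})" for w
    by (auto simp: cylinder_iff)
  then show ?thesis by (subst measurable_count_space_eq_countable) auto
qed

lemma measurable_coord [measurable]: "(\<lambda>x. x i) \<in> measurable (shift_borel M) (count_space UNIV)"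
proof -
  have "(\<lambda>x. (last \<circ> initial (Suc i)) x) \<in> measurable (shift_borel M) (count_space UNIV)" by measurable
  also have "(\<lambda>x. (last \<circ> initial (Suc i)) x) = (\<lambda>x. x i)" by (auto simp: last_initial)
  finally show ?thesis .
qed

text \<open>Two cylinders are nested or disjoint; the empty set is added for the second
  case.\<close>

lemma cylinder_Int_stable: "Int_stable (insert {} (range (cylinder M)))"
proof -
  have *: "cylinder M u \<inter> cylinder M v \<in> insert {} (range (cylinder M))" if "length u \<le> length v" for u v
  proof (cases "take (length u) v = u")
    case True
    then have "cylinder M v = cylinder M u \<inter> (shift ^^ length u) -` cylinder M (drop (length u) v)"
      using cylinder_append[of M u "drop (length u) v"] by (metis append_take_drop_id)
    then have "cylinder M u \<inter> cylinder M v = cylinder M v" by blast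
    then show ?thesis by auto
  next
    case False
    have "cylinder M u \<inter> cylinder M v = {}"
    proof (rule ccontr)
      assume "cylinder M u \<inter> cylinder M v \<noteq> {}"
      then obtain x where x: "initial (length u) x = u" "initial (length v) x = v" by (auto simp: cylinder_iff)
      have "take (length u) (initial (length v) x) = initial (length u) x"
        using that by (simp add: initial_def take_map)
      with x False show False by simp
    qed
    then show ?thesis by simp
  qed
  show ?thesis
  proof (rule Int_stableI)
    fix a b assume ab: "a \<in> insert {} (range (cylinder M))" "b \<in> insert {} (range (cylinder M))"
    show "a \<inter> b \<in> insert {} (range (cylinder M))"
    proof (cases "a = {} \<or> b = {}")
      case False
      then obtain u v where "a = cylinder M u" "b = cylinder M v" using ab by auto
      then show ?thesis using *[of u v] *[of v u] by (cases "length u \<le> length v") (auto simp: Int_commute)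
    qed auto
  qed
qed

lemma measure_eqI_cylinders:
  assumes "prob_space \<mu>" "prob_space \<nu>" "sets \<mu> = sets (shift_borel M)" "sets \<nu> = sets (shift_borel M)"
    and eq: "\<And>w. measure \<mu> (cylinder M w) = measure \<nu> (cylinder M w)"
  shows "\<mu> = \<nu>"
proof (rule measure_eqI_generator_eq[OF cylinder_Int_stable])
  interpret mu: prob_space \<mu> by fact
  interpret nu: prob_space \<nu> by fact
  show "insert {} (range (cylinder M)) \<subseteq> Pow (shift_space M)" by (auto simp: cylinder_def)
  show "emeasure \<mu> X = emeasure \<nu> X" if "X \<in> insert {} (range (cylinder M))" for X
    using that eq by (auto simp: mu.emeasure_eq_measure nu.emeasure_eq_measure)
  have "sigma_sets (shift_space M) (range (cylinder M)) = sigma_sets (shift_space M) (insert {} (range (cylinder M)))"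
    by (intro sigma_sets_eqI) (auto intro: sigma_sets.Basic sigma_sets.Empty)
  then show "sets \<mu> = sigma_sets (shift_space M) (insert {} (range (cylinder M)))"
    "sets \<nu> = sigma_sets (shift_space M) (insert {} (range (cylinder M)))"
    using assms(3,4) by (auto simp: sets_shift_borel)
  show "range (\<lambda>_::nat. shift_space M) \<subseteq> insert {} (range (cylinder M))"
    using cylinder_Nil[of M] by (metis UNIV_I image_eqI image_subsetI insertI2)
  show "(\<Union>i::nat. shift_space M) = shift_space M" by simp
  show "emeasure \<mu> (shift_space M) \<noteq> \<infinity>" by (simp add: mu.emeasure_eq_measure)
qed

section \<open>Invariant probability measures\<close>

locale shift_measure = mixing_shift M + prob_space \<mu> for M and \<mu> :: "(nat \<Rightarrow> nat) measure" +
  assumes sets_eq [measurable_cong]: "sets \<mu> = sets (shift_borel M)"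
begin

lemma space_eq [simp]: "space \<mu> = shift_space M"
  using sets_eq_imp_space_eq[OF sets_eq] by simp

lemma cylinder_events [measurable]: "cylinder M w \<in> sets \<mu>"
  by (simp add: sets_eq)

end

locale invariant_measure = shift_measure +
  assumes invariant: "\<And>A. A \<in> sets (shift_borel M) \<Longrightarrow> prob (shift -` A \<inter> shift_space M) = prob A"

context mixing_shift
begin

lemma invariant_measures_iff: "\<mu> \<in> invariant_measures M \<longleftrightarrow> invariant_measure M \<mu>"
proof
  assume "\<mu> \<in> invariant_measures M"
  then have mu: "prob_space \<mu>" "sets \<mu> = sets (shift_borel M)" "space \<mu> = shift_space M"
    "\<And>A. A \<in> sets \<mu> \<Longrightarrow> emeasure \<mu> (shift -` A \<inter> space \<mu>) = emeasure \<mu> A"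
    unfolding invariant_measures_def sets_shift_borel_eq_open by auto
  interpret prob_space \<mu> by fact
  show "invariant_measure M \<mu>"
    by unfold_locales (use mu in \<open>auto simp: measure_def\<close>)
next
  assume "invariant_measure M \<mu>"
  then interpret invariant_measure M \<mu> .
  show "\<mu> \<in> invariant_measures M"
    unfolding invariant_measures_def sets_shift_borel_eq_open
    using invariant sets_eq prob_space_axioms by (auto simp: emeasure_eq_measure)
qed

end

context invariant_measure
begin

lemma distr_shift: "distr \<mu> (shift_borel M) shift = \<mu>"
proof (rule measure_eqI)
  fix A assume "A \<in> sets (distr \<mu> (shift_borel M) shift)"
  then have A: "A \<in> sets (shift_borel M)" by simp
  then show "emeasure (distr \<mu> (shift_borel M) shift) A = emeasure \<mu> A"
    by (subst emeasure_distr) (use invariant[OF A] in \<open>auto simp: emeasure_eq_measure\<close>)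
qed (simp add: sets_eq)

lemma distr_funpow_shift: "distr \<mu> (shift_borel M) (shift ^^ n) = \<mu>"
proof (induction n)
  case 0
  have "distr \<mu> (shift_borel M) (\<lambda>x. x) = \<mu>"
    using distr_id2[OF sets_eq[symmetric]] .
  then show ?case by (simp add: id_def)
next
  case (Suc n)
  have "distr \<mu> (shift_borel M) (shift ^^ Suc n) = distr (distr \<mu> (shift_borel M) (shift ^^ n)) (shift_borel M) shift"
    by (subst distr_distr) auto
  then show ?case unfolding Suc distr_shift .
qed

lemma prob_funpow_shift:
  assumes "A \<in> sets (shift_borel M)"
  shows "prob ((shift ^^ n) -` A \<inter> shift_space M) = prob A"
  using assms by (subst (2) distr_funpow_shift[of n, symmetric]) (simp add: measure_distr)

end

section \<open>Measures from cylinder weights\<close>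

text \<open>The partial sums cut \<open>[0, t)\<close> into consecutive half-open intervals of
  lengths \<open>a i\<close>; the one containing \<open>x\<close> ends at the first partial sum that
  exceeds \<open>x\<close>.\<close>

lemma disjoint_unique_index:
  fixes a :: "nat \<Rightarrow> real"
  assumes nn: "\<And>i. 0 \<le> a i" and s: "a sums t" and x: "0 \<le> x" "x < t"
  shows "\<exists>!i. (\<Sum>j<i. a j) \<le> x \<and> x < (\<Sum>j<Suc i. a j)"
proof -
  have "(\<lambda>n. \<Sum>j<n. a j) \<longlonglongrightarrow> t" using s by (simp add: sums_def)
  then have "\<forall>\<^sub>F n in sequentially. x < (\<Sum>j<n. a j)" using x by (intro order_tendstoD)
  then obtain n where n: "x < (\<Sum>j<n. a j)" by (auto simp: eventually_sequentially)
  define k where "k = (LEAST n. x < (\<Sum>j<n. a j))"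
  have k: "x < (\<Sum>j<k. a j)" unfolding k_def by (rule LeastI[of _ n]) (rule n)
  have "k \<noteq> 0" using k x by (intro notI) simp
  then obtain i where i: "k = Suc i" by (cases k) auto
  have "\<not> x < (\<Sum>j<i. a j)" using not_less_Least[of i "\<lambda>n. x < (\<Sum>j<n. a j)"] i by (simp add: k_def)
  moreover have mono: "(\<Sum>j<m. a j) \<le> (\<Sum>j<n. a j)" if "m \<le> n" for m n
    using that nn by (intro sum_mono2) auto
  show ?thesis
  proof (rule ex1I[of _ i])
    show "(\<Sum>j<i. a j) \<le> x \<and> x < (\<Sum>j<Suc i. a j)" using k i calculation by simp
    fix i' assume i': "(\<Sum>j<i'. a j) \<le> x \<and> x < (\<Sum>j<Suc i'. a j)"
    show "i' = i"
    proof (rule ccontr)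
      assume "i' \<noteq> i"
      then have "Suc i \<le> i' \<or> Suc i' \<le> i" by auto
      then show False using mono[of "Suc i" i'] mono[of "Suc i'" i] i' k i \<open>\<not> x < (\<Sum>j<i. a j)\<close> by auto
    qed
  qed
qed

context mixing_shift
begin

text \<open>
  The measure is the image of Lebesgue measure on \<open>[0,1)\<close> under the map that reads off a sequence
  from nested half-open intervals of lengths \<open>p u\<close>.
\<close>

lemma measure_of_cylinder_weights:
  fixes p :: "nat list \<Rightarrow> real"
  assumes one: "p [] = 1" and nn: "\<And>u. 0 \<le> p u"
    and sums: "\<And>u. (\<lambda>i. p (u @ [i])) sums p u"
    and adm: "\<And>u. u \<noteq> [] \<Longrightarrow> \<not> admissible M u \<Longrightarrow> p u = 0"
  shows "\<exists>\<mu>. shift_measure M \<mu> \<and> (\<forall>u. measure \<mu> (cylinder M u) = p u)"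
proof -
  \<comment> \<open>Left end point of the interval of \<open>u\<close>: at each letter of
    \<open>u\<close> the lengths of all smaller siblings are added up.\<close>
  define l where "l u = (\<Sum>k<length u. \<Sum>j<u ! k. p (take k u @ [j]))" for u
  have l_snoc: "l (u @ [i]) = l u + (\<Sum>j<i. p (u @ [j]))" for u i
    unfolding l_def by (simp add: nth_append)
  define I where "I u = {l u..<l u + p u}" for u
  define step where "step x u = (THE i. x \<in> I (u @ [i]))" for x u
  have I_snoc: "x \<in> I (u @ [i]) \<longleftrightarrow> (\<Sum>j<i. p (u @ [j])) \<le> x - l u \<and> x - l u < (\<Sum>j<Suc i. p (u @ [j]))" for x u i
    by (auto simp: I_def l_snoc)
  have ex1: "\<exists>!i. x \<in> I (u @ [i])" if "x \<in> I u" for x u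
    unfolding I_snoc using that by (intro disjoint_unique_index[OF nn sums]) (auto simp: I_def)
  have sub: "x \<in> I u" if "x \<in> I (u @ [i])" for x u i
  proof -
    have "(\<Sum>j<Suc i. p (u @ [j])) \<le> p u" using sums[of u] nn
      by (metis sum_le_suminf sums_iff finite_lessThan)
    moreover have "0 \<le> (\<Sum>j<i. p (u @ [j]))" using nn by (intro sum_nonneg) auto
    ultimately show ?thesis using that unfolding I_snoc by (auto simp: I_def)
  qed
  define word where "word x n = rec_nat [] (\<lambda>_ u. u @ [step x u]) n" for x and n :: nat
  have word0: "word x 0 = []" and wordS: "word x (Suc n) = word x n @ [step x (word x n)]" for x n
    by (auto simp: word_def)
  have len: "length (word x n) = n" for x n by (induction n) (auto simp: word0 wordS)
  have word_I: "x \<in> I (word x n)" if "x \<in> {0..<1}" for x n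
  proof (induction n)
    case 0
    then show ?case using that one by (simp add: word0 I_def l_def)
  next
    case (Suc n)
    show ?case unfolding wordS step_def by (rule theI'[OF ex1[OF Suc]])
  qed
  have word_eq: "word x (length u) = u" if "x \<in> I u" for x u
    using that
  proof (induction u rule: rev_induct)
    case (snoc i u)
    then have "x \<in> I u" using sub by blast
    then show ?case using snoc by (simp add: wordS step_def the1_equality[OF ex1])
  qed (simp add: word0)
  define X where "X x n = word x (Suc n) ! n" for x n
  have init: "initial n (X x) = word x n" for x n
    by (induction n) (auto simp: word0 wordS initial_Suc X_def nth_append len)
  have X_in: "X x \<in> shift_space M" if x: "x \<in> {0..<1}" for x
  proof -
    have "M (X x i) (X x (Suc i)) = 1" for i
    proof -
      \<comment> \<open>The interval of this word contains \<open>x\<close>, so it has positive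
        length, and words with positive \<open>p\<close> are admissible.\<close>
      have "p (word x (Suc (Suc i))) > 0"
        using word_I[OF x, of "Suc (Suc i)"] nn[of "word x (Suc (Suc i))"] by (auto simp: I_def)
      then have "admissible M (initial (Suc (Suc i)) (X x))"
        unfolding init using adm[of "word x (Suc (Suc i))"] len[of x "Suc (Suc i)"] by force
      then have "M (initial (Suc (Suc i)) (X x) ! i) (initial (Suc (Suc i)) (X x) ! Suc i) = 1"
        unfolding admissible_def length_initial by blast
      then show ?thesis by simp
    qed
    then show ?thesis by (simp add: shift_space_def)
  qed
  have X_cyl: "X -` cylinder M u \<inter> {0..<1} = I u \<inter> {0..<1}" for u
  proof (intro equalityI subsetI)
    fix x assume "x \<in> X -` cylinder M u \<inter> {0..<1}"
    then have "word x (length u) = u" "x \<in> {0..<1}" by (auto simp: cylinder_iff init)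
    then show "x \<in> I u \<inter> {0..<1}" using word_I[of x "length u"] by auto
  next
    fix x assume "x \<in> I u \<inter> {0..<1}"
    then show "x \<in> X -` cylinder M u \<inter> {0..<1}" using X_in word_eq by (auto simp: cylinder_iff init)
  qed
  have I_sub: "I u \<subseteq> {0..<1}" for u
  proof (induction u rule: rev_induct)
    case Nil
    then show ?case using one by (auto simp: I_def l_def)
  next
    case (snoc i u)
    then show ?case using sub by blast
  qed
  let ?L = "restrict_space lborel {0..<1::real}"
  have L: "space ?L = {0..<1}" by (simp add: space_restrict_space)
  have meas: "X \<in> measurable ?L (shift_borel M)"
  proof (rule measurable_sigma_sets[OF sets_shift_borel])
    show "range (cylinder M) \<subseteq> Pow (shift_space M)" by (auto simp: cylinder_def)
    show "X \<in> space ?L \<rightarrow> shift_space M" using X_in by (auto simp: L)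
    fix A assume "A \<in> range (cylinder M)"
    then obtain u where u: "A = cylinder M u" by auto
    show "X -` A \<inter> space ?L \<in> sets ?L"
      unfolding L u X_cyl by (subst sets_restrict_space_iff) (auto simp: I_def)
  qed
  define \<mu> where "\<mu> = distr ?L (shift_borel M) X"
  have em: "emeasure \<mu> (cylinder M u) = ennreal (p u)" for u
  proof -
    have "emeasure \<mu> (cylinder M u) = emeasure ?L (I u)"
      unfolding \<mu>_def using I_sub[of u] meas
      by (subst emeasure_distr) (auto simp: L X_cyl Int_absorb2)
    also have "\<dots> = emeasure lborel (I u)"
      using I_sub by (subst emeasure_restrict_space) auto
    also have "\<dots> = ennreal (p u)" using nn by (simp add: I_def)
    finally show ?thesis .
  qed
  have "shift_measure M \<mu>"
  proof -
    have "emeasure \<mu> (space \<mu>) = 1" using em[of "[]"] one by (simp add: \<mu>_def)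
    then interpret prob_space \<mu> by (rule prob_spaceI)
    show ?thesis by unfold_locales (simp add: \<mu>_def)
  qed
  moreover have "measure \<mu> (cylinder M u) = p u" for u
    using em[of u] nn by (simp add: measure_def)
  ultimately show ?thesis by blast
qed

end

section \<open>Compactness of families of cylinder weights\<close>

text \<open>A diagonal sequence of the Bolzano-Weierstrass subsequences for one index after the
  other.\<close>

lemma countable_convergent_subsequence:
  fixes a :: "nat \<Rightarrow> 'b::countable \<Rightarrow> real"
  assumes "\<And>k w. \<bar>a k w\<bar> \<le> B"
  obtains r :: "nat \<Rightarrow> nat" where "strict_mono r" "\<And>w. convergent (\<lambda>k. a (r k) w)"
proof -
  define P where "P n s \<longleftrightarrow> convergent (\<lambda>k. a (s k) (from_nat n))" for n and s :: "nat \<Rightarrow> nat"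
  interpret subseqs P
  proof
    fix n and s :: "nat \<Rightarrow> nat" assume "strict_mono s"
    have "bounded (range (\<lambda>k. a (s k) (from_nat n)))"
      using assms by (intro boundedI[of _ B]) auto
    then obtain l r where "strict_mono r" "((\<lambda>k. a (s k) (from_nat n)) \<circ> r) \<longlonglongrightarrow> l"
      using bounded_imp_convergent_subsequence by blast
    then show "\<exists>r'. strict_mono r' \<and> P n (s \<circ> r')" by (auto simp: P_def convergent_def o_def)
  qed
  have "convergent (\<lambda>k. a (diagseq k) w)" for w
  proof -
    have "P (to_nat w) (diagseq \<circ> (+) (Suc (to_nat w)))"
    proof (rule diagseq_holds)
      fix r s :: "nat \<Rightarrow> nat" and n assume r: "strict_mono r" "P n s"
      show "P n (s \<circ> r)"
        using convergent_subseq_convergent[OF r(2)[unfolded P_def] r(1)] by (simp add: P_def o_def)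
    qed
    then have "convergent (\<lambda>k. a (diagseq (k + Suc (to_nat w))) w)"
      by (simp add: P_def o_def add.commute)
    then show ?thesis by (subst (asm) convergent_ignore_initial_segment)
  qed
  then show thesis using subseq_diagseq that by blast
qed

context mixing_shift
begin

text \<open>The image of \<open>\<mu>\<close> under the shift is then at most \<open>\<mu>\<close>
  on every cylinder. The complement of a cylinder is a countable union of cylinders of the same
  length, so the same holds there; both measures have mass 1 and hence agree. An inequality for
  finite sums is what survives a limit.\<close>

lemma invariant_of_le:
  assumes "shift_measure M \<mu>"
    and le: "\<And>u I. (\<Sum>i<I. measure \<mu> (cylinder M (i # u))) \<le> measure \<mu> (cylinder M u)"
  shows "invariant_measure M \<mu>"
proof -
  interpret shift_measure M \<mu> by fact
  let ?\<nu> = "distr \<mu> (shift_borel M) shift"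
  interpret nu: prob_space ?\<nu> by (rule prob_space_distr) simp
  have nu_eq: "nu.prob A = prob (shift -` A \<inter> shift_space M)" if "A \<in> sets (shift_borel M)" for A
    using that by (simp add: measure_distr)
  have nu_le: "nu.prob (cylinder M u) \<le> prob (cylinder M u)" for u
  proof -
    have "(\<lambda>i. prob (cylinder M (i # u))) sums prob (\<Union>i. cylinder M (i # u))"
    proof (rule finite_measure_UNION)
      show "disjoint_family (\<lambda>i. cylinder M (i # u))"
        unfolding disjoint_family_on_def using cylinder_disjoint[of "_ # u" "_ # u" M] by auto
    qed auto
    then have "prob (\<Union>i. cylinder M (i # u)) \<le> prob (cylinder M u)"
      unfolding sums_def using le by (intro LIMSEQ_le_const2) auto
    then show ?thesis by (simp add: nu_eq shift_vimage_cylinder)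
  qed
  have "nu.prob (cylinder M u) = prob (cylinder M u)" for u
  proof -
    define J where "J = {w. length w = length u \<and> w \<noteq> u}"
    have A: "shift_space M - cylinder M u = (\<Union>w\<in>J. cylinder M w)"
      by (auto simp: J_def cylinder_iff)
    have disj: "disjoint_family_on (cylinder M) J"
      unfolding disjoint_family_on_def using cylinder_disjoint by (auto simp: J_def)
    have "emeasure ?\<nu> (\<Union>w\<in>J. cylinder M w) = (\<integral>\<^sup>+w. emeasure ?\<nu> (cylinder M w) \<partial>count_space J)"
      using disj by (intro emeasure_UN_countable) auto
    also have "\<dots> \<le> (\<integral>\<^sup>+w. emeasure \<mu> (cylinder M w) \<partial>count_space J)"
      using nu_le by (intro nn_integral_mono) (auto simp: nu.emeasure_eq_measure emeasure_eq_measure intro: ennreal_leI)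
    also have "\<dots> = emeasure \<mu> (\<Union>w\<in>J. cylinder M w)"
      using disj by (intro emeasure_UN_countable[symmetric]) auto
    finally have "nu.prob (shift_space M - cylinder M u) \<le> prob (shift_space M - cylinder M u)"
      unfolding A by (simp add: nu.emeasure_eq_measure emeasure_eq_measure)
    then have "prob (cylinder M u) \<le> nu.prob (cylinder M u)"
      using prob_compl[of "cylinder M u"] nu.prob_compl[of "cylinder M u"] by simp
    then show ?thesis using nu_le[of u] by simp
  qed
  then have eq: "?\<nu> = \<mu>"
    by (intro measure_eqI_cylinders[of _ _ M]) (auto intro: prob_space_axioms nu.prob_space_axioms simp: sets_eq)
  show ?thesis
    by unfold_locales (metis nu_eq eq)
qed

text \<open>Along a subsequence the weights of all words converge. Only finite sums pass to the
  limit, so additivity could be lost by mass escaping to large letters; the tightness hypothesis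
  excludes exactly this. Invariance is asked for only up to an error that vanishes in the
  limit.\<close>

lemma cylinder_weights_compact:
  fixes p :: "nat \<Rightarrow> nat list \<Rightarrow> real"
  assumes one: "\<And>k. p k [] = 1" and nn: "\<And>k u. 0 \<le> p k u"
    and sub: "\<And>k u I. (\<Sum>i<I. p k (u @ [i])) \<le> p k u"
    and tight: "\<And>u e. e > 0 \<Longrightarrow> \<exists>I. \<forall>\<^sub>F k in sequentially. p k u - (\<Sum>i<I. p k (u @ [i])) \<le> e"
    and adm: "\<And>k u. u \<noteq> [] \<Longrightarrow> \<not> admissible M u \<Longrightarrow> p k u = 0"
    and inv: "\<And>u I e. e > 0 \<Longrightarrow> \<forall>\<^sub>F k in sequentially. (\<Sum>i<I. p k (i # u)) \<le> p k u + e"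
  shows "\<exists>r \<mu>. strict_mono (r :: nat \<Rightarrow> nat) \<and> invariant_measure M \<mu> \<and>
    (\<forall>u. (\<lambda>k. p (r k) u) \<longlonglongrightarrow> measure \<mu> (cylinder M u))"
proof -
  have le1: "p k u \<le> 1" for k u
  proof (induction u rule: rev_induct)
    case (snoc i u)
    have "p k (u @ [i]) \<le> (\<Sum>j<Suc i. p k (u @ [j]))" using nn by (simp add: sum_nonneg)
    then show ?case using sub[of k u "Suc i"] snoc by simp
  qed (simp add: one)
  obtain r :: "nat \<Rightarrow> nat" where r: "strict_mono r" "\<And>w. convergent (\<lambda>k. p (r k) w)"
    using countable_convergent_subsequence[of p 1] nn le1 by (metis abs_of_nonneg)
  define q where "q u = lim (\<lambda>k. p (r k) u)" for u
  have q: "(\<lambda>k. p (r k) u) \<longlonglongrightarrow> q u" for u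
    unfolding q_def using r(2) by (simp add: convergent_LIMSEQ_iff)
  have sub_ev: "\<forall>\<^sub>F k in sequentially. Q (r k)" if "\<forall>\<^sub>F k in sequentially. Q k" for Q
    using that r(1) by (rule eventually_subseq[rotated])
  have q_nn: "0 \<le> q u" for u by (rule LIMSEQ_le_const[OF q]) (use nn in auto)
  have q_sub: "(\<Sum>i<I. q (u @ [i])) \<le> q u" for u I
    by (rule LIMSEQ_le[OF tendsto_sum[of "{..<I}" "\<lambda>i k. p (r k) (u @ [i])"] q]) (use q sub in auto)
  have q_tight: "\<exists>I. q u - (\<Sum>i<I. q (u @ [i])) \<le> e" if "e > 0" for u e
  proof -
    obtain I where I: "\<forall>\<^sub>F k in sequentially. p k u - (\<Sum>i<I. p k (u @ [i])) \<le> e" using tight[OF \<open>e > 0\<close>] by blast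
    have "(\<lambda>k. p (r k) u - (\<Sum>i<I. p (r k) (u @ [i]))) \<longlonglongrightarrow> q u - (\<Sum>i<I. q (u @ [i]))"
      by (intro tendsto_intros q)
    then have "q u - (\<Sum>i<I. q (u @ [i])) \<le> e"
      by (rule tendsto_upperbound) (use sub_ev[OF I] in auto)
    then show ?thesis by blast
  qed
  have q_sums: "(\<lambda>i. q (u @ [i])) sums q u" for u
    unfolding sums_def
  proof (rule LIMSEQ_I)
    fix e :: real assume "e > 0"
    then obtain I where I: "q u - (\<Sum>i<I. q (u @ [i])) \<le> e / 2" using q_tight[of "e / 2"] by auto
    show "\<exists>n0. \<forall>n\<ge>n0. norm ((\<Sum>i<n. q (u @ [i])) - q u) < e"
    proof (intro exI allI impI)
      fix n assume "n \<ge> I"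
      then have "(\<Sum>i<I. q (u @ [i])) \<le> (\<Sum>i<n. q (u @ [i]))" using q_nn by (intro sum_mono2) auto
      then show "norm ((\<Sum>i<n. q (u @ [i])) - q u) < e" using I q_sub[of u n] \<open>e > 0\<close> by auto
    qed
  qed
  have q_inv: "(\<Sum>i<I. q (i # u)) \<le> q u" for u I
  proof (rule field_le_epsilon)
    fix e :: real assume "e > 0"
    have "(\<lambda>k. p (r k) u + e) \<longlonglongrightarrow> q u + e" by (intro tendsto_intros q)
    moreover have "(\<lambda>k. \<Sum>i<I. p (r k) (i # u)) \<longlonglongrightarrow> (\<Sum>i<I. q (i # u))" by (intro tendsto_intros q)
    ultimately show "(\<Sum>i<I. q (i # u)) \<le> q u + e"
      by (rule tendsto_le[OF sequentially_bot]) (rule sub_ev[OF inv[OF \<open>e > 0\<close>]])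
  qed
  have "q [] = 1" using LIMSEQ_unique[OF q[of "[]"]] by (simp add: one)
  moreover have "q u = 0" if "u \<noteq> []" "\<not> admissible M u" for u
    using LIMSEQ_unique[OF q[of u]] adm[OF that] by simp
  ultimately obtain \<mu> where mu: "shift_measure M \<mu>" "\<And>u. measure \<mu> (cylinder M u) = q u"
    using measure_of_cylinder_weights[of q] q_nn q_sums by blast
  have "invariant_measure M \<mu>" using mu q_inv by (intro invariant_of_le) auto
  then show ?thesis using r(1) q mu(2) by (intro exI[of _ r] exI[of _ \<mu>]) auto
qed

end

section \<open>Weak convergence\<close>

definition cylinders :: "(nat \<Rightarrow> nat \<Rightarrow> nat) \<Rightarrow> nat list set \<Rightarrow> (nat \<Rightarrow> nat) set" where
  "cylinders M S = (\<Union>w\<in>S. cylinder M w)"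

text \<open>A finite union of cylinders whose complement has small measure for large
  \<open>N\<close>; it takes the role of a compact set.\<close>

definition bounded_part :: "(nat \<Rightarrow> nat \<Rightarrow> nat) \<Rightarrow> nat \<Rightarrow> nat \<Rightarrow> (nat \<Rightarrow> nat) set" where
  "bounded_part M n N = {x \<in> shift_space M. \<forall>i<n. x i < N}"

lemma shift_space_sets [measurable, simp]: "shift_space M \<in> sets (shift_borel M)"
  using sets.top[of "shift_borel M"] by simp

lemma cylinders_sets [measurable, simp]: "cylinders M S \<in> sets (shift_borel M)"
  unfolding cylinders_def by (intro sets.countable_UN'' cylinder_sets) auto

lemma mem_cylinders_words: "S \<subseteq> words A n \<Longrightarrow> x \<in> cylinders M S \<longleftrightarrow> x \<in> shift_space M \<and> initial n x \<in> S"
  unfolding cylinders_def words_def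
  by (auto simp: cylinder_iff intro!: bexI[of _ "initial n x"])

lemma cylinders_subset: "cylinders M S \<subseteq> shift_space M"
  by (auto simp: cylinders_def cylinder_def)

lemma initial_in_words: "x \<in> bounded_part M n N \<Longrightarrow> initial n x \<in> words {..<N} n"
  by (auto simp: bounded_part_def words_def initial_def)

lemma bounded_part_eq: "bounded_part M n N = cylinders M (words {..<N} n)"
  by (auto simp: mem_cylinders_words[OF order_refl] initial_in_words)
     (auto simp: bounded_part_def words_def initial_def image_subset_iff mem_cylinders_words[OF order_refl])

lemma bounded_part_sets [measurable, simp]: "bounded_part M n N \<in> sets (shift_borel M)"
  unfolding bounded_part_eq by (rule cylinders_sets)

context shift_measure
begin

lemma prob_cylinders:
  assumes "finite S" "S \<subseteq> words A n"
  shows "prob (cylinders M S) = (\<Sum>w\<in>S. prob (cylinder M w))"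
  unfolding cylinders_def
proof (rule finite_measure_finite_Union)
  show "disjoint_family_on (cylinder M) S"
    unfolding disjoint_family_on_def
  proof (intro ballI impI)
    fix u v assume "u \<in> S" "v \<in> S" "u \<noteq> v"
    then show "cylinder M u \<inter> cylinder M v = {}"
      using assms by (intro cylinder_disjoint) (auto simp: words_def)
  qed
qed (use assms in auto)

lemma eventually_bounded_part:
  assumes "e > 0"
  shows "\<forall>\<^sub>F N in sequentially. prob (shift_space M - bounded_part M n N) < e"
proof -
  have un: "(\<Union>N. bounded_part M n N) = shift_space M"
  proof
    show "shift_space M \<subseteq> (\<Union>N. bounded_part M n N)"
    proof
      fix x assume x: "x \<in> shift_space M"
      obtain N where "x ` {..<n} \<subseteq> {..<N}" using finite_nat_iff_bounded[of "x ` {..<n}"] by auto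
      then show "x \<in> (\<Union>N. bounded_part M n N)" using x by (auto simp: bounded_part_def)
    qed
  qed (auto simp: bounded_part_def)
  have "(\<lambda>N. prob (bounded_part M n N)) \<longlonglongrightarrow> prob (\<Union>N. bounded_part M n N)"
  proof (rule finite_Lim_measure_incseq)
    show "range (bounded_part M n) \<subseteq> events" by (auto simp: sets_eq)
    show "incseq (bounded_part M n)"
      unfolding incseq_def bounded_part_def using less_le_trans by blast
  qed
  then have "\<forall>\<^sub>F N in sequentially. prob (bounded_part M n N) > 1 - e"
    unfolding un using assms prob_space by (intro order_tendstoD) auto
  then show ?thesis
  proof eventually_elim
    case (elim N)
    then show ?case using prob_compl[of "bounded_part M n N"] by (simp add: sets_eq)
  qed
qed

end

context mixing_shift
begin

section \<open>Approximation of Borel sets and of integrals by cylinders\<close>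

text \<open>Induction over the generation of the sigma-algebra. The approximation is asserted for
  all large \<open>n\<close> and then all large \<open>N\<close>, so that several sets can be
  approximated by words of a common length over a common alphabet; the step for unions relies on
  this. Several measures are treated at once because absolute continuity compares two of them on the
  same set of words.\<close>

lemma cylinder_approximation:
  assumes R: "finite R" "\<And>\<rho>. \<rho> \<in> R \<Longrightarrow> shift_measure M \<rho>"
    and D: "D \<in> sets (shift_borel M)" and e: "e > 0"
  shows "\<forall>\<^sub>F n in sequentially. \<forall>\<^sub>F N in sequentially. \<exists>S\<subseteq>words {..<N} n.
    \<forall>\<rho>\<in>R. measure \<rho> (D - cylinders M S \<union> (cylinders M S - D)) < e"
proof -
  have tail: "\<forall>\<^sub>F N in sequentially. \<forall>\<rho>\<in>R. measure \<rho> (shift_space M - bounded_part M n N) < e"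
    if "e > 0" for n e
    using R that by (intro eventually_ball_finite ballI shift_measure.eventually_bounded_part) auto
  have mono: "measure \<rho> A \<le> measure \<rho> B" if "\<rho> \<in> R" "A \<subseteq> B" "B \<in> sets (shift_borel M)" for \<rho> A B
  proof -
    interpret shift_measure M \<rho> using R that by auto
    show ?thesis using that by (intro finite_measure_mono) (auto simp: sets_eq)
  qed
  have meas_sym: "A - cylinders M S \<union> (cylinders M S - A) \<in> sets (shift_borel M)"
    if "A \<in> sets (shift_borel M)" for A S using that by auto
  from D have "D \<in> sigma_sets (shift_space M) (range (cylinder M))" by (simp add: sets_shift_borel)
  then show ?thesis using e
  proof (induction arbitrary: e rule: sigma_sets.induct)
    case (Basic a)
    then obtain u where a: "a = cylinder M u" by auto
    show ?case using eventually_ge_at_top[of "length u"]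
    proof eventually_elim
      case (elim n)
      show ?case using tail[OF Basic(2), of n]
      proof eventually_elim
        case (elim N)
        define S where "S = {w \<in> words {..<N} n. take (length u) w = u}"
        have S: "S \<subseteq> words {..<N} n" by (auto simp: S_def)
        have tk: "take (length u) (initial n x) = initial (length u) x" for x
          using \<open>length u \<le> n\<close> by (simp add: initial_def take_map)
        have "a - cylinders M S \<union> (cylinders M S - a) \<subseteq> shift_space M - bounded_part M n N"
          using initial_in_words[of _ M n N] tk
          by (auto simp: a mem_cylinders_words[OF S] cylinder_iff) (auto simp: S_def)
        then have lt: "measure \<rho> (a - cylinders M S \<union> (cylinders M S - a)) < e" if rho: "\<rho> \<in> R" for \<rho>
        proof (rule le_less_trans[OF mono[OF rho]])
          show "measure \<rho> (shift_space M - bounded_part M n N) < e" using elim rho by blast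
        qed auto
        show ?case by (intro exI[of _ S] conjI ballI S lt)
      qed
    qed
  next
    case Empty
    have "cylinders M {} = {}" by (simp add: cylinders_def)
    then have "\<forall>\<rho>\<in>R. measure \<rho> ({} - cylinders M {} \<union> (cylinders M {} - {})) < e" using Empty by simp
    then have "\<exists>S\<subseteq>words {..<N} n. \<forall>\<rho>\<in>R. measure \<rho> ({} - cylinders M S \<union> (cylinders M S - {})) < e" for N n
      by (intro exI[of _ "{}"] conjI) auto
    then show ?case by (intro always_eventually allI)
  next
    case (Compl a)
    have a: "a \<in> sets (shift_borel M)" using Compl by (simp add: sets_shift_borel)
    have "e / 2 > 0" using Compl by simp
    from Compl.IH[OF this] show ?case
    proof eventually_elim
      case (elim n)
      from elim tail[OF \<open>e / 2 > 0\<close>, of n] show ?case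
      proof eventually_elim
        case (elim N)
        then obtain S where S: "S \<subseteq> words {..<N} n"
          "\<And>\<rho>. \<rho> \<in> R \<Longrightarrow> measure \<rho> (a - cylinders M S \<union> (cylinders M S - a)) < e / 2" by blast
        define S' where "S' = words {..<N} n - S"
        have S': "S' \<subseteq> words {..<N} n" by (auto simp: S'_def)
        let ?E = "a - cylinders M S \<union> (cylinders M S - a)" and ?T = "shift_space M - bounded_part M n N"
        have incl: "(shift_space M - a) - cylinders M S' \<union> (cylinders M S' - (shift_space M - a)) \<subseteq> ?E \<union> ?T"
          using initial_in_words[of _ M n N]
          by (auto simp: mem_cylinders_words[OF S'] mem_cylinders_words[OF S(1)]) (auto simp: S'_def)
        have "measure \<rho> ((shift_space M - a) - cylinders M S' \<union> (cylinders M S' - (shift_space M - a))) < e"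
          if rho: "\<rho> \<in> R" for \<rho>
        proof -
          interpret shift_measure M \<rho> using R rho by auto
          have "measure \<rho> ((shift_space M - a) - cylinders M S' \<union> (cylinders M S' - (shift_space M - a)))
              \<le> measure \<rho> (?E \<union> ?T)"
            using rho incl a by (intro mono) auto
          also have "\<dots> \<le> measure \<rho> ?E + measure \<rho> ?T"
            using a by (intro measure_Un_le) (auto simp: sets_eq)
          finally show ?thesis using S(2)[OF rho] elim(2) rho by fastforce
        qed
        then show ?case using S' by blast
      qed
    qed
  next
    case (Union a)
    have a: "a i \<in> sets (shift_borel M)" for i using Union by (simp add: sets_shift_borel)
    let ?A = "\<Union>i. a i"
    have "\<forall>\<^sub>F I in sequentially. \<forall>\<rho>\<in>R. measure \<rho> (?A - (\<Union>i<I. a i)) < e / 2"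
    proof (intro eventually_ball_finite ballI R)
      fix \<rho> assume "\<rho> \<in> R"
      then interpret shift_measure M \<rho> using R by auto
      have "(\<lambda>I. prob (?A - (\<Union>i<I. a i))) \<longlonglongrightarrow> prob (\<Inter>I. ?A - (\<Union>i<I. a i))"
        using a by (intro finite_Lim_measure_decseq) (auto simp: sets_eq decseq_def intro!: sets.Diff sets.countable_UN'')
      also have "(\<Inter>I. ?A - (\<Union>i<I. a i)) = {}" by auto
      finally have "(\<lambda>I. prob (?A - (\<Union>i<I. a i))) \<longlonglongrightarrow> 0" by simp
      then show "\<forall>\<^sub>F I in sequentially. prob (?A - (\<Union>i<I. a i)) < e / 2"
        using Union by (intro order_tendstoD) auto
    qed
    then obtain I where I: "\<And>\<rho>. \<rho> \<in> R \<Longrightarrow> measure \<rho> (?A - (\<Union>i<I. a i)) < e / 2"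
      by (auto simp: eventually_sequentially)
    \<comment> \<open>Cutting the union down to \<open>I\<close> sets has cost \<open>e / 2\<close>;
      the approximations of these sets share the other half. The added 1 covers
      \<open>I = 0\<close>.\<close>
    define d where "d = e / (2 * (real I + 1))"
    have d: "d > 0" "real I * d < e / 2" using Union by (auto simp: d_def field_simps)
    have "\<forall>\<^sub>F n in sequentially. \<forall>i\<in>{..<I}. \<forall>\<^sub>F N in sequentially. \<exists>S\<subseteq>words {..<N} n.
        \<forall>\<rho>\<in>R. measure \<rho> (a i - cylinders M S \<union> (cylinders M S - a i)) < d"
      using d by (intro eventually_ball_finite ballI Union.IH) auto
    then show ?case
    proof eventually_elim
      case (elim n)
      then have "\<forall>\<^sub>F N in sequentially. \<forall>i\<in>{..<I}. \<exists>S\<subseteq>words {..<N} n.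
        \<forall>\<rho>\<in>R. measure \<rho> (a i - cylinders M S \<union> (cylinders M S - a i)) < d"
        by (intro eventually_ball_finite) auto
      then show ?case
      proof eventually_elim
        case (elim N)
        then obtain S where S: "\<And>i. i < I \<Longrightarrow> S i \<subseteq> words {..<N} n"
          "\<And>i \<rho>. i < I \<Longrightarrow> \<rho> \<in> R \<Longrightarrow> measure \<rho> (a i - cylinders M (S i) \<union> (cylinders M (S i) - a i)) < d"
          unfolding Ball_def lessThan_iff by metis
        define S' where "S' = (\<Union>i<I. S i)"
        have S': "S' \<subseteq> words {..<N} n" using S(1) by (auto simp: S'_def)
        have cS': "cylinders M S' = (\<Union>i<I. cylinders M (S i))" by (auto simp: S'_def cylinders_def)
        let ?E = "\<lambda>i. a i - cylinders M (S i) \<union> (cylinders M (S i) - a i)"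
        have incl: "?A - cylinders M S' \<union> (cylinders M S' - ?A) \<subseteq> (?A - (\<Union>i<I. a i)) \<union> (\<Union>i<I. ?E i)"
          unfolding cS' by blast
        have "measure \<rho> (?A - cylinders M S' \<union> (cylinders M S' - ?A)) < e" if rho: "\<rho> \<in> R" for \<rho>
        proof -
          interpret shift_measure M \<rho> using R rho by auto
          have m1: "?A - (\<Union>i<I. a i) \<in> events" using a by (auto simp: sets_eq)
          have m2: "(\<Union>i<I. ?E i) \<in> events" using meas_sym[OF a] by (auto simp: sets_eq)
          have "prob (?A - cylinders M S' \<union> (cylinders M S' - ?A))
              \<le> prob ((?A - (\<Union>i<I. a i)) \<union> (\<Union>i<I. ?E i))"
            by (rule mono[OF rho incl]) (use m1 m2 in \<open>auto simp: sets_eq\<close>)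
          also have "\<dots> \<le> prob (?A - (\<Union>i<I. a i)) + prob (\<Union>i<I. ?E i)"
            using m1 m2 by (intro measure_Un_le)
          also have "prob (\<Union>i<I. ?E i) \<le> (\<Sum>i<I. prob (?E i))"
            using meas_sym[OF a] by (intro measure_UNION_le) (auto simp: sets_eq)
          also have "\<dots> \<le> (\<Sum>i<I. d)"
            using S(2) rho by (intro sum_mono) (auto intro: less_imp_le)
          also have "\<dots> < e / 2" using d by simp
          finally show ?thesis using I[OF rho] by simp
        qed
        then show ?case using S' by blast
      qed
    qed
  qed
qed

text \<open>A continuous \<open>g\<close> is nearly constant on the cylinder of a long initial word
  of any given point. Finitely many such cylinders of one length carry almost all the mass of
  \<open>\<mu>\<close>, and then also of \<open>\<mu>s k\<close> for large \<open>k\<close>, as the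
  measures converge on them. There the integrals are close to finite sums of cylinder
  measures.\<close>

lemma weakly_converges_if_cylinders:
  assumes mus: "\<And>k. shift_measure M (\<mu>s k)" and mu: "shift_measure M \<mu>"
    and lim: "\<And>u. (\<lambda>k. measure (\<mu>s k) (cylinder M u)) \<longlonglongrightarrow> measure \<mu> (cylinder M u)"
  shows "weakly_converges M \<mu>s \<mu>"
  unfolding weakly_converges_def
proof (intro allI impI, elim conjE)
  fix g assume g: "continuous_map (shift_topology M) euclideanreal g" and "bounded (g ` shift_space M)"
  then obtain B where B: "B > 0" "\<And>x. x \<in> shift_space M \<Longrightarrow> \<bar>g x\<bar> \<le> B"
    unfolding bounded_pos by auto
  interpret mu: shift_measure M \<mu> by fact
  note [measurable] = measurable_continuous_map[OF g]
  define good where "good d w \<longleftrightarrow> (\<forall>x\<in>cylinder M w. \<forall>y\<in>cylinder M w. \<bar>g x - g y\<bar> \<le> d)" for d w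
  have ex_good: "\<exists>n. good d (initial n x)" if d: "d > 0" and x: "x \<in> shift_space M" for d x
  proof -
    have "openin (shift_topology M) {y \<in> shift_space M. g y \<in> ball (g x) (d / 2)}"
      using openin_continuous_map_preimage[OF g, of "ball (g x) (d / 2)"] by simp
    then obtain n where n: "cylinder M (initial n x) \<subseteq> {y \<in> shift_space M. g y \<in> ball (g x) (d / 2)}"
      using openin_shift_nhd[of M _ x] x d by fastforce
    have "good d (initial n x)" unfolding good_def
    proof (intro ballI)
      fix y z assume "y \<in> cylinder M (initial n x)" "z \<in> cylinder M (initial n x)"
      then have "dist (g x) (g y) < d / 2" "dist (g x) (g z) < d / 2" using n by auto
      then show "\<bar>g y - g z\<bar> \<le> d" using dist_triangle3[of "g y" "g z" "g x"]
        unfolding dist_real_def[symmetric] by linarith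
    qed
    then show ?thesis by blast
  qed
  show "(\<lambda>k. integral\<^sup>L (\<mu>s k) g) \<longlonglongrightarrow> integral\<^sup>L \<mu> g"
  proof (rule LIMSEQ_I)
    fix e :: real assume e: "e > 0"
    \<comment> \<open>Each integral is replaced at a cost of at most \<open>d + 2 * B * d\<close>
      and the sums differ by less than \<open>d\<close>, which is together less than
      \<open>8 * (B + 1) * d\<close>.\<close>
    define d where "d = e / (8 * (B + 1))"
    have d: "d > 0" using e B by (auto simp: d_def)
    have "8 * d + 8 * (B * d) = 8 * (B + 1) * d" by (simp add: algebra_simps)
    also have "\<dots> = e" using B by (simp add: d_def)
    finally have dB: "8 * d + 8 * (B * d) = e" .
    define G where "G n = {x \<in> shift_space M. good d (initial n x)}" for n
    have G_eq: "G n = cylinders M {w. length w = n \<and> good d w}" for n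
      by (auto simp: G_def cylinders_def cylinder_iff)
    have "(\<lambda>n. mu.prob (G n)) \<longlonglongrightarrow> mu.prob (\<Union>n. G n)"
    proof (rule mu.finite_Lim_measure_incseq)
      show "range G \<subseteq> mu.events" by (auto simp: G_eq mu.sets_eq)
      show "incseq G"
      proof (rule incseq_SucI, rule subsetI)
        fix n x assume "x \<in> G n"
        then show "x \<in> G (Suc n)"
          using cylinder_initial_mono[of n "Suc n" M x] unfolding G_def good_def by auto
      qed
    qed
    also have "(\<Union>n. G n) = shift_space M" using ex_good[OF d] by (auto simp: G_def)
    finally have "\<forall>\<^sub>F n in sequentially. 1 - d < mu.prob (G n)"
      using d mu.prob_space by (intro order_tendstoD) auto
    then obtain n where n: "1 - d < mu.prob (G n)" by (auto simp: eventually_sequentially)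
    obtain N where N: "mu.prob (shift_space M - bounded_part M n N) < d"
      using mu.eventually_bounded_part[OF d, of n] by (auto simp: eventually_sequentially)
    define S where "S = {w \<in> words {..<N} n. good d w}"
    have S: "finite S" "S \<subseteq> words {..<N} n" by (auto simp: S_def)
    define U where "U = cylinders M S"
    have U[measurable]: "U \<in> sets (shift_borel M)" by (simp add: U_def)
    have "x \<in> U \<longleftrightarrow> x \<in> shift_space M \<and> initial n x \<in> S" for x
      unfolding U_def by (rule mem_cylinders_words[OF S(2)])
    then have "G n \<subseteq> U \<union> (shift_space M - bounded_part M n N)"
      using initial_in_words[of _ M n N] by (auto simp: G_def S_def)
    then have "mu.prob (G n) \<le> mu.prob (U \<union> (shift_space M - bounded_part M n N))"
      by (intro mu.finite_measure_mono) (auto simp: mu.sets_eq)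
    also have "\<dots> \<le> mu.prob U + mu.prob (shift_space M - bounded_part M n N)"
      by (intro measure_Un_le) (auto simp: mu.sets_eq)
    finally have muU: "1 - 2 * d < mu.prob U" using n N by simp
    define A where "A \<rho> = (\<Sum>w\<in>S. g (pick w) * measure \<rho> (cylinder M w))" for \<rho>
    have est: "\<bar>integral\<^sup>L \<rho> g - A \<rho>\<bar> \<le> d + B * (1 - measure \<rho> U)" if "shift_measure M \<rho>" for \<rho>
    proof -
      interpret shift_measure M \<rho> by fact
      define h where "h x = (\<Sum>w\<in>S. g (pick w) * indicator (cylinder M w) x)" for x
      have int_h: "integrable \<rho> h" unfolding h_def
        by (intro Bochner_Integration.integrable_sum integrable_mult_right integrable_real_indicator) (auto simp: sets_eq emeasure_eq_measure)
      have Ah: "integral\<^sup>L \<rho> h = A \<rho>" unfolding h_def A_def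
        by (subst Bochner_Integration.integral_sum)
          (auto intro!: integrable_mult_right integrable_real_indicator
            simp: sets_eq emeasure_eq_measure Int_absorb2[OF cylinder_subset])
      have int_g: "integrable \<rho> g"
        by (rule integrable_const_bound[of _ B]) (use B in \<open>auto simp: measurable_cong_sets[OF sets_eq refl]\<close>)
      have hU: "h x = g (pick w)" if "w \<in> S" "x \<in> cylinder M w" for x w
      proof -
        have "h x = (\<Sum>w'\<in>S. if w' = w then g (pick w) else 0)"
          unfolding h_def using that cylinder_disjoint[of w _ M] S(2)
          by (intro sum.cong) (auto simp: words_def indicator_def)
        then show ?thesis using that S by simp
      qed
      have hnU: "h x = 0" if "x \<notin> U" for x
        unfolding h_def using that by (intro sum.neutral) (auto simp: U_def cylinders_def)
      have pt: "\<bar>g x - h x\<bar> \<le> d + B * indicator (shift_space M - U) x" if x: "x \<in> shift_space M" for x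
      proof (cases "x \<in> U")
        case True
        then obtain w where w: "w \<in> S" "x \<in> cylinder M w" by (auto simp: U_def cylinders_def)
        have "pick w \<in> cylinder M w"
          using w(2) unfolding pick_def by (rule someI[of "\<lambda>x. x \<in> cylinder M w"])
        then have "\<bar>g x - g (pick w)\<bar> \<le> d" using w by (simp add: S_def good_def)
        then show ?thesis using hU[OF w] True by simp
      next
        case False
        then show ?thesis using B(2)[OF x] d x hnU by simp
      qed
      have "\<bar>integral\<^sup>L \<rho> g - A \<rho>\<bar> = \<bar>\<integral>x. g x - h x \<partial>\<rho>\<bar>"
        using int_g int_h Ah by simp
      also have "\<dots> \<le> (\<integral>x. \<bar>g x - h x\<bar> \<partial>\<rho>)" by (rule integral_abs_bound)
      also have "\<dots> \<le> (\<integral>x. d + B * indicator (shift_space M - U) x \<partial>\<rho>)"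
        using int_g int_h pt by (intro integral_mono) (auto simp: sets_eq emeasure_eq_measure intro!: integrable_real_indicator)
      also have "\<dots> = d + B * prob (shift_space M - U)"
        using prob_space
        by (subst Bochner_Integration.integral_add)
          (auto simp: sets_eq emeasure_eq_measure Int_absorb2 intro!: integrable_real_indicator)
      also have "prob (shift_space M - U) = 1 - prob U" using prob_compl[of U] by (simp add: sets_eq)
      finally show ?thesis .
    qed
    have mU: "measure \<rho> U = (\<Sum>w\<in>S. measure \<rho> (cylinder M w))" if "shift_measure M \<rho>" for \<rho>
      unfolding U_def using shift_measure.prob_cylinders[OF that S] .
    have "(\<lambda>k. measure (\<mu>s k) U) \<longlonglongrightarrow> measure \<mu> U"
      unfolding mU[OF mus] mU[OF mu] by (intro tendsto_intros lim)
    then have ev1: "\<forall>\<^sub>F k in sequentially. 1 - 2 * d < measure (\<mu>s k) U" using muU by (intro order_tendstoD)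
    have "(\<lambda>k. A (\<mu>s k)) \<longlonglongrightarrow> A \<mu>" unfolding A_def by (intro tendsto_intros lim)
    then have ev2: "\<forall>\<^sub>F k in sequentially. \<bar>A (\<mu>s k) - A \<mu>\<bar> < d"
      using d by (auto simp: tendsto_iff dist_real_def)
    have "\<forall>\<^sub>F k in sequentially. norm (integral\<^sup>L (\<mu>s k) g - integral\<^sup>L \<mu> g) < e"
      using ev1 ev2
    proof eventually_elim
      case (elim k)
      have "B * (1 - measure (\<mu>s k) U) \<le> B * (2 * d)" "B * (1 - measure \<mu> U) \<le> B * (2 * d)"
        using elim muU B by (auto intro!: mult_left_mono)
      moreover have "0 < B * d" using B d by simp
      ultimately show ?case using est[OF mus[of k]] est[OF mu] elim(2) dB d unfolding real_norm_def by linarith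
    qed
    then show "\<exists>n0. \<forall>k\<ge>n0. norm (integral\<^sup>L (\<mu>s k) g - integral\<^sup>L \<mu> g) < e"
      by (auto simp: eventually_sequentially)
  qed
qed

end

section \<open>Entropy of finite partitions\<close>

lemma neg_mult_ln_mono:
  fixes p q :: real
  assumes "0 \<le> p" "p \<le> q" shows "- (p * ln q) \<le> - (p * ln p)"
proof (cases "p = 0")
  case False
  then have "ln p \<le> ln q" using assms by (intro ln_mono) auto
  then show ?thesis using assms by (simp add: mult_left_mono)
qed simp

context prob_space
begin

definition fiber :: "('a \<Rightarrow> 'b) \<Rightarrow> 'b \<Rightarrow> 'a set" where
  "fiber X v = X -` {v} \<inter> space M"

text \<open>Partitions are represented by simple functions, whose fibers are the cells: a join
  becomes a tuple, and being finer becomes determining the value.\<close>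

definition ent :: "('a \<Rightarrow> 'b) \<Rightarrow> real" where
  "ent X = (\<Sum>v\<in>X ` space M. - (prob (fiber X v) * ln (prob (fiber X v))))"

lemma fiber_events: "simple_function M X \<Longrightarrow> fiber X v \<in> events"
  unfolding fiber_def by (rule simple_functionD)

lemma finite_range: "simple_function M X \<Longrightarrow> finite (X ` space M)"
  by (rule simple_functionD)

lemma ent_superset:
  assumes "finite A" "X ` space M \<subseteq> A"
  shows "ent X = (\<Sum>v\<in>A. - (prob (fiber X v) * ln (prob (fiber X v))))"
  unfolding ent_def
proof (rule sum.mono_neutral_left[OF assms], intro ballI)
  fix v assume "v \<in> A - X ` space M"
  then have "fiber X v = {}" by (auto simp: fiber_def)
  then show "- (prob (fiber X v) * ln (prob (fiber X v))) = 0" by simp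
qed

lemma prob_fiber_sum:
  assumes "simple_function M X" "simple_function M Y" and g: "\<And>x. x \<in> space M \<Longrightarrow> Y x = g (X x)"
    and A: "finite A" "X ` space M \<subseteq> A"
  shows "prob (fiber Y v) = (\<Sum>u\<in>{u\<in>A. g u = v}. prob (fiber X u))"
proof -
  have "fiber Y v = (\<Union>u\<in>{u\<in>A. g u = v}. fiber X u)"
    using g A by (auto simp: fiber_def)
  moreover have "prob (\<Union>u\<in>{u\<in>A. g u = v}. fiber X u) = (\<Sum>u\<in>{u\<in>A. g u = v}. prob (fiber X u))"
    using A fiber_events[OF assms(1)]
    by (intro finite_measure_finite_Union) (auto simp: disjoint_family_on_def fiber_def)
  ultimately show ?thesis by simp
qed

lemma ent_nonneg: "0 \<le> ent X"
  unfolding ent_def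
proof (intro sum_nonneg)
  fix v
  show "0 \<le> - (prob (fiber X v) * ln (prob (fiber X v)))"
    using neg_mult_ln_mono[of "prob (fiber X v)" 1] by simp
qed

text \<open>Merging cells only increases the probability inside the logarithm.\<close>

lemma ent_le_of_determined:
  assumes X: "simple_function M X" and Y: "simple_function M Y"
    and det: "\<And>x y. x \<in> space M \<Longrightarrow> y \<in> space M \<Longrightarrow> X x = X y \<Longrightarrow> Y x = Y y"
  shows "ent Y \<le> ent X"
proof -
  define g where "g u = Y (SOME x. x \<in> space M \<and> X x = u)" for u
  have g: "Y x = g (X x)" if "x \<in> space M" for x
  proof -
    have "\<exists>y. y \<in> space M \<and> X y = X x" using that by auto
    from someI_ex[OF this] show ?thesis unfolding g_def using det that by metis
  qed
  let ?A = "X ` space M" and ?B = "Y ` space M"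
  have fin: "finite ?A" "finite ?B" using X Y finite_range by auto
  have B: "?B = g ` ?A" using g by auto
  have "ent Y = (\<Sum>v\<in>?B. - ((\<Sum>u\<in>{u\<in>?A. g u = v}. prob (fiber X u)) * ln (prob (fiber Y v))))"
    unfolding ent_def using prob_fiber_sum[OF X Y g fin(1) order_refl] by simp
  also have "\<dots> = (\<Sum>v\<in>?B. \<Sum>u\<in>{u\<in>?A. g u = v}. - (prob (fiber X u) * ln (prob (fiber Y (g u)))))"
    by (intro sum.cong refl) (simp add: sum_distrib_right sum_negf)
  also have "\<dots> = (\<Sum>u\<in>?A. - (prob (fiber X u) * ln (prob (fiber Y (g u)))))"
    unfolding B using fin(1) by (rule sum.image_gen[symmetric])
  also have "\<dots> \<le> (\<Sum>u\<in>?A. - (prob (fiber X u) * ln (prob (fiber X u))))"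
  proof (intro sum_mono neg_mult_ln_mono)
    fix u
    show "prob (fiber X u) \<le> prob (fiber Y (g u))"
      using g by (intro finite_measure_mono fiber_events Y) (auto simp: fiber_def)
  qed auto
  finally show ?thesis by (simp add: ent_def)
qed

lemma ent_eq_of_determined:
  assumes "simple_function M X" "simple_function M Y"
    and "\<And>x y. x \<in> space M \<Longrightarrow> y \<in> space M \<Longrightarrow> X x = X y \<longleftrightarrow> Y x = Y y"
  shows "ent X = ent Y"
  using assms by (intro antisym ent_le_of_determined) auto

text \<open>Nonnegativity of the conditional mutual information of \<open>X\<close> and
  \<open>Y\<close> given \<open>Z\<close>, written without conditional entropies. It follows from
  \<open>ln r \<le> r - 1\<close> for the ratio \<open>r\<close> of the conditionally independent
  law \<open>pxz * pyz / pz\<close> to the true law \<open>p\<close>, both of total mass 1.\<close>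

lemma ent_strong_subadditive:
  assumes X: "simple_function M X" and Y: "simple_function M Y" and Z: "simple_function M Z"
  shows "ent (\<lambda>x. (X x, Y x, Z x)) + ent Z \<le> ent (\<lambda>x. (X x, Z x)) + ent (\<lambda>x. (Y x, Z x))"
proof -
  let ?A = "X ` space M" and ?B = "Y ` space M" and ?C = "Z ` space M"
  have fin: "finite ?A" "finite ?B" "finite ?C" using X Y Z finite_range by auto
  define p where "p a b c = prob (fiber (\<lambda>x. (X x, Y x, Z x)) (a, b, c))" for a b c
  define pxz where "pxz a c = prob (fiber (\<lambda>x. (X x, Z x)) (a, c))" for a c
  define pyz where "pyz b c = prob (fiber (\<lambda>x. (Y x, Z x)) (b, c))" for b c
  define pz where "pz c = prob (fiber Z c)" for c
  note sf = simple_function_Pair[OF X simple_function_Pair[OF Y Z]] simple_function_Pair[OF X Z]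
    simple_function_Pair[OF Y Z]
  have nn: "0 \<le> p a b c" "0 \<le> pxz a c" "0 \<le> pyz b c" "0 \<le> pz c" for a b c
    by (auto simp: p_def pxz_def pyz_def pz_def)
  have le: "p a b c \<le> pxz a c" "p a b c \<le> pyz b c" "p a b c \<le> pz c" for a b c
    unfolding p_def pxz_def pyz_def pz_def
    by (intro finite_measure_mono fiber_events sf Z; auto simp: fiber_def)+
  have mxz: "pxz a c = (\<Sum>b\<in>?B. p a b c)" if "a \<in> ?A" "c \<in> ?C" for a c
  proof -
    have "pxz a c = (\<Sum>u\<in>{u\<in>?A \<times> ?B \<times> ?C. (fst u, snd (snd u)) = (a, c)}. prob (fiber (\<lambda>x. (X x, Y x, Z x)) u))"
      unfolding pxz_def using fin by (intro prob_fiber_sum sf) auto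
    also have "{u\<in>?A \<times> ?B \<times> ?C. (fst u, snd (snd u)) = (a, c)} = (\<lambda>b. (a, b, c)) ` ?B" using that by auto
    finally show ?thesis by (simp add: sum.reindex inj_on_def p_def)
  qed
  have myz: "pyz b c = (\<Sum>a\<in>?A. p a b c)" if "b \<in> ?B" "c \<in> ?C" for b c
  proof -
    have "pyz b c = (\<Sum>u\<in>{u\<in>?A \<times> ?B \<times> ?C. snd u = (b, c)}. prob (fiber (\<lambda>x. (X x, Y x, Z x)) u))"
      unfolding pyz_def using fin by (intro prob_fiber_sum sf) auto
    also have "{u\<in>?A \<times> ?B \<times> ?C. snd u = (b, c)} = (\<lambda>a. (a, b, c)) ` ?A" using that by auto
    finally show ?thesis by (simp add: sum.reindex inj_on_def p_def)
  qed
  have mz: "pz c = (\<Sum>a\<in>?A. pxz a c)" "pz c = (\<Sum>b\<in>?B. pyz b c)" if "c \<in> ?C" for c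
  proof -
    have "pz c = (\<Sum>u\<in>{u\<in>?A \<times> ?C. snd u = c}. prob (fiber (\<lambda>x. (X x, Z x)) u))"
      unfolding pz_def using fin by (intro prob_fiber_sum sf Z) auto
    also have "{u\<in>?A \<times> ?C. snd u = c} = (\<lambda>a. (a, c)) ` ?A" using that by auto
    finally show "pz c = (\<Sum>a\<in>?A. pxz a c)" by (simp add: sum.reindex inj_on_def pxz_def)
    have "pz c = (\<Sum>u\<in>{u\<in>?B \<times> ?C. snd u = c}. prob (fiber (\<lambda>x. (Y x, Z x)) u))"
      unfolding pz_def using fin by (intro prob_fiber_sum sf Z) auto
    also have "{u\<in>?B \<times> ?C. snd u = c} = (\<lambda>b. (b, c)) ` ?B" using that by auto
    finally show "pz c = (\<Sum>b\<in>?B. pyz b c)" by (simp add: sum.reindex inj_on_def pyz_def)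
  qed
  have one: "(\<Sum>c\<in>?C. pz c) = 1"
  proof -
    have "prob (fiber (\<lambda>_. ()) ()) = (\<Sum>u\<in>{u\<in>?C. () = ()}. prob (fiber Z u))"
      using fin by (intro prob_fiber_sum Z) auto
    then show ?thesis by (simp add: pz_def fiber_def prob_space)
  qed
  have "ent (\<lambda>x. (X x, Y x, Z x)) = (\<Sum>u\<in>?A \<times> ?B \<times> ?C. - (prob (fiber (\<lambda>x. (X x, Y x, Z x)) u) * ln (prob (fiber (\<lambda>x. (X x, Y x, Z x)) u))))"
    using fin by (intro ent_superset) auto
  then have e1: "ent (\<lambda>x. (X x, Y x, Z x)) = (\<Sum>a\<in>?A. \<Sum>b\<in>?B. \<Sum>c\<in>?C. - (p a b c * ln (p a b c)))"
    by (simp add: sum.cartesian_product p_def case_prod_unfold)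
  have "ent Z = (\<Sum>c\<in>?C. - ((\<Sum>a\<in>?A. \<Sum>b\<in>?B. p a b c) * ln (pz c)))"
    unfolding ent_def by (intro sum.cong refl) (simp add: mz(1) mxz flip: pz_def)
  also have "\<dots> = (\<Sum>c\<in>?C. \<Sum>a\<in>?A. \<Sum>b\<in>?B. - (p a b c * ln (pz c)))"
    by (simp add: sum_distrib_right sum_negf)
  also have "\<dots> = (\<Sum>a\<in>?A. \<Sum>c\<in>?C. \<Sum>b\<in>?B. - (p a b c * ln (pz c)))" by (rule sum.swap)
  also have "\<dots> = (\<Sum>a\<in>?A. \<Sum>b\<in>?B. \<Sum>c\<in>?C. - (p a b c * ln (pz c)))" by (intro sum.cong refl sum.swap)
  finally have e2: "ent Z = (\<Sum>a\<in>?A. \<Sum>b\<in>?B. \<Sum>c\<in>?C. - (p a b c * ln (pz c)))" .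
  have "ent (\<lambda>x. (X x, Z x)) = (\<Sum>u\<in>?A \<times> ?C. - (prob (fiber (\<lambda>x. (X x, Z x)) u) * ln (prob (fiber (\<lambda>x. (X x, Z x)) u))))"
    using fin by (intro ent_superset) auto
  also have "\<dots> = (\<Sum>a\<in>?A. \<Sum>c\<in>?C. - (pxz a c * ln (pxz a c)))"
    by (simp add: sum.cartesian_product pxz_def case_prod_unfold)
  also have "\<dots> = (\<Sum>a\<in>?A. \<Sum>c\<in>?C. - ((\<Sum>b\<in>?B. p a b c) * ln (pxz a c)))"
    by (intro sum.cong refl) (simp add: mxz)
  also have "\<dots> = (\<Sum>a\<in>?A. \<Sum>c\<in>?C. \<Sum>b\<in>?B. - (p a b c * ln (pxz a c)))"
    by (simp add: sum_distrib_right sum_negf)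
  also have "\<dots> = (\<Sum>a\<in>?A. \<Sum>b\<in>?B. \<Sum>c\<in>?C. - (p a b c * ln (pxz a c)))" by (intro sum.cong refl sum.swap)
  finally have e3: "ent (\<lambda>x. (X x, Z x)) = (\<Sum>a\<in>?A. \<Sum>b\<in>?B. \<Sum>c\<in>?C. - (p a b c * ln (pxz a c)))" .
  have "ent (\<lambda>x. (Y x, Z x)) = (\<Sum>u\<in>?B \<times> ?C. - (prob (fiber (\<lambda>x. (Y x, Z x)) u) * ln (prob (fiber (\<lambda>x. (Y x, Z x)) u))))"
    using fin by (intro ent_superset) auto
  also have "\<dots> = (\<Sum>b\<in>?B. \<Sum>c\<in>?C. - (pyz b c * ln (pyz b c)))"
    by (simp add: sum.cartesian_product pyz_def case_prod_unfold)
  also have "\<dots> = (\<Sum>b\<in>?B. \<Sum>c\<in>?C. - ((\<Sum>a\<in>?A. p a b c) * ln (pyz b c)))"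
    by (intro sum.cong refl) (simp add: myz)
  also have "\<dots> = (\<Sum>b\<in>?B. \<Sum>c\<in>?C. \<Sum>a\<in>?A. - (p a b c * ln (pyz b c)))"
    by (simp add: sum_distrib_right sum_negf)
  also have "\<dots> = (\<Sum>b\<in>?B. \<Sum>a\<in>?A. \<Sum>c\<in>?C. - (p a b c * ln (pyz b c)))" by (intro sum.cong refl sum.swap)
  also have "\<dots> = (\<Sum>a\<in>?A. \<Sum>b\<in>?B. \<Sum>c\<in>?C. - (p a b c * ln (pyz b c)))" by (rule sum.swap)
  finally have e4: "ent (\<lambda>x. (Y x, Z x)) = (\<Sum>a\<in>?A. \<Sum>b\<in>?B. \<Sum>c\<in>?C. - (p a b c * ln (pyz b c)))" .
  have pt: "p a b c - pxz a c * pyz b c / pz c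
      \<le> p a b c * ln (p a b c) + p a b c * ln (pz c) - p a b c * ln (pxz a c) - p a b c * ln (pyz b c)" for a b c
  proof (cases "p a b c = 0")
    case True
    then show ?thesis using nn by simp
  next
    case False
    then have pos: "0 < p a b c" "0 < pxz a c" "0 < pyz b c" "0 < pz c"
      using nn(1)[of a b c] le[of a b c] by linarith+
    let ?r = "pxz a c * pyz b c / (p a b c * pz c)"
    have "ln ?r \<le> ?r - 1" using pos by (intro ln_le_minus_one) auto
    then have "p a b c * ln ?r \<le> p a b c * (?r - 1)" using pos by (intro mult_left_mono) auto
    also have "\<dots> = pxz a c * pyz b c / pz c - p a b c" using pos by (simp add: field_simps)
    also have "ln ?r = ln (pxz a c) + ln (pyz b c) - ln (p a b c) - ln (pz c)"
      using pos by (simp add: ln_div ln_mult_pos)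
    finally show ?thesis by (simp add: algebra_simps)
  qed
  have "(\<Sum>a\<in>?A. \<Sum>b\<in>?B. \<Sum>c\<in>?C. p a b c) = 1"
  proof -
    have "(\<Sum>a\<in>?A. \<Sum>b\<in>?B. \<Sum>c\<in>?C. p a b c) = (\<Sum>a\<in>?A. \<Sum>c\<in>?C. \<Sum>b\<in>?B. p a b c)"
      by (intro sum.cong refl sum.swap)
    also have "\<dots> = (\<Sum>c\<in>?C. \<Sum>a\<in>?A. \<Sum>b\<in>?B. p a b c)" by (rule sum.swap)
    also have "\<dots> = (\<Sum>c\<in>?C. pz c)" by (intro sum.cong refl) (simp add: mz(1) mxz)
    finally show ?thesis by (simp add: one)
  qed
  moreover have "(\<Sum>a\<in>?A. \<Sum>b\<in>?B. \<Sum>c\<in>?C. pxz a c * pyz b c / pz c) = 1"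
  proof -
    have "(\<Sum>a\<in>?A. \<Sum>b\<in>?B. \<Sum>c\<in>?C. pxz a c * pyz b c / pz c)
        = (\<Sum>a\<in>?A. \<Sum>c\<in>?C. \<Sum>b\<in>?B. pxz a c * pyz b c / pz c)" by (intro sum.cong refl sum.swap)
    also have "\<dots> = (\<Sum>a\<in>?A. \<Sum>c\<in>?C. pxz a c * pz c / pz c)"
      by (intro sum.cong refl) (simp add: mz(2) sum_distrib_left sum_divide_distrib)
    also have "\<dots> = (\<Sum>c\<in>?C. \<Sum>a\<in>?A. pxz a c * pz c / pz c)" by (rule sum.swap)
    also have "\<dots> = (\<Sum>c\<in>?C. pz c * pz c / pz c)"
      by (intro sum.cong refl) (simp add: mz(1) sum_distrib_right sum_divide_distrib)
    \<comment> \<open>A value \<open>c\<close> may have probability 0; then both sides vanish, as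
      division by 0 gives 0.\<close>
    also have "\<dots> = (\<Sum>c\<in>?C. pz c)" by (intro sum.cong refl) auto
    finally show ?thesis by (simp add: one)
  qed
  ultimately have "0 = (\<Sum>a\<in>?A. \<Sum>b\<in>?B. \<Sum>c\<in>?C. p a b c - pxz a c * pyz b c / pz c)"
    by (simp add: sum_subtractf)
  also have "\<dots> \<le> (\<Sum>a\<in>?A. \<Sum>b\<in>?B. \<Sum>c\<in>?C.
      p a b c * ln (p a b c) + p a b c * ln (pz c) - p a b c * ln (pxz a c) - p a b c * ln (pyz b c))"
    by (intro sum_mono pt)
  also have "\<dots> = ent (\<lambda>x. (X x, Z x)) + ent (\<lambda>x. (Y x, Z x)) - ent (\<lambda>x. (X x, Y x, Z x)) - ent Z"
    unfolding e1 e2 e3 e4 by (simp add: sum_subtractf sum.distrib sum_negf)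
  finally show ?thesis by simp
qed

lemma ent_const: "ent (\<lambda>_. c) = 0"
proof -
  have "(\<lambda>_. c) ` space M = {c}" using not_empty by auto
  moreover have "fiber (\<lambda>_. c) c = space M" by (auto simp: fiber_def)
  ultimately show ?thesis by (simp add: ent_def prob_space)
qed

lemma ent_subadditive:
  assumes X: "simple_function M X" and Y: "simple_function M Y"
  shows "ent (\<lambda>x. (X x, Y x)) \<le> ent X + ent Y"
proof -
  have c: "simple_function M (\<lambda>_. ())" by simp
  have "ent (\<lambda>x. (X x, Y x, ())) + ent (\<lambda>_. ()) \<le> ent (\<lambda>x. (X x, ())) + ent (\<lambda>x. (Y x, ()))"
    using X Y c by (rule ent_strong_subadditive)
  moreover have "ent (\<lambda>x. (X x, Y x, ())) = ent (\<lambda>x. (X x, Y x))"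
    using X Y by (intro ent_eq_of_determined simple_function_Pair) auto
  moreover have "ent (\<lambda>x. (X x, ())) = ent X" "ent (\<lambda>x. (Y x, ())) = ent Y"
    using X Y by (intro ent_eq_of_determined simple_function_Pair; auto)+
  ultimately show ?thesis by (simp add: ent_const)
qed

text \<open>Entropy as the expectation of the information function, so that pointwise bounds on the
  measures of cells can be integrated.\<close>

lemma ent_eq_integral:
  assumes X: "simple_function M X"
  shows "integrable M (\<lambda>x. - ln (prob (fiber X (X x))))"
    and "ent X = (\<integral>x. - ln (prob (fiber X (X x))) \<partial>M)"
proof -
  let ?A = "X ` space M"
  have fin: "finite ?A" using X finite_range by auto
  define h where "h x = (\<Sum>v\<in>?A. - ln (prob (fiber X v)) * indicator (fiber X v) x)" for x
  have h: "- ln (prob (fiber X (X x))) = h x" if "x \<in> space M" for x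
  proof -
    have "h x = (\<Sum>v\<in>?A. if v = X x then - ln (prob (fiber X v)) else 0)"
      unfolding h_def using that by (intro sum.cong) (auto simp: fiber_def)
    then show ?thesis using that fin by simp
  qed
  have int: "integrable M h" unfolding h_def using fiber_events[OF X]
    by (intro Bochner_Integration.integrable_sum integrable_mult_right integrable_real_indicator) (auto simp: emeasure_eq_measure)
  show "integrable M (\<lambda>x. - ln (prob (fiber X (X x))))"
    using int h by (subst Bochner_Integration.integrable_cong[OF refl h]) auto
  have "(\<integral>x. - ln (prob (fiber X (X x))) \<partial>M) = (\<integral>x. h x \<partial>M)"
    using h by (intro Bochner_Integration.integral_cong) auto
  also have "\<dots> = (\<Sum>v\<in>?A. - ln (prob (fiber X v)) * prob (fiber X v))"
    unfolding h_def using fiber_events[OF X]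
    by (subst Bochner_Integration.integral_sum)
      (auto intro!: integrable_mult_right integrable_real_indicator simp: emeasure_eq_measure fiber_def Int_assoc)
  finally show "ent X = (\<integral>x. - ln (prob (fiber X (X x))) \<partial>M)" by (simp add: ent_def mult.commute)
qed

end

lemma neg_mult_ln_le_sqrt:
  fixes p :: real
  assumes "0 \<le> p" shows "- (p * ln p) \<le> 2 * sqrt p"
proof (cases "p = 0")
  case False
  then have p: "p > 0" using assms by simp
  have "ln (1 / sqrt p) \<le> 1 / sqrt p - 1" using p by (intro ln_le_minus_one) auto
  then have "- ln p \<le> 2 * (1 / sqrt p)" using p by (simp add: ln_div ln_sqrt)
  then have "p * (- ln p) \<le> p * (2 * (1 / sqrt p))" using p by (intro mult_left_mono) auto
  also have "\<dots> = 2 * (p / sqrt p)" by simp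
  also have "\<dots> = 2 * sqrt p" using p by (subst real_div_sqrt) auto
  finally show ?thesis by simp
qed simp

text \<open>Bounds the conditional entropy of \<open>X\<close> given \<open>Y\<close> when
  \<open>Y\<close> is almost always the singleton of \<open>X\<close>. The values of
  \<open>Y\<close> are sets because the fibers of \<open>X\<close> will be approximated by sets that
  need neither cover the space nor be disjoint; a point is then labelled by all \<open>v\<close>
  whose approximation contains it.\<close>

lemma (in prob_space) ent_set_valued_approx:
  assumes X: "simple_function M X" and Y: "simple_function M Y"
    and V: "finite V" "X ` space M \<subseteq> V" "Y ` space M \<subseteq> Pow V"
    and d: "prob {x \<in> space M. Y x \<noteq> {X x}} \<le> d"
  shows "ent (\<lambda>x. (X x, Y x)) - ent Y \<le> real (card (V \<times> Pow V)) * (d + 2 * sqrt d)"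
proof -
  define p where "p u = prob (fiber (\<lambda>x. (X x, Y x)) u)" for u
  define P where "P s = prob (fiber Y s)" for s
  note sf = simple_function_Pair[OF X Y]
  have finP: "finite (V \<times> Pow V)" using V by auto
  have pP: "p (v, s) \<le> P s" for v s
    unfolding p_def P_def by (intro finite_measure_mono fiber_events Y) (auto simp: fiber_def)
  have P_eq: "P s = (\<Sum>u\<in>{u\<in>V \<times> Pow V. snd u = s}. p u)" for s
    unfolding P_def p_def using V by (intro prob_fiber_sum sf Y finP) auto
  then have P_sum: "P s = (\<Sum>v\<in>V. p (v, s))" if "s \<in> Pow V" for s
  proof -
    have "{u\<in>V \<times> Pow V. snd u = s} = (\<lambda>v. (v, s)) ` V" using that by auto
    then show ?thesis unfolding P_eq by (simp add: sum.reindex inj_on_def)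
  qed
  have bad: "{x \<in> space M. Y x \<noteq> {X x}} \<in> events"
  proof -
    have "simple_function M (\<lambda>x. Y x \<noteq> {X x})"
      using simple_function_compose1[OF sf, of "\<lambda>u. snd u \<noteq> {fst u}"] by simp
    from simple_functionD(2)[OF this, of "{True}"] show ?thesis by (simp add: vimage_def Int_def conj_commute)
  qed
  have d0: "0 \<le> d" using d measure_nonneg[of M] order_trans by blast
  have "ent (\<lambda>x. (X x, Y x)) = (\<Sum>u\<in>V \<times> Pow V. - (p u * ln (p u)))"
    unfolding p_def using V by (intro ent_superset finP) auto
  moreover have "ent Y = (\<Sum>s\<in>Pow V. - (P s * ln (P s)))"
    unfolding P_def using V by (intro ent_superset) auto
  moreover have "(\<Sum>s\<in>Pow V. - (P s * ln (P s))) = (\<Sum>u\<in>V \<times> Pow V. - (p u * ln (P (snd u))))"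
  proof -
    have "(\<Sum>s\<in>Pow V. - (P s * ln (P s))) = (\<Sum>s\<in>Pow V. \<Sum>v\<in>V. - (p (v, s) * ln (P s)))"
      by (intro sum.cong refl) (simp add: P_sum sum_distrib_right sum_negf)
    also have "\<dots> = (\<Sum>v\<in>V. \<Sum>s\<in>Pow V. - (p (v, s) * ln (P s)))" by (rule sum.swap)
    finally show ?thesis by (simp add: sum.cartesian_product case_prod_unfold)
  qed
  ultimately have "ent (\<lambda>x. (X x, Y x)) - ent Y = (\<Sum>u\<in>V \<times> Pow V. p u * ln (P (snd u)) - p u * ln (p u))"
    by (simp add: sum_subtractf sum_negf)
  also have "\<dots> \<le> (\<Sum>u\<in>V \<times> Pow V. d + 2 * sqrt d)"
  proof (intro sum_mono)
    fix u assume "u \<in> V \<times> Pow V"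
    then obtain v s where u: "u = (v, s)" by auto
    have p0: "0 \<le> p u" by (simp add: p_def)
    show "p u * ln (P (snd u)) - p u * ln (p u) \<le> d + 2 * sqrt d"
    \<comment> \<open>For \<open>s = {v}\<close> the term is at most \<open>P s - p u\<close>, the
      probability that \<open>Y\<close> is \<open>{v}\<close> while \<open>X\<close> is not
      \<open>v\<close>. Otherwise \<open>p u\<close> is itself at most \<open>d\<close>.\<close>
    proof (cases "s = {v}")
      case True
      have "p u * ln (P s) - p u * ln (p u) \<le> P s - p u"
      proof (cases "p u = 0")
        case True
        then show ?thesis by (simp add: P_def)
      next
        case False
        then have pos: "0 < p u" "0 < P s" using p0 pP[of v s] u by auto
        then have "ln (P s / p u) \<le> P s / p u - 1" by (intro ln_le_minus_one) auto
        then have "p u * ln (P s / p u) \<le> p u * (P s / p u - 1)" using pos by (intro mult_left_mono) auto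
        then show ?thesis using pos by (simp add: ln_div algebra_simps)
      qed
      also have "P s - p u = prob (fiber Y s - fiber (\<lambda>x. (X x, Y x)) u)"
        unfolding P_def p_def
        by (intro finite_measure_Diff[symmetric] fiber_events Y sf) (auto simp: fiber_def u)
      also have "\<dots> \<le> prob {x \<in> space M. Y x \<noteq> {X x}}"
        using bad True by (intro finite_measure_mono) (auto simp: fiber_def u)
      finally have "p u * ln (P s) - p u * ln (p u) \<le> d" using d by simp
      also have "d \<le> d + 2 * sqrt d" using d0 by simp
      finally show ?thesis using u by simp
    next
      case False
      have "p u \<le> prob {x \<in> space M. Y x \<noteq> {X x}}"
        unfolding p_def using bad False by (intro finite_measure_mono) (auto simp: fiber_def u)
      then have "p u \<le> d" using d by simp
      have "ln (P s) \<le> 0" unfolding P_def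
        by (cases "prob (fiber Y s) = 0") (auto simp: zero_less_measure_iff)
      then have "p u * ln (P s) \<le> 0" using p0 by (intro mult_nonneg_nonpos)
      moreover have "- (p u * ln (p u)) \<le> 2 * sqrt (p u)" by (rule neg_mult_ln_le_sqrt[OF p0])
      moreover have "sqrt (p u) \<le> sqrt d" using \<open>p u \<le> d\<close> by simp
      ultimately have "p u * ln (P s) - p u * ln (p u) \<le> d + 2 * sqrt d" using d0 by linarith
      then show ?thesis using u by simp
    qed
  qed
  also have "\<dots> = real (card (V \<times> Pow V)) * (d + 2 * sqrt d)" by simp
  finally show ?thesis .
qed

section \<open>Entropy of the shift\<close>

definition itin :: "((nat \<Rightarrow> nat) \<Rightarrow> 'b) \<Rightarrow> nat \<Rightarrow> (nat \<Rightarrow> nat) \<Rightarrow> 'b list" where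
  "itin X n x = map (\<lambda>i. X ((shift ^^ i) x)) [0..<n]"

lemma length_itin [simp]: "length (itin X n x) = n" by (simp add: itin_def)

lemma itin_nth [simp]: "i < n \<Longrightarrow> itin X n x ! i = X ((shift ^^ i) x)" by (simp add: itin_def)

lemma itin_Suc: "itin X (Suc n) x = itin X n x @ [X ((shift ^^ n) x)]" by (simp add: itin_def)

lemma itin_add: "itin X (m + n) x = itin X m x @ itin X n ((shift ^^ m) x)"
  by (rule nth_equalityI) (auto simp: nth_append funpow_add[symmetric, THEN fun_cong, unfolded o_def] add.commute)

lemma itin_eq_iff: "itin X n x = itin X n y \<longleftrightarrow> (\<forall>i<n. X ((shift ^^ i) x) = X ((shift ^^ i) y))"
  by (auto simp: itin_def)

context invariant_measure
begin

lemma simple_funpow: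
  assumes "simple_function \<mu> X" shows "simple_function \<mu> (\<lambda>x. X ((shift ^^ n) x))"
proof -
  have "X -` {v} \<inter> shift_space M \<in> sets (shift_borel M)" for v
    using simple_functionD(2)[OF assms, of "{v}"] by (simp add: sets_eq)
  then have "(shift ^^ n) -` (X -` {v} \<inter> shift_space M) \<inter> shift_space M \<in> sets (shift_borel M)" for v
    using measurable_sets[OF measurable_funpow_shift[of n M], of "X -` {v} \<inter> shift_space M"] by simp
  moreover have "(\<lambda>x. X ((shift ^^ n) x)) -` {v} \<inter> shift_space M
      = (shift ^^ n) -` (X -` {v} \<inter> shift_space M) \<inter> shift_space M" for v
    by (auto intro: funpow_shift_in)
  moreover have "finite ((\<lambda>x. X ((shift ^^ n) x)) ` shift_space M)"
    by (rule finite_subset[OF _ finite_range[OF assms]]) (auto intro: funpow_shift_in)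
  ultimately show ?thesis unfolding simple_function_def by (simp add: sets_eq)
qed

lemma simple_itin:
  assumes "simple_function \<mu> X" shows "simple_function \<mu> (itin X n)"
proof (induction n)
  case 0
  have "itin X 0 = (\<lambda>_. [])" by (auto simp: itin_def)
  then show ?case by simp
next
  case (Suc n)
  have "simple_function \<mu> (\<lambda>x. (itin X n x, X ((shift ^^ n) x)))"
    using Suc simple_funpow[OF assms] by (intro simple_function_Pair)
  from simple_function_compose1[OF this, of "\<lambda>(u, v). u @ [v]"] show ?case
    by (simp add: itin_Suc[abs_def])
qed

lemma ent_funpow:
  assumes X: "simple_function \<mu> X" shows "ent (\<lambda>x. X ((shift ^^ n) x)) = ent X"
proof -
  have "prob (fiber (\<lambda>x. X ((shift ^^ n) x)) v) = prob (fiber X v)" for v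
  proof -
    have "fiber X v \<in> sets (shift_borel M)" using fiber_events[OF X] by (simp add: sets_eq)
    then have "prob ((shift ^^ n) -` fiber X v \<inter> shift_space M) = prob (fiber X v)"
      by (rule prob_funpow_shift)
    moreover have "fiber (\<lambda>x. X ((shift ^^ n) x)) v = (shift ^^ n) -` fiber X v \<inter> shift_space M"
      by (auto simp: fiber_def intro: funpow_shift_in)
    ultimately show ?thesis by simp
  qed
  moreover have "(\<lambda>x. X ((shift ^^ n) x)) ` space \<mu> \<subseteq> X ` space \<mu>" by (auto intro: funpow_shift_in)
  ultimately show ?thesis
    using ent_superset[OF finite_range[OF X], of "\<lambda>x. X ((shift ^^ n) x)"] by (simp add: ent_def)
qed

lemma ent_itin_add:
  assumes X: "simple_function \<mu> X"
  shows "ent (itin X (m + n)) \<le> ent (itin X m) + ent (itin X n)"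
proof -
  note s = simple_itin[OF X]
  have "ent (itin X (m + n)) \<le> ent (\<lambda>x. (itin X m x, itin X n ((shift ^^ m) x)))"
    by (intro ent_le_of_determined s simple_function_Pair simple_funpow) (auto simp: itin_add)
  also have "\<dots> \<le> ent (itin X m) + ent (\<lambda>x. itin X n ((shift ^^ m) x))"
    by (intro ent_subadditive s simple_funpow)
  finally show ?thesis by (simp add: ent_funpow[OF s])
qed

definition hent :: "((nat \<Rightarrow> nat) \<Rightarrow> 'b) \<Rightarrow> real" where
  "hent X = lim (\<lambda>n. ent (itin X n) / real n)"

lemma hent_tendsto:
  assumes X: "simple_function \<mu> X" shows "(\<lambda>n. ent (itin X n) / real n) \<longlonglongrightarrow> hent X"
proof -
  have "(\<lambda>n. ent (itin X n) / real n) \<longlonglongrightarrow> (INF n\<in>{1..}. ent (itin X n) / real n)"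
    by (rule fekete[where c = 0]) (use ent_itin_add[OF X] ent_nonneg in auto)
  then show ?thesis unfolding hent_def by (simp add: limI)
qed

text \<open>By subadditivity the averages along the multiples of \<open>n\<close> stay below the
  average at \<open>n\<close>, and they converge to the rate.\<close>

lemma hent_le:
  assumes X: "simple_function \<mu> X" and n: "n \<ge> 1"
  shows "real n * hent X \<le> ent (itin X n)"
proof -
  have "ent (itin X (n * k)) \<le> real k * ent (itin X n)" for k
  proof (induction k)
    case 0
    have "itin X 0 = (\<lambda>_. [])" by (auto simp: itin_def)
    then show ?case by (simp add: ent_const)
  next
    case (Suc k)
    then show ?case using ent_itin_add[OF X, of n "n * k"] by (simp add: algebra_simps)
  qed
  then have "ent (itin X (n * k)) / real (n * k) \<le> ent (itin X n) / real n" if "k \<ge> 1" for k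
    using that n by (simp add: field_simps)
  moreover have "(\<lambda>k. ent (itin X (n * k)) / real (n * k)) \<longlonglongrightarrow> hent X"
    using n by (intro filterlim_compose[OF hent_tendsto[OF X]])
      (auto intro!: filterlim_subseq simp: strict_mono_def)
  ultimately have "hent X \<le> ent (itin X n) / real n"
    by (intro LIMSEQ_le_const2) auto
  then show ?thesis using n by (simp add: field_simps)
qed

lemma hent_mono:
  assumes X: "simple_function \<mu> X" and Y: "simple_function \<mu> Y"
    and det: "\<And>x y. x \<in> shift_space M \<Longrightarrow> y \<in> shift_space M \<Longrightarrow> X x = X y \<Longrightarrow> Y x = Y y"
  shows "hent Y \<le> hent X"
proof (rule LIMSEQ_le[OF hent_tendsto[OF Y] hent_tendsto[OF X]], intro exI allI impI divide_right_mono)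
  fix n
  show "ent (itin Y n) \<le> ent (itin X n)"
    by (intro ent_le_of_determined simple_itin X Y) (auto simp: itin_eq_iff intro!: det funpow_shift_in)
qed simp

text \<open>Each further step costs at most the conditional entropy of \<open>X\<close> given
  \<open>Y\<close>, which is the same at all times by invariance.\<close>

lemma ent_itin_le:
  assumes X: "simple_function \<mu> X" and Y: "simple_function \<mu> Y"
  shows "ent (itin X n) \<le> ent (itin Y n) + real n * (ent (\<lambda>x. (X x, Y x)) - ent Y)"
proof -
  note s = simple_itin[OF X] simple_itin[OF Y] simple_funpow[OF X] simple_funpow[OF Y]
  let ?d = "ent (\<lambda>x. (X x, Y x)) - ent Y"
  have "ent (\<lambda>x. (itin X n x, itin Y n x)) \<le> ent (itin Y n) + real n * ?d"
  proof (induction n)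
    case 0
    have "(\<lambda>x. (itin X 0 x, itin Y 0 x)) = (\<lambda>_. ([], []))" "itin Y 0 = (\<lambda>_. [])" by (auto simp: itin_def)
    then show ?case by (simp add: ent_const)
  next
    case (Suc n)
    define A where "A = itin X n"
    define Z where "Z = itin Y n"
    define B where "B x = X ((shift ^^ n) x)" for x
    define Y' where "Y' x = Y ((shift ^^ n) x)" for x
    have sABZY: "simple_function \<mu> A" "simple_function \<mu> B" "simple_function \<mu> Z" "simple_function \<mu> Y'"
      using s unfolding A_def Z_def B_def Y'_def by auto
    have len: "length (A x) = n" "length (Z x) = n" for x by (auto simp: A_def Z_def)
    have SX: "itin X (Suc n) = (\<lambda>x. A x @ [B x])" and SY: "itin Y (Suc n) = (\<lambda>x. Z x @ [Y' x])"
      by (auto simp: itin_Suc A_def B_def Z_def Y'_def)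
    have sXY: "simple_function \<mu> (\<lambda>x. (itin X (Suc n) x, itin Y (Suc n) x))"
      by (intro simple_function_Pair simple_itin X Y)
    have eq1: "ent (\<lambda>x. (itin X (Suc n) x, itin Y (Suc n) x)) = ent (\<lambda>x. (A x, B x, (Z x, Y' x)))"
      by (intro ent_eq_of_determined sXY simple_function_Pair sABZY) (auto simp: SX SY len)
    have eq2: "ent (itin Y (Suc n)) = ent (\<lambda>x. (Z x, Y' x))"
      by (intro ent_eq_of_determined simple_itin Y simple_function_Pair sABZY) (auto simp: SY len)
    have eq3: "ent (\<lambda>x. (A x, (Z x, Y' x))) = ent (\<lambda>x. (A x, Y' x, Z x))"
      "ent (\<lambda>x. (Y' x, Z x)) = ent (\<lambda>x. (Z x, Y' x))"
      "ent (\<lambda>x. (B x, (Z x, Y' x))) = ent (\<lambda>x. (B x, Z x, Y' x))"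
      by (intro ent_eq_of_determined simple_function_Pair sABZY; auto)+
    have eq4: "ent (\<lambda>x. (B x, Y' x)) = ent (\<lambda>x. (X x, Y x))" "ent Y' = ent Y"
      using ent_funpow[OF simple_function_Pair[OF X Y], of n] ent_funpow[OF Y, of n]
      unfolding B_def Y'_def by auto
    \<comment> \<open>Strong subadditivity three times. In conditional form:
      \<open>H(A,B|Z,Y')\<close> is at most \<open>H(A|Z,Y') + H(B|Z,Y')\<close>, and dropping one
      condition in each term gives at most \<open>H(A|Z) + H(B|Y')\<close>.\<close>
    have "ent (\<lambda>x. (A x, B x, (Z x, Y' x))) + ent (\<lambda>x. (Z x, Y' x))
        \<le> ent (\<lambda>x. (A x, (Z x, Y' x))) + ent (\<lambda>x. (B x, (Z x, Y' x)))"
      by (intro ent_strong_subadditive simple_function_Pair sABZY)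
    moreover have "ent (\<lambda>x. (A x, Y' x, Z x)) + ent Z \<le> ent (\<lambda>x. (A x, Z x)) + ent (\<lambda>x. (Y' x, Z x))"
      by (intro ent_strong_subadditive sABZY)
    moreover have "ent (\<lambda>x. (B x, Z x, Y' x)) + ent Y' \<le> ent (\<lambda>x. (B x, Y' x)) + ent (\<lambda>x. (Z x, Y' x))"
      by (intro ent_strong_subadditive sABZY)
    moreover have "ent (\<lambda>x. (A x, Z x)) \<le> ent Z + real n * ?d"
      using Suc by (simp add: A_def Z_def)
    ultimately show ?case unfolding eq1 eq2 using eq3 eq4 by (simp add: algebra_simps)
  qed
  moreover have "ent (itin X n) \<le> ent (\<lambda>x. (itin X n x, itin Y n x))"
    by (intro ent_le_of_determined simple_function_Pair s) auto
  ultimately show ?thesis by simp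
qed

lemma hent_le_cond:
  assumes X: "simple_function \<mu> X" and Y: "simple_function \<mu> Y"
  shows "hent X \<le> hent Y + (ent (\<lambda>x. (X x, Y x)) - ent Y)"
proof (rule LIMSEQ_le[OF hent_tendsto[OF X]])
  let ?d = "ent (\<lambda>x. (X x, Y x)) - ent Y"
  show "(\<lambda>n. ent (itin Y n) / real n + ?d) \<longlonglongrightarrow> hent Y + ?d"
    by (intro tendsto_intros hent_tendsto Y)
  have "ent (itin X n) / real n \<le> ent (itin Y n) / real n + ?d" if "n \<ge> 1" for n
  proof -
    have "ent (itin X n) / real n \<le> (ent (itin Y n) + real n * ?d) / real n"
      by (intro divide_right_mono ent_itin_le X Y) simp
    then show ?thesis using that by (simp add: add_divide_distrib)
  qed
  then show "\<exists>N. \<forall>n\<ge>N. ent (itin X n) / real n \<le> ent (itin Y n) / real n + ?d" by blast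
qed

end

section \<open>Truncated first-letter partitions\<close>

text \<open>All letters from \<open>N\<close> on share one cell, because the entropy is a supremum
  over finite partitions.\<close>

definition first_letter :: "nat \<Rightarrow> (nat \<Rightarrow> nat) \<Rightarrow> nat" where
  "first_letter N x = min (x 0) N"

lemma itin_first_letter: "itin (first_letter N) n x = map (\<lambda>a. min a N) (initial n x)"
  by (auto simp: itin_def first_letter_def initial_def funpow_shift)

context shift_measure
begin

lemma simple_countable_space:
  assumes "finite (g ` A)" "X \<in> measurable (shift_borel M) (count_space UNIV)" "X ` shift_space M \<subseteq> A"
  shows "simple_function \<mu> (\<lambda>x. g (X x))"
proof -
  have "finite ((\<lambda>x. g (X x)) ` shift_space M)"
    by (rule finite_subset[OF _ assms(1)]) (use assms(3) in auto)
  moreover have "(\<lambda>x. g (X x)) -` {v} \<inter> shift_space M \<in> sets (shift_borel M)" for v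
  proof -
    have "X -` (g -` {v}) \<inter> space (shift_borel M) \<in> sets (shift_borel M)"
      using assms(2) by (rule measurable_sets) simp
    then show ?thesis by (simp add: vimage_def)
  qed
  ultimately show ?thesis by (simp add: simple_function_def sets_eq)
qed

lemma simple_first_letter: "simple_function \<mu> (first_letter N)"
proof -
  have "(\<lambda>a. min a N) ` UNIV \<subseteq> {..N}" by auto
  then have "finite ((\<lambda>a. min a N) ` UNIV)" by (rule finite_subset) simp
  from simple_countable_space[OF this, of "\<lambda>x. x 0"] show ?thesis
    unfolding first_letter_def[abs_def] by simp
qed

end

context invariant_measure
begin

text \<open>The fibers of \<open>X\<close> are approximated by unions of cylinders of length
  \<open>n\<close> over letters below \<open>N\<close>, and \<open>Y\<close> records which of these
  contain the point. Given \<open>Y\<close>, the entropy of \<open>X\<close> is small; and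
  \<open>Y\<close> is a function of \<open>n\<close> consecutive truncated letters, so its rate is
  at most theirs.\<close>

lemma hent_le_first_letter:
  assumes X: "simple_function \<mu> X" and e: "e > 0"
  shows "\<exists>N. hent X \<le> hent (first_letter N) + e"
proof -
  define V where "V = X ` shift_space M"
  have V: "finite V" using finite_range[OF X] by (simp add: V_def)
  define c where "c = real (card (V \<times> Pow V))"
  have "((\<lambda>d. c * (real (card V) * d + 2 * sqrt (real (card V) * d))) \<longlongrightarrow> c * (real (card V) * 0 + 2 * sqrt (real (card V) * 0))) (at_right 0)"
    by (intro tendsto_intros)
  then have "((\<lambda>d. c * (real (card V) * d + 2 * sqrt (real (card V) * d))) \<longlongrightarrow> 0) (at_right 0)" by simp
  then have "\<forall>\<^sub>F d in at_right 0. c * (real (card V) * d + 2 * sqrt (real (card V) * d)) < e"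
    using e by (intro order_tendstoD)
  moreover have "\<forall>\<^sub>F d in at_right 0. (0::real) < d" by (simp add: eventually_at_right_less)
  ultimately have "\<forall>\<^sub>F d in at_right 0. (0::real) < d \<and> c * (real (card V) * d + 2 * sqrt (real (card V) * d)) < e"
    by eventually_elim simp
  then obtain d where d: "d > 0" "c * (real (card V) * d + 2 * sqrt (real (card V) * d)) < e"
    using eventually_happens[of _ "at_right (0::real)"] by auto
  have fib: "fiber X v \<in> sets (shift_borel M)" for v using fiber_events[OF X] by (simp add: sets_eq)
  have "\<forall>\<^sub>F n in sequentially. \<forall>v\<in>V. \<forall>\<^sub>F N in sequentially. \<exists>S\<subseteq>words {..<N} n.
      \<forall>\<rho>\<in>{\<mu>}. measure \<rho> (fiber X v - cylinders M S \<union> (cylinders M S - fiber X v)) < d"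
    using d fib V shift_measure_axioms
    by (intro eventually_ball_finite ballI cylinder_approximation) auto
  then obtain n where n: "\<forall>v\<in>V. \<forall>\<^sub>F N in sequentially. \<exists>S\<subseteq>words {..<N} n.
      \<forall>\<rho>\<in>{\<mu>}. measure \<rho> (fiber X v - cylinders M S \<union> (cylinders M S - fiber X v)) < d"
    by (auto simp: eventually_sequentially)
  then have "\<forall>\<^sub>F N in sequentially. \<forall>v\<in>V. \<exists>S\<subseteq>words {..<N} n.
      \<forall>\<rho>\<in>{\<mu>}. measure \<rho> (fiber X v - cylinders M S \<union> (cylinders M S - fiber X v)) < d"
    using V by (intro eventually_ball_finite) auto
  then obtain N where "\<forall>v\<in>V. \<exists>S\<subseteq>words {..<N} n. prob (fiber X v - cylinders M S \<union> (cylinders M S - fiber X v)) < d"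
    by (auto simp: eventually_sequentially)
  then obtain S where S: "\<And>v. v \<in> V \<Longrightarrow> S v \<subseteq> words {..<N} n"
    "\<And>v. v \<in> V \<Longrightarrow> prob (fiber X v - cylinders M (S v) \<union> (cylinders M (S v) - fiber X v)) < d"
    by metis
  define Y where "Y x = {v\<in>V. initial n x \<in> S v}" for x
  have "finite ((\<lambda>u. {v\<in>V. u \<in> S v}) ` UNIV)"
    by (rule finite_subset[of _ "Pow V"]) (use V in auto)
  from simple_countable_space[OF this, of "initial n"] have Y: "simple_function \<mu> Y"
    unfolding Y_def[abs_def] by simp
  let ?E = "\<lambda>v. fiber X v - cylinders M (S v) \<union> (cylinders M (S v) - fiber X v)"
  have E: "?E v \<in> events" for v using fib by (auto simp: sets_eq)
  have "{x \<in> space \<mu>. Y x \<noteq> {X x}} \<subseteq> (\<Union>v\<in>V. ?E v)"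
  proof
    fix x assume "x \<in> {x \<in> space \<mu>. Y x \<noteq> {X x}}"
    then have x: "x \<in> shift_space M" "Y x \<noteq> {X x}" by auto
    have "\<exists>v\<in>V. (v \<in> Y x) \<noteq> (v = X x)"
    proof (rule ccontr)
      assume "\<not> ?thesis"
      moreover have "Y x \<subseteq> V" "X x \<in> V" using x(1) by (auto simp: Y_def V_def)
      ultimately have "Y x = {X x}" by blast
      with x(2) show False by simp
    qed
    then obtain v where v: "v \<in> V" "(v \<in> Y x) \<noteq> (v = X x)" by blast
    then have "x \<in> ?E v"
      using x mem_cylinders_words[OF S(1)[OF v(1)], of x M] by (auto simp: Y_def fiber_def)
    then show "x \<in> (\<Union>v\<in>V. ?E v)" using v by blast
  qed
  then have "prob {x \<in> space \<mu>. Y x \<noteq> {X x}} \<le> prob (\<Union>v\<in>V. ?E v)"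
    using E V by (intro finite_measure_mono) auto
  also have "\<dots> \<le> (\<Sum>v\<in>V. prob (?E v))" using V E by (intro measure_UNION_le) auto
  also have "\<dots> \<le> (\<Sum>v\<in>V. d)" using S(2) by (intro sum_mono) (auto intro: less_imp_le)
  also have "\<dots> = real (card V) * d" by simp
  finally have "ent (\<lambda>x. (X x, Y x)) - ent Y \<le> c * (real (card V) * d + 2 * sqrt (real (card V) * d))"
    unfolding c_def using V by (intro ent_set_valued_approx X Y) (auto simp: V_def Y_def)
  then have 1: "hent X \<le> hent Y + e" using hent_le_cond[OF X Y] d(2) by simp
  have "hent Y \<le> hent (first_letter N)"
  proof (rule LIMSEQ_le[OF hent_tendsto[OF Y]])
    note sN = simple_first_letter[of N]
    show "(\<lambda>k. ent (itin (first_letter N) n) / real k + ent (itin (first_letter N) k) / real k) \<longlonglongrightarrow> hent (first_letter N)"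
      using tendsto_add[OF lim_const_over_n hent_tendsto[OF sN]] by simp
    have "ent (itin Y k) / real k \<le> ent (itin (first_letter N) n) / real k + ent (itin (first_letter N) k) / real k" for k
    proof -
      \<comment> \<open>The \<open>k\<close> windows of length \<open>n\<close> lie within the first
        \<open>n + k\<close> positions; the extra letters cost a bounded entropy, which disappears
        after division by \<open>k\<close>.\<close>
      have "ent (itin Y k) \<le> ent (itin (first_letter N) (n + k))"
      proof (intro ent_le_of_determined simple_itin Y sN)
        fix x y assume xy: "itin (first_letter N) (n + k) x = itin (first_letter N) (n + k) y"
        have "Y ((shift ^^ i) x) = Y ((shift ^^ i) y)" if i: "i < k" for i
        proof -
          have *: "min (x (i + j)) N = min (y (i + j)) N" if "j < n" for j
            using xy i that unfolding itin_eq_iff by (auto simp: first_letter_def funpow_shift)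
          have "initial n ((shift ^^ i) x) \<in> S v \<longleftrightarrow> initial n ((shift ^^ i) y) \<in> S v" if v: "v \<in> V" for v
          proof -
            \<comment> \<open>Words in \<open>S v\<close> have only letters below \<open>N\<close>,
              which truncation does not alter, so the truncated letters decide membership.\<close>
            have "initial n ((shift ^^ i) z) = initial n ((shift ^^ i) z')"
              if "initial n ((shift ^^ i) z) \<in> S v" "\<And>j. j < n \<Longrightarrow> min (z (i + j)) N = min (z' (i + j)) N" for z z'
            proof -
              have lt: "z (i + j) < N" if "j < n" for j
                using S(1)[OF v] \<open>initial n ((shift ^^ i) z) \<in> S v\<close> that
                by (auto simp: words_def initial_def funpow_shift image_subset_iff subset_iff add.commute)
              have eq: "z (i + j) = z' (i + j)" if j: "j < n" for j
                using lt[OF j] \<open>\<And>j. j < n \<Longrightarrow> min (z (i + j)) N = min (z' (i + j)) N\<close>[OF j] by linarith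
              then have "z (j + i) = z' (j + i)" if "j < n" for j
                using eq[OF that] by (simp only: add.commute[of j i])
              then show ?thesis by (auto simp: initial_def funpow_shift)
            qed
            then show ?thesis using * by metis
          qed
          then show ?thesis by (auto simp: Y_def)
        qed
        then show "itin Y k x = itin Y k y" by (simp add: itin_eq_iff)
      qed
      also have "\<dots> \<le> ent (itin (first_letter N) n) + ent (itin (first_letter N) k)" by (rule ent_itin_add[OF sN])
      finally have "ent (itin Y k) / real k \<le> (ent (itin (first_letter N) n) + ent (itin (first_letter N) k)) / real k"
        by (rule divide_right_mono) simp
      then show ?thesis by (simp add: add_divide_distrib)
    qed
    then show "\<exists>K. \<forall>k\<ge>K. ent (itin Y k) / real k \<le> ent (itin (first_letter N) n) / real k + ent (itin (first_letter N) k) / real k"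
      by blast
  qed
  with 1 show ?thesis by (intro exI[of _ N]) simp
qed

text \<open>A point is labelled by the set of members of the partition that contain it, a singleton,
  which avoids selecting an element. Distinct label sequences give the same cell of the join only if
  that cell is empty, and the empty cell contributes 0, so sum over cells and sum over labels
  agree.\<close>

lemma entropy_wrt_partition_eq:
  assumes xi: "finite \<xi>" "\<xi> \<subseteq> sets \<mu>" "partition_on (space \<mu>) \<xi>"
  defines "lab \<equiv> \<lambda>x. {A\<in>\<xi>. x \<in> A}"
  shows "simple_function \<mu> lab" "entropy_wrt_partition \<mu> shift \<xi> = hent lab"
proof -
  have disj: "A = B" if "A \<in> \<xi>" "B \<in> \<xi>" "x \<in> A" "x \<in> B" for A B x
    using partition_onD2[OF xi(3)] that unfolding disjoint_def by blast
  have lab_eq: "lab x = {A} \<longleftrightarrow> x \<in> A" if "A \<in> \<xi>" for A x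
    unfolding lab_def using disj[OF _ that] that by auto
  have cover: "\<exists>A\<in>\<xi>. lab x = {A}" if x: "x \<in> space \<mu>" for x
  proof -
    obtain A where "A \<in> \<xi>" "x \<in> A" using partition_onD1[OF xi(3)] x by auto
    then show ?thesis using lab_eq by auto
  qed
  show sl: "simple_function \<mu> lab"
    unfolding simple_function_def
  proof (intro conjI ballI)
    show "finite (lab ` space \<mu>)"
      by (rule finite_subset[of _ "Pow \<xi>"]) (use xi in \<open>auto simp: lab_def\<close>)
    fix l assume "l \<in> lab ` space \<mu>"
    then obtain A where A: "A \<in> \<xi>" "l = {A}" using cover by blast
    have "lab -` {l} \<inter> space \<mu> = A"
      using A lab_eq partition_onD1[OF xi(3)] by auto
    then show "lab -` {l} \<inter> space \<mu> \<in> sets \<mu>" using A xi by auto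
  qed
  have "partition_entropy \<mu> (iterated_join \<mu> shift \<xi> n) = ent (itin lab n)" for n
  proof -
    define W where "W = {w. set w \<subseteq> (\<lambda>A. {A}) ` \<xi> \<and> length w = n}"
    have W: "finite W" unfolding W_def using xi by (intro finite_lists_length_eq) auto
    have range: "itin lab n ` space \<mu> \<subseteq> W"
    proof
      fix w assume "w \<in> itin lab n ` space \<mu>"
      then obtain x where x: "x \<in> shift_space M" "w = itin lab n x" by auto
      have "lab ((shift ^^ i) x) \<in> (\<lambda>A. {A}) ` \<xi>" for i
        using cover[of "(shift ^^ i) x"] funpow_shift_in[OF x(1)] by auto
      then show "w \<in> W" using x(2) by (auto simp: W_def itin_def)
    qed
    have cell: "space \<mu> \<inter> (\<Inter>i<n. (shift ^^ i) -` B i) = fiber (itin lab n) (map (\<lambda>i. {B i}) [0..<n])"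
      if B: "\<forall>i<n. B i \<in> \<xi>" for B
      using B lab_eq by (auto simp: fiber_def itin_def)
    have join: "iterated_join \<mu> shift \<xi> n = fiber (itin lab n) ` W"
    proof (intro equalityI subsetI)
      fix A assume "A \<in> iterated_join \<mu> shift \<xi> n"
      then obtain B where B: "\<forall>i<n. B i \<in> \<xi>" "A = space \<mu> \<inter> (\<Inter>i<n. (shift ^^ i) -` B i)"
        unfolding iterated_join_def by blast
      have "map (\<lambda>i. {B i}) [0..<n] \<in> W" using B(1) by (auto simp: W_def)
      then show "A \<in> fiber (itin lab n) ` W" using cell[OF B(1)] B(2) by blast
    next
      fix A assume "A \<in> fiber (itin lab n) ` W"
      then obtain w where w: "w \<in> W" "A = fiber (itin lab n) w" by blast
      define B where "B i = the_elem (w ! i)" for i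
      have wB: "w ! i = {B i} \<and> B i \<in> \<xi>" if "i < n" for i
      proof -
        have "w ! i \<in> (\<lambda>A. {A}) ` \<xi>" using w(1) that nth_mem[of i w] unfolding W_def by blast
        then show ?thesis by (auto simp: B_def)
      qed
      then have "w = map (\<lambda>i. {B i}) [0..<n]" using w(1) by (auto simp: W_def intro!: nth_equalityI)
      then have "A = space \<mu> \<inter> (\<Inter>i<n. (shift ^^ i) -` B i)"
        using cell[of B] wB w(2) by simp
      then show "A \<in> iterated_join \<mu> shift \<xi> n"
        using wB unfolding iterated_join_def by (intro CollectI exI[of _ B] conjI) auto
    qed
    define \<eta> where "\<eta> A = - (prob A * ln (prob A))" for A
    have "partition_entropy \<mu> (iterated_join \<mu> shift \<xi> n) = sum \<eta> (fiber (itin lab n) ` W)"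
      unfolding partition_entropy_def join \<eta>_def sum_negf ..
    also have "\<dots> = sum (\<eta> \<circ> fiber (itin lab n)) W"
    proof (rule sum.reindex_nontrivial[OF W])
      fix u w assume "u \<noteq> w" "fiber (itin lab n) u = fiber (itin lab n) w"
      then have "fiber (itin lab n) u = {}" by (auto simp: fiber_def)
      then show "\<eta> (fiber (itin lab n) u) = 0" by (simp add: \<eta>_def)
    qed
    also have "\<dots> = (\<Sum>w\<in>W. - (prob (fiber (itin lab n) w) * ln (prob (fiber (itin lab n) w))))"
      by (simp add: \<eta>_def)
    also have "\<dots> = ent (itin lab n)" using ent_superset[OF W range] by simp
    finally show ?thesis .
  qed
  then show "entropy_wrt_partition \<mu> shift \<xi> = hent lab"
    by (simp add: entropy_wrt_partition_def hent_def)
qed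

text \<open>A generator theorem of Kolmogorov-Sinai type: one inequality is the preceding
  approximation of arbitrary finite partitions, the other holds because each truncation is itself a
  finite partition.\<close>

lemma ks_entropy_eq: "ks_entropy \<mu> shift = (SUP N. ereal (hent (first_letter N)))"
proof (rule antisym)
  show "ks_entropy \<mu> shift \<le> (SUP N. ereal (hent (first_letter N)))"
    unfolding ks_entropy_def
  proof (rule SUP_least)
    fix \<xi> assume "\<xi> \<in> {\<xi>. finite \<xi> \<and> \<xi> \<subseteq> sets \<mu> \<and> partition_on (space \<mu>) \<xi>}"
    then have xi: "finite \<xi>" "\<xi> \<subseteq> sets \<mu>" "partition_on (space \<mu>) \<xi>" by auto
    note lab = entropy_wrt_partition_eq[OF xi]
    show "ereal (entropy_wrt_partition \<mu> shift \<xi>) \<le> (SUP N. ereal (hent (first_letter N)))"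
    proof (rule ereal_le_epsilon2)
      fix e :: real assume "e > 0"
      then obtain N where "hent (\<lambda>x. {A\<in>\<xi>. x \<in> A}) \<le> hent (first_letter N) + e"
        using hent_le_first_letter[OF lab(1)] by blast
      then have "ereal (entropy_wrt_partition \<mu> shift \<xi>) \<le> ereal (hent (first_letter N)) + ereal e"
        by (simp add: lab(2))
      also have "\<dots> \<le> (SUP N. ereal (hent (first_letter N))) + ereal e"
        by (intro add_right_mono SUP_upper) auto
      finally show "ereal (entropy_wrt_partition \<mu> shift \<xi>) \<le> (SUP N. ereal (hent (first_letter N))) + ereal e" .
    qed
  qed
  show "(SUP N. ereal (hent (first_letter N))) \<le> ks_entropy \<mu> shift"
  proof (rule SUP_least)
    fix N
    let ?X = "first_letter N"
    define \<xi> where "\<xi> = fiber ?X ` (?X ` shift_space M)"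
    note sX = simple_first_letter[of N]
    have xi: "finite \<xi>" "\<xi> \<subseteq> sets \<mu>" "partition_on (space \<mu>) \<xi>"
    proof -
      show "finite \<xi>" unfolding \<xi>_def using finite_range[OF sX] by simp
      show "\<xi> \<subseteq> sets \<mu>" unfolding \<xi>_def using fiber_events[OF sX] by auto
      show "partition_on (space \<mu>) \<xi>"
        by (rule partition_onI) (auto simp: \<xi>_def fiber_def disjnt_def)
    qed
    note lab = entropy_wrt_partition_eq[OF xi]
    have "hent ?X \<le> hent (\<lambda>x. {A\<in>\<xi>. x \<in> A})"
    proof (rule hent_mono[OF lab(1) sX])
      fix x y assume xy: "x \<in> shift_space M" "y \<in> shift_space M" "{A\<in>\<xi>. x \<in> A} = {A\<in>\<xi>. y \<in> A}"
      have "fiber ?X (?X x) \<in> {A\<in>\<xi>. x \<in> A}" using xy(1) by (auto simp: \<xi>_def fiber_def)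
      then have "y \<in> fiber ?X (?X x)" unfolding xy(3) by simp
      then show "?X x = ?X y" by (simp add: fiber_def)
    qed
    then have "ereal (hent ?X) \<le> ereal (entropy_wrt_partition \<mu> shift \<xi>)" by (simp add: lab(2))
    also have "\<dots> \<le> ks_entropy \<mu> shift" unfolding ks_entropy_def using xi by (intro SUP_upper) auto
    finally show "ereal (hent ?X) \<le> ks_entropy \<mu> shift" .
  qed
qed

end

section \<open>The variational inequality\<close>

lemma extended_integral_integrable:
  assumes "integrable \<mu> g" shows "extended_integral \<mu> g = ereal (integral\<^sup>L \<mu> g)"
proof -
  have fin: "(\<integral>\<^sup>+x. ennreal (g x) \<partial>\<mu>) \<noteq> \<infinity>" "(\<integral>\<^sup>+x. ennreal (- g x) \<partial>\<mu>) \<noteq> \<infinity>"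
    using assms unfolding real_integrable_def by auto
  then obtain a b where ab: "(\<integral>\<^sup>+x. ennreal (g x) \<partial>\<mu>) = ennreal a" "(\<integral>\<^sup>+x. ennreal (- g x) \<partial>\<mu>) = ennreal b"
    "0 \<le> a" "0 \<le> b"
    by (metis ennreal_cases infinity_ennreal_def)
  then show ?thesis
    unfolding extended_integral_def real_lebesgue_integral_def[OF assms] by (simp add: enn2ereal_ennreal)
qed

text \<open>The upper bound keeps the positive part finite, so integrability can only fail through
  the negative part.\<close>

lemma extended_integral_not_integrable:
  assumes "finite_measure \<mu>" "g \<in> borel_measurable \<mu>" "\<And>x. x \<in> space \<mu> \<Longrightarrow> g x \<le> B" "\<not> integrable \<mu> g"
  shows "extended_integral \<mu> g = - \<infinity>"
proof -
  interpret finite_measure \<mu> by fact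
  have "(\<integral>\<^sup>+x. ennreal (g x) \<partial>\<mu>) \<le> (\<integral>\<^sup>+x. ennreal B \<partial>\<mu>)"
    using assms(3) by (intro nn_integral_mono ennreal_leI) auto
  also have "\<dots> < \<infinity>" by (simp add: ennreal_mult_less_top emeasure_eq_measure)
  finally have fin: "(\<integral>\<^sup>+x. ennreal (g x) \<partial>\<mu>) \<noteq> \<infinity>" by simp
  then have inf: "(\<integral>\<^sup>+x. ennreal (- g x) \<partial>\<mu>) = \<infinity>"
    using assms(2,4) unfolding real_integrable_def by auto
  obtain a where "(\<integral>\<^sup>+x. ennreal (g x) \<partial>\<mu>) = ennreal a" "0 \<le> a"
    using fin by (metis ennreal_cases infinity_ennreal_def)
  then show ?thesis unfolding extended_integral_def inf by (simp add: enn2ereal_ennreal)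
qed

context potential
begin

lemma f1_bounded: "\<exists>B\<ge>0. \<forall>x\<in>shift_space M. f 1 x \<le> B"
proof -
  define d where "d = (\<Sum>i. exp (phi [i]))"
  have le: "exp (phi [i]) \<le> d" for i
    unfolding d_def using sum_le_suminf[OF summable_letters, of "{i}"] by simp
  have "f 1 x \<le> \<bar>C\<bar> + \<bar>ln d\<bar>" if x: "x \<in> shift_space M" for x
  proof -
    have "\<bar>f 1 x - phi (initial 1 x)\<bar> \<le> C" using f_phi_initial[OF x] by simp
    moreover have "initial 1 x = [x 0]" by (simp add: initial_def)
    moreover have "ln (exp (phi [x 0])) \<le> ln d" by (intro ln_mono le) auto
    ultimately show ?thesis by auto
  qed
  then show ?thesis by (intro exI[of _ "\<bar>C\<bar> + \<bar>ln d\<bar>"]) auto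
qed

text \<open>Comparison with the Birkhoff sum of \<open>f 1\<close>; an error linear in
  \<open>n\<close> is good enough for questions of boundedness and integrability at a fixed
  \<open>n\<close>.\<close>

lemma f_sum_bounds:
  assumes "x \<in> shift_space M" "n \<ge> 1"
  shows "\<bar>f n x - (\<Sum>i<n. f 1 ((shift ^^ i) x))\<bar> \<le> real n * C"
  using assms(2)
proof (induction n rule: nat_induct_at_least)
  case base
  then show ?case using C_nonneg by simp
next
  case (Suc n)
  have "f n x + f 1 ((shift ^^ n) x) - C \<le> f (n + 1) x" "f (n + 1) x \<le> f n x + f 1 ((shift ^^ n) x) + C"
    using upper_add[of n 1 x] lower_add[of n 1 x] Suc assms by auto
  then show ?case using Suc.IH by (auto simp: abs_le_iff algebra_simps)
qed

lemma measurable_f [measurable]: "n \<ge> 1 \<Longrightarrow> f n \<in> borel_measurable (shift_borel M)"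
  using continuous unfolding continuous_potential_def by (intro measurable_continuous_map) auto

lemma weight_le_total: "weight w \<le> total (length w)"
proof -
  have "weight w = wsum (set w) (length w) (\<lambda>u. u = w)" using wsum_singleton[of w "set w"] by simp
  also have "\<dots> \<le> wsum (set w) (length w) (\<lambda>_. True)" by (rule wsum_mono) auto
  also have "\<dots> \<le> total (length w)" unfolding total_def by (intro wsum_le_ssum) auto
  finally show ?thesis .
qed

lemma sum_weight_le_total: "finite A \<Longrightarrow> S \<subseteq> words A n \<Longrightarrow> (\<Sum>w\<in>S. weight w) \<le> total n"
proof -
  assume A: "finite A" "S \<subseteq> words A n"
  then have "(\<Sum>w\<in>S. weight w) \<le> (\<Sum>w\<in>words A n. weight w)" by (intro sum_mono2) auto
  also have "\<dots> = wsum A n (\<lambda>_. True)" by (simp add: wsum_def)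
  also have "\<dots> \<le> total n" unfolding total_def using A by (intro wsum_le_ssum)
  finally show ?thesis .
qed

end

section \<open>Means of the potential\<close>

locale potential_measure = potential M f C + invariant_measure M \<mu> for M f C \<mu>
begin

lemma integrable_funpow:
  fixes g :: "(nat \<Rightarrow> nat) \<Rightarrow> real"
  assumes "integrable \<mu> g" "g \<in> borel_measurable (shift_borel M)"
  shows "integrable \<mu> (\<lambda>x. g ((shift ^^ n) x))"
    and "(\<integral>x. g ((shift ^^ n) x) \<partial>\<mu>) = (\<integral>x. g x \<partial>\<mu>)"
proof -
  have m: "shift ^^ n \<in> measurable \<mu> (shift_borel M)"
    by (simp add: measurable_cong_sets[OF sets_eq refl])
  show "integrable \<mu> (\<lambda>x. g ((shift ^^ n) x))"
    using integrable_distr[OF m, of g] assms(1) by (simp add: distr_funpow_shift)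
  show "(\<integral>x. g ((shift ^^ n) x) \<partial>\<mu>) = (\<integral>x. g x \<partial>\<mu>)"
    using integral_distr[OF m assms(2)] by (simp add: distr_funpow_shift)
qed

lemma integrable_f:
  assumes "integrable \<mu> (f 1)" "n \<ge> 1" shows "integrable \<mu> (f n)"
proof (rule Bochner_Integration.integrable_bound)
  show "integrable \<mu> (\<lambda>x. (\<Sum>i<n. \<bar>f 1 ((shift ^^ i) x)\<bar>) + real n * C)"
    using integrable_funpow(1)[OF assms(1) measurable_f]
    by (intro Bochner_Integration.integrable_add Bochner_Integration.integrable_sum integrable_abs) auto
  show "AE x in \<mu>. norm (f n x) \<le> norm ((\<Sum>i<n. \<bar>f 1 ((shift ^^ i) x)\<bar>) + real n * C)"
  proof (rule AE_I2)
    fix x assume "x \<in> space \<mu>"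
    then have "\<bar>f n x - (\<Sum>i<n. f 1 ((shift ^^ i) x))\<bar> \<le> real n * C" using f_sum_bounds assms by simp
    moreover have "\<bar>\<Sum>i<n. f 1 ((shift ^^ i) x)\<bar> \<le> (\<Sum>i<n. \<bar>f 1 ((shift ^^ i) x)\<bar>)" by (rule sum_abs)
    ultimately have "\<bar>f n x\<bar> \<le> (\<Sum>i<n. \<bar>f 1 ((shift ^^ i) x)\<bar>) + real n * C" by linarith
    then show "norm (f n x) \<le> norm ((\<Sum>i<n. \<bar>f 1 ((shift ^^ i) x)\<bar>) + real n * C)"
      unfolding real_norm_def by (rule order_trans[OF _ abs_ge_self])
  qed
qed (use assms in auto)

text \<open>As \<open>f 1\<close> is bounded above, all summands of the Birkhoff sum but the first
  can be replaced by a constant. So \<open>f n\<close> is at most \<open>f 1\<close> plus a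
  constant, and an integrable \<open>f n\<close> would bound \<open>f 1\<close> from below.\<close>

lemma not_integrable_f:
  assumes "\<not> integrable \<mu> (f 1)" "n \<ge> 1" shows "\<not> integrable \<mu> (f n)"
proof
  assume int: "integrable \<mu> (f n)"
  obtain B where B: "B \<ge> 0" "\<And>x. x \<in> shift_space M \<Longrightarrow> f 1 x \<le> B" using f1_bounded by blast
  have "integrable \<mu> (f 1)"
  proof (rule Bochner_Integration.integrable_bound)
    show "integrable \<mu> (\<lambda>x. \<bar>f n x\<bar> + real n * (B + C))"
      using int by (intro Bochner_Integration.integrable_add integrable_abs) auto
    show "AE x in \<mu>. norm (f 1 x) \<le> norm (\<bar>f n x\<bar> + real n * (B + C))"
    proof (rule AE_I2)
      fix x assume "x \<in> space \<mu>"
      then have x: "x \<in> shift_space M" by simp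
      have "(\<Sum>i<n. f 1 ((shift ^^ i) x)) = f 1 x + (\<Sum>i\<in>{1..<n}. f 1 ((shift ^^ i) x))"
        using assms(2) sum.atLeast_Suc_lessThan[of 0 n "\<lambda>i. f 1 ((shift ^^ i) x)"]
        by (simp add: lessThan_atLeast0)
      also have "\<dots> \<le> f 1 x + (\<Sum>i\<in>{1..<n}. B)"
        using B x by (intro add_left_mono sum_mono B funpow_shift_in)
      also have "\<dots> = f 1 x + (real n - 1) * B" using assms(2) by (simp add: of_nat_diff)
      finally have "f n x \<le> f 1 x + (real n - 1) * B + real n * C"
        using f_sum_bounds[OF x assms(2)] by (simp add: abs_le_iff)
      moreover have "f 1 x \<le> B" "B \<le> real n * B" "0 \<le> real n * C"
        using B x assms(2) C_nonneg mult_right_mono[of 1 "real n" B] by auto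
      ultimately have "\<bar>f 1 x\<bar> \<le> \<bar>f n x\<bar> + real n * (B + C)"
        using B(1) by (auto simp: algebra_simps abs_if)
      then show "norm (f 1 x) \<le> norm (\<bar>f n x\<bar> + real n * (B + C))" by simp
    qed
  qed auto
  with assms show False by simp
qed

lemma integral_f_add:
  assumes "integrable \<mu> (f 1)" "n \<ge> 1" "m \<ge> 1"
  shows "\<bar>(\<integral>x. f (n + m) x \<partial>\<mu>) - (\<integral>x. f n x \<partial>\<mu>) - (\<integral>x. f m x \<partial>\<mu>)\<bar> \<le> C"
proof -
  note int = integrable_f[OF assms(1)]
  note im = integrable_funpow[OF int[OF assms(3)] measurable_f[OF assms(3)], of n]
  have eq: "(\<integral>x. f (n + m) x \<partial>\<mu>) - (\<integral>x. f n x \<partial>\<mu>) - (\<integral>x. f m x \<partial>\<mu>)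
      = (\<integral>x. f (n + m) x - f n x - f m ((shift ^^ n) x) \<partial>\<mu>)"
    using int[of "n + m"] int[OF assms(2)] im assms by simp
  have "\<bar>\<integral>x. f (n + m) x - f n x - f m ((shift ^^ n) x) \<partial>\<mu>\<bar> \<le> (\<integral>x. C \<partial>\<mu>)"
  proof (rule order_trans[OF integral_abs_bound integral_mono])
    fix x assume "x \<in> space \<mu>"
    then show "\<bar>f (n + m) x - f n x - f m ((shift ^^ n) x)\<bar> \<le> C"
      using upper_add[of n m x] lower_add[of n m x] assms by (simp add: abs_le_iff)
  qed (use int[of "n + m"] int[OF assms(2)] im assms in auto)
  then show ?thesis unfolding eq using prob_space by simp
qed

definition mean :: real where
  "mean = lim (\<lambda>n. (\<integral>x. f n x \<partial>\<mu>) / real n)"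

text \<open>The integrals are almost additive, so adding \<open>C\<close> makes them subadditive.
  Comparing \<open>n\<close> with its multiples \<open>n * k\<close> as \<open>k\<close> tends to
  infinity bounds the deviation from linearity by \<open>C\<close> for every
  \<open>n\<close>.\<close>

lemma mean_properties:
  assumes "integrable \<mu> (f 1)"
  shows "(\<lambda>n. (\<integral>x. f n x \<partial>\<mu>) / real n) \<longlonglongrightarrow> mean"
    and "n \<ge> 1 \<Longrightarrow> \<bar>(\<integral>x. f n x \<partial>\<mu>) - real n * mean\<bar> \<le> C"
    and "potential_mean f \<mu> = ereal mean"
proof -
  define I where "I n = (\<integral>x. f n x \<partial>\<mu>)" for n
  have add: "\<bar>I (n + m) - I n - I m\<bar> \<le> C" if "n \<ge> 1" "m \<ge> 1" for n m
    unfolding I_def using integral_f_add[OF assms that] .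
  have mult: "\<bar>I (n * k) - real k * I n\<bar> \<le> real k * C" if "n \<ge> 1" "k \<ge> 1" for n k
    using that(2)
  proof (induction k rule: nat_induct_at_least)
    case base
    then show ?case using C_nonneg by simp
  next
    case (Suc k)
    have "\<bar>I (n + n * k) - I n - I (n * k)\<bar> \<le> C" using add[of n "n * k"] that Suc by simp
    then show ?case using Suc.IH by (auto simp: abs_le_iff algebra_simps)
  qed
  have "(\<lambda>n. (I n + C) / real n) \<longlonglongrightarrow> (INF n\<in>{1..}. (I n + C) / real n)"
  proof (rule fekete[where c = "I 1 - C"])
    fix m n :: nat assume "m \<ge> 1" "n \<ge> 1"
    then show "I (m + n) + C \<le> I m + C + (I n + C)" using add[of m n] by (simp add: abs_le_iff)
  next
    fix n :: nat assume "n \<ge> 1"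
    then show "(I 1 - C) * real n \<le> I n + C" using mult[of 1 n] C_nonneg by (simp add: abs_le_iff algebra_simps)
  qed
  moreover have "(\<lambda>n. C / real n) \<longlonglongrightarrow> 0" by (rule lim_const_over_n)
  ultimately have "(\<lambda>n. (I n + C) / real n - C / real n) \<longlonglongrightarrow> (INF n\<in>{1..}. (I n + C) / real n) - 0"
    by (rule tendsto_diff)
  then have "(\<lambda>n. I n / real n) \<longlonglongrightarrow> (INF n\<in>{1..}. (I n + C) / real n)"
    by (simp add: add_divide_distrib)
  then show lim: "(\<lambda>n. (\<integral>x. f n x \<partial>\<mu>) / real n) \<longlonglongrightarrow> mean"
    unfolding mean_def I_def[symmetric] by (simp add: limI)
  show "\<bar>(\<integral>x. f n x \<partial>\<mu>) - real n * mean\<bar> \<le> C" if n: "n \<ge> 1"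
  proof -
    have "(\<lambda>k. I (n * k) / real (n * k)) \<longlonglongrightarrow> mean"
      using n by (intro filterlim_compose[OF lim[folded I_def]])
        (auto intro!: filterlim_subseq simp: strict_mono_def)
    then have "(\<lambda>k. \<bar>real n * (I (n * k) / real (n * k)) - I n\<bar>) \<longlonglongrightarrow> \<bar>real n * mean - I n\<bar>"
      by (intro tendsto_intros)
    moreover have "\<forall>\<^sub>F k in sequentially. \<bar>real n * (I (n * k) / real (n * k)) - I n\<bar> \<le> C"
      using eventually_ge_at_top[of 1]
    proof eventually_elim
      case (elim k)
      have "real n * (I (n * k) / real (n * k)) - I n = (I (n * k) - real k * I n) / real k"
        using n elim by (simp add: field_simps)
      also have "\<bar>\<dots>\<bar> = \<bar>I (n * k) - real k * I n\<bar> / real k" by simp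
      also have "\<dots> \<le> real k * C / real k"
        by (rule divide_right_mono[OF mult[OF n elim]]) simp
      finally show ?case using elim by simp
    qed
    ultimately have "\<bar>real n * mean - I n\<bar> \<le> C" by (intro tendsto_upperbound) auto
    then show ?thesis by (simp add: I_def abs_minus_commute)
  qed
  have "(\<lambda>n. ereal (I n / real n)) \<longlonglongrightarrow> ereal mean" using lim by (simp add: I_def)
  moreover have "\<forall>\<^sub>F n in sequentially. ereal (I n / real n) = extended_integral \<mu> (f n) / ereal (real n)"
    using eventually_ge_at_top[of 1]
    by eventually_elim (simp add: extended_integral_integrable[OF integrable_f[OF assms]] I_def)
  ultimately have "(\<lambda>n. extended_integral \<mu> (f n) / ereal (real n)) \<longlonglongrightarrow> ereal mean"
    by (rule Lim_transform_eventually)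
  then show "potential_mean f \<mu> = ereal mean" unfolding potential_mean_def by (rule limI)
qed

lemma f_bounded_above: "n \<ge> 1 \<Longrightarrow> \<exists>B. \<forall>x\<in>shift_space M. f n x \<le> B"
proof -
  assume n: "n \<ge> 1"
  obtain B where B: "B \<ge> 0" "\<And>x. x \<in> shift_space M \<Longrightarrow> f 1 x \<le> B" using f1_bounded by blast
  have "f n x \<le> real n * B + real n * C" if x: "x \<in> shift_space M" for x
  proof -
    have "(\<Sum>i<n. f 1 ((shift ^^ i) x)) \<le> (\<Sum>i<n. B)" using x by (intro sum_mono B funpow_shift_in)
    then show ?thesis using f_sum_bounds[OF x n] by (simp add: abs_le_iff)
  qed
  then show ?thesis by blast
qed

lemma potential_mean_not_integrable:
  assumes "\<not> integrable \<mu> (f 1)" shows "potential_mean f \<mu> = - \<infinity>"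
proof -
  have "\<forall>\<^sub>F n in sequentially. - \<infinity> = extended_integral \<mu> (f n) / ereal (real n)"
    using eventually_ge_at_top[of 1]
  proof eventually_elim
    case (elim n)
    obtain B where B: "\<forall>x\<in>shift_space M. f n x \<le> B" using f_bounded_above[OF elim] by blast
    have "extended_integral \<mu> (f n) = - \<infinity>"
      using not_integrable_f[OF assms elim] B elim
      by (intro extended_integral_not_integrable[where B = B]) (auto intro: finite_measure_axioms)
    then show ?case using elim by simp
  qed
  then have "(\<lambda>n. extended_integral \<mu> (f n) / ereal (real n)) \<longlonglongrightarrow> - \<infinity>"
    by (rule Lim_transform_eventually[OF tendsto_const])
  then show ?thesis unfolding potential_mean_def by (rule limI)
qed

lemma measurable_of_initial [measurable]:
  fixes g :: "nat list \<Rightarrow> real" shows "(\<lambda>x. g (initial n x)) \<in> borel_measurable \<mu>"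
proof -
  have "(\<lambda>x. g (initial n x)) \<in> borel_measurable (shift_borel M)" by measurable
  then show ?thesis by (simp add: measurable_cong_sets[OF sets_eq refl])
qed

lemma integrable_phi_initial:
  assumes "integrable \<mu> (f 1)" "n \<ge> 1"
  shows "integrable \<mu> (\<lambda>x. phi (initial n x))"
    and "\<bar>(\<integral>x. f n x \<partial>\<mu>) - (\<integral>x. phi (initial n x) \<partial>\<mu>)\<bar> \<le> C"
proof -
  note int = integrable_f[OF assms]
  have le: "\<bar>f n x - phi (initial n x)\<bar> \<le> C" if "x \<in> space \<mu>" for x
    using f_phi_initial[of x n] that assms by simp
  show int': "integrable \<mu> (\<lambda>x. phi (initial n x))"
  proof (rule Bochner_Integration.integrable_bound)
    show "integrable \<mu> (\<lambda>x. \<bar>f n x\<bar> + C)" using int by auto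
    show "AE x in \<mu>. norm (phi (initial n x)) \<le> norm (\<bar>f n x\<bar> + C)"
    proof (rule AE_I2)
      fix x assume "x \<in> space \<mu>"
      then have "\<bar>phi (initial n x)\<bar> \<le> \<bar>f n x\<bar> + C" using le[of x] by linarith
      then show "norm (phi (initial n x)) \<le> norm (\<bar>f n x\<bar> + C)"
        unfolding real_norm_def by (rule order_trans[OF _ abs_ge_self])
    qed
  qed simp
  have "\<bar>\<integral>x. f n x - phi (initial n x) \<partial>\<mu>\<bar> \<le> (\<integral>x. C \<partial>\<mu>)"
    by (rule order_trans[OF integral_abs_bound integral_mono]) (use le int int' in auto)
  then show "\<bar>(\<integral>x. f n x \<partial>\<mu>) - (\<integral>x. phi (initial n x) \<partial>\<mu>)\<bar> \<le> C"
    using int int' prob_space by simp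
qed

section \<open>Entropy against weights\<close>

lemma AE_fiber_pos:
  assumes "simple_function \<mu> X" shows "AE x in \<mu>. 0 < prob (fiber X (X x))"
proof (rule AE_I')
  let ?N = "\<Union>v\<in>{v\<in>X ` space \<mu>. prob (fiber X v) = 0}. fiber X v"
  have "prob ?N \<le> (\<Sum>v\<in>{v\<in>X ` space \<mu>. prob (fiber X v) = 0}. prob (fiber X v))"
    using finite_range[OF assms] fiber_events[OF assms] by (intro measure_UNION_le) auto
  also have "\<dots> = 0" by (intro sum.neutral) auto
  finally have "prob ?N = 0" by (simp add: measure_le_0_iff)
  moreover have "?N \<in> events" using finite_range[OF assms] fiber_events[OF assms] by auto
  ultimately show "?N \<in> null_sets \<mu>" by (auto simp: null_sets_def emeasure_eq_measure)
  show "{x \<in> space \<mu>. \<not> 0 < prob (fiber X (X x))} \<subseteq> ?N"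
    by (auto simp: zero_less_measure_iff fiber_def)
qed

text \<open>
  Jensen's inequality for the logarithm, applied separately on a set \<open>S\<close> of words and on its
  complement; the free parameter \<open>c\<close> is what makes a small total weight of \<open>S\<close> count against a large
  measure of \<open>S\<close>.
\<close>

lemma entropy_weight_inequality:
  assumes int: "integrable \<mu> (f 1)" and n: "n \<ge> 1" and A: "finite A" "S \<subseteq> words A n" and c: "c > 0"
  shows "ent (itin (first_letter N) n) + (\<integral>x. f n x \<partial>\<mu>)
    \<le> real n * pressure + C + total n * exp (- (real n * pressure)) + prob (cylinders M S) * (ln c - 1)
      + (\<Sum>w\<in>S. weight w) * exp (- (real n * pressure)) / c"
proof -
  define X where "X = itin (first_letter N) n"
  have X: "simple_function \<mu> X" unfolding X_def by (intro simple_itin simple_first_letter)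
  define P where "P = exp (- (real n * pressure))"
  \<comment> \<open>The measure of the cell of \<open>x\<close>, which contains the cylinder of its
    first \<open>n\<close> letters. Hence \<open>E\<close> is at most the normalised weight divided
    by the measure of this cylinder, and the integral of \<open>E\<close> over the cylinder is at
    most the normalised weight.\<close>
  define D where "D x = prob (fiber X (X x))" for x
  define E where "E x = weight (initial n x) * P / D x" for x
  define \<psi> where "\<psi> x = phi (initial n x) - real n * pressure - ln (D x)" for x
  have P: "P > 0" by (simp add: P_def)
  have finS: "finite S" using A by (metis finite_words finite_subset)
  have D0: "0 \<le> D x" for x by (simp add: D_def)
  have Emeas: "E \<in> borel_measurable \<mu>"
  proof -
    have "simple_function \<mu> D" unfolding D_def[abs_def] by (rule simple_function_compose1[OF X])
    then have [measurable]: "D \<in> borel_measurable \<mu>" by (rule borel_measurable_simple_function)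
    show ?thesis unfolding E_def by measurable
  qed
  have E0: "0 \<le> E x" for x using P D0 by (simp add: E_def)
  \<comment> \<open>Leads to a crude bound on \<open>E\<close>, which gives integrability and makes
    sets of small measure negligible.\<close>
  define Q where "Q = (\<Sum>v\<in>X ` space \<mu>. 1 / prob (fiber X v))"
  define B where "B = total n * P * Q"
  have EB: "E x \<le> B" if "x \<in> space \<mu>" for x
  proof -
    have "1 / D x \<le> Q"
      unfolding D_def Q_def using that finite_range[OF X]
      by (intro member_le_sum[of "X x" _ "\<lambda>v. 1 / prob (fiber X v)"]) auto
    moreover have "weight (initial n x) \<le> total n" using weight_le_total[of "initial n x"] by simp
    ultimately have "weight (initial n x) * P * (1 / D x) \<le> total n * P * Q"
      using P D0 total_pos[of n] by (intro mult_mono) (auto intro: less_imp_le)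
    then show ?thesis by (simp add: E_def B_def)
  qed
  have B0: "0 \<le> B" using EB E0 shift_space_nonempty by (metis ex_in_conv order_trans space_eq)
  have Eint: "integrable \<mu> E"
    by (rule integrable_const_bound[of _ B]) (use EB E0 Emeas in auto)
  have Eint_ind: "integrable \<mu> (\<lambda>x. indicator U x * E x)" if "U \<in> sets (shift_borel M)" for U
    using integrable_real_mult_indicator[OF _ Eint, of U] that by (simp add: sets_eq mult.commute)
  have cyl_le: "(\<integral>x. indicator (cylinder M w) x * E x \<partial>\<mu>) \<le> weight w * P" if w: "length w = n" for w
  proof (cases "prob (cylinder M w) = 0")
    case True
    have "(\<integral>x. indicator (cylinder M w) x * E x \<partial>\<mu>) \<le> (\<integral>x. B * indicator (cylinder M w) x \<partial>\<mu>)"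
      using EB B0 by (intro integral_mono Eint_ind integrable_mult_right integrable_real_indicator)
        (auto simp: emeasure_eq_measure indicator_def)
    also have "\<dots> = B * prob (cylinder M w)" by (simp add: Int_absorb2[OF cylinder_subset])
    also have "\<dots> \<le> weight w * P" using True P by simp
    finally show ?thesis .
  next
    case False
    then have pos: "0 < prob (cylinder M w)" by (simp add: zero_less_measure_iff)
    have "(\<integral>x. indicator (cylinder M w) x * E x \<partial>\<mu>)
        \<le> (\<integral>x. weight w * P / prob (cylinder M w) * indicator (cylinder M w) x \<partial>\<mu>)"
    proof (intro integral_mono Eint_ind integrable_mult_right integrable_real_indicator)
      fix x assume "x \<in> space \<mu>"
      show "indicator (cylinder M w) x * E x \<le> weight w * P / prob (cylinder M w) * indicator (cylinder M w) x"
      proof (cases "x \<in> cylinder M w")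
        case True
        then have x: "initial n x = w" using w by (simp add: cylinder_iff)
        have "cylinder M w \<subseteq> fiber X (X x)"
          using w x by (auto simp: fiber_def X_def itin_first_letter cylinder_iff)
        then have "prob (cylinder M w) \<le> D x"
          unfolding D_def by (intro finite_measure_mono fiber_events X)
        then have "weight w * P / D x \<le> weight w * P / prob (cylinder M w)"
          using pos P by (intro divide_left_mono mult_pos_pos) auto
        then show ?thesis using True x by (simp add: E_def)
      qed simp
    qed (auto simp: emeasure_eq_measure)
    also have "\<dots> = weight w * P" using pos by (simp add: Int_absorb2[OF cylinder_subset])
    finally show ?thesis .
  qed
  have words_le: "(\<integral>x. indicator (cylinders M T) x * E x \<partial>\<mu>) \<le> (\<Sum>w\<in>T. weight w) * P"
    if T: "finite T" "T \<subseteq> words A' n" for T A'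
  proof -
    have ind: "indicator (cylinders M T) x = (\<Sum>w\<in>T. indicator (cylinder M w) x :: real)" for x
    proof (cases "x \<in> shift_space M")
      case True
      have "(\<Sum>w\<in>T. indicator (cylinder M w) x :: real) = (\<Sum>w\<in>T. if w = initial n x then 1 else 0)"
        using T(2) True by (intro sum.cong) (auto simp: words_def cylinder_iff)
      then show ?thesis using T True mem_cylinders_words[OF T(2), of x M] by (auto simp: indicator_def)
    next
      case False
      have "(\<Sum>w\<in>T. indicator (cylinder M w) x :: real) = 0"
        using False by (intro sum.neutral) (auto simp: cylinder_iff)
      then show ?thesis using False cylinders_subset[of M T] by (auto simp: indicator_def)
    qed
    have "(\<integral>x. indicator (cylinders M T) x * E x \<partial>\<mu>) = (\<Sum>w\<in>T. \<integral>x. indicator (cylinder M w) x * E x \<partial>\<mu>)"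
      unfolding ind sum_distrib_right
      by (rule Bochner_Integration.integral_sum) (intro Eint_ind cylinder_sets)
    also have "\<dots> \<le> (\<Sum>w\<in>T. weight w * P)"
      using T by (intro sum_mono cyl_le) (auto simp: words_def)
    finally show ?thesis by (simp add: sum_distrib_right)
  qed
  have E_total: "(\<integral>x. E x \<partial>\<mu>) \<le> total n * P"
  proof (rule field_le_epsilon)
    fix e :: real assume e: "e > 0"
    have "e / (B + 1) > 0" using e B0 by simp
    then obtain N' where N': "prob (shift_space M - bounded_part M n N') < e / (B + 1)"
      using eventually_bounded_part[of "e / (B + 1)" n] by (auto simp: eventually_sequentially)
    let ?U = "bounded_part M n N'"
    have "(\<integral>x. E x \<partial>\<mu>) \<le> (\<integral>x. indicator ?U x * E x + B * indicator (shift_space M - ?U) x \<partial>\<mu>)"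
    proof (intro integral_mono Eint Bochner_Integration.integrable_add Eint_ind integrable_mult_right integrable_real_indicator)
      fix x assume "x \<in> space \<mu>"
      then show "E x \<le> indicator ?U x * E x + B * indicator (shift_space M - ?U) x"
        using EB[of x] by (auto simp: indicator_def)
    qed (auto simp: emeasure_eq_measure sets_eq)
    also have "\<dots> = (\<integral>x. indicator ?U x * E x \<partial>\<mu>) + B * prob (shift_space M - ?U)"
      by (subst Bochner_Integration.integral_add)
        (auto simp: emeasure_eq_measure sets_eq Int_absorb2 intro!: Eint_ind integrable_real_indicator)
    also have "(\<integral>x. indicator ?U x * E x \<partial>\<mu>) \<le> (\<Sum>w\<in>words {..<N'} n. weight w) * P"
      unfolding bounded_part_eq by (intro words_le[of _ "{..<N'}"]) auto
    also have "\<dots> \<le> total n * P"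
      using P sum_weight_le_total[of "{..<N'}" "words {..<N'} n" n] by (intro mult_right_mono) auto
    also have "B * prob (shift_space M - ?U) \<le> B * (e / (B + 1))"
      using N' B0 by (intro mult_left_mono) auto
    also have "\<dots> \<le> e" using B0 e by (simp add: field_simps)
    finally show "(\<integral>x. E x \<partial>\<mu>) \<le> total n * P + e" by simp
  qed
  \<comment> \<open>\<open>ln (E x / c) \<le> E x / c - 1\<close> on the cylinders of
    \<open>S\<close>, and \<open>ln (E x) \<le> E x - 1\<close> elsewhere. As \<open>E\<close> is
    nonnegative, it may be added on \<open>S\<close> as well.\<close>
  have pt: "\<psi> x \<le> indicator (cylinders M S) x * (ln c - 1) + indicator (cylinders M S) x * E x / c + E x"
    if x: "x \<in> space \<mu>" "0 < D x" for x
  proof -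
    have "admissible M (initial n x)" using admissible_initial[of x M n] x n by simp
    then have "weight (initial n x) = exp (phi (initial n x))" by (auto simp: weight_def)
    then have lnE: "ln (E x) = \<psi> x" and Epos: "E x > 0"
      using x(2) P by (simp_all add: E_def \<psi>_def P_def ln_div ln_mult_pos)
    show ?thesis
    proof (cases "x \<in> cylinders M S")
      case True
      have "ln (E x / c) \<le> E x / c - 1" using Epos c by (intro ln_le_minus_one) auto
      then show ?thesis using lnE Epos c True by (simp add: ln_div)
    next
      case False
      have "ln (E x) \<le> E x - 1" using Epos by (intro ln_le_minus_one) auto
      then show ?thesis using lnE False by simp
    qed
  qed
  have lnD: "integrable \<mu> (\<lambda>x. - ln (D x))" "ent X = (\<integral>x. - ln (D x) \<partial>\<mu>)"
    unfolding D_def using ent_eq_integral[OF X] by auto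
  note phi_int = integrable_phi_initial[OF int n]
  have psi_eq: "\<psi> x = (phi (initial n x) + - ln (D x)) - real n * pressure" for x by (simp add: \<psi>_def)
  have psi_int: "integrable \<mu> \<psi>"
    unfolding psi_eq[abs_def] using phi_int lnD by (intro Bochner_Integration.integrable_diff Bochner_Integration.integrable_add) auto
  have psi_val: "(\<integral>x. \<psi> x \<partial>\<mu>) = (\<integral>x. phi (initial n x) \<partial>\<mu>) + ent X - real n * pressure"
  proof -
    have "(\<integral>x. \<psi> x \<partial>\<mu>) = (\<integral>x. phi (initial n x) + - ln (D x) \<partial>\<mu>) - (\<integral>x. real n * pressure \<partial>\<mu>)"
      unfolding psi_eq using phi_int lnD
      by (intro Bochner_Integration.integral_diff Bochner_Integration.integrable_add) auto
    also have "(\<integral>x. phi (initial n x) + - ln (D x) \<partial>\<mu>) = (\<integral>x. phi (initial n x) \<partial>\<mu>) + ent X"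
      unfolding lnD(2) using phi_int lnD(1) by (intro Bochner_Integration.integral_add) auto
    finally show ?thesis using prob_space by simp
  qed
  have "(\<integral>x. \<psi> x \<partial>\<mu>) \<le> (\<integral>x. (indicator (cylinders M S) x * (ln c - 1) + indicator (cylinders M S) x * E x / c) + E x \<partial>\<mu>)"
  proof (rule integral_mono_AE[OF psi_int])
    show "integrable \<mu> (\<lambda>x. (indicator (cylinders M S) x * (ln c - 1) + indicator (cylinders M S) x * E x / c) + E x)"
      using Eint by (intro Bochner_Integration.integrable_add integrable_divide_zero integrable_mult_left integrable_real_indicator Eint_ind)
        (auto simp: emeasure_eq_measure sets_eq)
    show "AE x in \<mu>. \<psi> x \<le> (indicator (cylinders M S) x * (ln c - 1) + indicator (cylinders M S) x * E x / c) + E x"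
      using AE_fiber_pos[OF X] AE_space by eventually_elim (rule pt, auto simp: D_def)
  qed
  also have "(\<integral>x. (indicator (cylinders M S) x * (ln c - 1) + indicator (cylinders M S) x * E x / c) + E x \<partial>\<mu>)
      = prob (cylinders M S) * (ln c - 1) + (\<integral>x. indicator (cylinders M S) x * E x \<partial>\<mu>) / c + (\<integral>x. E x \<partial>\<mu>)"
  proof -
    have i1: "integrable \<mu> (\<lambda>x. indicator (cylinders M S) x * (ln c - 1))"
      by (intro integrable_mult_left integrable_real_indicator) (auto simp: emeasure_eq_measure sets_eq)
    have i2: "integrable \<mu> (\<lambda>x. indicator (cylinders M S) x * E x / c)"
      by (intro integrable_divide_zero Eint_ind) auto
    have "(\<integral>x. indicator (cylinders M S) x * (ln c - 1) \<partial>\<mu>) = prob (cylinders M S) * (ln c - 1)"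
      by (simp add: Int_absorb2[OF cylinders_subset])
    then show ?thesis
      by (subst Bochner_Integration.integral_add[OF Bochner_Integration.integrable_add[OF i1 i2] Eint],
          subst Bochner_Integration.integral_add[OF i1 i2]) simp
  qed
  finally have "(\<integral>x. phi (initial n x) \<partial>\<mu>) + ent X - real n * pressure
      \<le> prob (cylinders M S) * (ln c - 1) + (\<integral>x. indicator (cylinders M S) x * E x \<partial>\<mu>) / c + (\<integral>x. E x \<partial>\<mu>)"
    unfolding psi_val .
  moreover have "(\<integral>x. indicator (cylinders M S) x * E x \<partial>\<mu>) / c \<le> (\<Sum>w\<in>S. weight w) * P / c"
    using c by (intro divide_right_mono words_le[OF finS A(2)]) auto
  ultimately show ?thesis using phi_int(2) E_total unfolding X_def P_def by (simp add: abs_le_iff)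
qed

text \<open>The case of an empty \<open>S\<close>: entropy plus energy of \<open>n\<close> steps
  exceed \<open>n * pressure\<close> by at most a constant, which disappears after division by
  \<open>n\<close>.\<close>

lemma variational_inequality:
  assumes int: "integrable \<mu> (f 1)"
  shows "ks_entropy \<mu> shift \<le> ereal (pressure - mean)"
  unfolding ks_entropy_eq
proof (rule SUP_least)
  fix N
  obtain K where K: "K > 0" "\<And>n. total n \<le> K * exp (real n * pressure)" using total_le by blast
  have le: "hent (first_letter N) \<le> pressure - mean + (2 * C + K) / real n" if n: "n \<ge> 1" for n
  proof -
    have "total n * exp (- (real n * pressure)) \<le> K"
      using K(2)[of n] by (simp add: exp_minus field_simps)
    then have "ent (itin (first_letter N) n) + (\<integral>x. f n x \<partial>\<mu>) \<le> real n * pressure + C + K"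
      using entropy_weight_inequality[OF int n, of "{}" "{}" 1 N] by (simp add: cylinders_def)
    moreover have "real n * hent (first_letter N) \<le> ent (itin (first_letter N) n)"
      by (intro hent_le simple_first_letter n)
    ultimately have "real n * hent (first_letter N) \<le> real n * pressure - real n * mean + (2 * C + K)"
      using mean_properties(2)[OF int n] by (simp add: abs_le_iff)
    then show ?thesis using n by (simp add: field_simps)
  qed
  have "(\<lambda>n. pressure - mean + (2 * C + K) / real n) \<longlonglongrightarrow> pressure - mean + 0"
    by (intro tendsto_intros lim_const_over_n)
  then have "hent (first_letter N) \<le> pressure - mean + 0"
    by (rule LIMSEQ_le_const) (use le in blast)
  then show "ereal (hent (first_letter N)) \<le> ereal (pressure - mean)" by simp
qed

text \<open>The entropy of \<open>n\<close> steps is at least \<open>n\<close> times the rate, and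
  the supremum of the rates over \<open>N\<close> is now \<open>pressure - mean\<close>. So all
  terms linear in \<open>n\<close> cancel, and the error terms alone must be nonnegative for every
  \<open>n\<close>, \<open>S\<close> and \<open>c\<close>.\<close>

lemma equality_weight_inequality:
  assumes int: "integrable \<mu> (f 1)" and eq: "ks_entropy \<mu> shift = ereal (pressure - mean)"
    and n: "n \<ge> 1" and A: "finite A" "S \<subseteq> words A n" and c: "c > 0"
  shows "0 \<le> 2 * C + total n * exp (- (real n * pressure)) + prob (cylinders M S) * (ln c - 1)
      + (\<Sum>w\<in>S. weight w) * exp (- (real n * pressure)) / c"
proof -
  define b where "b = C + total n * exp (- (real n * pressure)) + prob (cylinders M S) * (ln c - 1)
      + (\<Sum>w\<in>S. weight w) * exp (- (real n * pressure)) / c"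
  have "hent (first_letter N) \<le> pressure - mean + (C + b) / real n" for N
  proof -
    have "real n * hent (first_letter N) \<le> ent (itin (first_letter N) n)"
      by (intro hent_le simple_first_letter n)
    also have "\<dots> \<le> real n * pressure + b - (\<integral>x. f n x \<partial>\<mu>)"
      using entropy_weight_inequality[OF int n A c, of N] by (simp add: b_def)
    also have "\<dots> \<le> real n * (pressure - mean) + (C + b)"
      using mean_properties(2)[OF int n] by (simp add: abs_le_iff algebra_simps)
    finally show ?thesis using n by (simp add: field_simps)
  qed
  then have "ks_entropy \<mu> shift \<le> ereal (pressure - mean + (C + b) / real n)"
    unfolding ks_entropy_eq by (intro SUP_least) simp
  then have "0 \<le> (C + b) / real n" unfolding eq by simp
  then have "0 \<le> C + b" using n by (simp add: zero_le_divide_iff)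
  then show ?thesis by (simp add: b_def)
qed

end

section \<open>Existence of a Gibbs measure\<close>

context weighted_words
begin

lemma wsum_mono_admissible:
  assumes "n \<ge> 1" "\<And>w. length w = n \<Longrightarrow> set w \<subseteq> A \<Longrightarrow> admissible M w \<Longrightarrow> Q w \<Longrightarrow> Q' w"
  shows "wsum A n Q \<le> wsum A n Q'"
  unfolding wsum_def
proof (intro sum_mono)
  fix w assume "w \<in> words A n"
  then show "weight w * of_bool (Q w) \<le> weight w * of_bool (Q' w)"
    using assms by (cases "admissible M w") (auto simp: words_def weight_def)
qed

lemma sum_wsum_le:
  assumes "\<And>w. (\<Sum>i\<in>J. of_bool (Q i w)) \<le> (of_bool (Q' w) :: real)"
  shows "(\<Sum>i\<in>J. wsum A n (Q i)) \<le> wsum A n Q'"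
proof -
  have "(\<Sum>i\<in>J. wsum A n (Q i)) = (\<Sum>w\<in>words A n. weight w * (\<Sum>i\<in>J. of_bool (Q i w)))"
    unfolding wsum_def sum_distrib_left by (rule sum.swap)
  also have "\<dots> \<le> wsum A n Q'"
    unfolding wsum_def using assms by (intro sum_mono mult_left_mono) auto
  finally show ?thesis .
qed

text \<open>The point \<open>pick w\<close> is followed instead of the word \<open>w\<close>: it
  continues beyond the end of \<open>w\<close>, so every position \<open>k\<close> makes sense and
  the sums over one more letter on either side are controlled at all positions.\<close>

definition visit :: "nat set \<Rightarrow> nat \<Rightarrow> nat \<Rightarrow> nat list \<Rightarrow> real" where
  "visit A n k u = wsum A n (\<lambda>w. (shift ^^ k) (pick w) \<in> cylinder M u)"

lemma sum_indicator_le: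
  assumes "finite J" "\<And>i. i \<in> J \<Longrightarrow> P i \<Longrightarrow> i = i0 \<and> Q"
  shows "(\<Sum>i\<in>J. of_bool (P i)) \<le> (of_bool Q :: real)"
proof -
  have "(\<Sum>i\<in>J. of_bool (P i)) \<le> (\<Sum>i\<in>J. if i = i0 then of_bool Q else 0 :: real)"
  proof (intro sum_mono)
    fix i assume i: "i \<in> J"
    show "of_bool (P i) \<le> (if i = i0 then of_bool Q else 0 :: real)"
    proof (cases "P i")
      case True
      then have "i = i0" Q using assms(2)[OF i] by blast+
      then show ?thesis by simp
    qed simp
  qed
  also have "\<dots> \<le> of_bool Q" using assms(1) by (simp add: sum.delta)
  finally show ?thesis .
qed

lemma pick_space: "admissible M w \<Longrightarrow> pick w \<in> shift_space M"
  using pick_in cylinder_subset by blast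

lemma pick_nth: "admissible M w \<Longrightarrow> i < length w \<Longrightarrow> pick w i = w ! i"
  using pick_in[of w] by (simp add: cylinder_def)

lemma visit_nonneg: "0 \<le> visit A n k u"
  by (simp add: visit_def)

lemma visit_le_all: "visit A n k u \<le> wsum A n (\<lambda>_. True)"
  unfolding visit_def by (rule wsum_mono) simp

lemma visit_Nil: "n \<ge> 1 \<Longrightarrow> visit A n k [] = wsum A n (\<lambda>_. True)"
  unfolding visit_def
  by (intro antisym wsum_mono_admissible) (auto intro: funpow_shift_in pick_space)

lemma visit_snoc_le: "(\<Sum>i<I. visit A n k (u @ [i])) \<le> visit A n k u"
  unfolding visit_def
proof (rule sum_wsum_le)
  fix w
  show "(\<Sum>i<I. of_bool ((shift ^^ k) (pick w) \<in> cylinder M (u @ [i])))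
      \<le> (of_bool ((shift ^^ k) (pick w) \<in> cylinder M u) :: real)"
    by (rule sum_indicator_le[of _ _ "(shift ^^ k) (pick w) (length u)"])
      (auto simp: cylinder_iff initial_Suc)
qed

lemma visit_Cons_le: "(\<Sum>i<I. visit A n k (i # u)) \<le> visit A n (Suc k) u"
  unfolding visit_def
proof (rule sum_wsum_le)
  fix w
  show "(\<Sum>i<I. of_bool ((shift ^^ k) (pick w) \<in> cylinder M (i # u)))
      \<le> (of_bool ((shift ^^ Suc k) (pick w) \<in> cylinder M u) :: real)"
    by (rule sum_indicator_le[of _ _ "(shift ^^ k) (pick w) 0"])
      (auto simp: cylinder_iff initial_Suc_Cons shift_in)
qed

lemma visit_in_word:
  assumes "admissible M w" "(shift ^^ k) (pick w) \<in> cylinder M u" "k + length u \<le> length w"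
  shows "take (length u) (drop k w) = u"
proof -
  note w = pick_nth[OF assms(1)]
  have u: "pick w (i + k) = u ! i" if "i < length u" for i
    using assms(2) that by (auto simp: cylinder_def funpow_shift)
  show ?thesis
  proof (rule nth_equalityI)
    fix i assume "i < length (take (length u) (drop k w))"
    then have i: "i < length u" "k + i < length w" by auto
    then show "take (length u) (drop k w) ! i = u ! i" using w[of "k + i"] u[of i] by (simp add: add.commute)
  qed (use assms(3) in simp)
qed

text \<open>As long as the position after \<open>u\<close> still belongs to \<open>w\<close>, its
  letter is below \<open>N\<close>, so summing over these letters loses nothing.\<close>

lemma visit_le_snoc:
  assumes "k + length u < n"
  shows "visit {..<N} n k u \<le> (\<Sum>i<N. visit {..<N} n k (u @ [i]))"
proof -
  have "visit {..<N} n k u \<le> (\<Sum>w\<in>words {..<N} n. weight w * (\<Sum>i<N. of_bool ((shift ^^ k) (pick w) \<in> cylinder M (u @ [i]))))"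
    unfolding visit_def wsum_def
  proof (intro sum_mono)
    fix w assume w: "w \<in> words {..<N} n"
    show "weight w * of_bool ((shift ^^ k) (pick w) \<in> cylinder M u)
        \<le> weight w * (\<Sum>i<N. of_bool ((shift ^^ k) (pick w) \<in> cylinder M (u @ [i])))"
    proof (cases "admissible M w \<and> (shift ^^ k) (pick w) \<in> cylinder M u")
      case True
      let ?i = "(shift ^^ k) (pick w) (length u)"
      have "w ! (length u + k) = ?i"
        using pick_nth[of w "length u + k"] True assms w by (simp add: funpow_shift words_def)
      moreover have "w ! (length u + k) \<in> set w"
        using w assms by (intro nth_mem) (auto simp: words_def)
      then have "w ! (length u + k) < N" using w by (auto simp: words_def)
      ultimately have i: "?i < N" by simp
      have "1 = (of_bool ((shift ^^ k) (pick w) \<in> cylinder M (u @ [?i])) :: real)"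
        using True by (simp add: cylinder_iff initial_Suc)
      also have "\<dots> \<le> (\<Sum>i<N. of_bool ((shift ^^ k) (pick w) \<in> cylinder M (u @ [i])))"
        using i by (intro member_le_sum[of ?i "{..<N}" "\<lambda>i. of_bool ((shift ^^ k) (pick w) \<in> cylinder M (u @ [i]))"]) auto
      finally show ?thesis by (intro mult_left_mono) auto
    next
      case False
      then have "weight w = 0 \<or> (shift ^^ k) (pick w) \<notin> cylinder M u"
        using w assms by (auto simp: weight_def words_def)
      then show ?thesis by (auto intro!: mult_nonneg_nonneg sum_nonneg)
    qed
  qed
  also have "\<dots> = (\<Sum>i<N. visit {..<N} n k (u @ [i]))"
    unfolding visit_def wsum_def sum_distrib_left by (rule sum.swap)
  finally show ?thesis .
qed

text \<open>The word is cut before and after the occurrence of \<open>u\<close>: two junctions,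
  hence \<open>exp (2 * D)\<close>.\<close>

lemma visit_le:
  assumes "finite A" "k + length u + m = n" "n \<ge> 1"
  shows "visit A n k u \<le> exp (2 * D) * (total k * weight u * total m)"
proof -
  have "visit A n k u \<le> wsum A (k + (length u + m)) (\<lambda>w. take (length u) (drop k w) = u)"
    unfolding visit_def using assms visit_in_word[of _ k u]
    by (simp add: add.assoc[symmetric]) (rule wsum_mono_admissible, auto)
  also have "\<dots> \<le> exp D * (wsum A k (\<lambda>_. True) * wsum A (length u + m) (\<lambda>w. take (length u) w = u))"
    by (rule wsum_append_le) simp
  finally have 1: "visit A n k u \<le> exp D * (wsum A k (\<lambda>_. True) * wsum A (length u + m) (\<lambda>w. take (length u) w = u))" .
  have 2: "wsum A (length u + m) (\<lambda>w. take (length u) w = u)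
      \<le> exp D * (wsum A (length u) (\<lambda>w. w = u) * wsum A m (\<lambda>_. True))"
    by (rule wsum_append_le) simp
  have 3: "wsum A (length u) (\<lambda>w. w = u) \<le> weight u"
  proof (cases "set u \<subseteq> A")
    case True
    then show ?thesis using wsum_singleton assms by simp
  next
    case False
    then have "wsum A (length u) (\<lambda>w. w = u) = 0"
      unfolding wsum_def by (intro sum.neutral) (auto simp: words_def)
    then show ?thesis by simp
  qed
  have 4: "wsum A j (\<lambda>_. True) \<le> total j" for j
    unfolding total_def by (rule wsum_le_ssum[OF assms(1)])
  have "visit A n k u \<le> exp D * (total k * (exp D * (weight u * total m)))"
    by (rule order_trans[OF 1], intro mult_left_mono mult_mono order_trans[OF 2] 3 4)
      (auto simp: total_def)
  moreover have "exp (2 * D) = exp D * exp D" by (simp flip: exp_add)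
  ultimately show ?thesis by (simp only: mult_ac)
qed

lemma visit_ge:
  assumes A: "finite A" "set u \<subseteq> A" and u: "u \<noteq> []" and n: "k + length u + m = n" "k \<ge> 1" "m \<ge> 1"
    and b: "M b' (hd u) = 1" and c: "M (last u) c' = 1"
  shows "between A b b' k * weight u * between A c' c m \<le> exp (2 * D) * visit A n k u"
proof -
  have "between A b b' k * weight u * between A c' c m
      = (wsum A k (\<lambda>w. hd w = b \<and> last w = b') * wsum A (length u) (\<lambda>w. w = u)) * wsum A m (\<lambda>w. hd w = c' \<and> last w = c)"
    using A by (simp add: wsum_singleton between_def)
  also have "\<dots> \<le> (exp D * wsum A (k + length u) (\<lambda>w. drop k w = u)) * wsum A m (\<lambda>w. hd w = c' \<and> last w = c)"
  proof (intro mult_right_mono wsum_prod_le)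
    fix v w :: "nat list" assume "length v = k" "hd v = b \<and> last v = b'" "w = u"
    then show "(v = [] \<or> w = [] \<or> M (last v) (hd w) = 1) \<and> drop k (v @ w) = u" using b by auto
  qed auto
  also have "\<dots> = exp D * (wsum A (k + length u) (\<lambda>w. drop k w = u) * wsum A m (\<lambda>w. hd w = c' \<and> last w = c))"
    by simp
  also have "\<dots> \<le> exp D * (exp D * wsum A (k + length u + m) (\<lambda>w. take (length u) (drop k w) = u))"
  proof (intro mult_left_mono wsum_prod_le)
    fix v w :: "nat list" assume *: "length v = k + length u" "drop k v = u" "hd w = c' \<and> last w = c"
    then have "last v = last u" using u last_drop[of k v] by auto
    then show "(v = [] \<or> w = [] \<or> M (last v) (hd w) = 1) \<and> take (length u) (drop k (v @ w)) = u"
      using * c by auto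
  qed auto
  also have "wsum A (k + length u + m) (\<lambda>w. take (length u) (drop k w) = u) \<le> visit A n k u"
    unfolding visit_def n(1)
  proof (rule wsum_mono_admissible)
    fix w assume w: "length w = n" "admissible M w" "take (length u) (drop k w) = u"
    have p: "pick w \<in> cylinder M w" using w by (intro pick_in)
    have "(shift ^^ k) (pick w) i = u ! i" if "i < length u" for i
    proof -
      have "(shift ^^ k) (pick w) i = w ! (i + k)"
        using pick_nth[OF w(2), of "i + k"] that w(1) n by (simp add: funpow_shift)
      also have "\<dots> = take (length u) (drop k w) ! i" using that w(1) n by (simp add: add.commute)
      finally show ?thesis using w(3) by simp
    qed
    then show "(shift ^^ k) (pick w) \<in> cylinder M u"
      using p funpow_shift_in[of "pick w" M k] by (auto simp: cylinder_def)
  qed (use n in auto)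
  finally show ?thesis by (simp add: mult_exp_exp flip: mult.assoc)
qed

text \<open>The alphabet in \<open>between_ge\<close> depends on the length and the end letters.
  Here one alphabet for each \<open>n\<close> serves all lengths and end letters up to
  \<open>n\<close>; as it contains all letters below \<open>n\<close>, it eventually covers every
  fixed word.\<close>

lemma ex_large_alphabets:
  "\<exists>N c0 n0. (\<forall>n. n \<le> N n) \<and> (\<forall>b c. c0 b c > 0) \<and>
    (\<forall>n k b c. k \<le> n \<longrightarrow> b \<le> n \<longrightarrow> c \<le> n \<longrightarrow> n0 b c \<le> k \<longrightarrow>
      c0 b c * exp (real k * pressure) \<le> between {..<N n} b c k)"
proof -
  have "\<forall>b c. \<exists>c0 n0. c0 > 0 \<and> (\<forall>n\<ge>n0. \<exists>N0. \<forall>N\<ge>N0. c0 * exp (real n * pressure) \<le> between {..<N} b c n)"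
    using between_ge by blast
  then obtain c0 n0 where c0: "\<And>b c. c0 b c > 0"
    "\<And>b c n. n \<ge> n0 b c \<Longrightarrow> \<exists>N0. \<forall>N\<ge>N0. c0 b c * exp (real n * pressure) \<le> between {..<N} b c n"
    by metis
  then have "\<forall>b c n. \<exists>N0. n \<ge> n0 b c \<longrightarrow> (\<forall>N\<ge>N0. c0 b c * exp (real n * pressure) \<le> between {..<N} b c n)"
    by blast
  then obtain N0 where N0: "\<And>b c n N. n \<ge> n0 b c \<Longrightarrow> N \<ge> N0 b c n \<Longrightarrow> c0 b c * exp (real n * pressure) \<le> between {..<N} b c n"
    by metis
  define N where "N n = n + (\<Sum>p\<in>{..n} \<times> {..n} \<times> {..n}. N0 (fst p) (fst (snd p)) (snd (snd p)))" for n
  have "N0 b c k \<le> N n" if "k \<le> n" "b \<le> n" "c \<le> n" for n k b c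
  proof -
    have "N0 (fst (b, c, k)) (fst (snd (b, c, k))) (snd (snd (b, c, k)))
        \<le> (\<Sum>p\<in>{..n} \<times> {..n} \<times> {..n}. N0 (fst p) (fst (snd p)) (snd (snd p)))"
      using that by (intro member_le_sum) auto
    then show ?thesis by (simp add: N_def)
  qed
  then show ?thesis using c0(1) N0
    by (intro exI[of _ N] exI[of _ c0] exI[of _ n0]) (auto simp: N_def)
qed

text \<open>
  Put the normalised weights on the words of length \<open>n\<close> over a large finite alphabet and average the
  distributions of the subwords over all positions. The averages are almost invariant, tight by
  summability, and satisfy the Gibbs bounds up to boundary effects of order \<open>1 / n\<close>.
\<close>

lemma gibbs_measure_exists:
  "\<exists>\<nu>. invariant_measure M \<nu> \<and>
    (\<exists>K>0. \<forall>u. measure \<nu> (cylinder M u) \<le> K * weight u * exp (- (real (length u) * pressure))) \<and>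
    (\<forall>b c. \<exists>k>0. \<forall>u. u \<noteq> [] \<longrightarrow> hd u = b \<longrightarrow> last u = c \<longrightarrow>
      k * weight u * exp (- (real (length u) * pressure)) \<le> measure \<nu> (cylinder M u))"
proof -
  obtain N c0 n0 where N: "\<And>n. n \<le> N n" and c0: "\<And>b c. c0 b c > (0::real)"
    and btw: "\<And>n k b c. k \<le> n \<Longrightarrow> b \<le> n \<Longrightarrow> c \<le> n \<Longrightarrow> n0 b c \<le> k \<Longrightarrow>
      c0 b c * exp (real k * pressure) \<le> between {..<N n} b c k"
    using ex_large_alphabets by metis
  obtain K where K: "K > 0" "\<And>n. total n \<le> K * exp (real n * pressure)" using total_le by blast
  define n1 where "n1 = max 1 (n0 0 0)"
  define L where "L n = wsum {..<N n} n (\<lambda>_. True)" for n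
  \<comment> \<open>The letter 0 is an arbitrary reference point: the words from 0 to 0 already give
    the normalisation \<open>L\<close> its full exponential order.\<close>
  define c1 where "c1 = c0 0 0"
  have c1: "c1 > 0" using c0 by (simp add: c1_def)
  have L_ge: "c1 * exp (real n * pressure) \<le> L n" if "n \<ge> n1" for n
  proof -
    have "c1 * exp (real n * pressure) \<le> between {..<N n} 0 0 n"
      unfolding c1_def using that by (intro btw) (auto simp: n1_def)
    also have "\<dots> \<le> L n" unfolding between_def L_def by (rule wsum_mono) simp
    finally show ?thesis .
  qed
  have L_pos: "L n > 0" if "n \<ge> n1" for n
    by (rule less_le_trans[OF _ L_ge[OF that]]) (use c1 in simp)
  have L_le: "L n \<le> K * exp (real n * pressure)" for n
    using K(2)[of n] wsum_le_ssum[of "{..<N n}" n "\<lambda>_. True"] by (simp add: L_def total_def)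
  define q where "q n k u = visit {..<N n} n k u / L n" for n k u
  have q0: "0 \<le> q n k u" if "n \<ge> n1" for n k u
    unfolding q_def using visit_nonneg L_pos[OF that] by (intro divide_nonneg_nonneg) auto
  have q1: "q n k u \<le> 1" if "n \<ge> n1" for n k u
    using visit_le_all[of "{..<N n}" n k u] L_pos[OF that] by (simp add: q_def L_def)
  have q_Nil: "q n k [] = 1" if "n \<ge> n1" for n k
    using visit_Nil[of n "{..<N n}" k] L_pos[OF that] that by (simp add: q_def L_def n1_def)
  have q_snoc: "(\<Sum>i<I. q n k (u @ [i])) \<le> q n k u" if "n \<ge> n1" for I n k u
    unfolding q_def sum_divide_distrib[symmetric]
    using L_pos[OF that] by (intro divide_right_mono visit_snoc_le) auto
  have q_Cons: "(\<Sum>i<I. q n k (i # u)) \<le> q n (Suc k) u" if "n \<ge> n1" for I n k u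
    unfolding q_def sum_divide_distrib[symmetric]
    using L_pos[OF that] by (intro divide_right_mono visit_Cons_le) auto
  define K2 where "K2 = exp (2 * D) * K * K / c1"
  have K2: "K2 > 0" using K c1 by (simp add: K2_def)
  have q_upper: "q n k u \<le> K2 * weight u * exp (- (real (length u) * pressure))"
    if n: "n \<ge> n1" and kn: "k + length u \<le> n" for n k u
  proof -
    obtain m where m: "k + length u + m = n" using le_Suc_ex[OF kn] by auto
    have "visit {..<N n} n k u \<le> exp (2 * D) * (total k * weight u * total m)"
      using n by (intro visit_le[OF _ m]) (auto simp: n1_def)
    also have "\<dots> \<le> exp (2 * D) * (K * exp (real k * pressure) * weight u * (K * exp (real m * pressure)))"
      using K total_pos by (intro mult_left_mono mult_mono mult_right_mono mult_nonneg_nonneg) (auto intro: less_imp_le)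
    also have "\<dots> = (K2 * weight u * exp (- (real (length u) * pressure))) * (c1 * exp (real n * pressure))"
    proof -
      have "real n * pressure = real k * pressure + real (length u) * pressure + real m * pressure"
        by (simp add: m[symmetric] algebra_simps)
      then have "exp (real k * pressure) * exp (real m * pressure) = exp (- (real (length u) * pressure)) * exp (real n * pressure)"
        by (simp flip: exp_add)
      then show ?thesis using c1 by (simp add: K2_def mult_ac)
    qed
    also have "\<dots> \<le> (K2 * weight u * exp (- (real (length u) * pressure))) * L n"
      using K2 by (intro mult_left_mono L_ge n) auto
    finally show ?thesis using L_pos[OF n] by (simp add: q_def field_simps)
  qed
  have q_lower: "\<exists>c3>0. \<exists>k0 n2. \<forall>u. u \<noteq> [] \<longrightarrow> hd u = b \<longrightarrow> last u = c \<longrightarrow>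
      (\<forall>n k m. n \<ge> n2 \<longrightarrow> set u \<subseteq> {..<n} \<longrightarrow> k \<ge> k0 \<longrightarrow> m \<ge> k0 \<longrightarrow> k + length u + m = n \<longrightarrow>
        c3 * weight u * exp (- (real (length u) * pressure)) \<le> q n k u)" for b c
  proof -
    obtain b' where b': "M b' b = 1" using ex_pred by blast
    obtain c' where c': "M c c' = 1" using ex_succ by blast
    \<comment> \<open>The lower bound counts words that lead from 0 to a predecessor
      \<open>b'\<close> of \<open>b\<close>, continue with \<open>u\<close>, and lead from a
      successor \<open>c'\<close> of \<open>c\<close> back to 0. The division by \<open>K\<close>
      comes from the normalisation.\<close>
    define c3 where "c3 = exp (- (2 * D)) * c0 0 b' * c0 c' 0 / K"
    define k0 where "k0 = max 1 (max (n0 0 b') (n0 c' 0))"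
    define n2 where "n2 = max n1 (max b' c')"
    have c3: "c3 > 0" using c0[of 0 b'] c0[of c' 0] K by (simp add: c3_def)
    show ?thesis
    proof (rule exI[of _ c3], intro conjI c3, rule exI[of _ k0], rule exI[of _ n2], intro allI impI)
      fix u :: "nat list" and n k m
      assume u: "u \<noteq> []" "hd u = b" "last u = c" and n: "n2 \<le> n" "set u \<subseteq> {..<n}" "k0 \<le> k" "k0 \<le> m" "k + length u + m = n"
      have nn: "n \<ge> n1" "b' \<le> n" "c' \<le> n" using n(1) by (auto simp: n2_def)
      have "c0 0 b' * exp (real k * pressure) \<le> between {..<N n} 0 b' k"
        using n nn by (intro btw) (auto simp: k0_def)
      moreover have "c0 c' 0 * exp (real m * pressure) \<le> between {..<N n} c' 0 m"
        using n nn by (intro btw) (auto simp: k0_def)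
      ultimately have "c0 0 b' * exp (real k * pressure) * weight u * (c0 c' 0 * exp (real m * pressure))
          \<le> between {..<N n} 0 b' k * weight u * between {..<N n} c' 0 m"
        using c0[of 0 b'] c0[of c' 0] by (intro mult_mono mult_right_mono) (auto simp: between_def less_imp_le)
      also have "\<dots> \<le> exp (2 * D) * visit {..<N n} n k u"
        using n u b' c' N[of n] by (intro visit_ge) (auto simp: k0_def)
      finally have *: "c0 0 b' * exp (real k * pressure) * weight u * (c0 c' 0 * exp (real m * pressure))
          \<le> exp (2 * D) * visit {..<N n} n k u" .
      have "c3 * weight u * exp (- (real (length u) * pressure)) * L n
          \<le> c3 * weight u * exp (- (real (length u) * pressure)) * (K * exp (real n * pressure))"
        using c3 by (intro mult_left_mono L_le) auto
      also have "\<dots> = exp (- (2 * D)) * (c0 0 b' * exp (real k * pressure) * weight u * (c0 c' 0 * exp (real m * pressure)))"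
      proof -
        have "real n * pressure = real k * pressure + real (length u) * pressure + real m * pressure"
          by (simp add: n(5)[symmetric] algebra_simps)
        then have "exp (- (real (length u) * pressure)) * exp (real n * pressure) = exp (real k * pressure) * exp (real m * pressure)"
          by (simp flip: exp_add)
        then show ?thesis using K by (simp add: c3_def mult_ac)
      qed
      also have "\<dots> \<le> exp (- (2 * D)) * (exp (2 * D) * visit {..<N n} n k u)"
        using * by (intro mult_left_mono) auto
      also have "\<dots> = visit {..<N n} n k u" by (simp flip: mult.assoc exp_add)
      finally show "c3 * weight u * exp (- (real (length u) * pressure)) \<le> q n k u"
        using L_pos[OF nn(1)] by (simp add: q_def field_simps)
    qed
  qed
  define p where "p n u = (\<Sum>k<n. q n k u) / real n" for n u
  have p_upper: "p n u \<le> K2 * weight u * exp (- (real (length u) * pressure)) + real (length u) / real n"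
    if n: "n \<ge> n1" for n u
  proof -
    let ?a = "K2 * weight u * exp (- (real (length u) * pressure))"
    have a: "0 \<le> ?a" using K2 by simp
    have "(\<Sum>k<n. q n k u) \<le> (\<Sum>k<n. ?a + of_bool (n < k + length u))"
      using q_upper[OF n] q1[OF n] a by (intro sum_mono) (auto simp: not_less of_bool_def intro: add_increasing)
    also have "\<dots> = real n * ?a + (\<Sum>k<n. of_bool (n < k + length u))" by (simp add: sum.distrib)
    also have "(\<Sum>k<n. of_bool (n < k + length u) :: real) = real (card {k\<in>{..<n}. n < k + length u})"
      by (simp add: sum.inter_filter[symmetric] of_bool_def)
    also have "card {k\<in>{..<n}. n < k + length u} \<le> card {n - length u..<n}"
      by (intro card_mono) auto
    also have "card {n - length u..<n} \<le> length u" by simp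
    finally have "(\<Sum>k<n. q n k u) \<le> real n * ?a + real (length u)" by simp
    then have "p n u \<le> (real n * ?a + real (length u)) / real n"
      unfolding p_def by (rule divide_right_mono) simp
    moreover have "n \<noteq> 0" using n by (auto simp: n1_def)
    ultimately show ?thesis by (simp add: add_divide_distrib)
  qed
  have tight: "\<exists>I. \<forall>\<^sub>F n in sequentially. p n u - (\<Sum>i<I. p n (u @ [i])) \<le> e" if e: "e > 0" for u e
  proof -
    \<comment> \<open>Appending a letter \<open>i\<close> multiplies the upper bound for
      \<open>u\<close> by at most a constant times \<open>exp (\<phi> [i])\<close>, so the letters
      from \<open>I\<close> on carry at most a tail of a convergent series.\<close>
    define a where "a = K2 * exp D * weight u * exp (- (real (Suc (length u)) * pressure))"
    have a: "a \<ge> 0" using K2 by (simp add: a_def)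
    have "(\<lambda>I. (\<Sum>i. exp (\<phi> [i + I]))) \<longlonglongrightarrow> 0" using suminf_exist_split2[OF summable_letters] .
    then have "(\<lambda>I. a * (\<Sum>i. exp (\<phi> [i + I]))) \<longlonglongrightarrow> a * 0" by (intro tendsto_intros)
    then have "\<forall>\<^sub>F I in sequentially. a * (\<Sum>i. exp (\<phi> [i + I])) < e / 2"
      using e by (intro order_tendstoD(2)[of _ "a * 0"]) auto
    then obtain I where I: "a * (\<Sum>i. exp (\<phi> [i + I])) < e / 2" by (auto simp: eventually_sequentially)
    have small: "q n k u - (\<Sum>i<I. q n k (u @ [i])) \<le> e / 2" if n: "n \<ge> n1" and k: "k + length u < n" for n k
    proof -
      have "q n k u \<le> (\<Sum>i<N n. q n k (u @ [i]))"
        unfolding q_def sum_divide_distrib[symmetric]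
        using L_pos[OF n] k by (intro divide_right_mono visit_le_snoc) auto
      also have "\<dots> \<le> (\<Sum>i<I + N n. q n k (u @ [i]))"
        using q0[OF n] by (intro sum_mono2) auto
      also have "\<dots> = (\<Sum>i<I. q n k (u @ [i])) + (\<Sum>i\<in>{I..<I + N n}. q n k (u @ [i]))"
        using sum.atLeastLessThan_concat[of 0 I "I + N n" "\<lambda>i. q n k (u @ [i])"] by (simp add: lessThan_atLeast0)
      also have "(\<Sum>i\<in>{I..<I + N n}. q n k (u @ [i])) = (\<Sum>i<N n. q n k (u @ [i + I]))"
        using sum.shift_bounds_nat_ivl[of "\<lambda>i. q n k (u @ [i])" 0 I "N n"] by (simp add: lessThan_atLeast0 add.commute)
      also have "\<dots> \<le> (\<Sum>i<N n. a * exp (\<phi> [i + I]))"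
      proof (intro sum_mono)
        fix i
        have "q n k (u @ [i + I]) \<le> K2 * weight (u @ [i + I]) * exp (- (real (length (u @ [i + I])) * pressure))"
          using n k by (intro q_upper) auto
        also have "\<dots> \<le> K2 * (exp D * (weight u * weight [i + I])) * exp (- (real (length (u @ [i + I])) * pressure))"
          using K2 by (intro mult_left_mono mult_right_mono weight_append_le) auto
        finally show "q n k (u @ [i + I]) \<le> a * exp (\<phi> [i + I])" by (simp add: a_def mult_ac)
      qed
      also have "\<dots> = a * (\<Sum>i<N n. exp (\<phi> [i + I]))" by (simp add: sum_distrib_left)
      also have "\<dots> \<le> a * (\<Sum>i. exp (\<phi> [i + I]))"
        using a summable_letters by (intro mult_left_mono sum_le_suminf)
          (auto simp: summable_iff_shift[of "\<lambda>i. exp (\<phi> [i])"])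
      finally show ?thesis using I by simp
    qed
    obtain n3 :: nat where n3: "real n3 > 2 * (real (length u) + 1) / e" using reals_Archimedean2 by blast
    have "p n u - (\<Sum>i<I. p n (u @ [i])) \<le> e" if n: "n \<ge> max n1 n3" for n
    proof -
      have n': "n \<ge> n1" using n by simp
      have npos: "0 < real n" using n by (simp add: n1_def)
      have "(\<Sum>k<n. q n k u - (\<Sum>i<I. q n k (u @ [i]))) \<le> (\<Sum>k<n. e / 2 + of_bool (n \<le> k + length u))"
      proof (intro sum_mono)
        fix k
        have "0 \<le> (\<Sum>i<I. q n k (u @ [i]))" using q0[OF n'] by (intro sum_nonneg) auto
        then show "q n k u - (\<Sum>i<I. q n k (u @ [i])) \<le> e / 2 + of_bool (n \<le> k + length u)"
          using small[OF n', of k] q1[OF n', of k u] e by (cases "n \<le> k + length u") auto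
      qed
      also have "\<dots> = real n * (e / 2) + (\<Sum>k<n. of_bool (n \<le> k + length u))" by (simp add: sum.distrib)
      also have "(\<Sum>k<n. of_bool (n \<le> k + length u) :: real) = real (card {k\<in>{..<n}. n \<le> k + length u})"
        by (simp add: sum.inter_filter[symmetric] of_bool_def)
      also have "card {k\<in>{..<n}. n \<le> k + length u} \<le> card {n - length u..<n}"
        by (intro card_mono) auto
      also have "card {n - length u..<n} \<le> length u" by simp
      finally have "(\<Sum>k<n. q n k u - (\<Sum>i<I. q n k (u @ [i]))) \<le> real n * (e / 2) + real (length u)" by simp
      also have "real (length u) \<le> real n * (e / 2)"
      proof -
        have "2 * (real (length u) + 1) / e < real n" using n3 n by simp
        then show ?thesis using e by (simp add: field_simps)
      qed
      finally have "(\<Sum>k<n. q n k u - (\<Sum>i<I. q n k (u @ [i]))) \<le> real n * e" by (simp add: field_simps)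
      moreover have "p n u - (\<Sum>i<I. p n (u @ [i])) = (\<Sum>k<n. q n k u - (\<Sum>i<I. q n k (u @ [i]))) / real n"
      proof -
        have "(\<Sum>i<I. p n (u @ [i])) = (\<Sum>i<I. \<Sum>k<n. q n k (u @ [i])) / real n"
          by (simp add: p_def sum_divide_distrib)
        also have "(\<Sum>i<I. \<Sum>k<n. q n k (u @ [i])) = (\<Sum>k<n. \<Sum>i<I. q n k (u @ [i]))" by (rule sum.swap)
        finally show ?thesis by (simp add: p_def sum_subtractf diff_divide_distrib)
      qed
      ultimately show ?thesis using npos by (simp only: pos_divide_le_eq mult.commute)
    qed
    then have "\<forall>\<^sub>F n in sequentially. p n u - (\<Sum>i<I. p n (u @ [i])) \<le> e"
      unfolding eventually_sequentially by blast
    then show ?thesis by blast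
  qed
  have inv: "\<forall>\<^sub>F n in sequentially. (\<Sum>i<I. p n (i # u)) \<le> p n u + e" if e: "e > 0" for I u e
  proof -
    \<comment> \<open>Shifting the averaging window by one position brings in one new term, which is
      at most 1 before the division by \<open>n\<close>.\<close>
    obtain n3 :: nat where n3: "real n3 > 1 / e" using reals_Archimedean2 by blast
    have "(\<Sum>i<I. p n (i # u)) \<le> p n u + e" if n: "n \<ge> max n1 n3" for n
    proof -
      have n': "n \<ge> n1" using n by simp
      have npos: "0 < real n" using n by (simp add: n1_def)
      have "(\<Sum>i<I. p n (i # u)) = (\<Sum>i<I. \<Sum>k<n. q n k (i # u)) / real n"
        by (simp add: p_def sum_divide_distrib)
      also have "(\<Sum>i<I. \<Sum>k<n. q n k (i # u)) = (\<Sum>k<n. \<Sum>i<I. q n k (i # u))" by (rule sum.swap)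
      also have "\<dots> / real n \<le> (\<Sum>k<n. q n (Suc k) u) / real n"
        using q_Cons[OF n'] by (intro divide_right_mono sum_mono) auto
      also have "(\<Sum>k<n. q n (Suc k) u) \<le> (\<Sum>k<n. q n k u) + 1"
      proof -
        have "(\<Sum>k<n. q n (Suc k) u) \<le> (\<Sum>k<Suc n. q n k u)"
          using q0[OF n', of 0 u] by (subst sum.lessThan_Suc_shift) simp
        then show ?thesis using q1[OF n', of n u] by simp
      qed
      finally have "(\<Sum>i<I. p n (i # u)) \<le> ((\<Sum>k<n. q n k u) + 1) / real n"
        using npos by (simp add: divide_right_mono)
      also have "\<dots> = p n u + 1 / real n" by (simp add: p_def add_divide_distrib)
      also have "1 / real n \<le> e"
      proof -
        have "1 / e < real n" using n3 n by simp
        then show ?thesis using e npos by (simp add: field_simps)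
      qed
      finally show ?thesis by simp
    qed
    then show ?thesis unfolding eventually_sequentially by blast
  qed
  have "\<exists>r \<mu>. strict_mono (r :: nat \<Rightarrow> nat) \<and> invariant_measure M \<mu> \<and>
    (\<forall>u. (\<lambda>k. p (r k + n1) u) \<longlonglongrightarrow> measure \<mu> (cylinder M u))"
  proof (rule cylinder_weights_compact[where p = "\<lambda>k. p (k + n1)"])
    fix k u I
    have n: "k + n1 \<ge> n1" "real (k + n1) > 0" by (auto simp: n1_def)
    show "p (k + n1) [] = 1" using q_Nil[OF n(1)] n by (simp add: p_def)
    show "0 \<le> p (k + n1) u" using q0[OF n(1)] by (auto simp: p_def intro!: divide_nonneg_nonneg sum_nonneg)
    have "(\<Sum>i<I. p (k + n1) (u @ [i])) = (\<Sum>i<I. \<Sum>j<k + n1. q (k + n1) j (u @ [i])) / real (k + n1)"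
      by (simp add: p_def sum_divide_distrib)
    also have "(\<Sum>i<I. \<Sum>j<k + n1. q (k + n1) j (u @ [i])) = (\<Sum>j<k + n1. \<Sum>i<I. q (k + n1) j (u @ [i]))" by (rule sum.swap)
    also have "\<dots> / real (k + n1) \<le> p (k + n1) u"
      unfolding p_def using q_snoc[OF n(1)] by (intro divide_right_mono sum_mono) auto
    finally show "(\<Sum>i<I. p (k + n1) (u @ [i])) \<le> p (k + n1) u" .
  next
    fix u :: "nat list" and e :: real assume "e > 0"
    then obtain I where "\<forall>\<^sub>F n in sequentially. p n u - (\<Sum>i<I. p n (u @ [i])) \<le> e" using tight by blast
    then show "\<exists>I. \<forall>\<^sub>F k in sequentially. p (k + n1) u - (\<Sum>i<I. p (k + n1) (u @ [i])) \<le> e"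
      by (intro exI[of _ I]) (rule sequentially_offset)
  next
    fix k and u :: "nat list" assume "u \<noteq> []" "\<not> admissible M u"
    then have "cylinder M u = {}" by (rule cylinder_eq_empty)
    then show "p (k + n1) u = 0" by (simp add: p_def q_def visit_def wsum_def)
  next
    fix u :: "nat list" and I and e :: real assume "e > 0"
    then show "\<forall>\<^sub>F k in sequentially. (\<Sum>i<I. p (k + n1) (i # u)) \<le> p (k + n1) u + e"
      by (intro sequentially_offset[of "\<lambda>k. (\<Sum>i<I. p k (i # u)) \<le> p k u + e"] inv)
  qed
  then obtain r \<nu> where r: "strict_mono (r :: nat \<Rightarrow> nat)" and nu: "invariant_measure M \<nu>"
    and lim: "\<And>u. (\<lambda>k. p (r k + n1) u) \<longlonglongrightarrow> measure \<nu> (cylinder M u)" by blast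
  have big: "filterlim (\<lambda>k. r k + n1) sequentially sequentially"
    by (rule filterlim_compose[OF filterlim_add_const_nat_at_top filterlim_subseq[OF r]])
  have up: "measure \<nu> (cylinder M u) \<le> K2 * weight u * exp (- (real (length u) * pressure))" for u
  proof -
    have "(\<lambda>k. K2 * weight u * exp (- (real (length u) * pressure)) + real (length u) / real (r k + n1))
        \<longlonglongrightarrow> K2 * weight u * exp (- (real (length u) * pressure)) + 0"
      by (intro tendsto_add tendsto_const filterlim_compose[OF lim_const_over_n big])
    then have "measure \<nu> (cylinder M u) \<le> K2 * weight u * exp (- (real (length u) * pressure)) + 0"
    proof (rule LIMSEQ_le[OF lim], intro exI allI impI)
      fix k
      show "p (r k + n1) u \<le> K2 * weight u * exp (- (real (length u) * pressure)) + real (length u) / real (r k + n1)"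
        by (rule p_upper) simp
    qed
    then show ?thesis by simp
  qed
  have low: "\<exists>k>0. \<forall>u. u \<noteq> [] \<longrightarrow> hd u = b \<longrightarrow> last u = c \<longrightarrow>
      k * weight u * exp (- (real (length u) * pressure)) \<le> measure \<nu> (cylinder M u)" for b c
  proof -
    obtain c3 k0 n2 where c3: "c3 > 0" and low: "\<forall>u. u \<noteq> [] \<longrightarrow> hd u = b \<longrightarrow> last u = c \<longrightarrow>
      (\<forall>n k m. n \<ge> n2 \<longrightarrow> set u \<subseteq> {..<n} \<longrightarrow> k \<ge> k0 \<longrightarrow> m \<ge> k0 \<longrightarrow> k + length u + m = n \<longrightarrow>
        c3 * weight u * exp (- (real (length u) * pressure)) \<le> q n k u)"
      using q_lower[of b c] by (elim exE conjE) rule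
    show ?thesis
    proof (intro exI[of _ "c3 / 2"] conjI allI impI)
      show "c3 / 2 > 0" using c3 by simp
      fix u :: "nat list" assume u: "u \<noteq> []" "hd u = b" "last u = c"
      let ?a = "c3 * weight u * exp (- (real (length u) * pressure))"
      have a: "0 \<le> ?a" using c3 by simp
      obtain n4 where n4: "set u \<subseteq> {..<n4}" using finite_nat_iff_bounded[of "set u"] by auto
      define n5 where "n5 = max (max n1 n2) (max n4 (2 * (2 * k0 + length u)))"
      have "?a / 2 \<le> p n u" if n: "n \<ge> n5" for n
      proof -
        have n': "n \<ge> n1" "n \<ge> n2" "set u \<subseteq> {..<n}" "2 * (2 * k0 + length u) \<le> n"
          using n n4 by (auto simp: n5_def)
        have npos: "0 < real n" using n' by (simp add: n1_def)
        \<comment> \<open>The positions with at least \<open>k0\<close> letters on either side of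
          \<open>u\<close>. For \<open>n\<close> at least twice \<open>2 * k0 + length u\<close>
          they are at least half of all positions, whence the constant
          \<open>c3 / 2\<close>.\<close>
        define J where "J = {k0..<n - k0 - length u}"
        have "real (card J) * ?a = (\<Sum>k\<in>J. ?a)" by simp
        also have "\<dots> \<le> (\<Sum>k\<in>J. q n k u)"
        proof (intro sum_mono)
          fix k assume "k \<in> J"
          then have "k0 \<le> k" "k0 \<le> n - k - length u" "k + length u + (n - k - length u) = n"
            by (auto simp: J_def)
          then show "?a \<le> q n k u" using low[rule_format, OF u n'(2,3)] by blast
        qed
        also have "\<dots> \<le> (\<Sum>k<n. q n k u)"
          using q0[OF n'(1)] by (intro sum_mono2) (auto simp: J_def)
        finally have "real (card J) * ?a \<le> (\<Sum>k<n. q n k u)" .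
        moreover have "real n / 2 \<le> real (card J)"
        proof -
          have "card J = n - (2 * k0 + length u)" by (simp add: J_def)
          moreover define j where "j = 2 * k0 + length u"
          ultimately have "card J = n - j" "2 * j \<le> n" using n'(4) by simp_all
          then have "n \<le> 2 * card J" by linarith
          then show ?thesis by linarith
        qed
        then have "real n / 2 * ?a \<le> real (card J) * ?a" using a by (intro mult_right_mono)
        ultimately have "real n / 2 * ?a \<le> (\<Sum>k<n. q n k u)" by linarith
        then have "real n / 2 * ?a / real n \<le> p n u" unfolding p_def by (rule divide_right_mono) simp
        then show ?thesis using npos by simp
      qed
      then have "\<forall>\<^sub>F n in sequentially. ?a / 2 \<le> p n u" unfolding eventually_sequentially by blast
      then have "\<forall>\<^sub>F k in sequentially. ?a / 2 \<le> p (r k + n1) u"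
        using big by (rule eventually_compose_filterlim)
      then have "?a / 2 \<le> measure \<nu> (cylinder M u)" by (intro tendsto_lowerbound[OF lim]) auto
      then show "c3 / 2 * weight u * exp (- (real (length u) * pressure)) \<le> measure \<nu> (cylinder M u)" by simp
    qed
  qed
  show ?thesis
    using nu up low K2 by (intro exI[of _ \<nu>] conjI allI) blast+
qed

end

section \<open>Gibbs measures are equilibrium states\<close>

context potential_measure
begin

text \<open>The cylinder of the letter \<open>i\<close> has measure at most a constant times
  \<open>exp (phi [i])\<close>, so the given series dominates the integral of the absolute value of
  \<open>phi\<close> at the first letter.\<close>

lemma integrable_f1_of_gibbs:
  assumes K: "K > 0" "\<And>u. prob (cylinder M u) \<le> K * weight u * exp (- (real (length u) * pressure))"
    and sm: "summable (\<lambda>i. exp (phi [i]) * \<bar>phi [i]\<bar>)"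
  shows "integrable \<mu> (f 1)"
proof -
  define g where "g x = \<bar>phi (initial 1 x)\<bar>" for x
  have g_meas: "g \<in> borel_measurable \<mu>" unfolding g_def by measurable
  define s where "s i = \<bar>phi [i]\<bar> * (K * exp (- pressure) * exp (phi [i]))" for i
  have s: "summable s"
  proof -
    have "summable (\<lambda>i. K * exp (- pressure) * (exp (phi [i]) * \<bar>phi [i]\<bar>))" by (intro summable_mult sm)
    then show ?thesis by (simp add: s_def[abs_def] mult_ac)
  qed
  have s0: "0 \<le> s i" for i using K by (simp add: s_def)
  have "(\<integral>\<^sup>+x. ennreal (g x) \<partial>\<mu>) = (\<integral>\<^sup>+x. (\<Sum>i. ennreal \<bar>phi [i]\<bar> * indicator (cylinder M [i]) x) \<partial>\<mu>)"
  proof (rule nn_integral_cong)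
    fix x assume x: "x \<in> space \<mu>"
    have "(\<Sum>i. ennreal \<bar>phi [i]\<bar> * indicator (cylinder M [i]) x)
        = (\<Sum>i\<in>{x 0}. ennreal \<bar>phi [i]\<bar> * indicator (cylinder M [i]) x)"
      by (rule suminf_finite) (auto simp: cylinder_def)
    also have "\<dots> = ennreal (g x)" using x by (simp add: cylinder_def g_def initial_def)
    finally show "ennreal (g x) = (\<Sum>i. ennreal \<bar>phi [i]\<bar> * indicator (cylinder M [i]) x)" ..
  qed
  also have "\<dots> = (\<Sum>i. ennreal \<bar>phi [i]\<bar> * emeasure \<mu> (cylinder M [i]))"
    by (subst nn_integral_suminf) (auto simp: nn_integral_cmult)
  also have "\<dots> \<le> (\<Sum>i. ennreal (s i))"
  proof (rule suminf_le)
    fix i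
    have "prob (cylinder M [i]) \<le> K * exp (- pressure) * exp (phi [i])"
      using K(2)[of "[i]"] by (simp add: mult_ac)
    then have "\<bar>phi [i]\<bar> * prob (cylinder M [i]) \<le> s i" unfolding s_def by (intro mult_left_mono) auto
    then show "ennreal \<bar>phi [i]\<bar> * emeasure \<mu> (cylinder M [i]) \<le> ennreal (s i)"
      by (simp add: emeasure_eq_measure ennreal_mult'[symmetric] ennreal_leI)
  qed auto
  also have "\<dots> = ennreal (suminf s)" using s s0 by (intro suminf_ennreal2) auto
  also have "\<dots> < \<infinity>" by simp
  finally have "(\<integral>\<^sup>+x. ennreal (norm (g x)) \<partial>\<mu>) < \<infinity>" by (simp add: g_def)
  then have g_int: "integrable \<mu> g" using g_meas by (rule integrableI_bounded[rotated])
  show ?thesis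
  proof (rule Bochner_Integration.integrable_bound)
    show "integrable \<mu> (\<lambda>x. g x + C)" using g_int by simp
    show "AE x in \<mu>. norm (f 1 x) \<le> norm (g x + C)"
    proof (rule AE_I2)
      fix x assume "x \<in> space \<mu>"
      then have "\<bar>f 1 x\<bar> \<le> g x + C" using f_phi_initial[of x 1] unfolding g_def by simp
      then show "norm (f 1 x) \<le> norm (g x + C)" unfolding real_norm_def by (rule order_trans[OF _ abs_ge_self])
    qed
  qed auto
qed

lemma fiber_first_letter: "i < N \<Longrightarrow> fiber (first_letter N) i = cylinder M [i]"
  "fiber (first_letter N) N = shift_space M - bounded_part M 1 N"
  by (auto simp: fiber_def first_letter_def cylinder_def bounded_part_def min_def split: if_splits)

text \<open>Only the lumped cell changes: it splits into single letters below \<open>N'\<close> and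
  a rest whose contribution is at most twice the square root of its measure.\<close>

lemma ent_first_letter_diff:
  assumes "N \<le> N'"
  shows "ent (first_letter N') - ent (first_letter N)
    \<le> (\<Sum>i\<in>{N..<N'}. - (prob (cylinder M [i]) * ln (prob (cylinder M [i]))))
      + 2 * sqrt (prob (shift_space M - bounded_part M 1 N'))"
proof -
  define \<eta> where "\<eta> p = - (p * ln p)" for p :: real
  have ent: "ent (first_letter N) = (\<Sum>i<N. \<eta> (prob (cylinder M [i]))) + \<eta> (prob (shift_space M - bounded_part M 1 N))" for N
  proof -
    have "ent (first_letter N) = (\<Sum>i\<in>{..N}. \<eta> (prob (fiber (first_letter N) i)))"
      unfolding \<eta>_def by (rule ent_superset) (auto simp: first_letter_def)
    also have "{..N} = insert N {..<N}" by auto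
    finally show ?thesis using fiber_first_letter(1)[of _ N] fiber_first_letter(2)[of N] by simp
  qed
  have eta0: "0 \<le> \<eta> (prob A)" for A
    using neg_mult_ln_mono[of "prob A" 1] by (simp add: \<eta>_def)
  have "(\<Sum>i<N'. \<eta> (prob (cylinder M [i]))) = (\<Sum>i<N. \<eta> (prob (cylinder M [i]))) + (\<Sum>i\<in>{N..<N'}. \<eta> (prob (cylinder M [i])))"
    unfolding lessThan_atLeast0 by (rule sum.atLeastLessThan_concat[symmetric]) (use assms in auto)
  moreover have "\<eta> (prob (shift_space M - bounded_part M 1 N')) \<le> 2 * sqrt (prob (shift_space M - bounded_part M 1 N'))"
    unfolding \<eta>_def by (rule neg_mult_ln_le_sqrt) simp
  ultimately show ?thesis using ent[of N] ent[of N'] eta0[of "shift_space M - bounded_part M 1 N"]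
    by (simp add: \<eta>_def)
qed

text \<open>On words with letters below \<open>N\<close> the truncated cell is a genuine cylinder,
  to which the Gibbs bound applies; elsewhere the information function is merely
  nonnegative.\<close>

lemma ent_itin_ge_gibbs:
  assumes K: "K > 0" "\<And>u. prob (cylinder M u) \<le> K * weight u * exp (- (real (length u) * pressure))"
    and int: "integrable \<mu> (f 1)" and n: "n \<ge> 1"
  shows "(\<integral>x. indicator (bounded_part M n N) x * (real n * pressure - ln K - phi (initial n x)) \<partial>\<mu>)
    \<le> ent (itin (first_letter N) n)"
proof -
  define X where "X = itin (first_letter N) n"
  have X: "simple_function \<mu> X" unfolding X_def by (intro simple_itin simple_first_letter)
  define D where "D x = prob (fiber X (X x))" for x
  note entX = ent_eq_integral[OF X, folded D_def]
  let ?h = "\<lambda>x. real n * pressure - ln K - phi (initial n x)"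
  have hint: "integrable \<mu> ?h" using integrable_phi_initial(1)[OF int n] by simp
  have "(\<integral>x. indicator (bounded_part M n N) x * ?h x \<partial>\<mu>) \<le> (\<integral>x. - ln (D x) \<partial>\<mu>)"
  proof (rule integral_mono_AE[OF _ entX(1)])
    show "integrable \<mu> (\<lambda>x. indicator (bounded_part M n N) x * ?h x)"
      using integrable_real_mult_indicator[OF _ hint, of "bounded_part M n N"] by (simp add: sets_eq mult.commute)
    show "AE x in \<mu>. indicator (bounded_part M n N) x * ?h x \<le> - ln (D x)"
      using AE_fiber_pos[OF X] AE_space
    proof eventually_elim
      case (elim x)
      then have D: "0 < D x" by (simp add: D_def)
      show ?case
      proof (cases "x \<in> bounded_part M n N")
        case True
        have "fiber X (X x) = cylinder M (initial n x)"
        proof (intro equalityI subsetI)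
          fix y assume "y \<in> fiber X (X x)"
          then have y: "y \<in> shift_space M" "map (\<lambda>a. min a N) (initial n y) = map (\<lambda>a. min a N) (initial n x)"
            by (auto simp: fiber_def X_def itin_first_letter)
          have "y i = x i" if "i < n" for i
          proof -
            have "min (y i) N = min (x i) N" using y(2) that by (simp add: initial_def)
            moreover have "x i < N" using True that by (simp add: bounded_part_def)
            ultimately show ?thesis by linarith
          qed
          then show "y \<in> cylinder M (initial n x)" using y(1) by (simp add: cylinder_def)
        next
          fix y assume "y \<in> cylinder M (initial n x)"
          then show "y \<in> fiber X (X x)" by (auto simp: fiber_def X_def itin_first_letter cylinder_iff)
        qed
        then have "D x \<le> K * weight (initial n x) * exp (- (real n * pressure))"
          using K(2)[of "initial n x"] by (simp add: D_def)
        moreover have "weight (initial n x) = exp (phi (initial n x))"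
          using admissible_initial[of x M n] elim n by (auto simp: weight_def)
        ultimately have "ln (D x) \<le> ln (K * exp (phi (initial n x)) * exp (- (real n * pressure)))"
          using D by (intro ln_mono) auto
        also have "\<dots> = ln K + phi (initial n x) - real n * pressure" using K by (simp add: ln_mult_pos)
        finally show ?thesis using True by simp
      next
        case False
        have "ln (D x) \<le> 0" using D by (simp add: D_def)
        then show ?thesis using False by simp
      qed
    qed
  qed
  then show ?thesis using entX(2) by (simp add: X_def)
qed

text \<open>The Gibbs bound speaks of full cylinders, the entropy rate of a finite partition.
  Refining the truncation from \<open>N\<close> to \<open>N'\<close> costs at most \<open>n\<close>
  times a tail of the series of \<open>s\<close>, plus a term that vanishes as \<open>N'\<close>
  grows. So \<open>N'\<close> tends to infinity first, then \<open>n\<close>, then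
  \<open>N\<close>.\<close>

lemma equality_of_gibbs:
  assumes K: "K > 0" "\<And>u. prob (cylinder M u) \<le> K * weight u * exp (- (real (length u) * pressure))"
    and sm: "summable (\<lambda>i. exp (phi [i]) * \<bar>phi [i]\<bar>)"
  shows "ks_entropy \<mu> shift = ereal (pressure - mean)"
proof (rule antisym)
  have int: "integrable \<mu> (f 1)" by (rule integrable_f1_of_gibbs[OF K sm])
  show "ks_entropy \<mu> shift \<le> ereal (pressure - mean)" by (rule variational_inequality[OF int])
  define s where "s i = exp (phi [i]) + K * exp (- pressure) * (exp (phi [i]) * \<bar>phi [i]\<bar>)" for i
  have s: "summable s" unfolding s_def by (intro summable_add summable_mult sm summable_letters)
  have s0: "0 \<le> s i" for i using K by (simp add: s_def)
  \<comment> \<open>With \<open>p\<close> the measure of the cylinder and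
    \<open>q = exp (phi [i])\<close>, the inequality \<open>ln (q / p) \<le> q / p - 1\<close> gives
    \<open>- (p * ln p) \<le> q - p - p * phi [i]\<close>, and the Gibbs bound replaces
    \<open>p\<close> by a multiple of \<open>q\<close>.\<close>
  have eta_le: "- (prob (cylinder M [i]) * ln (prob (cylinder M [i]))) \<le> s i" for i
  proof (cases "prob (cylinder M [i]) = 0")
    case True
    then show ?thesis using s0 by simp
  next
    case False
    let ?p = "prob (cylinder M [i])" and ?q = "exp (phi [i])"
    have p: "0 < ?p" using False by (simp add: zero_less_measure_iff)
    have "ln (?q / ?p) \<le> ?q / ?p - 1" using p by (intro ln_le_minus_one) auto
    then have "?p * ln (?q / ?p) \<le> ?p * (?q / ?p - 1)" using p by (intro mult_left_mono) auto
    then have "- (?p * ln ?p) \<le> ?q - ?p - ?p * phi [i]" using p by (simp add: ln_div algebra_simps)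
    also have "\<dots> \<le> ?q + ?p * \<bar>phi [i]\<bar>"
      using p mult_left_mono[OF abs_ge_minus_self[of "phi [i]"], of ?p] by simp
    also have "?p \<le> K * exp (- pressure) * ?q" using K(2)[of "[i]"] by (simp add: mult_ac)
    then have "?p * \<bar>phi [i]\<bar> \<le> K * exp (- pressure) * ?q * \<bar>phi [i]\<bar>" by (intro mult_right_mono) auto
    then have "?q + ?p * \<bar>phi [i]\<bar> \<le> s i" by (simp add: s_def mult_ac)
    finally show ?thesis .
  qed
  have main: "pressure - mean \<le> hent (first_letter N) + (\<Sum>i. s (i + N))" for N
  proof -
    let ?S = "\<Sum>i. s (i + N)"
    have step: "real n * pressure - ln K - (\<integral>x. phi (initial n x) \<partial>\<mu>) \<le> ent (itin (first_letter N) n) + real n * ?S"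
      if n: "n \<ge> 1" for n
    proof -
      let ?h = "\<lambda>x. real n * pressure - ln K - phi (initial n x)"
      have hint: "integrable \<mu> ?h" using integrable_phi_initial(1)[OF int n] by simp
      have "(\<lambda>N'. \<integral>x. indicator (bounded_part M n N') x * ?h x \<partial>\<mu>) \<longlonglongrightarrow> (\<integral>x. ?h x \<partial>\<mu>)"
      proof (rule integral_dominated_convergence[where w = "\<lambda>x. norm (?h x)"])
        show "?h \<in> borel_measurable \<mu>" using hint by auto
        have "(\<lambda>x. indicator (bounded_part M n N') x :: real) \<in> borel_measurable \<mu>" for N'
          by (rule borel_measurable_indicator) (simp add: sets_eq)
        then show "(\<lambda>x. indicator (bounded_part M n N') x * ?h x) \<in> borel_measurable \<mu>" for N'
          using hint by (intro borel_measurable_times) auto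
        show "integrable \<mu> (\<lambda>x. norm (?h x))" using hint by (rule integrable_norm)
        show "AE x in \<mu>. (\<lambda>N'. indicator (bounded_part M n N') x * ?h x) \<longlonglongrightarrow> ?h x"
        proof (rule AE_I2)
          fix x assume x: "x \<in> space \<mu>"
          obtain N0 where N0: "x ` {..<n} \<subseteq> {..<N0}" using finite_nat_iff_bounded[of "x ` {..<n}"] by auto
          have "\<forall>\<^sub>F N' in sequentially. ?h x = indicator (bounded_part M n N') x * ?h x"
            using eventually_ge_at_top[of N0]
          proof eventually_elim
            case (elim N')
            then have "x \<in> bounded_part M n N'" using x N0 by (force simp: bounded_part_def)
            then show ?case by simp
          qed
          then show "(\<lambda>N'. indicator (bounded_part M n N') x * ?h x) \<longlonglongrightarrow> ?h x"
            by (rule Lim_transform_eventually[OF tendsto_const])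
        qed
        show "AE x in \<mu>. norm (indicator (bounded_part M n N') x * ?h x) \<le> norm (?h x)" for N'
          by (rule AE_I2) (simp add: indicator_def)
      qed
      moreover have "(\<lambda>N'. ent (itin (first_letter N) n) + real n * (?S + 2 * sqrt (prob (shift_space M - bounded_part M 1 N'))))
          \<longlonglongrightarrow> ent (itin (first_letter N) n) + real n * (?S + 2 * sqrt 0)"
      proof (intro tendsto_intros)
        show "(\<lambda>N'. prob (shift_space M - bounded_part M 1 N')) \<longlonglongrightarrow> 0"
        proof (rule tendstoI)
          fix e :: real assume "e > 0"
          then show "\<forall>\<^sub>F N' in sequentially. dist (prob (shift_space M - bounded_part M 1 N')) 0 < e"
            using eventually_bounded_part[of e 1] by simp
        qed
      qed
      moreover have "\<forall>\<^sub>F N' in sequentially. (\<integral>x. indicator (bounded_part M n N') x * ?h x \<partial>\<mu>)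
          \<le> ent (itin (first_letter N) n) + real n * (?S + 2 * sqrt (prob (shift_space M - bounded_part M 1 N')))"
        using eventually_ge_at_top[of N]
      proof eventually_elim
        case (elim N')
        note sN = simple_first_letter
        have "(\<integral>x. indicator (bounded_part M n N') x * ?h x \<partial>\<mu>) \<le> ent (itin (first_letter N') n)"
          by (rule ent_itin_ge_gibbs[OF K int n])
        also have "\<dots> \<le> ent (itin (first_letter N) n)
            + real n * (ent (\<lambda>x. (first_letter N' x, first_letter N x)) - ent (first_letter N))"
          by (intro ent_itin_le sN)
        also have "ent (\<lambda>x. (first_letter N' x, first_letter N x)) = ent (first_letter N')"
          using elim by (intro ent_eq_of_determined simple_function_Pair sN) (auto simp: first_letter_def)
        also have "ent (first_letter N') - ent (first_letter N)
            \<le> ?S + 2 * sqrt (prob (shift_space M - bounded_part M 1 N'))"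
        proof -
          have "(\<Sum>i\<in>{N..<N'}. - (prob (cylinder M [i]) * ln (prob (cylinder M [i])))) \<le> (\<Sum>i\<in>{N..<N'}. s i)"
            by (intro sum_mono eta_le)
          also have "\<dots> = (\<Sum>i<N' - N. s (i + N))"
            using sum.shift_bounds_nat_ivl[of s 0 N "N' - N"] elim by (simp add: lessThan_atLeast0)
          also have "\<dots> \<le> ?S" using s s0 by (intro sum_le_suminf) (auto simp: summable_iff_shift)
          finally show ?thesis using ent_first_letter_diff[OF elim] by simp
        qed
        finally show ?case by (simp add: mult_left_mono)
      qed
      ultimately have "(\<integral>x. ?h x \<partial>\<mu>) \<le> ent (itin (first_letter N) n) + real n * (?S + 2 * sqrt 0)"
        using tendsto_le[OF sequentially_bot] by blast
      then show ?thesis using integrable_phi_initial(1)[OF int n] prob_space by simp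
    qed
    have bnd: "pressure - (\<integral>x. f n x \<partial>\<mu>) / real n - (ln K + C) / real n \<le> ent (itin (first_letter N) n) / real n + ?S"
      if n: "n \<ge> 1" for n
    proof -
      have "real n * pressure - (\<integral>x. f n x \<partial>\<mu>) - (ln K + C) \<le> ent (itin (first_letter N) n) + real n * ?S"
        using step[OF n] integrable_phi_initial(2)[OF int n] by (simp add: abs_le_iff)
      then have "(real n * pressure - (\<integral>x. f n x \<partial>\<mu>) - (ln K + C)) / real n
          \<le> (ent (itin (first_letter N) n) + real n * ?S) / real n"
        by (rule divide_right_mono) simp
      moreover have "n \<noteq> 0" using n by auto
      ultimately show ?thesis by (simp add: add_divide_distrib diff_divide_distrib)
    qed
    have "(\<lambda>n. pressure - (\<integral>x. f n x \<partial>\<mu>) / real n - (ln K + C) / real n) \<longlonglongrightarrow> pressure - mean - 0"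
      by (intro tendsto_diff tendsto_const mean_properties(1)[OF int] lim_const_over_n)
    moreover have "(\<lambda>n. ent (itin (first_letter N) n) / real n + ?S) \<longlonglongrightarrow> hent (first_letter N) + ?S"
      by (intro tendsto_add tendsto_const hent_tendsto simple_first_letter)
    ultimately have "pressure - mean - 0 \<le> hent (first_letter N) + ?S"
      by (rule LIMSEQ_le) (use bnd in blast)
    then show ?thesis by simp
  qed
  show "ereal (pressure - mean) \<le> ks_entropy \<mu> shift"
  proof (rule ereal_le_epsilon2)
    fix e :: real assume e: "e > 0"
    have "(\<lambda>N. \<Sum>i. s (i + N)) \<longlonglongrightarrow> 0" using suminf_exist_split2[OF s] .
    then have "\<forall>\<^sub>F N in sequentially. (\<Sum>i. s (i + N)) < e" using e by (intro order_tendstoD)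
    then obtain N where "(\<Sum>i. s (i + N)) < e" by (auto simp: eventually_sequentially)
    then have "pressure - mean \<le> hent (first_letter N) + e" using main[of N] by simp
    then have "ereal (pressure - mean) \<le> ereal (hent (first_letter N)) + ereal e" by simp
    also have "\<dots> \<le> ks_entropy \<mu> shift + ereal e"
      unfolding ks_entropy_eq by (intro add_right_mono SUP_upper) auto
    finally show "ereal (pressure - mean) \<le> ks_entropy \<mu> shift + ereal e" .
  qed
qed

end

section \<open>Ergodicity\<close>

lemma funpow_shift_vimage_sets [simp]:
  "A \<in> sets (shift_borel M) \<Longrightarrow> (shift ^^ n) -` A \<inter> shift_space M \<in> sets (shift_borel M)"
  using measurable_sets[OF measurable_funpow_shift[of n M], of A] by simp

text \<open>By invariance the last letter has the same distribution as the first, so each end leaves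
  the range below \<open>N\<close> with the same probability.\<close>

lemma (in invariant_measure) prob_restrict_ends:
  assumes S: "S \<subseteq> words A n" and n: "n \<ge> 1"
  shows "prob (cylinders M S) \<le> prob (cylinders M {w\<in>S. hd w < N \<and> last w < N}) + 2 * prob (shift_space M - bounded_part M 1 N)"
proof -
  let ?S' = "{w\<in>S. hd w < N \<and> last w < N}" and ?T = "shift_space M - bounded_part M 1 N"
  let ?U = "(shift ^^ (n - 1)) -` ?T \<inter> shift_space M"
  have S': "?S' \<subseteq> words A n" using S by auto
  have T: "?T \<in> sets (shift_borel M)" by auto
  have U: "?U \<in> sets (shift_borel M)"
    using measurable_sets[OF measurable_funpow_shift[of "n - 1" M] T] by simp
  have "cylinders M S \<subseteq> cylinders M ?S' \<union> (?T \<union> ?U)"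
  proof
    fix x assume "x \<in> cylinders M S"
    then have x: "x \<in> shift_space M" "initial n x \<in> S" using mem_cylinders_words[OF S] by auto
    show "x \<in> cylinders M ?S' \<union> (?T \<union> ?U)"
    proof (cases "x 0 < N \<and> x (n - 1) < N")
      case True
      then have "initial n x \<in> ?S'" using x n by (simp add: hd_initial last_initial)
      then show ?thesis using mem_cylinders_words[OF S'] x by auto
    next
      case False
      then have "x \<in> ?T \<or> x \<in> ?U"
        using x funpow_shift_in[OF x(1), of "n - 1"] by (auto simp: bounded_part_def funpow_shift)
      then show ?thesis by blast
    qed
  qed
  then have "prob (cylinders M S) \<le> prob (cylinders M ?S' \<union> (?T \<union> ?U))"
    using T U by (intro finite_measure_mono) (auto simp: sets_eq)
  also have "\<dots> \<le> prob (cylinders M ?S') + prob (?T \<union> ?U)"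
    using T U by (intro measure_Un_le) (auto simp: sets_eq)
  also have "prob (?T \<union> ?U) \<le> prob ?T + prob ?U"
    using T U by (intro measure_Un_le) (auto simp: sets_eq)
  also have "prob ?U = prob ?T" by (rule prob_funpow_shift[OF T])
  finally show ?thesis by simp
qed

locale gibbs_measure = potential_measure M f C \<mu> for M f C \<mu> +
  fixes K :: real
  assumes K_pos: "0 < K"
    and gibbs_upper: "\<And>u. prob (cylinder M u) \<le> K * weight u * exp (- (real (length u) * pressure))"
    and gibbs_lower: "\<And>b c. \<exists>k>0. \<forall>u. u \<noteq> [] \<longrightarrow> hd u = b \<longrightarrow> last u = c \<longrightarrow>
      k * weight u * exp (- (real (length u) * pressure)) \<le> prob (cylinder M u)"
begin

text \<open>Filling the gap with all words of length \<open>k\<close> from a successor of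
  \<open>b\<close> to a predecessor of \<open>c\<close> gives words with ends \<open>a\<close> and
  \<open>d\<close>. The lower Gibbs bound is applied to these only, so its constant depends on the
  outer ends; \<open>u\<close> and \<open>v\<close> are estimated by the uniform upper
  bound.\<close>

lemma mixing_for_ends:
  "\<exists>c4>0. \<exists>k0. \<forall>k\<ge>k0. \<forall>u v. u \<noteq> [] \<longrightarrow> v \<noteq> [] \<longrightarrow> hd u = a \<longrightarrow> last u = b \<longrightarrow> hd v = c \<longrightarrow> last v = d \<longrightarrow>
    c4 * (prob (cylinder M u) * prob (cylinder M v)) \<le> prob (cylinder M u \<inter> (shift ^^ (length u + k)) -` cylinder M v)"
proof -
  obtain p where p: "M b p = 1" using ex_succ by blast
  obtain q where q: "M q c = 1" using ex_pred by blast
  obtain c0 n0 where c0: "c0 > 0" and btw: "\<And>n. n \<ge> n0 \<Longrightarrow> \<exists>N0. \<forall>N\<ge>N0. c0 * exp (real n * pressure) \<le> between {..<N} p q n"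
    using between_ge[of p q] by blast
  obtain kl where kl: "kl > 0" and low: "\<forall>u. u \<noteq> [] \<longrightarrow> hd u = a \<longrightarrow> last u = d \<longrightarrow>
      kl * weight u * exp (- (real (length u) * pressure)) \<le> prob (cylinder M u)"
    using gibbs_lower[of a d] by blast
  \<comment> \<open>\<open>exp (- (2 * slack))\<close> for the two junctions, \<open>c0\<close> for
    the weight of the fillings, and \<open>K * K\<close> for the upper bounds on \<open>u\<close>
    and \<open>v\<close>.\<close>
  define c4 where "c4 = kl * exp (- (2 * slack)) * c0 / (K * K)"
  have c4: "c4 > 0" using kl c0 K_pos by (simp add: c4_def)
  show ?thesis
  proof (rule exI[of _ c4], rule conjI[OF c4], rule exI[of _ "max 1 n0"], intro allI impI)
    fix k and u v :: "nat list"
    assume k: "max 1 n0 \<le> k" and uv: "u \<noteq> []" "v \<noteq> []" "hd u = a" "last u = b" "hd v = c" "last v = d"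
    obtain N where N: "c0 * exp (real k * pressure) \<le> between {..<N} p q k" using btw[of k] k by auto
    define W where "W = {z \<in> words {..<N} k. hd z = p \<and> last z = q}"
    have W: "finite W" "W \<subseteq> words {..<N} k" by (auto simp: W_def)
    have Wne: "z \<noteq> []" "length z = k" if "z \<in> W" for z using that k by (auto simp: W_def words_def)
    have Wlt: "x < N" if "z \<in> W" "x \<in> set z" for x z
      using that by (auto simp: W_def words_def)
    have between_W: "between {..<N} p q k = (\<Sum>z\<in>W. weight z)"
      unfolding between_def wsum_def W_def by (rule sum.mono_neutral_cong_right) auto
    define S where "S = (\<lambda>z. u @ z @ v) ` W"
    define l where "l = length u + k + length v"
    have S: "finite S" "S \<subseteq> words (set u \<union> {..<N} \<union> set v) l"
      using W(1) Wlt Wne(2) by (auto simp: S_def words_def l_def)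
    have inj: "inj_on (\<lambda>z. u @ z @ v) W" by (auto simp: inj_on_def)
    have wt: "weight u * weight v * weight z \<le> exp (2 * slack) * weight (u @ z @ v)" if z: "z \<in> W" for z
    proof -
      have zz: "hd z = p" "last z = q" "z \<noteq> []" using z Wne by (auto simp: W_def)
      have "weight z * weight v \<le> exp slack * weight (z @ v)"
        using zz q uv by (intro weight_append_ge) auto
      then have "weight u * (weight z * weight v) \<le> weight u * (exp slack * weight (z @ v))"
        by (intro mult_left_mono) auto
      also have "\<dots> = exp slack * (weight u * weight (z @ v))" by simp
      also have "\<dots> \<le> exp slack * (exp slack * weight (u @ z @ v))"
        using zz p uv by (intro mult_left_mono weight_append_ge) auto
      finally have "weight u * (weight z * weight v) \<le> exp slack * exp slack * weight (u @ z @ v)"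
        by (simp only: mult.assoc)
      moreover have "exp (2 * slack) = exp slack * exp slack" by (simp flip: exp_add)
      ultimately show ?thesis by (simp only: mult_ac)
    qed
    have ex: "exp (- (real l * pressure)) * exp (real k * pressure)
        = exp (- (real (length u) * pressure)) * exp (- (real (length v) * pressure))"
      by (simp add: l_def algebra_simps flip: exp_add)
    let ?G = "\<lambda>w. weight w * exp (- (real (length w) * pressure))"
    have "prob (cylinder M u) * prob (cylinder M v) \<le> (K * ?G u) * (K * ?G v)"
      using gibbs_upper[of u] gibbs_upper[of v] K_pos by (intro mult_mono) (auto simp: mult_ac)
    then have "c4 * (prob (cylinder M u) * prob (cylinder M v)) \<le> c4 * ((K * ?G u) * (K * ?G v))"
      using c4 by (intro mult_left_mono) auto
    also have "\<dots> = kl * exp (- (2 * slack)) * (weight u * weight v) * exp (- (real l * pressure)) * (c0 * exp (real k * pressure))"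
      using K_pos ex by (simp add: c4_def field_simps)
    also have "\<dots> \<le> kl * exp (- (2 * slack)) * (weight u * weight v) * exp (- (real l * pressure)) * between {..<N} p q k"
      using N kl by (intro mult_left_mono) auto
    also have "\<dots> = (\<Sum>z\<in>W. kl * exp (- (2 * slack)) * exp (- (real l * pressure)) * (weight u * weight v * weight z))"
      unfolding between_W sum_distrib_left by (intro sum.cong refl) (simp only: mult_ac)
    also have "\<dots> \<le> (\<Sum>z\<in>W. kl * exp (- (2 * slack)) * exp (- (real l * pressure)) * (exp (2 * slack) * weight (u @ z @ v)))"
      using kl by (intro sum_mono mult_left_mono wt) auto
    also have "\<dots> = (\<Sum>z\<in>W. kl * weight (u @ z @ v) * exp (- (real l * pressure)))"
    proof (rule sum.cong[OF refl])
      fix z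
      have "exp (- (2 * slack)) * exp (2 * slack) = 1" by (simp flip: exp_add)
      moreover have "kl * exp (- (2 * slack)) * exp (- (real l * pressure)) * (exp (2 * slack) * weight (u @ z @ v))
          = kl * weight (u @ z @ v) * exp (- (real l * pressure)) * (exp (- (2 * slack)) * exp (2 * slack))"
        by (simp only: mult_ac)
      ultimately show "kl * exp (- (2 * slack)) * exp (- (real l * pressure)) * (exp (2 * slack) * weight (u @ z @ v))
          = kl * weight (u @ z @ v) * exp (- (real l * pressure))"
        by simp
    qed
    also have "\<dots> \<le> (\<Sum>z\<in>W. prob (cylinder M (u @ z @ v)))"
    proof (rule sum_mono)
      fix z assume z: "z \<in> W"
      have "real (length (u @ z @ v)) = real l" using Wne[OF z] by (simp add: l_def)
      moreover have "hd (u @ z @ v) = a" "last (u @ z @ v) = d" "u @ z @ v \<noteq> []" using uv by auto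
      ultimately show "kl * weight (u @ z @ v) * exp (- (real l * pressure)) \<le> prob (cylinder M (u @ z @ v))"
        using low by metis
    qed
    also have "\<dots> = (\<Sum>w\<in>S. prob (cylinder M w))" unfolding S_def by (simp add: sum.reindex[OF inj])
    also have "\<dots> = prob (cylinders M S)" by (rule prob_cylinders[OF S, symmetric])
    also have "\<dots> \<le> prob (cylinder M u \<inter> (shift ^^ (length u + k)) -` cylinder M v)"
    proof (rule finite_measure_mono)
      show "cylinders M S \<subseteq> cylinder M u \<inter> (shift ^^ (length u + k)) -` cylinder M v"
      proof
        fix x assume "x \<in> cylinders M S"
        then obtain z where z: "z \<in> W" "x \<in> cylinder M ((u @ z) @ v)" by (auto simp: cylinders_def S_def)
        then have "x \<in> cylinder M (u @ z)" "(shift ^^ length (u @ z)) x \<in> cylinder M v"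
          unfolding cylinder_append[of M "u @ z"] by auto
        then show "x \<in> cylinder M u \<inter> (shift ^^ (length u + k)) -` cylinder M v"
          using Wne[OF z(1)] by (auto simp: cylinder_append[of M u])
      qed
      have "(shift ^^ (length u + k)) -` cylinder M v \<inter> shift_space M \<in> sets (shift_borel M)"
        by simp
      moreover have "cylinder M u \<inter> (shift ^^ (length u + k)) -` cylinder M v
          = cylinder M u \<inter> ((shift ^^ (length u + k)) -` cylinder M v \<inter> shift_space M)"
        using cylinder_subset by blast
      ultimately show "cylinder M u \<inter> (shift ^^ (length u + k)) -` cylinder M v \<in> events"
        by (simp add: sets_eq sets.Int)
    qed
    finally show "c4 * (prob (cylinder M u) * prob (cylinder M v)) \<le> prob (cylinder M u \<inter> (shift ^^ (length u + k)) -` cylinder M v)" .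
  qed
qed

text \<open>Finitely many quadruples of end letters can share one constant and one gap
  length.\<close>

lemma mixing_for_finite_ends:
  assumes F: "finite F"
  shows "\<exists>c4>0. \<exists>k. \<forall>u v. u \<noteq> [] \<longrightarrow> v \<noteq> [] \<longrightarrow> {hd u, last u, hd v, last v} \<subseteq> F \<longrightarrow>
    c4 * (prob (cylinder M u) * prob (cylinder M v)) \<le> prob (cylinder M u \<inter> (shift ^^ (length u + k)) -` cylinder M v)"
proof -
  let ?P = "\<lambda>c4 k u v. c4 * (prob (cylinder M u) * prob (cylinder M v)) \<le> prob (cylinder M u \<inter> (shift ^^ (length u + k)) -` cylinder M v)"
  have "\<forall>e. \<exists>c4 k0. c4 > 0 \<and> (\<forall>k\<ge>k0. \<forall>u v. u \<noteq> [] \<longrightarrow> v \<noteq> [] \<longrightarrow> (hd u, last u, hd v, last v) = e \<longrightarrow> ?P c4 k u v)"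
  proof
    fix e :: "nat \<times> nat \<times> nat \<times> nat"
    obtain a b c d where e: "e = (a, b, c, d)" by (cases e) auto
    from mixing_for_ends[of a b c d] show "\<exists>c4 k0. c4 > 0 \<and> (\<forall>k\<ge>k0. \<forall>u v. u \<noteq> [] \<longrightarrow> v \<noteq> [] \<longrightarrow> (hd u, last u, hd v, last v) = e \<longrightarrow> ?P c4 k u v)"
      unfolding e prod.inject by blast
  qed
  then obtain c4 k0 where c4: "\<And>e. c4 e > (0::real)"
    and mx: "\<And>e k u v. k \<ge> k0 e \<Longrightarrow> u \<noteq> [] \<Longrightarrow> v \<noteq> [] \<Longrightarrow> (hd u, last u, hd v, last v) = e \<Longrightarrow> ?P (c4 e) k u v"
    by metis
  let ?F4 = "F \<times> F \<times> F \<times> F"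
  have fin: "finite ?F4" using F by auto
  define c where "c = Min (insert 1 (c4 ` ?F4))"
  define k where "k = (\<Sum>e\<in>?F4. k0 e)"
  have c: "c > 0" unfolding c_def using fin c4 by auto
  show ?thesis
  proof (rule exI[of _ c], rule conjI[OF c], rule exI[of _ k], intro allI impI)
    fix u v :: "nat list" assume uv: "u \<noteq> []" "v \<noteq> []" "{hd u, last u, hd v, last v} \<subseteq> F"
    let ?e = "(hd u, last u, hd v, last v)"
    have e: "?e \<in> ?F4" using uv by auto
    then have "k0 ?e \<le> k" unfolding k_def using fin by (intro member_le_sum) auto
    moreover have "c \<le> c4 ?e" unfolding c_def using fin e by (intro Min_le) auto
    then have "c * (prob (cylinder M u) * prob (cylinder M v)) \<le> c4 ?e * (prob (cylinder M u) * prob (cylinder M v))"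
      by (intro mult_right_mono) auto
    ultimately show "?P c k u v" using mx[of ?e k u v] uv by fastforce
  qed
qed

text \<open>By hypothesis almost every point of \<open>E\<close> stays in \<open>E\<close>. If
  \<open>E\<close> and its complement \<open>F\<close> both had positive measure, both could be
  approximated by cylinders with end letters in a finite set, and the mixing bound would produce a
  positive measure of points that pass from \<open>E\<close> to \<open>F\<close>.\<close>

lemma ergodic:
  assumes E: "E \<in> sets (shift_borel M)" and inv: "prob (E - shift -` E) = 0"
  shows "prob E = 0 \<or> prob E = 1"
proof (rule ccontr)
  assume "\<not> (prob E = 0 \<or> prob E = 1)"
  then have E01: "0 < prob E" "prob E < 1" using zero_less_measure_iff prob_le_1[of E] by (auto simp: less_le)
  define F where "F = shift_space M - E"
  have Fs: "F \<in> sets (shift_borel M)" using E by (auto simp: F_def)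
  have Esub: "E \<subseteq> shift_space M" using sets.sets_into_space[OF E] by simp
  have "prob F = 1 - prob E" using prob_compl[of E] E by (simp add: F_def sets_eq)
  \<comment> \<open>Of a measure of at least \<open>6 * e\<close>, less than
    \<open>d \<le> e\<close> is lost by the approximation and less than \<open>2 * e\<close> by
    restricting the end letters; more than \<open>e\<close> remains.\<close>
  define e where "e = min (prob E) (prob F) / 6"
  have e: "e > 0" "6 * e \<le> prob E" "6 * e \<le> prob F" using E01 \<open>prob F = 1 - prob E\<close> by (auto simp: e_def)
  obtain N0 where N0: "prob (shift_space M - bounded_part M 1 N0) < e"
    using eventually_bounded_part[OF e(1), of 1] by (auto simp: eventually_sequentially)
  obtain c4 k where c4: "c4 > 0" and mx: "\<And>u v. u \<noteq> [] \<Longrightarrow> v \<noteq> [] \<Longrightarrow> {hd u, last u, hd v, last v} \<subseteq> {..<N0} \<Longrightarrow>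
    c4 * (prob (cylinder M u) * prob (cylinder M v)) \<le> prob (cylinder M u \<inter> (shift ^^ (length u + k)) -` cylinder M v)"
    using mixing_for_finite_ends[of "{..<N0}"] by auto
  \<comment> \<open>The two approximation errors together must stay below the mixing bound
    \<open>c4 * (e * e)\<close>.\<close>
  define d where "d = min e (c4 * (e * e) / 2)"
  have d: "d > 0" "d \<le> e" "2 * d \<le> c4 * (e * e)" using e c4 by (auto simp: d_def)
  have approx: "\<exists>n\<ge>1. \<exists>N S. S \<subseteq> words {..<N} n \<and> prob (A - cylinders M S \<union> (cylinders M S - A)) < d"
    if A: "A \<in> sets (shift_borel M)" for A
  proof -
    have "\<forall>\<^sub>F n in sequentially. \<forall>\<^sub>F N in sequentially. \<exists>S\<subseteq>words {..<N} n.
        \<forall>\<rho>\<in>{\<mu>}. measure \<rho> (A - cylinders M S \<union> (cylinders M S - A)) < d"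
      using A d(1) shift_measure_axioms by (intro cylinder_approximation) auto
    with eventually_ge_at_top[of 1] have "\<forall>\<^sub>F n in sequentially. n \<ge> 1 \<and> (\<exists>N. \<exists>S\<subseteq>words {..<N} n.
        prob (A - cylinders M S \<union> (cylinders M S - A)) < d)"
    proof eventually_elim
      case (elim n)
      from eventually_happens[OF elim(2)] show ?case using elim(1) by auto
    qed
    from eventually_happens[OF this] show ?thesis by auto
  qed
  obtain n N S where S: "n \<ge> 1" "S \<subseteq> words {..<N} n" "prob (E - cylinders M S \<union> (cylinders M S - E)) < d"
    using approx[OF E] by blast
  obtain m N' V where V: "m \<ge> 1" "V \<subseteq> words {..<N'} m" "prob (F - cylinders M V \<union> (cylinders M V - F)) < d"
    using approx[OF Fs] by blast
  define S' where "S' = {w\<in>S. hd w < N0 \<and> last w < N0}"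
  define V' where "V' = {w\<in>V. hd w < N0 \<and> last w < N0}"
  have S': "finite S'" "S' \<subseteq> words {..<N} n" "S' \<subseteq> S"
    using S(2) finite_subset[OF S(2)] by (auto simp: S'_def)
  have V': "finite V'" "V' \<subseteq> words {..<N'} m" "V' \<subseteq> V"
    using V(2) finite_subset[OF V(2)] by (auto simp: V'_def)
  have big: "e \<le> prob (cylinders M T')"
    if T: "l \<ge> 1" "T \<subseteq> words A l" "prob (G - cylinders M T \<union> (cylinders M T - G)) < d" "6 * e \<le> prob G"
      "G \<in> sets (shift_borel M)" "T' = {w\<in>T. hd w < N0 \<and> last w < N0}" for G T T' A l
  proof -
    have "prob G \<le> prob (cylinders M T \<union> (G - cylinders M T \<union> (cylinders M T - G)))"
      using T by (intro finite_measure_mono) (auto simp: sets_eq)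
    also have "\<dots> \<le> prob (cylinders M T) + prob (G - cylinders M T \<union> (cylinders M T - G))"
      using T by (intro measure_Un_le) (auto simp: sets_eq)
    also have "prob (cylinders M T) \<le> prob (cylinders M T') + 2 * prob (shift_space M - bounded_part M 1 N0)"
      unfolding T(6) by (rule prob_restrict_ends[OF T(2,1)])
    finally show ?thesis using T(3,4) N0 d(2) e(1) by linarith
  qed
  have mB: "cylinders M S - E \<in> events" "(shift ^^ (n + k)) -` (cylinders M V - F) \<inter> shift_space M \<in> events"
    "E \<inter> ((shift ^^ (n + k)) -` F \<inter> shift_space M) \<in> events"
  proof -
    have "cylinders M V - F \<in> sets (shift_borel M)" using Fs by simp
    then show "(shift ^^ (n + k)) -` (cylinders M V - F) \<inter> shift_space M \<in> events"
      unfolding sets_eq by (rule funpow_shift_vimage_sets)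
    show "E \<inter> ((shift ^^ (n + k)) -` F \<inter> shift_space M) \<in> events"
      unfolding sets_eq by (intro sets.Int E funpow_shift_vimage_sets Fs)
    show "cylinders M S - E \<in> events" unfolding sets_eq using E by simp
  qed
  have "e \<le> prob (cylinders M S')" by (rule big[OF S e(2) E S'_def])
  moreover have "e \<le> prob (cylinders M V')" by (rule big[OF V e(3) Fs V'_def])
  ultimately have "e * e \<le> prob (cylinders M S') * prob (cylinders M V')"
    using e by (intro mult_mono) auto
  then have "c4 * (e * e) \<le> c4 * (prob (cylinders M S') * prob (cylinders M V'))"
    using c4 by (intro mult_left_mono) auto
  also have "\<dots> = (\<Sum>u\<in>S'. \<Sum>v\<in>V'. c4 * (prob (cylinder M u) * prob (cylinder M v)))"
    unfolding prob_cylinders[OF S'(1,2)] prob_cylinders[OF V'(1,2)] sum_product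
    by (simp add: sum_distrib_left)
  also have "\<dots> \<le> (\<Sum>u\<in>S'. \<Sum>v\<in>V'. prob (cylinder M u \<inter> (shift ^^ (n + k)) -` cylinder M v))"
  proof (intro sum_mono)
    fix u v assume uv: "u \<in> S'" "v \<in> V'"
    then have "length u = n" "length v = m" using S'(2) V'(2) by (auto simp: words_def)
    moreover from this have "u \<noteq> []" "v \<noteq> []" using S(1) V(1) by auto
    moreover have "{hd u, last u, hd v, last v} \<subseteq> {..<N0}" using uv by (auto simp: S'_def V'_def)
    ultimately show "c4 * (prob (cylinder M u) * prob (cylinder M v)) \<le> prob (cylinder M u \<inter> (shift ^^ (n + k)) -` cylinder M v)"
      using mx[of u v] by simp
  qed
  also have "\<dots> = (\<Sum>p\<in>S' \<times> V'. prob (cylinder M (fst p) \<inter> (shift ^^ (n + k)) -` cylinder M (snd p)))"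
    by (simp add: sum.cartesian_product case_prod_unfold)
  also have "\<dots> = prob (\<Union>p\<in>S' \<times> V'. cylinder M (fst p) \<inter> (shift ^^ (n + k)) -` cylinder M (snd p))"
  proof (rule finite_measure_finite_Union[symmetric])
    show "finite (S' \<times> V')" using S' V' by auto
    have "cylinder M u \<inter> (shift ^^ (n + k)) -` cylinder M v \<in> events" for u v
    proof -
      have "(shift ^^ (n + k)) -` cylinder M v \<inter> shift_space M \<in> sets (shift_borel M)"
        by simp
      moreover have "cylinder M u \<inter> (shift ^^ (n + k)) -` cylinder M v
          = cylinder M u \<inter> ((shift ^^ (n + k)) -` cylinder M v \<inter> shift_space M)"
        using cylinder_subset by blast
      ultimately show ?thesis by (simp add: sets_eq sets.Int)
    qed
    then show "(\<lambda>p. cylinder M (fst p) \<inter> (shift ^^ (n + k)) -` cylinder M (snd p)) ` (S' \<times> V') \<subseteq> events" by auto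
    show "disjoint_family_on (\<lambda>p. cylinder M (fst p) \<inter> (shift ^^ (n + k)) -` cylinder M (snd p)) (S' \<times> V')"
    proof -
      have "length u = n" if "u \<in> S'" for u using that S'(2) by (auto simp: words_def)
      moreover have "length v = m" if "v \<in> V'" for v using that V'(2) by (auto simp: words_def)
      ultimately show ?thesis by (auto simp: disjoint_family_on_def cylinder_iff)
    qed
  qed
  also have "\<dots> \<le> prob ((cylinders M S - E) \<union> ((shift ^^ (n + k)) -` (cylinders M V - F) \<inter> shift_space M) \<union> (E \<inter> ((shift ^^ (n + k)) -` F \<inter> shift_space M)))"
  proof (rule finite_measure_mono)
    show "(\<Union>p\<in>S' \<times> V'. cylinder M (fst p) \<inter> (shift ^^ (n + k)) -` cylinder M (snd p))
        \<subseteq> (cylinders M S - E) \<union> ((shift ^^ (n + k)) -` (cylinders M V - F) \<inter> shift_space M) \<union> (E \<inter> ((shift ^^ (n + k)) -` F \<inter> shift_space M))"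
    proof
      fix x assume "x \<in> (\<Union>p\<in>S' \<times> V'. cylinder M (fst p) \<inter> (shift ^^ (n + k)) -` cylinder M (snd p))"
      then have "x \<in> cylinders M S" "(shift ^^ (n + k)) x \<in> cylinders M V" "x \<in> shift_space M"
        using S'(3) V'(3) by (auto simp: cylinders_def) (simp add: cylinder_iff)
      then show "x \<in> (cylinders M S - E) \<union> ((shift ^^ (n + k)) -` (cylinders M V - F) \<inter> shift_space M) \<union> (E \<inter> ((shift ^^ (n + k)) -` F \<inter> shift_space M))"
        by blast
    qed
    show "(cylinders M S - E) \<union> ((shift ^^ (n + k)) -` (cylinders M V - F) \<inter> shift_space M) \<union> (E \<inter> ((shift ^^ (n + k)) -` F \<inter> shift_space M)) \<in> events"
      by (intro sets.Un mB)
  qed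
  also have "\<dots> \<le> prob (cylinders M S - E) + prob ((shift ^^ (n + k)) -` (cylinders M V - F) \<inter> shift_space M)
      + prob (E \<inter> ((shift ^^ (n + k)) -` F \<inter> shift_space M))"
    by (intro order_trans[OF measure_Un_le] add_right_mono measure_Un_le sets.Un mB)
  also have "prob ((shift ^^ (n + k)) -` (cylinders M V - F) \<inter> shift_space M) = prob (cylinders M V - F)"
    using Fs by (intro prob_funpow_shift) auto
  also have "prob (E \<inter> ((shift ^^ (n + k)) -` F \<inter> shift_space M)) = 0"
  proof -
    \<comment> \<open>A point that passes from \<open>E\<close> to \<open>F\<close> in
      \<open>j + 1\<close> steps either leaves \<open>E\<close> at the first step, which is a null
      event, or its image passes from \<open>E\<close> to \<open>F\<close> in \<open>j\<close>
      steps.\<close>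
    have null: "prob (E \<inter> ((shift ^^ j) -` F \<inter> shift_space M)) = 0" for j
    proof (induction j)
      case 0
      have "E \<inter> ((shift ^^ 0) -` F \<inter> shift_space M) = {}" by (auto simp: F_def)
      then show ?case by (simp only: measure_empty)
    next
      case (Suc j)
      let ?B = "E \<inter> ((shift ^^ j) -` F \<inter> shift_space M)"
      have B: "?B \<in> sets (shift_borel M)"
        using measurable_sets[OF measurable_funpow_shift[of j M] Fs] E by simp
      have sE: "shift -` E \<inter> shift_space M \<in> sets (shift_borel M)"
        using measurable_sets[OF measurable_shift E] by simp
      have "E - shift -` E = E - (shift -` E \<inter> shift_space M)" using Esub by auto
      then have Em: "E - shift -` E \<in> sets (shift_borel M)" using E sE by simp
      have sB: "shift -` ?B \<inter> shift_space M \<in> sets (shift_borel M)"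
        using measurable_sets[OF measurable_shift B] by simp
      have "E \<inter> ((shift ^^ Suc j) -` F \<inter> shift_space M) \<subseteq> (E - shift -` E) \<union> (shift -` ?B \<inter> shift_space M)"
        by (auto simp: funpow_swap1 shift_in)
      then have "prob (E \<inter> ((shift ^^ Suc j) -` F \<inter> shift_space M)) \<le> prob ((E - shift -` E) \<union> (shift -` ?B \<inter> shift_space M))"
        using Em sB by (intro finite_measure_mono) (auto simp: sets_eq)
      also have "\<dots> \<le> prob (E - shift -` E) + prob (shift -` ?B \<inter> shift_space M)"
        using Em sB by (intro measure_Un_le) (auto simp: sets_eq)
      also have "\<dots> = 0" using inv invariant[OF B] Suc by simp
      finally show ?case by (intro antisym measure_nonneg)
    qed
    show ?thesis by (rule null)
  qed
  also have "prob (cylinders M S - E) + prob (cylinders M V - F) + 0 < d + d"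
  proof -
    have "prob (cylinders M S - E) \<le> prob (E - cylinders M S \<union> (cylinders M S - E))"
      "prob (cylinders M V - F) \<le> prob (F - cylinders M V \<union> (cylinders M V - F))"
      using E Fs by (intro finite_measure_mono; auto simp: sets_eq)+
    then show ?thesis using S(3) V(3) by simp
  qed
  finally have "c4 * (e * e) < 2 * d" by simp
  then show False using d(3) by simp
qed

end

section \<open>Uniqueness\<close>

text \<open>The set \<open>E\<close> where the density exceeds 1 turns out to be invariant up to a
  null set, so it has \<open>\<nu>\<close>-measure 0 or 1. Measure 1 would give \<open>\<mu>\<close>
  a mass above 1. So the density is at most 1 almost everywhere, and probability measures with
  \<open>\<mu> \<le> \<nu>\<close> are equal.\<close>

lemma absolutely_continuous_invariant_eq:
  assumes mu: "invariant_measure M \<mu>" and nu: "invariant_measure M \<nu>"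
    and erg: "\<And>E. E \<in> sets (shift_borel M) \<Longrightarrow> measure \<nu> (E - shift -` E) = 0 \<Longrightarrow> measure \<nu> E = 0 \<or> measure \<nu> E = 1"
    and ac: "\<And>D. D \<in> sets (shift_borel M) \<Longrightarrow> measure \<nu> D = 0 \<Longrightarrow> measure \<mu> D = 0"
  shows "\<mu> = \<nu>"
proof -
  interpret mu: invariant_measure M \<mu> by fact
  interpret nu: invariant_measure M \<nu> by fact
  have "absolutely_continuous \<nu> \<mu>"
    unfolding absolutely_continuous_def null_sets_def using ac
    by (auto simp: nu.sets_eq mu.sets_eq nu.emeasure_eq_measure mu.emeasure_eq_measure)
  moreover have "sets \<mu> = sets \<nu>" by (simp add: mu.sets_eq nu.sets_eq)
  ultimately obtain g where g: "g \<in> borel_measurable \<nu>" "density \<nu> g = \<mu>"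
    using nu.Radon_Nikodym[of \<mu>] by blast
  have g_sb: "g \<in> borel_measurable (shift_borel M)"
    using g(1) by (simp add: measurable_cong_sets[OF nu.sets_eq refl])
  have em: "emeasure \<mu> A = (\<integral>\<^sup>+x. g x * indicator A x \<partial>\<nu>)" if "A \<in> sets (shift_borel M)" for A
    using that g(1) by (subst g(2)[symmetric], subst emeasure_density) (auto simp: nu.sets_eq)
  define E where "E = {x \<in> shift_space M. g x > 1}"
  have E: "E \<in> sets (shift_borel M)"
  proof -
    have "g -` {1<..} \<inter> space (shift_borel M) \<in> sets (shift_borel M)" using g_sb by (rule measurable_sets) simp
    also have "g -` {1<..} \<inter> space (shift_borel M) = E" by (auto simp: E_def)
    finally show ?thesis .
  qed
  define T where "T = shift -` E \<inter> shift_space M"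
  have T: "T \<in> sets (shift_borel M)" using measurable_sets[OF measurable_shift E] by (simp add: T_def)
  have Esub: "E \<subseteq> shift_space M" by (auto simp: E_def)
  have sym: "measure \<rho> (T - E) = measure \<rho> (E - T)" if "invariant_measure M \<rho>" for \<rho>
  proof -
    interpret invariant_measure M \<rho> by fact
    have "prob (T - E) = prob T - prob (T \<inter> E)" "prob (E - T) = prob E - prob (E \<inter> T)"
      using T E finite_measure_Diff'[of T E] finite_measure_Diff'[of E T] by (auto simp: sets_eq)
    moreover have "prob T = prob E" unfolding T_def by (rule invariant[OF E])
    ultimately show ?thesis by (simp add: Int_commute)
  qed
  \<comment> \<open>The density is at most 1 on \<open>T - E\<close> and exceeds 1 on
    \<open>E - T\<close>. By \<open>sym\<close> the two differences have equal measure, for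
    \<open>\<mu>\<close> as for \<open>\<nu>\<close>, which forces \<open>E - T\<close> to be a null
    set.\<close>
  have le: "emeasure \<mu> (T - E) \<le> emeasure \<nu> (T - E)"
  proof -
    have "emeasure \<mu> (T - E) \<le> (\<integral>\<^sup>+x. indicator (T - E) x \<partial>\<nu>)"
      unfolding em[OF sets.Diff[OF T E]]
      by (intro nn_integral_mono) (auto simp: E_def T_def indicator_def not_less)
    then show ?thesis using T E by (simp add: nu.sets_eq)
  qed
  have "emeasure \<mu> (E - T) \<le> emeasure \<nu> (E - T)"
    using le sym[OF mu] sym[OF nu] by (simp add: mu.emeasure_eq_measure nu.emeasure_eq_measure)
  then have int_le: "(\<integral>\<^sup>+x. g x * indicator (E - T) x \<partial>\<nu>) \<le> (\<integral>\<^sup>+x. indicator (E - T) x \<partial>\<nu>)"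
    unfolding em[OF sets.Diff[OF E T]] using T E by (simp add: nu.sets_eq)
  have null: "measure \<nu> (E - T) = 0"
  proof -
    have meas: "(\<lambda>x. g x * indicator (E - T) x) \<in> borel_measurable \<nu>"
      "(\<lambda>x. indicator (E - T) x :: ennreal) \<in> borel_measurable \<nu>"
      using g(1) E T by (auto simp: nu.sets_eq intro!: borel_measurable_times_ennreal borel_measurable_indicator)
    have fin: "(\<integral>\<^sup>+x. indicator (E - T) x \<partial>\<nu>) \<noteq> \<infinity>"
      using E T by (simp add: nu.sets_eq nu.emeasure_eq_measure)
    have "(\<integral>\<^sup>+x. g x * indicator (E - T) x - indicator (E - T) x \<partial>\<nu>)
        = (\<integral>\<^sup>+x. g x * indicator (E - T) x \<partial>\<nu>) - (\<integral>\<^sup>+x. indicator (E - T) x \<partial>\<nu>)"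
      by (rule nn_integral_diff[OF meas fin]) (auto simp: E_def indicator_def)
    also have "\<dots> = 0"
      by (intro diff_eq_0_ennreal le_less_trans[OF int_le] int_le) (use fin in \<open>simp add: less_top\<close>)
    finally have "AE x in \<nu>. g x * indicator (E - T) x - indicator (E - T) x = 0"
      using meas by (subst (asm) nn_integral_0_iff_AE) auto
    then have "AE x in \<nu>. x \<notin> E - T"
    proof eventually_elim
      case (elim x)
      show ?case
      proof
        assume "x \<in> E - T"
        then have "g x > 1" "g x - 1 = 0" using elim by (auto simp: E_def)
        then show False using ennreal_minus_eq_0 not_less by blast
      qed
    qed
    then have "emeasure \<nu> (E - T) = 0"
      using E T by (subst AE_iff_measurable[symmetric, of _ _ "\<lambda>x. x \<notin> E - T"]) (auto simp: nu.sets_eq E_def)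
    then show ?thesis by (simp add: nu.emeasure_eq_measure)
  qed
  have "E - shift -` E = E - T" using Esub by (auto simp: T_def)
  then have "measure \<nu> E = 0 \<or> measure \<nu> E = 1" using erg[OF E] null by simp
  then have le_all: "emeasure \<mu> A \<le> emeasure \<nu> A" if A: "A \<in> sets (shift_borel M)" for A
  proof
    assume "measure \<nu> E = 0"
    then have "emeasure \<nu> E = 0" by (simp add: nu.emeasure_eq_measure)
    then have "AE x in \<nu>. x \<notin> E"
      using E by (intro AE_I[of _ _ E]) (auto simp: nu.sets_eq)
    then have "AE x in \<nu>. g x * indicator A x \<le> indicator A x"
      using AE_space by eventually_elim (auto simp: E_def indicator_def)
    then have "emeasure \<mu> A \<le> (\<integral>\<^sup>+x. indicator A x \<partial>\<nu>)"
      unfolding em[OF A] by (rule nn_integral_mono_AE)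
    then show ?thesis using A by (simp add: nu.sets_eq)
  next
    assume one: "measure \<nu> E = 1"
    have aeE: "AE x in \<nu>. x \<in> E" using one E by (subst nu.prob_eq_1[symmetric]) (auto simp: nu.sets_eq)
    have "(\<integral>\<^sup>+x. g x \<partial>\<nu>) = emeasure \<mu> (shift_space M)"
      unfolding em[OF shift_space_sets] by (intro nn_integral_cong) auto
    then have total: "(\<integral>\<^sup>+x. g x \<partial>\<nu>) = 1" using mu.emeasure_space_1 by simp
    have one': "(\<integral>\<^sup>+x. 1 \<partial>\<nu>) = 1" using nu.emeasure_space_1 by simp
    have "(\<integral>\<^sup>+x. g x - 1 \<partial>\<nu>) = (\<integral>\<^sup>+x. g x \<partial>\<nu>) - (\<integral>\<^sup>+x. 1 \<partial>\<nu>)"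
    proof (rule nn_integral_diff)
      show "AE x in \<nu>. 1 \<le> g x" using aeE by eventually_elim (auto simp: E_def)
    qed (use g(1) one' in auto)
    then have "(\<integral>\<^sup>+x. g x - 1 \<partial>\<nu>) = 0" using total one' by simp
    then have "AE x in \<nu>. g x - 1 = 0" using g(1) by (subst (asm) nn_integral_0_iff_AE) auto
    with aeE have "AE x in \<nu>. False"
    proof eventually_elim
      case (elim x)
      then show ?case using ennreal_minus_eq_0[of "g x" 1] by (auto simp: E_def not_less[symmetric])
    qed
    then show ?thesis using nu.AE_False by simp
  qed
  show ?thesis
  proof (rule measure_eqI)
    fix A assume "A \<in> sets \<mu>"
    then have A: "A \<in> sets (shift_borel M)" by (simp add: mu.sets_eq)
    have 1: "mu.prob A \<le> nu.prob A" using le_all[OF A] by (simp add: mu.emeasure_eq_measure nu.emeasure_eq_measure)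
    have "mu.prob (shift_space M - A) \<le> nu.prob (shift_space M - A)"
      using le_all[of "shift_space M - A"] A by (simp add: mu.emeasure_eq_measure nu.emeasure_eq_measure)
    then have "nu.prob A \<le> mu.prob A"
      using mu.prob_compl[of A] nu.prob_compl[of A] A by (simp add: mu.sets_eq nu.sets_eq)
    with 1 show "emeasure \<mu> A = emeasure \<nu> A"
      by (simp add: mu.emeasure_eq_measure nu.emeasure_eq_measure)
  qed (simp add: mu.sets_eq nu.sets_eq)
qed

section \<open>Absolute continuity of equilibrium states\<close>

context gibbs_measure
begin

lemma gibbs_lower_finite_ends:
  assumes F: "finite F"
  shows "\<exists>k>0. \<forall>u. u \<noteq> [] \<longrightarrow> hd u \<in> F \<longrightarrow> last u \<in> F \<longrightarrow>
    k * (weight u * exp (- (real (length u) * pressure))) \<le> prob (cylinder M u)"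
proof -
  have "\<forall>b c. \<exists>k>0. \<forall>u. u \<noteq> [] \<longrightarrow> hd u = b \<longrightarrow> last u = c \<longrightarrow>
      k * weight u * exp (- (real (length u) * pressure)) \<le> prob (cylinder M u)"
    using gibbs_lower by blast
  then obtain k where k: "\<And>b c. k b c > (0::real)" "\<And>b c u. u \<noteq> [] \<Longrightarrow> hd u = b \<Longrightarrow> last u = c \<Longrightarrow>
      k b c * weight u * exp (- (real (length u) * pressure)) \<le> prob (cylinder M u)"
    by metis
  define k0 where "k0 = Min (insert 1 ((\<lambda>(b, c). k b c) ` (F \<times> F)))"
  have k0: "k0 > 0" unfolding k0_def using F k(1) by auto
  have "k0 * (weight u * exp (- (real (length u) * pressure))) \<le> prob (cylinder M u)"
    if u: "u \<noteq> []" "hd u \<in> F" "last u \<in> F" for u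
  proof -
    have "k0 \<le> k (hd u) (last u)" unfolding k0_def using F u by (intro Min_le) auto
    then have "k0 * (weight u * exp (- (real (length u) * pressure)))
        \<le> k (hd u) (last u) * (weight u * exp (- (real (length u) * pressure)))"
      by (intro mult_right_mono) auto
    also have "\<dots> \<le> prob (cylinder M u)" using k(2)[OF u(1) refl refl] by (simp add: mult.assoc)
    finally show ?thesis .
  qed
  then show ?thesis using k0 by blast
qed

text \<open>
  Bowen's argument: if \<open>\<rho>\<close> charged a null set of the Gibbs measure, then words carrying definite
  \<open>\<rho>\<close>-measure would have arbitrarily small total weight, which makes the entropy inequality fail.
\<close>

lemma equality_absolutely_continuous:
  assumes rho: "potential_measure M f C \<rho>" and int: "integrable \<rho> (f 1)"
    and eq: "ks_entropy \<rho> shift = ereal (pressure - potential_measure.mean f \<rho>)"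
    and D: "D \<in> sets (shift_borel M)" "prob D = 0"
  shows "measure \<rho> D = 0"
proof (rule ccontr)
  interpret rho: potential_measure M f C \<rho> by fact
  assume "measure \<rho> D \<noteq> 0"
  then have m: "rho.prob D > 0" by (simp add: zero_less_measure_iff)
  define m where "m = rho.prob D"
  have m0: "m > 0" using m by (simp add: m_def)
  obtain N0 where N0: "rho.prob (shift_space M - bounded_part M 1 N0) < m / 8"
    using rho.eventually_bounded_part[of "m / 8" 1] m0 by (auto simp: eventually_sequentially)
  obtain k where k: "k > 0" and low: "\<And>u. u \<noteq> [] \<Longrightarrow> hd u \<in> {..<N0} \<Longrightarrow> last u \<in> {..<N0} \<Longrightarrow>
    k * (weight u * exp (- (real (length u) * pressure))) \<le> prob (cylinder M u)"
    using gibbs_lower_finite_ends[of "{..<N0}"] by auto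
  obtain Kt where Kt: "Kt > 0" "\<And>n. total n \<le> Kt * exp (real n * pressure)" using total_le by blast
  \<comment> \<open>Chosen so that a \<open>\<rho>\<close>-measure of at least \<open>m / 2\<close>
    contributes at most \<open>- (2 * C + Kt + 1)\<close>, which outweighs the constant terms by
    1.\<close>
  define c where "c = exp (1 - 2 / m * (2 * C + Kt + 1))"
  have c: "c > 0" by (simp add: c_def)
  have lnc: "ln c - 1 = - (2 / m * (2 * C + Kt + 1))" by (simp add: c_def)
  \<comment> \<open>The bound \<open>m / 4\<close> leaves the restricted words with
    \<open>\<rho>\<close>-measure at least \<open>m / 2\<close>; the bound \<open>k * c / 2\<close>
    makes the weight term, after division by \<open>c\<close>, smaller than the gain of 1.\<close>
  define d where "d = min (m / 4) (k * c / 2)"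
  have d: "d > 0" "d \<le> m / 4" "d \<le> k * c / 2" using m0 k c by (auto simp: d_def)
  have "\<forall>\<^sub>F n in sequentially. \<forall>\<^sub>F N in sequentially. \<exists>S\<subseteq>words {..<N} n.
      \<forall>\<pi>\<in>{\<mu>, \<rho>}. measure \<pi> (D - cylinders M S \<union> (cylinders M S - D)) < d"
    using D d(1) shift_measure_axioms rho.shift_measure_axioms by (intro cylinder_approximation) auto
  with eventually_ge_at_top[of 1] have "\<forall>\<^sub>F n in sequentially. n \<ge> 1 \<and> (\<exists>N. \<exists>S\<subseteq>words {..<N} n.
      \<forall>\<pi>\<in>{\<mu>, \<rho>}. measure \<pi> (D - cylinders M S \<union> (cylinders M S - D)) < d)"
  proof eventually_elim
    case (elim n)
    from eventually_happens[OF elim(2)] show ?case using elim(1) by auto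
  qed
  from eventually_happens[OF this] obtain n N S where n: "n \<ge> 1" and S: "S \<subseteq> words {..<N} n"
    "prob (D - cylinders M S \<union> (cylinders M S - D)) < d"
    "rho.prob (D - cylinders M S \<union> (cylinders M S - D)) < d"
    by auto
  define S' where "S' = {w\<in>S. hd w < N0 \<and> last w < N0}"
  have S': "finite S'" "S' \<subseteq> words {..<N} n" "S' \<subseteq> S"
    using S(1) finite_subset[OF S(1)] by (auto simp: S'_def)
  have big: "m / 2 \<le> rho.prob (cylinders M S')"
  proof -
    have "rho.prob D \<le> rho.prob (cylinders M S \<union> (D - cylinders M S \<union> (cylinders M S - D)))"
      using D by (intro rho.finite_measure_mono) (auto simp: rho.sets_eq)
    also have "\<dots> \<le> rho.prob (cylinders M S) + rho.prob (D - cylinders M S \<union> (cylinders M S - D))"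
      using D by (intro measure_Un_le) (auto simp: rho.sets_eq)
    also have "rho.prob (cylinders M S) \<le> rho.prob (cylinders M S') + 2 * rho.prob (shift_space M - bounded_part M 1 N0)"
      unfolding S'_def by (rule rho.prob_restrict_ends[OF S(1) n])
    finally show ?thesis using S(3) N0 d(2) m0 by (simp add: m_def)
  qed
  have "k * ((\<Sum>w\<in>S'. weight w) * exp (- (real n * pressure))) \<le> (\<Sum>w\<in>S'. prob (cylinder M w))"
    unfolding sum_distrib_right sum_distrib_left
  proof (rule sum_mono)
    fix w assume w: "w \<in> S'"
    then have "length w = n" "hd w \<in> {..<N0}" "last w \<in> {..<N0}" using S'(2) by (auto simp: words_def S'_def)
    moreover from this have "w \<noteq> []" using n by auto
    ultimately show "k * (weight w * exp (- (real n * pressure))) \<le> prob (cylinder M w)" using low[of w] by simp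
  qed
  also have "\<dots> = prob (cylinders M S')" by (rule prob_cylinders[OF S'(1,2), symmetric])
  also have "\<dots> \<le> prob (D \<union> (D - cylinders M S \<union> (cylinders M S - D)))"
    using D S'(3) by (intro finite_measure_mono) (auto simp: sets_eq cylinders_def)
  also have "\<dots> \<le> prob D + prob (D - cylinders M S \<union> (cylinders M S - D))"
    using D by (intro measure_Un_le) (auto simp: sets_eq)
  also have "\<dots> < k * c / 2" using D(2) S(2) d(3) by simp
  finally have small: "(\<Sum>w\<in>S'. weight w) * exp (- (real n * pressure)) / c < 1 / 2"
    using k c by (simp add: field_simps)
  have "total n * exp (- (real n * pressure)) \<le> Kt" using Kt(2)[of n] by (simp add: exp_minus field_simps)
  moreover have "0 \<le> 2 * C + total n * exp (- (real n * pressure)) + rho.prob (cylinders M S') * (ln c - 1)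
      + (\<Sum>w\<in>S'. weight w) * exp (- (real n * pressure)) / c"
    using S' c n by (intro rho.equality_weight_inequality[OF int eq]) auto
  moreover have "rho.prob (cylinders M S') * (ln c - 1) \<le> m / 2 * (ln c - 1)"
    unfolding lnc using big m0 C_nonneg Kt by (intro mult_right_mono_neg) auto
  moreover have "m / 2 * (ln c - 1) = - (2 * C + Kt + 1)" unfolding lnc using m0 by (simp add: field_simps)
  ultimately show False using small by linarith
qed

end

context potential
begin

text \<open>The case \<open>t = 1\<close> of \<open>equilibrium_state\<close>, in a form that can be
  instantiated with a scaled potential.\<close>

definition is_equilibrium :: "(nat \<Rightarrow> nat) measure \<Rightarrow> bool" where
  "is_equilibrium \<mu> \<longleftrightarrow> \<mu> \<in> invariant_measures M \<and> potential_mean f \<mu> > - \<infinity> \<and>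
     gurevich_pressure M f = ks_entropy \<mu> shift + potential_mean f \<mu>"

lemma is_equilibrium_iff:
  "is_equilibrium \<mu> \<longleftrightarrow> potential_measure M f C \<mu> \<and> integrable \<mu> (f 1) \<and>
    ks_entropy \<mu> shift = ereal (pressure - potential_measure.mean f \<mu>)"
proof -
  have loc: "potential_measure M f C \<mu> \<longleftrightarrow> \<mu> \<in> invariant_measures M"
    unfolding invariant_measures_iff potential_measure_def using potential_axioms by simp
  show ?thesis
  proof (cases "\<mu> \<in> invariant_measures M")
    case True
    then interpret potential_measure M f C \<mu> using loc by simp
    show ?thesis
    proof (cases "integrable \<mu> (f 1)")
      case int: True
      have "ereal pressure = ks_entropy \<mu> shift + ereal mean \<longleftrightarrow> ks_entropy \<mu> shift = ereal (pressure - mean)"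
        by (cases "ks_entropy \<mu> shift") auto
      then show ?thesis
        using True loc int mean_properties(3)[OF int] by (auto simp: is_equilibrium_def gurevich_pressure)
    next
      case False
      then show ?thesis using potential_mean_not_integrable[OF False] by (simp add: is_equilibrium_def)
    qed
  qed (simp add: is_equilibrium_def loc)
qed

theorem ex1_equilibrium:
  assumes sm: "summable (\<lambda>i. exp (phi [i]) * \<bar>phi [i]\<bar>)"
  shows "\<exists>!\<mu>. is_equilibrium \<mu>"
proof -
  obtain \<nu> K where inv: "invariant_measure M \<nu>" and K: "K > 0"
    "\<And>u. measure \<nu> (cylinder M u) \<le> K * weight u * exp (- (real (length u) * pressure))"
    and low: "\<And>b c. \<exists>k>0. \<forall>u. u \<noteq> [] \<longrightarrow> hd u = b \<longrightarrow> last u = c \<longrightarrow>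
      k * weight u * exp (- (real (length u) * pressure)) \<le> measure \<nu> (cylinder M u)"
    using gibbs_measure_exists by blast
  have "potential_measure M f C \<nu>"
    unfolding potential_measure_def using potential_axioms inv by simp
  then interpret nu: potential_measure M f C \<nu> .
  interpret nu: gibbs_measure M f C \<nu> K by unfold_locales (use K low in auto)
  show ?thesis
  proof (rule ex1I[of _ \<nu>])
    show "is_equilibrium \<nu>"
      unfolding is_equilibrium_iff
      using nu.potential_measure_axioms nu.integrable_f1_of_gibbs[OF K sm] nu.equality_of_gibbs[OF K sm] by simp
    fix \<rho> assume "is_equilibrium \<rho>"
    then have rho: "potential_measure M f C \<rho>" "integrable \<rho> (f 1)"
      "ks_entropy \<rho> shift = ereal (pressure - potential_measure.mean f \<rho>)"
      by (auto simp: is_equilibrium_iff)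
    have "invariant_measure M \<rho>" using rho(1) by (simp add: potential_measure_def)
    then show "\<rho> = \<nu>" using inv nu.ergodic nu.equality_absolutely_continuous[OF rho]
      by (rule absolutely_continuous_invariant_eq)
  qed
qed

end

section \<open>Zero temperature limit\<close>

context invariant_measure
begin

text \<open>Hypotheses of the compactness lemma. By invariance the letter after \<open>u\<close> is
  distributed like the first letter, so a tail bound for the first letter gives tightness for all
  words at once.\<close>

lemma sum_snoc_le: "(\<Sum>i<I. prob (cylinder M (u @ [i]))) \<le> prob (cylinder M u)"
  and snoc_tail_le: "prob (cylinder M u) - (\<Sum>i<I. prob (cylinder M (u @ [i]))) \<le> prob (shift_space M - bounded_part M 1 I)"
  and sum_Cons_le: "(\<Sum>i<I. prob (cylinder M (i # u))) \<le> prob (cylinder M u)"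
proof -
  define S where "S = (\<lambda>i. u @ [i]) ` {..<I}"
  have S: "finite S" "S \<subseteq> words (set u \<union> {..<I}) (length u + 1)" by (auto simp: S_def words_def)
  have "(\<Sum>i<I. prob (cylinder M (u @ [i]))) = (\<Sum>w\<in>S. prob (cylinder M w))"
    unfolding S_def by (subst sum.reindex) (auto simp: inj_on_def)
  then have sumS: "(\<Sum>i<I. prob (cylinder M (u @ [i]))) = prob (cylinders M S)"
    by (simp add: prob_cylinders[OF S])
  have "cylinders M S \<subseteq> cylinder M u" by (auto simp: S_def cylinders_def cylinder_append)
  then show "(\<Sum>i<I. prob (cylinder M (u @ [i]))) \<le> prob (cylinder M u)"
    unfolding sumS by (intro finite_measure_mono) auto
  let ?T = "shift_space M - bounded_part M 1 I"
  let ?U = "(shift ^^ length u) -` ?T \<inter> shift_space M"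
  have U: "?U \<in> sets (shift_borel M)" by (intro funpow_shift_vimage_sets) simp
  have "cylinder M u \<subseteq> cylinders M S \<union> ?U"
  proof
    fix x assume x: "x \<in> cylinder M u"
    then have xs: "x \<in> shift_space M" "initial (length u) x = u" by (auto simp: cylinder_iff)
    show "x \<in> cylinders M S \<union> ?U"
    proof (cases "x (length u) < I")
      case True
      have "x \<in> cylinder M (u @ [x (length u)])" using xs by (simp add: cylinder_iff initial_Suc)
      then show ?thesis using True by (auto simp: cylinders_def S_def)
    next
      case False
      then show ?thesis using xs funpow_shift_in[OF xs(1)] by (auto simp: bounded_part_def funpow_shift)
    qed
  qed
  then have "prob (cylinder M u) \<le> prob (cylinders M S \<union> ?U)"
    using U by (intro finite_measure_mono) (auto simp: sets_eq)
  also have "\<dots> \<le> prob (cylinders M S) + prob ?U" using U by (intro measure_Un_le) (auto simp: sets_eq)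
  also have "prob ?U = prob ?T" by (rule prob_funpow_shift) simp
  finally show "prob (cylinder M u) - (\<Sum>i<I. prob (cylinder M (u @ [i]))) \<le> prob ?T" unfolding sumS by simp
  define S2 where "S2 = (\<lambda>i. i # u) ` {..<I}"
  have S2: "finite S2" "S2 \<subseteq> words (set u \<union> {..<I}) (length u + 1)" by (auto simp: S2_def words_def)
  have "(\<Sum>i<I. prob (cylinder M (i # u))) = (\<Sum>w\<in>S2. prob (cylinder M w))"
    unfolding S2_def by (subst sum.reindex) (auto simp: inj_on_def)
  also have "\<dots> = prob (cylinders M S2)" by (rule prob_cylinders[OF S2, symmetric])
  also have "\<dots> \<le> prob (shift -` cylinder M u \<inter> shift_space M)"
    using funpow_shift_vimage_sets[OF cylinder_sets, of 1 M u]
    by (intro finite_measure_mono) (auto simp: S2_def cylinders_def shift_vimage_cylinder sets_eq)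
  also have "\<dots> = prob (cylinder M u)" by (rule invariant) simp
  finally show "(\<Sum>i<I. prob (cylinder M (i # u))) \<le> prob (cylinder M u)" .
qed

end

section \<open>Scaling the potential\<close>

context potential
begin

lemma letters_tendsto: "\<forall>\<^sub>F i in sequentially. phi [i] < - R"
proof -
  have "(\<lambda>i. exp (phi [i])) \<longlonglongrightarrow> 0" by (rule summable_LIMSEQ_zero[OF summable_letters])
  then have "\<forall>\<^sub>F i in sequentially. exp (phi [i]) < exp (- R)" by (rule order_tendstoD) simp
  then show ?thesis by simp
qed

text \<open>All additive errors scale with \<open>t\<close>. Summability is inherited because the
  suprema over the letters are eventually negative, and a factor \<open>t \<ge> 1\<close> only
  decreases them.\<close>

lemma potential_scaled:
  assumes t: "t \<ge> 1" shows "potential M (scaled_potential t f) (t * C)"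
proof unfold_locales
  show "0 \<le> t * C" using t C_nonneg by simp
  show "continuous_potential M (scaled_potential t f)"
    using continuous unfolding continuous_potential_def scaled_potential_def
    by (auto intro: continuous_map_real_mult_left)
  fix n m :: nat and x assume nmx: "1 \<le> n" "1 \<le> m" "x \<in> shift_space M"
  have "t * f (n + m) x \<le> t * (f n x + f m ((shift ^^ n) x) + C)"
    using upper_add[OF nmx] t by (intro mult_left_mono) auto
  then show "scaled_potential t f (n + m) x \<le> scaled_potential t f n x + scaled_potential t f m ((shift ^^ n) x) + t * C"
    by (simp add: scaled_potential_def algebra_simps)
  have "t * (f n x + f m ((shift ^^ n) x) - C) \<le> t * f (n + m) x"
    using lower_add[OF nmx] t by (intro mult_left_mono) auto
  then show "scaled_potential t f n x + scaled_potential t f m ((shift ^^ n) x) - t * C \<le> scaled_potential t f (n + m) x"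
    by (simp add: scaled_potential_def algebra_simps)
next
  fix n :: nat and x y assume "1 \<le> n" "x \<in> shift_space M" "y \<in> shift_space M" "\<forall>i<n. x i = y i"
  then have "t * \<bar>f n x - f n y\<bar> \<le> t * C" using t by (intro mult_left_mono variation) auto
  moreover have "\<bar>t * f n x - t * f n y\<bar> = t * \<bar>f n x - f n y\<bar>"
    using t by (simp add: abs_mult flip: right_diff_distrib)
  ultimately show "\<bar>scaled_potential t f n x - scaled_potential t f n y\<bar> \<le> t * C"
    by (simp add: scaled_potential_def)
next
  define s where "s i = (SUP x\<in>cylinder M [i]. f 1 x)" for i
  have bound: "t * f 1 x \<le> t * s i" if "x \<in> cylinder M [i]" for x i
    unfolding s_def using f1_le_SUP[OF that] t by (intro mult_left_mono) auto
  have le: "(SUP x\<in>cylinder M [i]. t * f 1 x) \<le> t * s i" for i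
    using pick_in[of "[i]"] by (intro cSUP_least bound) auto
  have s: "summable (\<lambda>i. exp (s i))" using summable by (simp add: summable_potential_def s_def)
  have "summable (\<lambda>i. exp (SUP x\<in>cylinder M [i]. t * f 1 x))"
  proof (rule summable_comparison_test_ev[OF _ s])
    have "(\<lambda>i. exp (s i)) \<longlonglongrightarrow> 0" by (rule summable_LIMSEQ_zero[OF s])
    then have "\<forall>\<^sub>F i in sequentially. exp (s i) < 1" by (rule order_tendstoD) simp
    then show "\<forall>\<^sub>F i in sequentially. norm (exp (SUP x\<in>cylinder M [i]. t * f 1 x)) \<le> exp (s i)"
    proof eventually_elim
      case (elim i)
      then have "t * s i \<le> 1 * s i" using t by (intro mult_right_mono_neg) auto
      then show ?case using le[of i] by simp
    qed
  qed
  moreover have "bdd_above ((\<lambda>x. t * f 1 x) ` cylinder M [i])" for i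
    using bound by (intro bdd_aboveI2)
  ultimately show "summable_potential M (scaled_potential t f)"
    by (simp add: summable_potential_def scaled_potential_def)
qed

text \<open>For \<open>x = - phi [i]\<close>, eventually positive, \<open>x\<close> times
  \<open>exp ((t - 1) * phi [i])\<close> is at most \<open>1 / (t - 1)\<close>; the remaining factor
  \<open>exp (phi [i])\<close> is summable.\<close>

lemma summable_scaled_letters:
  assumes t: "t > 1" shows "summable (\<lambda>i. exp (t * phi [i]) * \<bar>t * phi [i]\<bar>)"
proof (rule summable_comparison_test_ev)
  show "summable (\<lambda>i. t / (t - 1) * exp (phi [i]))" by (intro summable_mult summable_letters)
  show "\<forall>\<^sub>F i in sequentially. norm (exp (t * phi [i]) * \<bar>t * phi [i]\<bar>) \<le> t / (t - 1) * exp (phi [i])"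
    using letters_tendsto[of 0]
  proof eventually_elim
    case (elim i)
    let ?x = "- phi [i]"
    have x: "?x > 0" using elim by simp
    have "(t - 1) * ?x \<le> exp ((t - 1) * ?x)" using exp_ge_add_one_self[of "(t - 1) * ?x"] by linarith
    then have "((t - 1) * ?x) * exp ((t - 1) * phi [i]) \<le> exp ((t - 1) * ?x) * exp ((t - 1) * phi [i])"
      by (intro mult_right_mono) auto
    also have "\<dots> = 1" by (simp flip: exp_add)
    finally have "?x * exp ((t - 1) * phi [i]) \<le> 1 / (t - 1)" using t by (simp add: field_simps)
    then have le: "t * exp (phi [i]) * (?x * exp ((t - 1) * phi [i])) \<le> t * exp (phi [i]) * (1 / (t - 1))"
      using t by (intro mult_left_mono) auto
    have ex: "exp (t * phi [i]) = exp (phi [i]) * exp ((t - 1) * phi [i])"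
      by (simp add: algebra_simps flip: exp_add)
    have "norm (exp (t * phi [i]) * \<bar>t * phi [i]\<bar>) = t * ?x * exp (t * phi [i])"
      using t x by (simp add: abs_mult)
    also have "\<dots> = t * exp (phi [i]) * (?x * exp ((t - 1) * phi [i]))"
      unfolding ex by (simp only: mult_ac)
    also have "\<dots> \<le> t * exp (phi [i]) * (1 / (t - 1))" by (rule le)
    also have "\<dots> = t / (t - 1) * exp (phi [i])" by simp
    finally show ?case .
  qed
qed

end

context potential_measure
begin

lemma scaled_mean:
  assumes t: "t \<ge> 1"
  shows "potential_measure M (scaled_potential t f) (t * C) \<mu>"
    and "integrable \<mu> (scaled_potential t f 1) \<longleftrightarrow> integrable \<mu> (f 1)"
    and "integrable \<mu> (f 1) \<Longrightarrow> potential_measure.mean (scaled_potential t f) \<mu> = t * mean"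
    and "potential_mean (scaled_potential t f) \<mu> = ereal t * potential_mean f \<mu>"
proof -
  show pm: "potential_measure M (scaled_potential t f) (t * C) \<mu>"
    unfolding potential_measure_def using potential_scaled[OF t] invariant_measure_axioms by simp
  interpret s: potential_measure M "scaled_potential t f" "t * C" \<mu> by (rule pm)
  show int: "integrable \<mu> (scaled_potential t f 1) \<longleftrightarrow> integrable \<mu> (f 1)"
    unfolding scaled_potential_def using t by simp
  show m: "s.mean = t * mean" if i: "integrable \<mu> (f 1)"
  proof (rule LIMSEQ_unique)
    show "(\<lambda>n. (\<integral>x. scaled_potential t f n x \<partial>\<mu>) / real n) \<longlonglongrightarrow> s.mean"
      using i int by (intro s.mean_properties(1)) simp
    have "(\<lambda>n. t * ((\<integral>x. f n x \<partial>\<mu>) / real n)) \<longlonglongrightarrow> t * mean"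
      by (intro tendsto_intros mean_properties(1)[OF i])
    then show "(\<lambda>n. (\<integral>x. scaled_potential t f n x \<partial>\<mu>) / real n) \<longlonglongrightarrow> t * mean"
      by (simp add: scaled_potential_def)
  qed
  show "potential_mean (scaled_potential t f) \<mu> = ereal t * potential_mean f \<mu>"
  proof (cases "integrable \<mu> (f 1)")
    case True
    then show ?thesis using s.mean_properties(3) mean_properties(3) int m by simp
  next
    case False
    then show ?thesis using s.potential_mean_not_integrable potential_mean_not_integrable int t by simp
  qed
qed

text \<open>An argument like Markov's inequality: \<open>f 1\<close> is at most \<open>C - R\<close>
  on the tail set and at most \<open>B1\<close> elsewhere, so a tail of large measure would push the
  integral below \<open>- B\<close>.\<close>

lemma first_letter_tail_le:
  assumes int: "integrable \<mu> (f 1)" and B: "- B \<le> (\<integral>x. f 1 x \<partial>\<mu>)"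
    and B1: "B1 \<ge> 0" "\<And>x. x \<in> shift_space M \<Longrightarrow> f 1 x \<le> B1"
    and N: "\<And>i. i \<ge> N \<Longrightarrow> phi [i] \<le> - R"
  shows "prob (shift_space M - bounded_part M 1 N) * (R - C) \<le> B + B1"
proof -
  let ?T = "shift_space M - bounded_part M 1 N"
  have T: "?T \<in> events" by (simp add: sets_eq)
  have "(\<integral>x. f 1 x \<partial>\<mu>) \<le> (\<integral>x. B1 + indicator ?T x * (C - R) \<partial>\<mu>)"
  proof (rule integral_mono[OF int])
    show "integrable \<mu> (\<lambda>x. B1 + indicator ?T x * (C - R))"
      using T by (intro Bochner_Integration.integrable_add integrable_mult_left integrable_real_indicator) (auto simp: emeasure_eq_measure)
    fix x assume "x \<in> space \<mu>"
    then have x: "x \<in> shift_space M" by simp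
    show "f 1 x \<le> B1 + indicator ?T x * (C - R)"
    proof (cases "x \<in> ?T")
      case True
      then have "x 0 \<ge> N" by (auto simp: bounded_part_def)
      then have "phi [x 0] \<le> - R" by (rule N)
      then have "f 1 x \<le> C - R" using f_phi_initial[OF x, of 1] by (simp add: initial_def abs_le_iff)
      then show ?thesis using True B1(1) by simp
    qed (use B1 x in simp)
  qed
  also have "\<dots> = B1 + prob ?T * (C - R)"
    using T prob_space by (subst Bochner_Integration.integral_add) (auto simp: emeasure_eq_measure Int_absorb2 intro!: integrable_real_indicator)
  finally show ?thesis using B by (simp add: algebra_simps)
qed

end

context potential
begin

lemma equilibrium_state_iff:
  assumes t: "t \<ge> 1"
  shows "equilibrium_state M f t \<mu> \<longleftrightarrow> potential.is_equilibrium M (scaled_potential t f) \<mu>"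
proof -
  interpret s: potential M "scaled_potential t f" "t * C" by (rule potential_scaled[OF t])
  show ?thesis
  proof (cases "\<mu> \<in> invariant_measures M")
    case True
    then have "potential_measure M f C \<mu>"
      unfolding invariant_measures_iff potential_measure_def using potential_axioms by simp
    then interpret potential_measure M f C \<mu> .
    have "- \<infinity> < ereal t * potential_mean f \<mu> \<longleftrightarrow> - \<infinity> < potential_mean f \<mu>"
      using t by (cases "potential_mean f \<mu>") auto
    then show ?thesis using scaled_mean(4)[OF t] by (simp add: equilibrium_state_def s.is_equilibrium_def)
  qed (simp add: equilibrium_state_def s.is_equilibrium_def)
qed

lemma ex1_equilibrium_state:
  assumes t: "t > 1" shows "\<exists>!\<mu>. equilibrium_state M f t \<mu>"
proof -
  interpret s: potential M "scaled_potential t f" "t * C" using t by (intro potential_scaled) simp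
  have "s.phi w = t * phi w" for w
    unfolding s.phi_def phi_def by (simp add: scaled_potential_def)
  then have "\<exists>!\<mu>. s.is_equilibrium \<mu>"
    using summable_scaled_letters[OF t] by (intro s.ex1_equilibrium) simp
  then show ?thesis using t by (simp add: equilibrium_state_iff)
qed

text \<open>
  The variational inequality for \<open>f\<close> itself bounds the entropy of an equilibrium state for \<open>t f\<close>, and
  a single periodic orbit bounds the pressure of \<open>t f\<close> from below by a linear function of \<open>t\<close>.
\<close>

lemma equilibrium_integral_bound:
  "\<exists>B. \<forall>t\<ge>2. \<forall>\<mu>. equilibrium_state M f t \<mu> \<longrightarrow>
    potential_measure M f C \<mu> \<and> integrable \<mu> (f 1) \<and> - B \<le> (\<integral>x. f 1 x \<partial>\<mu>)"
proof -
  obtain b where b: "M b 0 = 1" using ex_pred by blast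
  obtain R where R: "R \<ge> 2" "\<And>x y n. x \<in> {0, b} \<Longrightarrow> y \<in> {0, b} \<Longrightarrow> n \<ge> R \<Longrightarrow>
      \<exists>w. length w = n \<and> admissible M w \<and> hd w = x \<and> last w = y"
    by (rule connecting_words[of "{0, b}"]) auto
  then obtain w where w: "length w = R" "admissible M w" "hd w = 0" "last w = b" by blast
  \<comment> \<open>The word \<open>w\<close> is a loop of length \<open>R\<close>, so the pressure
    of \<open>t f\<close> is at least \<open>t * c0\<close>: both \<open>phi w\<close> and
    \<open>slack\<close> scale with \<open>t\<close>.\<close>
  define c0 where "c0 = (phi w - slack) / real R"
  \<comment> \<open>For \<open>t \<ge> 2\<close> one has \<open>t \<le> 2 * (t - 1)\<close>, whence
    the factor 2; the summand \<open>C\<close> passes from the mean to the integral of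
    \<open>f 1\<close>.\<close>
  define B where "B = 2 * \<bar>c0\<bar> + \<bar>pressure\<bar> + C"
  have "potential_measure M f C \<mu> \<and> integrable \<mu> (f 1) \<and> - B \<le> (\<integral>x. f 1 x \<partial>\<mu>)"
    if t: "t \<ge> 2" and eq: "equilibrium_state M f t \<mu>" for t \<mu>
  proof -
    have t1: "t \<ge> 1" using t by simp
    interpret s: potential M "scaled_potential t f" "t * C" by (rule potential_scaled[OF t1])
    have "s.is_equilibrium \<mu>" using eq equilibrium_state_iff[OF t1] by simp
    then have s: "potential_measure M (scaled_potential t f) (t * C) \<mu>" "integrable \<mu> (scaled_potential t f 1)"
      "ks_entropy \<mu> shift = ereal (s.pressure - potential_measure.mean (scaled_potential t f) \<mu>)"
      by (auto simp: s.is_equilibrium_iff)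
    have pm: "potential_measure M f C \<mu>"
      using s(1) potential_axioms by (simp add: potential_measure_def)
    then interpret potential_measure M f C \<mu> .
    have int: "integrable \<mu> (f 1)" using s(2) scaled_mean(2)[OF t1] by simp
    have "ereal (s.pressure - t * mean) \<le> ereal (pressure - mean)"
      using variational_inequality[OF int] s(3) scaled_mean(3)[OF t1 int] by simp
    then have 1: "s.pressure - pressure \<le> (t - 1) * mean" by (simp add: algebra_simps)
    have "t * c0 \<le> s.pressure"
    proof -
      have "s.weight w = s.wsum (set w) (length w) (\<lambda>u. u = w)" by (rule s.wsum_singleton[symmetric]) auto
      also have "\<dots> \<le> s.loops (set w) 0 R"
        unfolding s.loops_def using w b by (simp flip: w(1)) (rule s.wsum_mono, auto)
      also have "\<dots> \<le> exp s.slack * exp (real R * s.pressure)"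
        using R by (intro s.loops_le) auto
      finally have "s.weight w \<le> exp (s.slack + real R * s.pressure)" by (simp add: exp_add)
      moreover have "s.phi w = t * phi w"
        unfolding s.phi_def phi_def by (simp add: scaled_potential_def)
      then have "s.weight w = exp (t * phi w)" using w(2) by (auto simp: s.weight_def)
      ultimately have "t * phi w \<le> s.slack + real R * s.pressure" by simp
      moreover have "s.slack = t * slack" by (simp add: s.slack_def slack_def)
      ultimately have "t * (phi w - slack) \<le> real R * s.pressure" by (simp add: algebra_simps)
      then show ?thesis using R by (simp add: c0_def field_simps)
    qed
    then have 2: "t * c0 - pressure \<le> (t - 1) * mean" using 1 by simp
    have "- (2 * \<bar>c0\<bar> + \<bar>pressure\<bar>) \<le> mean"
    proof (rule ccontr)
      assume "\<not> ?thesis"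
      then have "(t - 1) * mean < (t - 1) * (- (2 * \<bar>c0\<bar> + \<bar>pressure\<bar>))"
        using t by (intro mult_strict_left_mono) auto
      moreover have "t * \<bar>c0\<bar> \<le> (t - 1) * (2 * \<bar>c0\<bar>)"
      proof -
        have "t * \<bar>c0\<bar> \<le> (2 * (t - 1)) * \<bar>c0\<bar>" using t by (intro mult_right_mono) auto
        then show ?thesis by (simp add: algebra_simps)
      qed
      moreover have "1 * \<bar>pressure\<bar> \<le> (t - 1) * \<bar>pressure\<bar>" using t by (intro mult_right_mono) auto
      moreover have "- (t * \<bar>c0\<bar>) \<le> t * c0"
        using t abs_ge_minus_self[of "t * c0"] by (simp add: abs_mult)
      moreover have "pressure \<le> \<bar>pressure\<bar>" by simp
      ultimately show False using 2 by (simp add: algebra_simps)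
    qed
    moreover have "\<bar>(\<integral>x. f 1 x \<partial>\<mu>) - real 1 * mean\<bar> \<le> C" by (rule mean_properties(2)[OF int]) simp
    ultimately show ?thesis using pm int by (simp add: B_def abs_le_iff)
  qed
  then show ?thesis by blast
qed

lemma ex_accumulation_point:
  "\<exists>\<mu>_inf. accumulation_point_at_top M (\<lambda>t. THE \<mu>. equilibrium_state M f t \<mu>) \<mu>_inf"
proof -
  define m where "m t = (THE \<mu>. equilibrium_state M f t \<mu>)" for t
  have m: "equilibrium_state M f t (m t)" if "t > 1" for t
    unfolding m_def by (rule theI'[OF ex1_equilibrium_state[OF that]])
  obtain B where "\<And>t \<mu>. t \<ge> 2 \<Longrightarrow> equilibrium_state M f t \<mu> \<Longrightarrow>
    potential_measure M f C \<mu> \<and> integrable \<mu> (f 1) \<and> - B \<le> (\<integral>x. f 1 x \<partial>\<mu>)"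
    using equilibrium_integral_bound by blast
  then have B: "potential_measure M f C (m t)" "integrable (m t) (f 1)" "- B \<le> (\<integral>x. f 1 x \<partial>(m t))"
    if "t \<ge> 2" for t using m[of t] that by auto
  \<comment> \<open>The parameters \<open>k + 2\<close> lie in the range where the integrals of
    \<open>f 1\<close> have a common lower bound.\<close>
  define \<nu> where "\<nu> k = m (real k + 2)" for k :: nat
  have nu: "potential_measure M f C (\<nu> k)" "integrable (\<nu> k) (f 1)" "- B \<le> (\<integral>x. f 1 x \<partial>(\<nu> k))" for k
    unfolding \<nu>_def using B[of "real k + 2"] by auto
  have inv: "invariant_measure M (\<nu> k)" for k using nu(1) by (simp add: potential_measure_def)
  obtain B1 where B1: "B1 \<ge> 0" "\<And>x. x \<in> shift_space M \<Longrightarrow> f 1 x \<le> B1" using f1_bounded by blast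
  have tail: "\<exists>N. \<forall>k. measure (\<nu> k) (shift_space M - bounded_part M 1 N) \<le> e" if e: "e > 0" for e
  proof -
    \<comment> \<open>Chosen so that \<open>(R - C) * e\<close> exceeds \<open>B + B1\<close>, which
      forces the measure of the tail to be at most \<open>e\<close>.\<close>
    define R where "R = C + (\<bar>B + B1\<bar> + 1) / e"
    obtain N where N: "\<And>i. i \<ge> N \<Longrightarrow> phi [i] < - R"
      using letters_tendsto[of R] by (auto simp: eventually_sequentially)
    have "measure (\<nu> k) (shift_space M - bounded_part M 1 N) \<le> e" for k
    proof -
      let ?p = "measure (\<nu> k) (shift_space M - bounded_part M 1 N)"
      have "?p * (R - C) \<le> B + B1"
        using N by (intro potential_measure.first_letter_tail_le[OF nu B1]) (auto intro: less_imp_le)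
      then have "?p * (\<bar>B + B1\<bar> + 1) / e \<le> \<bar>B + B1\<bar> + 1" by (simp add: R_def)
      then have "(\<bar>B + B1\<bar> + 1) * ?p \<le> (\<bar>B + B1\<bar> + 1) * e"
        using e by (simp only: pos_divide_le_eq mult.commute)
      moreover have "0 < \<bar>B + B1\<bar> + 1" by linarith
      ultimately show ?thesis by (rule mult_left_le_imp_le)
    qed
    then show ?thesis by blast
  qed
  have "\<exists>r \<mu>. strict_mono (r :: nat \<Rightarrow> nat) \<and> invariant_measure M \<mu> \<and>
    (\<forall>u. (\<lambda>k. measure (\<nu> (r k)) (cylinder M u)) \<longlonglongrightarrow> measure \<mu> (cylinder M u))"
  proof (rule cylinder_weights_compact[where p = "\<lambda>k u. measure (\<nu> k) (cylinder M u)"])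
    fix k u I
    interpret invariant_measure M "\<nu> k" by (rule inv)
    show "measure (\<nu> k) (cylinder M []) = 1" using prob_space by simp
    show "(\<Sum>i<I. measure (\<nu> k) (cylinder M (u @ [i]))) \<le> measure (\<nu> k) (cylinder M u)" by (rule sum_snoc_le)
  next
    fix u :: "nat list" and e :: real assume "e > 0"
    then obtain N where N: "\<And>k. measure (\<nu> k) (shift_space M - bounded_part M 1 N) \<le> e" using tail by blast
    have "measure (\<nu> k) (cylinder M u) - (\<Sum>i<N. measure (\<nu> k) (cylinder M (u @ [i]))) \<le> e" for k
      using invariant_measure.snoc_tail_le[OF inv, of k u N] N[of k] by linarith
    then show "\<exists>I. \<forall>\<^sub>F k in sequentially. measure (\<nu> k) (cylinder M u) - (\<Sum>i<I. measure (\<nu> k) (cylinder M (u @ [i]))) \<le> e"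
      by (intro exI[of _ N] always_eventually allI)
  next
    fix k and u :: "nat list" assume "u \<noteq> []" "\<not> admissible M u"
    then show "measure (\<nu> k) (cylinder M u) = 0" using cylinder_eq_empty[of u M] by simp
  next
    fix u :: "nat list" and I and e :: real assume e: "e > 0"
    have "(\<Sum>i<I. measure (\<nu> k) (cylinder M (i # u))) \<le> measure (\<nu> k) (cylinder M u) + e" for k
      using invariant_measure.sum_Cons_le[OF inv, where k1 = k and u = u and I = I] e by linarith
    then show "\<forall>\<^sub>F k in sequentially. (\<Sum>i<I. measure (\<nu> k) (cylinder M (i # u))) \<le> measure (\<nu> k) (cylinder M u) + e"
      by (intro always_eventually allI)
  qed simp
  then obtain r \<mu> where r: "strict_mono (r :: nat \<Rightarrow> nat)" and mu: "invariant_measure M \<mu>"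
    and lim: "\<And>u. (\<lambda>k. measure (\<nu> (r k)) (cylinder M u)) \<longlonglongrightarrow> measure \<mu> (cylinder M u)" by blast
  have "weakly_converges M (\<lambda>k. \<nu> (r k)) \<mu>"
    by (rule weakly_converges_if_cylinders[OF _ _ lim])
      (use inv mu in \<open>auto simp: invariant_measure_def\<close>)
  moreover have "filterlim (\<lambda>k. real (r k) + 2) at_top sequentially"
    by (rule filterlim_at_top_mono[OF filterlim_compose[OF filterlim_real_sequentially filterlim_subseq[OF r]]]) simp
  moreover have "\<mu> \<in> invariant_measures M" using mu by (simp add: invariant_measures_iff)
  ultimately have "accumulation_point_at_top M m \<mu>"
    unfolding accumulation_point_at_top_def \<nu>_def by (intro conjI exI[of _ "\<lambda>k. real (r k) + 2"]) auto
  then show ?thesis unfolding m_def by blast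
qed

end

theorem theorem1p1:
  fixes M :: "nat \<Rightarrow> nat \<Rightarrow> nat"
    and f :: "nat \<Rightarrow> (nat \<Rightarrow> nat) \<Rightarrow> real"
  assumes "transition_matrix M"
    and "topologically_mixing M"
    and "continuous_potential M f"
    and "almost_additive M f"
    and "summable_potential M f"
    and "bounded_variation M f"
  shows "(\<forall>t>1. \<exists>!\<mu>. equilibrium_state M f t \<mu>) \<and>
         (\<exists>\<mu>_inf. accumulation_point_at_top M (\<lambda>t. THE \<mu>. equilibrium_state M f t \<mu>) \<mu>_inf)"
proof -
  obtain C1 where C1: "C1 \<ge> 0" and add: "\<And>n m x. n \<ge> 1 \<Longrightarrow> m \<ge> 1 \<Longrightarrow> x \<in> shift_space M \<Longrightarrow>
      f n x + f m ((shift ^^ n) x) - C1 \<le> f (n + m) x \<and> f (n + m) x \<le> f n x + f m ((shift ^^ n) x) + C1"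
    using assms(4) unfolding almost_additive_def by blast
  obtain C2 where C2: "C2 \<ge> 0" and var: "\<And>n x y. n \<ge> 1 \<Longrightarrow> x \<in> shift_space M \<Longrightarrow> y \<in> shift_space M \<Longrightarrow>
      (\<forall>i<n. x i = y i) \<Longrightarrow> \<bar>f n x - f n y\<bar> \<le> C2"
    using assms(6) unfolding bounded_variation_def by blast
  \<comment> \<open>Both hypotheses persist when their constant is enlarged, so one constant can
    serve for the two.\<close>
  interpret potential M f "max C1 C2"
  proof unfold_locales
    fix n m :: nat and x assume "1 \<le> n" "1 \<le> m" "x \<in> shift_space M"
    note * = add[OF this]
    show "f (n + m) x \<le> f n x + f m ((shift ^^ n) x) + max C1 C2" using * by linarith
    show "f n x + f m ((shift ^^ n) x) - max C1 C2 \<le> f (n + m) x" using * by linarith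
  next
    fix n :: nat and x y assume "1 \<le> n" "x \<in> shift_space M" "y \<in> shift_space M" "\<forall>i<n. x i = y i"
    from var[OF this] show "\<bar>f n x - f n y\<bar> \<le> max C1 C2" by linarith
  qed (use assms C1 in auto)
  show ?thesis using ex1_equilibrium_state ex_accumulation_point by blast
qed

end
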